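(* Let $\mathfrak h$ be a vector space over $\mathbb{C}$ equipped with a symmetric bilinear form $\langle\cdot,\cdot\rangle$, let $q$ be a nonzero complex number which is not a root of unity and let $\hat{\mathfrak h}_q$ be the Lie algebra $\hat{\mathfrak h}_q=\mathfrak h\otimes\mathbb{C}[t,t^{-1}]\oplus\mathbb{C}c$ with $c$ central and $$[a\otimes t^m,b\otimes t^n]=m\langle a,b\rangle\delta_{m+n,0}(q^m+q^{-m})c\quad\text{for }a,b\in\mathfrak h,\ m,n\in\mathbb{Z}.$$ Let $\mathfrak h[\mathbb{Z}]=\mathfrak h\otimes\mathbb{C}[\mathbb{Z}]$ be the abelian Lie algebra equipped with the symmetric bilinear form $$\langle a\otimes e^m,b\otimes e^n\rangle=\langle a,b\rangle(\delta_{m,n+1}+\delta_{n,m+1})\quad\text{for }a,b\in\mathfrak h,\ m,n\in\mathbb{Z},$$ and let $\widehat{\mathfrak h[\mathbb{Z}]}$ be the corresponding affine Lie algebra. Then for any restricted $\hat{\mathfrak h}_q$-module $W$ of level $\ell$ ($\ell\in\mathbb{C}$), there exists a unique quasi $V_{\widehat{\mathfrak h[\mathbb{Z}]}}(\ell,0)$-module structure on $W$ with $Y_W(a\otimes e^m,x)=a_W(m,x)$ for $a\in\mathfrak h$, $m\in\mathbb{Z}$.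
   Context: $x,x_0,x_1,x_2$ are commuting formal variables; $\delta(z)=\sum_{n\in\mathbb{Z}}z^n$; integer powers of a binomial are expanded in nonnegative powers of the second-written term. $\{e^m\}_{m\in\mathbb{Z}}$ is the standard basis of the group algebra $\mathbb{C}[\mathbb{Z}]$. An $\hat{\mathfrak h}_q$-module has level $\ell$ if $c$ acts as the scalar $\ell$; it is restricted if for every $a\in\mathfrak h$ and $w\in W$, $(a\otimes t^n)w=0$ for $n$ sufficiently large. For $a\in\mathfrak h$ set $a(x)=\sum_{n\in\mathbb{Z}}(a\otimes t^n)x^{-n-1}$ and $a(m,x)=q^ma(q^mx)$ for $m\in\mathbb{Z}$; $a_W(m,x)\in\operatorname{Hom}(W,W((x)))$ is the resulting series of operators on a restricted module $W$. For a Lie algebra $\mathfrak g$ with a symmetric invariant bilinear form, the affine Lie algebra is $\hat{\mathfrak g}=\mathfrak g\otimes\mathbb{C}[t,t^{-1}]\oplus\mathbb{C}\mathbf k$ with $\mathbf k$ central and $[a\otimes t^m,b\otimes t^n]=[a,b]\otimes t^{m+n}+m\langle a,b\rangle\delta_{m+n,0}\mathbf k$. $V_{\hat{\mathfrak g}}(\ell,0)=U(\hat{\mathfrak g})\otimes_{U(\mathfrak g\otimes\mathbb{C}[t]\oplus\mathbb{C}\mathbf k)}\mathbb{C}_\ell$, where $\mathbb{C}_\ell=\mathbb{C}$ with $\mathfrak g\otimes\mathbb{C}[t]$ acting trivially and $\mathbf k$ acting as $\ell$; $\mathbf 1=1\otimes1$; $\mathfrak g$ is identified with a subspace via $a\mapsto(a\otimes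 t^{-1})\mathbf 1$. It is known that $V_{\hat{\mathfrak g}}(\ell,0)$ has a unique vertex algebra structure with vacuum $\mathbf 1$ and $Y(a,x)=\sum_{n\in\mathbb{Z}}(a\otimes t^n)x^{-n-1}$ for $a\in\mathfrak g$, and that $\mathfrak g$ generates it. Quasi module: for a vertex algebra $(V,Y,\mathbf 1)$, a quasi $V$-module is a vector space $W$ with a linear map $Y_W:V\to\operatorname{Hom}(W,W((x)))$ such that $Y_W(\mathbf 1,x)=1_W$ and for any $u,v\in V$ there is a nonzero polynomial $f(x_1,x_2)$ with $$x_0^{-1}\delta\left(\tfrac{x_1-x_2}{x_0}\right)f(x_1,x_2)Y_W(u,x_1)Y_W(v,x_2)-x_0^{-1}\delta\left(\tfrac{x_2-x_1}{-x_0}\right)f(x_1,x_2)Y_W(v,x_2)Y_W(u,x_1)=x_2^{-1}\delta\left(\tfrac{x_1-x_0}{x_2}\right)f(x_1,x_2)Y_W(Y(u,x_0)v,x_2).$$ *)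

theory Defs
  imports
    Complex_Main
    "HOL-Library.Poly_Mapping"
    "HOL-Library.Product_Plus"
    "HOL-Library.FuncSet"
    "HOL-Computational_Algebra.Polynomial"
    "HOL-Algebra.QuotRing"
    "HOL-Algebra.Module"
    "HOL-Algebra.Algebraic_Closure_Type"
begin

section \<open>Complex vector spaces\<close>

text \<open>
  The spaces \<open>\<hh>\<close> and \<open>W\<close> are types with a scalar multiplication making them a
  \<^locale>\<open>vector_space\<close> over the complex numbers.  The vacuum module depends on the
  level, hence it is a \<^typ>\<open>(complex, 'v) module\<close> record with an explicit carrier.  The
  fields \<open>mult\<close> and \<open>one\<close>, which such a record inherits from rings, play no role.
\<close>

abbreviation complex_ring :: "complex ring" where
  "complex_ring \<equiv> ring_of_type_algebra"

definition module_of_type :: "(complex \<Rightarrow> 'w \<Rightarrow> 'w) \<Rightarrow> (complex, 'w::ab_group_add) module" where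
  "module_of_type s =
     \<lparr>carrier = UNIV, monoid.mult = undefined, one = undefined, zero = 0, add = (+), module.smult = s\<rparr>"

definition quotient_module :: "(complex, 'v) module \<Rightarrow> 'v set \<Rightarrow> (complex, 'v set) module" where
  "quotient_module M J =
     \<lparr>carrier = a_rcosets\<^bsub>M\<^esub> J, monoid.mult = undefined, one = undefined, zero = J, add = set_add M,
      module.smult = (\<lambda>c A. \<Union>x\<in>A. J +>\<^bsub>M\<^esub> (c \<odot>\<^bsub>M\<^esub> x))\<rparr>"

text \<open>
  For a vector space \<open>U\<close>, the tensor products \<open>U \<otimes> \<complex>[t,t\<^sup>-\<^sup>1]\<close> and \<open>U \<otimes> \<complex>[\<int>]\<close> are
  rendered as the finitely supported functions from the integers to \<open>U\<close>; the pure tensors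
  \<open>a \<otimes> t\<^sup>n\<close> and \<open>a \<otimes> e\<^sup>n\<close> are \<open>Poly_Mapping.single n a\<close>.
\<close>

definition fin_scale :: "(complex \<Rightarrow> 'a \<Rightarrow> 'a) \<Rightarrow> complex \<Rightarrow> ('i \<Rightarrow>\<^sub>0 'a::ab_group_add) \<Rightarrow> ('i \<Rightarrow>\<^sub>0 'a)" where
  "fin_scale s c u = Poly_Mapping.map (s c) u"

definition symmetric_bilinear :: "(complex \<Rightarrow> 'a \<Rightarrow> 'a) \<Rightarrow> ('a::ab_group_add \<Rightarrow> 'a \<Rightarrow> complex) \<Rightarrow> bool" where
  "symmetric_bilinear s B \<longleftrightarrow>
     (\<forall>a. Vector_Spaces.linear s (*) (B a)) \<and> (\<forall>a b. B a b = B b a)"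


section \<open>The Lie algebras\<close>

text \<open>Central extensions \<open>U \<otimes> \<complex>[t,t\<^sup>-\<^sup>1] \<oplus> \<complex>\<close>, the second component being the central one.\<close>

type_synonym 'a loop_ext = "(int \<Rightarrow>\<^sub>0 'a) \<times> complex"

definition loop_scale :: "(complex \<Rightarrow> 'a \<Rightarrow> 'a) \<Rightarrow> complex \<Rightarrow> 'a::ab_group_add loop_ext \<Rightarrow> 'a loop_ext" where
  "loop_scale s c x = (fin_scale s c (fst x), c * snd x)"

definition mode :: "'a::ab_group_add \<Rightarrow> int \<Rightarrow> 'a loop_ext" where
  "mode a n = (Poly_Mapping.single n a, 0)"

definition central :: "'a::ab_group_add loop_ext" where
  "central = (0, 1)"

text \<open>The brackets and forms below are the bilinear extensions of the formulas on pure tensors.\<close>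

definition hq_bracket ::
  "('h::ab_group_add \<Rightarrow> 'h \<Rightarrow> complex) \<Rightarrow> complex \<Rightarrow> 'h loop_ext \<Rightarrow> 'h loop_ext \<Rightarrow> 'h loop_ext" where
  "hq_bracket B q x y =
     (0, \<Sum>m\<in>Poly_Mapping.keys (fst x). \<Sum>n\<in>Poly_Mapping.keys (fst y).
           if m + n = 0
           then of_int m * B (Poly_Mapping.lookup (fst x) m) (Poly_Mapping.lookup (fst y) n)
                  * (q powi m + q powi (- m))
           else 0)"

definition affine_bracket ::
  "('g \<Rightarrow> 'g \<Rightarrow> 'g) \<Rightarrow> ('g::ab_group_add \<Rightarrow> 'g \<Rightarrow> complex)
     \<Rightarrow> 'g loop_ext \<Rightarrow> 'g loop_ext \<Rightarrow> 'g loop_ext" where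
  "affine_bracket br B x y =
     (\<Sum>m\<in>Poly_Mapping.keys (fst x). \<Sum>n\<in>Poly_Mapping.keys (fst y).
        Poly_Mapping.single (m + n) (br (Poly_Mapping.lookup (fst x) m) (Poly_Mapping.lookup (fst y) n)),
      \<Sum>m\<in>Poly_Mapping.keys (fst x). \<Sum>n\<in>Poly_Mapping.keys (fst y).
        if m + n = 0
        then of_int m * B (Poly_Mapping.lookup (fst x) m) (Poly_Mapping.lookup (fst y) n)
        else 0)"

definition hZ_form ::
  "('h::ab_group_add \<Rightarrow> 'h \<Rightarrow> complex) \<Rightarrow> (int \<Rightarrow>\<^sub>0 'h) \<Rightarrow> (int \<Rightarrow>\<^sub>0 'h) \<Rightarrow> complex" where
  "hZ_form B x y =
     (\<Sum>m\<in>Poly_Mapping.keys x. \<Sum>n\<in>Poly_Mapping.keys y.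
        B (Poly_Mapping.lookup x m) (Poly_Mapping.lookup y n)
          * (of_bool (m = n + 1) + of_bool (n = m + 1)))"

definition lie_module ::
  "(complex \<Rightarrow> 'l \<Rightarrow> 'l) \<Rightarrow> ('l \<Rightarrow> 'l \<Rightarrow> 'l) \<Rightarrow> (complex \<Rightarrow> 'w \<Rightarrow> 'w)
     \<Rightarrow> ('l::ab_group_add \<Rightarrow> 'w::ab_group_add \<Rightarrow> 'w) \<Rightarrow> bool" where
  "lie_module sL br sW \<rho> \<longleftrightarrow>
     (\<forall>x. Vector_Spaces.linear sW sW (\<rho> x)) \<and>
     (\<forall>w. Vector_Spaces.linear sL sW (\<lambda>x. \<rho> x w)) \<and>
     (\<forall>x y w. \<rho> (br x y) w = \<rho> x (\<rho> y w) - \<rho> y (\<rho> x w))"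

definition has_level ::
  "(complex \<Rightarrow> 'w \<Rightarrow> 'w) \<Rightarrow> ('a::ab_group_add loop_ext \<Rightarrow> 'w \<Rightarrow> 'w) \<Rightarrow> complex \<Rightarrow> bool" where
  "has_level sW \<rho> l \<longleftrightarrow> (\<forall>w. \<rho> central w = sW l w)"

definition restricted :: "('a::ab_group_add loop_ext \<Rightarrow> 'w::zero \<Rightarrow> 'w) \<Rightarrow> bool" where
  "restricted \<rho> \<longleftrightarrow> (\<forall>a w. \<exists>N. \<forall>n\<ge>N. \<rho> (mode a n) w = 0)"


section \<open>Universal enveloping algebras and induced modules\<close>

text \<open>
  The free associative algebra on the set of elements of \<open>L\<close> is the monoid algebra of the
  monoid of words.  The latter is written additively, since this is the convention under which
  \<open>'l word \<Rightarrow>\<^sub>0 complex\<close> carries the convolution product.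
\<close>

datatype 'l word = Word "'l list"

instantiation word :: (type) monoid_add
begin

definition "0 = Word []"

fun plus_word :: "'a word \<Rightarrow> 'a word \<Rightarrow> 'a word" where
  "Word xs + Word ys = Word (xs @ ys)"

instance
proof
  fix a b c :: "'a word"
  show "a + b + c = a + (b + c)" by (cases a; cases b; cases c) simp
  show "0 + a = a" by (cases a) (simp add: zero_word_def)
  show "a + 0 = a" by (cases a) (simp add: zero_word_def)
qed

end

type_synonym 'l free_algebra = "'l word \<Rightarrow>\<^sub>0 complex"

definition letter :: "'l \<Rightarrow> 'l free_algebra" where
  "letter x = Poly_Mapping.single (Word [x]) 1"

definition scalar :: "complex \<Rightarrow> 'l free_algebra" where
  "scalar c = Poly_Mapping.single 0 c"

text \<open>
  \<open>U(L)\<close> is the tensor algebra of \<open>L\<close> modulo \<open>xy - yx - [x,y]\<close>; the first two families of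
  relations turn the free algebra on the set \<open>L\<close> into the tensor algebra of the vector space \<open>L\<close>.
\<close>

definition uea_ideal ::
  "(complex \<Rightarrow> 'l \<Rightarrow> 'l) \<Rightarrow> ('l \<Rightarrow> 'l \<Rightarrow> 'l) \<Rightarrow> 'l::ab_group_add free_algebra set" where
  "uea_ideal s br = Idl\<^bsub>ring_of_type_algebra\<^esub>
     ({letter (x + y) - letter x - letter y | x y. True} \<union>
      {letter (s c x) - scalar c * letter x | c x. True} \<union>
      {letter x * letter y - letter y * letter x - letter (br x y) | x y. True})"

definition uea ::
  "(complex \<Rightarrow> 'l \<Rightarrow> 'l) \<Rightarrow> ('l \<Rightarrow> 'l \<Rightarrow> 'l) \<Rightarrow> 'l::ab_group_add free_algebra set ring" where
  "uea s br = ring_of_type_algebra Quot uea_ideal s br"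

definition uea_class ::
  "(complex \<Rightarrow> 'l \<Rightarrow> 'l) \<Rightarrow> ('l \<Rightarrow> 'l \<Rightarrow> 'l)
     \<Rightarrow> 'l::ab_group_add free_algebra \<Rightarrow> 'l free_algebra set" where
  "uea_class s br t = uea_ideal s br +>\<^bsub>ring_of_type_algebra\<^esub> t"

text \<open>
  \<open>U(L) \<otimes>\<^bsub>U(P)\<^esub> \<complex>\<^sub>\<chi>\<close> for a subalgebra \<open>P\<close> of \<open>L\<close> acting on the one-dimensional module
  \<open>\<complex>\<^sub>\<chi>\<close> through the functional \<open>\<chi>\<close>: the free vector space on the set \<open>U(L) \<times> \<complex>\<close>
  modulo bilinearity and \<open>u b \<otimes> z = u \<otimes> b z\<close>.  As \<open>P\<close> generates \<open>U(P)\<close>, it suffices to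
  impose the last relation for \<open>b \<in> P\<close>.
\<close>

type_synonym 'l tensors = "('l free_algebra set \<times> complex) \<Rightarrow>\<^sub>0 complex"

abbreviation pure :: "'u \<Rightarrow> complex \<Rightarrow> ('u \<times> complex) \<Rightarrow>\<^sub>0 complex" where
  "pure u z \<equiv> Poly_Mapping.single (u, z) 1"

definition pretensor_module ::
  "(complex \<Rightarrow> 'l \<Rightarrow> 'l) \<Rightarrow> ('l \<Rightarrow> 'l \<Rightarrow> 'l)
     \<Rightarrow> (complex, 'l::ab_group_add tensors) module" where
  "pretensor_module s br =
     \<lparr>carrier = {f. Poly_Mapping.keys f \<subseteq> carrier (uea s br) \<times> UNIV},
      monoid.mult = undefined, one = undefined, zero = 0, add = (+), module.smult = fin_scale (*)\<rparr>"

definition tensor_relations ::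
  "(complex \<Rightarrow> 'l \<Rightarrow> 'l) \<Rightarrow> ('l \<Rightarrow> 'l \<Rightarrow> 'l) \<Rightarrow> 'l set \<Rightarrow> ('l \<Rightarrow> complex)
     \<Rightarrow> 'l::ab_group_add tensors set" where
  "tensor_relations s br P \<chi> = module.span (fin_scale (*))
     (let U = uea s br; cl = uea_class s br in
      {pure (u \<oplus>\<^bsub>U\<^esub> v) z - pure u z - pure v z | u v z. u \<in> carrier U \<and> v \<in> carrier U} \<union>
      {pure u (y + z) - pure u y - pure u z | u y z. u \<in> carrier U} \<union>
      {pure (cl (scalar c) \<otimes>\<^bsub>U\<^esub> u) z - fin_scale (*) c (pure u z) | c u z. u \<in> carrier U} \<union>
      {pure u (c * z) - fin_scale (*) c (pure u z) | c u z. u \<in> carrier U} \<union>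
      {pure (u \<otimes>\<^bsub>U\<^esub> cl (letter b)) z - pure u (\<chi> b * z) | u b z. u \<in> carrier U \<and> b \<in> P})"

definition induced_module ::
  "(complex \<Rightarrow> 'l \<Rightarrow> 'l) \<Rightarrow> ('l \<Rightarrow> 'l \<Rightarrow> 'l) \<Rightarrow> 'l set \<Rightarrow> ('l \<Rightarrow> complex)
     \<Rightarrow> (complex, 'l::ab_group_add tensors set) module" where
  "induced_module s br P \<chi> =
     quotient_module (pretensor_module s br) (tensor_relations s br P \<chi>)"

definition induced_class ::
  "(complex \<Rightarrow> 'l \<Rightarrow> 'l) \<Rightarrow> ('l \<Rightarrow> 'l \<Rightarrow> 'l) \<Rightarrow> 'l set \<Rightarrow> ('l \<Rightarrow> complex)
     \<Rightarrow> 'l::ab_group_add tensors \<Rightarrow> 'l tensors set" where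
  "induced_class s br P \<chi> f = tensor_relations s br P \<chi> +>\<^bsub>pretensor_module s br\<^esub> f"

text \<open>The action of \<open>x \<in> L\<close> is induced by \<open>u \<otimes> z \<mapsto> x u \<otimes> z\<close>.\<close>

definition induced_action ::
  "(complex \<Rightarrow> 'l \<Rightarrow> 'l) \<Rightarrow> ('l \<Rightarrow> 'l \<Rightarrow> 'l) \<Rightarrow> 'l set \<Rightarrow> ('l \<Rightarrow> complex)
     \<Rightarrow> 'l::ab_group_add \<Rightarrow> 'l tensors set \<Rightarrow> 'l tensors set" where
  "induced_action s br P \<chi> x A =
     (\<Union>f\<in>A. induced_class s br P \<chi>
        (\<Sum>(u, z)\<in>Poly_Mapping.keys f.
           fin_scale (*) (Poly_Mapping.lookup f (u, z))
             (pure (uea_class s br (letter x) \<otimes>\<^bsub>uea s br\<^esub> u) z)))"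


section \<open>The vacuum module of an affine Lie algebra\<close>

text \<open>
  Here \<open>s\<close>, \<open>br\<close> and \<open>B\<close> are the scalar multiplication, the bracket and the form of \<open>\<gg>\<close>, and
  \<open>l\<close> is the level.
\<close>

definition nonneg_part :: "'g::ab_group_add loop_ext set" where
  "nonneg_part = {x. \<forall>n<0. Poly_Mapping.lookup (fst x) n = 0}"

definition level_functional :: "complex \<Rightarrow> 'g loop_ext \<Rightarrow> complex" where
  "level_functional l x = snd x * l"

definition affine_module ::
  "(complex \<Rightarrow> 'g \<Rightarrow> 'g) \<Rightarrow> ('g \<Rightarrow> 'g \<Rightarrow> 'g) \<Rightarrow> ('g::ab_group_add \<Rightarrow> 'g \<Rightarrow> complex) \<Rightarrow> complex
     \<Rightarrow> (complex, 'g loop_ext tensors set) module" where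
  "affine_module s br B l =
     induced_module (loop_scale s) (affine_bracket br B) nonneg_part (level_functional l)"

definition affine_vacuum ::
  "(complex \<Rightarrow> 'g \<Rightarrow> 'g) \<Rightarrow> ('g \<Rightarrow> 'g \<Rightarrow> 'g) \<Rightarrow> ('g::ab_group_add \<Rightarrow> 'g \<Rightarrow> complex) \<Rightarrow> complex
     \<Rightarrow> 'g loop_ext tensors set" where
  "affine_vacuum s br B l =
     induced_class (loop_scale s) (affine_bracket br B) nonneg_part (level_functional l)
       (pure \<one>\<^bsub>uea (loop_scale s) (affine_bracket br B)\<^esub> 1)"

definition affine_action ::
  "(complex \<Rightarrow> 'g \<Rightarrow> 'g) \<Rightarrow> ('g \<Rightarrow> 'g \<Rightarrow> 'g) \<Rightarrow> ('g::ab_group_add \<Rightarrow> 'g \<Rightarrow> complex) \<Rightarrow> complex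
     \<Rightarrow> 'g loop_ext \<Rightarrow> 'g loop_ext tensors set \<Rightarrow> 'g loop_ext tensors set" where
  "affine_action s br B l =
     induced_action (loop_scale s) (affine_bracket br B) nonneg_part (level_functional l)"

definition affine_embed ::
  "(complex \<Rightarrow> 'g \<Rightarrow> 'g) \<Rightarrow> ('g \<Rightarrow> 'g \<Rightarrow> 'g) \<Rightarrow> ('g::ab_group_add \<Rightarrow> 'g \<Rightarrow> complex) \<Rightarrow> complex
     \<Rightarrow> 'g \<Rightarrow> 'g loop_ext tensors set" where
  "affine_embed s br B l a = affine_action s br B l (mode a (- 1)) (affine_vacuum s br B l)"


section \<open>Formal calculus\<close>

text \<open>
  A formal distribution in \<open>x\<^sub>0, x\<^sub>1, x\<^sub>2\<close> is the function sending \<open>(k\<^sub>0, k\<^sub>1, k\<^sub>2)\<close> to its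
  coefficient of \<open>x\<^sub>0\<^bsup>k\<^sub>0\<^esup> x\<^sub>1\<^bsup>k\<^sub>1\<^esup> x\<^sub>2\<^bsup>k\<^sub>2\<^esup>\<close>.
\<close>

type_synonym 'w distribution = "int \<times> int \<times> int \<Rightarrow> 'w"

text \<open>
  Product of a scalar and a vector valued distribution.  In the Jacobi identity all index sets
  below are finite, because \<open>f\<close> is a polynomial and the vertex operators are lower truncated;
  so \<^const>\<open>finsum\<close> never takes its default value there.
\<close>

definition dist_mult ::
  "(complex, 'w) module \<Rightarrow> complex distribution \<Rightarrow> 'w distribution \<Rightarrow> 'w distribution" where
  "dist_mult W D A k =
     (\<Oplus>\<^bsub>W\<^esub>j\<in>{j. D j \<noteq> 0 \<and> A (k - j) \<noteq> \<zero>\<^bsub>W\<^esub>}. D j \<odot>\<^bsub>W\<^esub> A (k - j))"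

text \<open>The coefficient of \<open>x\<^sup>i y\<^sup>j\<close> in \<open>(x - y)\<^sup>n\<close>, expanded in nonnegative powers of \<open>y\<close>.\<close>

definition diff_pow :: "int \<Rightarrow> int \<Rightarrow> int \<Rightarrow> complex" where
  "diff_pow n i j =
     (if 0 \<le> j \<and> i + j = n then (- 1) ^ nat j * (of_int n gchoose nat j) else 0)"

text \<open>
  The three delta functions
  \<open>x\<^sub>0\<^sup>-\<^sup>1 \<delta>((x\<^sub>1 - x\<^sub>2) / x\<^sub>0) = \<Sum>\<^sub>n x\<^sub>0\<^sup>-\<^sup>n\<^sup>-\<^sup>1 (x\<^sub>1 - x\<^sub>2)\<^sup>n\<close>,
  \<open>x\<^sub>0\<^sup>-\<^sup>1 \<delta>((x\<^sub>2 - x\<^sub>1) / -x\<^sub>0) = \<Sum>\<^sub>n (-1)\<^sup>n x\<^sub>0\<^sup>-\<^sup>n\<^sup>-\<^sup>1 (x\<^sub>2 - x\<^sub>1)\<^sup>n\<close> and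
  \<open>x\<^sub>2\<^sup>-\<^sup>1 \<delta>((x\<^sub>1 - x\<^sub>0) / x\<^sub>2) = \<Sum>\<^sub>n x\<^sub>2\<^sup>-\<^sup>n\<^sup>-\<^sup>1 (x\<^sub>1 - x\<^sub>0)\<^sup>n\<close>.
\<close>

definition delta_12 :: "complex distribution" where
  "delta_12 = (\<lambda>(k0, k1, k2). diff_pow (- k0 - 1) k1 k2)"

definition delta_21 :: "complex distribution" where
  "delta_21 = (\<lambda>(k0, k1, k2). (- 1) powi (- k0 - 1) * diff_pow (- k0 - 1) k2 k1)"

definition delta_10 :: "complex distribution" where
  "delta_10 = (\<lambda>(k0, k1, k2). diff_pow (- k2 - 1) k1 k0)"

text \<open>A polynomial \<open>f(x\<^sub>1, x\<^sub>2)\<close> is a polynomial in \<open>x\<^sub>1\<close> whose coefficients are polynomials in \<open>x\<^sub>2\<close>.\<close>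

definition poly_dist :: "complex poly poly \<Rightarrow> complex distribution" where
  "poly_dist f = (\<lambda>(k0, k1, k2).
     if k0 = 0 \<and> 0 \<le> k1 \<and> 0 \<le> k2 then Polynomial.coeff (Polynomial.coeff f (nat k1)) (nat k2) else 0)"


section \<open>Vertex algebras and quasi modules\<close>

text \<open>
  Below, \<open>Y v k w\<close> is the coefficient of \<open>x\<^sup>k\<close> (not of \<open>x\<^sup>-\<^sup>k\<^sup>-\<^sup>1\<close>) in \<open>Y(v,x)w\<close>.
  The following says that \<open>Y\<close> is a linear map from \<open>V\<close> to \<open>Hom(W, W((x)))\<close>.
\<close>

definition vertex_map ::
  "(complex, 'v) module \<Rightarrow> (complex, 'w) module \<Rightarrow> ('v \<Rightarrow> int \<Rightarrow> 'w \<Rightarrow> 'w) \<Rightarrow> bool" where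
  "vertex_map V W Y \<longleftrightarrow>
     (\<forall>v\<in>carrier V. \<forall>k. \<forall>w\<in>carrier W. Y v k w \<in> carrier W) \<and>
     (\<forall>u\<in>carrier V. \<forall>v\<in>carrier V. \<forall>k. \<forall>w\<in>carrier W. Y (u \<oplus>\<^bsub>V\<^esub> v) k w = Y u k w \<oplus>\<^bsub>W\<^esub> Y v k w) \<and>
     (\<forall>c. \<forall>v\<in>carrier V. \<forall>k. \<forall>w\<in>carrier W. Y (c \<odot>\<^bsub>V\<^esub> v) k w = c \<odot>\<^bsub>W\<^esub> Y v k w) \<and>
     (\<forall>v\<in>carrier V. \<forall>k. \<forall>w\<in>carrier W. \<forall>w'\<in>carrier W. Y v k (w \<oplus>\<^bsub>W\<^esub> w') = Y v k w \<oplus>\<^bsub>W\<^esub> Y v k w') \<and>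
     (\<forall>c. \<forall>v\<in>carrier V. \<forall>k. \<forall>w\<in>carrier W. Y v k (c \<odot>\<^bsub>W\<^esub> w) = c \<odot>\<^bsub>W\<^esub> Y v k w) \<and>
     (\<forall>v\<in>carrier V. \<forall>w\<in>carrier W. \<exists>N. \<forall>k<N. Y v k w = \<zero>\<^bsub>W\<^esub>)"

text \<open>The Jacobi identity for \<open>u, v\<close>, multiplied by \<open>f(x\<^sub>1, x\<^sub>2)\<close> and applied to \<open>w\<close>.\<close>

definition quasi_jacobi ::
  "('v \<Rightarrow> int \<Rightarrow> 'v \<Rightarrow> 'v) \<Rightarrow> (complex, 'w) module \<Rightarrow> ('v \<Rightarrow> int \<Rightarrow> 'w \<Rightarrow> 'w)
     \<Rightarrow> complex poly poly \<Rightarrow> 'v \<Rightarrow> 'v \<Rightarrow> 'w \<Rightarrow> bool" where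
  "quasi_jacobi Y W YW f u v w \<longleftrightarrow>
     (let A = (\<lambda>(k0, k1, k2). if k0 = 0 then YW u k1 (YW v k2 w) else \<zero>\<^bsub>W\<^esub>);
          B = (\<lambda>(k0, k1, k2). if k0 = 0 then YW v k2 (YW u k1 w) else \<zero>\<^bsub>W\<^esub>);
          C = (\<lambda>(k0, k1, k2). if k1 = 0 then YW (Y u k0 v) k2 w else \<zero>\<^bsub>W\<^esub>)
      in \<forall>k. dist_mult W delta_12 (dist_mult W (poly_dist f) A) k
               \<ominus>\<^bsub>W\<^esub> dist_mult W delta_21 (dist_mult W (poly_dist f) B) k
             = dist_mult W delta_10 (dist_mult W (poly_dist f) C) k)"

definition vertex_algebra ::
  "(complex, 'v) module \<Rightarrow> ('v \<Rightarrow> int \<Rightarrow> 'v \<Rightarrow> 'v) \<Rightarrow> 'v \<Rightarrow> bool" where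
  "vertex_algebra V Y vac \<longleftrightarrow>
     Module.module complex_ring V \<and> vac \<in> carrier V \<and> vertex_map V V Y \<and>
     (\<forall>v\<in>carrier V. \<forall>k. Y vac k v = (if k = 0 then v else \<zero>\<^bsub>V\<^esub>)) \<and>
     (\<forall>v\<in>carrier V. (\<forall>k<0. Y v k vac = \<zero>\<^bsub>V\<^esub>) \<and> Y v 0 vac = v) \<and>
     (\<forall>u\<in>carrier V. \<forall>v\<in>carrier V. \<forall>w\<in>carrier V. quasi_jacobi Y V Y 1 u v w)"

definition quasi_module ::
  "(complex, 'v) module \<Rightarrow> ('v \<Rightarrow> int \<Rightarrow> 'v \<Rightarrow> 'v) \<Rightarrow> 'v
     \<Rightarrow> (complex, 'w) module \<Rightarrow> ('v \<Rightarrow> int \<Rightarrow> 'w \<Rightarrow> 'w) \<Rightarrow> bool" where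
  "quasi_module V Y vac W YW \<longleftrightarrow>
     Module.module complex_ring W \<and> vertex_map V W YW \<and>
     (\<forall>w\<in>carrier W. \<forall>k. YW vac k w = (if k = 0 then w else \<zero>\<^bsub>W\<^esub>)) \<and>
     (\<forall>u\<in>carrier V. \<forall>v\<in>carrier V. \<exists>f. f \<noteq> 0 \<and> (\<forall>w\<in>carrier W. quasi_jacobi Y W YW f u v w))"

text \<open>
  \<open>Y\<close> is the vertex algebra structure on the vacuum module with vacuum \<open>\<one>\<close> and
  \<open>Y(a,x) = \<Sum>\<^sub>n (a \<otimes> t\<^sup>n) x\<^sup>-\<^sup>n\<^sup>-\<^sup>1\<close>; such a \<open>Y\<close> is known to exist and to be unique.
\<close>

definition affine_vertex_structure ::
  "(complex \<Rightarrow> 'g \<Rightarrow> 'g) \<Rightarrow> ('g \<Rightarrow> 'g \<Rightarrow> 'g) \<Rightarrow> ('g::ab_group_add \<Rightarrow> 'g \<Rightarrow> complex) \<Rightarrow> complex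
     \<Rightarrow> ('g loop_ext tensors set \<Rightarrow> int \<Rightarrow> 'g loop_ext tensors set \<Rightarrow> 'g loop_ext tensors set)
     \<Rightarrow> bool" where
  "affine_vertex_structure s br B l Y \<longleftrightarrow>
     vertex_algebra (affine_module s br B l) Y (affine_vacuum s br B l) \<and>
     (\<forall>a k. \<forall>v\<in>carrier (affine_module s br B l).
        Y (affine_embed s br B l a) k v = affine_action s br B l (mode a (- k - 1)) v)"

text \<open>The coefficient of \<open>x\<^sup>k\<close> in \<open>a\<^sub>W(x) = \<Sum>\<^sub>n (a \<otimes> t\<^sup>n) x\<^sup>-\<^sup>n\<^sup>-\<^sup>1\<close> and in \<open>a\<^sub>W(m,x) = q\<^sup>m a\<^sub>W(q\<^sup>m x)\<close>.\<close>

definition field_of ::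
  "('a::ab_group_add loop_ext \<Rightarrow> 'w \<Rightarrow> 'w) \<Rightarrow> 'a \<Rightarrow> int \<Rightarrow> 'w \<Rightarrow> 'w" where
  "field_of \<rho> a k w = \<rho> (mode a (- k - 1)) w"

definition twisted_field ::
  "complex \<Rightarrow> (complex \<Rightarrow> 'w \<Rightarrow> 'w) \<Rightarrow> ('a::ab_group_add loop_ext \<Rightarrow> 'w \<Rightarrow> 'w)
     \<Rightarrow> 'a \<Rightarrow> int \<Rightarrow> int \<Rightarrow> 'w \<Rightarrow> 'w" where
  "twisted_field q sW \<rho> a m k w = sW (q powi m * (q powi m) powi k) (field_of \<rho> a k w)"

text \<open>
  The vertex algebra attached to the abelian Lie algebra \<open>\<hh>[\<int>]\<close> with its form; \<open>sh\<close> and \<open>B\<close>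
  are the scalar multiplication and the form of \<open>\<hh>\<close>.
\<close>

abbreviation "hZ_module sh B \<equiv> affine_module (fin_scale sh) (\<lambda>_ _. 0) (hZ_form B)"
abbreviation "hZ_vacuum sh B \<equiv> affine_vacuum (fin_scale sh) (\<lambda>_ _. 0) (hZ_form B)"
abbreviation "hZ_embed sh B \<equiv> affine_embed (fin_scale sh) (\<lambda>_ _. 0) (hZ_form B)"
abbreviation "hZ_vertex_structure sh B \<equiv>
  affine_vertex_structure (fin_scale sh) (\<lambda>_ _. 0) (hZ_form B)"

end

theory Submission
  imports Defs "HOL-Computational_Algebra.Formal_Power_Series" "HOL-Library.Function_Algebras"
begin

text \<open>
  For \<open>a, b \<in> \<hh>\<close> the commutator \<open>[a\<^sub>W(m, x\<^sub>1), b\<^sub>W(n, x\<^sub>2)]\<close> is a scalar, the sum of two double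
  poles at \<open>x\<^sub>1 = q\<^sup>n\<^sup>-\<^sup>m\<^sup>+\<^sup>1 x\<^sub>2\<close> and \<open>x\<^sub>1 = q\<^sup>n\<^sup>-\<^sup>m\<^sup>-\<^sup>1 x\<^sub>2\<close>.  A product of linear forms
  in \<open>x\<^sub>1\<close> and \<open>x\<^sub>2\<close> kills it, so the generating fields are pairwise quasi local.  For two quasi
  local fields, the product \<open>\<alpha>(x\<^sub>1) \<beta>(x\<^sub>2)\<close> can be multiplied by such forms, expanded at
  \<open>x\<^sub>1 = x\<^sub>2 + x\<^sub>0\<close>, and divided by the forms again, in the distributions truncated in \<open>x\<^sub>0\<close>; this
  defines a product of the two fields with values in Laurent series in \<open>x\<^sub>0\<close> (\<open>is_prod\<close>).

  Three facts about these products carry the proof.  Their coefficients are again quasi local to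
  every field that is quasi local to both factors (\<open>prod_quasi_local\<close>).  The three iterated products of three fields satisfy the Jacobi
  identity without any polynomial factor (\<open>field_jacobi\<close>).  The singular part of the product of two
  generating fields comes only from the poles on the diagonal \<open>x\<^sub>1 = x\<^sub>2\<close>; as \<open>q\<close> is not a root of
  unity, it is \<open>\<ell> \<langle>a \<otimes> e\<^sup>m, b \<otimes> e\<^sup>n\<rangle> x\<^sub>0\<^sup>-\<^sup>2\<close>.  Hence the coefficients of the products with the
  generating fields represent the affine Lie algebra of \<open>\<hh>[\<int>]\<close> at level \<open>\<ell>\<close> on the space of fields
  that are quasi local to the generators (\<open>prd_commutator\<close>), and the identity field is a vacuum vector.

  The universal property of the induced module (\<open>ind_map_properties\<close>) now gives a linear map \<open>\<Phi>\<close>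
  from the vacuum module to fields which takes \<open>a \<otimes> e\<^sup>m\<close> to \<open>a\<^sub>W(m, x)\<close>.  Comparing the Jacobi
  identity of the vertex algebra with that of the fields shows by induction that \<open>\<Phi>\<close> takes
  \<open>Y(u, x\<^sub>0) v\<close> to the product of \<open>\<Phi> u\<close> and \<open>\<Phi> v\<close> (\<open>\<Phi>_prod\<close>).  For a product of two
  fields, the quasi Jacobi identity is the three-term identity of the delta functions applied to a
  distribution truncated in both variables (\<open>defect_T\<close>, \<open>quasi_jacobi_prod\<close>); so \<open>\<Phi>\<close> is a quasi
  module structure.  It is the only one: a quasi Jacobi identity determines its third term by the first
  two (\<open>third_term_unique\<close>), so the fields of the generators determine all others.
\<close>

section \<open>Binomial coefficients with integer arguments\<close>

text \<open>
  The coefficient of \<open>x\<^sub>0\<^sup>i x\<^sub>2\<^sup>k\<^sup>-\<^sup>i\<close> in \<open>(x\<^sub>2 + x\<^sub>0)\<^sup>k\<close>.  It vanishes for negative \<open>i\<close>, so that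
  sums over all integers \<open>i\<close> may be shifted and reflected freely.
\<close>

definition bin :: "int \<Rightarrow> int \<Rightarrow> complex" where
  "bin k i = (if i < 0 then 0 else of_int k gchoose nat i)"

lemma bin_negative [simp]: "i < 0 \<Longrightarrow> bin k i = 0"
  by (simp add: bin_def)

lemma bin_0_right [simp]: "bin k 0 = 1"
  by (simp add: bin_def)

lemma bin_0_left: "bin 0 i = (if i = 0 then 1 else 0)"
  by (simp add: bin_def gbinomial_0_left)

lemma bin_Pascal: "bin (k + 1) i = bin k i + bin k (i - 1)"
proof (cases "i \<le> 0")
  case True
  then show ?thesis by (cases "i = 0") auto
next
  case False
  then obtain n where n: "i = int (Suc n)"
    by (metis not_gr0 of_nat_0_le_iff not_le pos_int_cases zero_less_imp_eq_int old.nat.exhaust of_nat_0_less_iff)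
  have e: "nat (int (Suc n) - 1) = n" "nat (int (Suc n)) = Suc n" by auto
  show ?thesis unfolding n bin_def e using gbinomial_Suc_Suc[of "of_int k :: complex" n] by simp
qed

lemma bin_Vandermonde: "bin (a + b) n = (\<Sum>l\<in>{0..n}. bin a l * bin b (n - l))"
proof (cases "n < 0")
  case True
  then show ?thesis by simp
next
  case False
  then obtain m where m: "n = int m" by (metis nonneg_int_cases not_less)
  have "(\<Sum>l\<in>{0..n}. bin a l * bin b (n - l)) = (\<Sum>k\<in>{0..m}. bin a (int k) * bin b (n - int k))"
    unfolding m by (rule sum.reindex_bij_witness[of _ int nat]) auto
  also have "\<dots> = (\<Sum>k\<in>{0..m}. (of_int a gchoose k) * (of_int b gchoose (m - k)))"
    by (intro sum.cong refl) (auto simp: bin_def m nat_diff_distrib)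
  also have "\<dots> = bin (a + b) n"
    by (simp add: gbinomial_Vandermonde bin_def m)
  finally show ?thesis by simp
qed

lemma bin_trinomial:
  assumes "0 \<le> i" "0 \<le> l"
  shows "bin k i * bin (k - i) l = bin (i + l) i * bin k (i + l)"
proof -
  obtain m n where mn: "i = int m" "l = int n" using assms nonneg_int_cases by meson
  have "(of_int k gchoose (m + n)) * (of_nat (m + n) gchoose m)
      = ((of_int k :: complex) gchoose m) * (of_int k - of_nat m gchoose (m + n - m))"
    by (rule gbinomial_trinomial_revision) simp
  then show ?thesis by (simp add: bin_def mn nat_add_distrib algebra_simps)
qed

lemma bin_symmetric:
  assumes "0 \<le> n" shows "bin n k = bin n (n - k)"
proof -
  obtain m where m: "n = int m" using assms nonneg_int_cases by auto
  consider "k < 0" | "0 \<le> k" "k \<le> n" | "n < k" by linarith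
  then show ?thesis
  proof cases
    case 1
    then have "m < nat (n - k)" by (simp add: m)
    then have "m choose nat (n - k) = 0" by (rule binomial_eq_0)
    with 1 show ?thesis by (simp add: bin_def m binomial_gbinomial[symmetric])
  next
    case 2
    then have "m choose nat k = (m choose (m - nat k))" by (intro binomial_symmetric) (simp add: m)
    moreover have "nat (n - k) = m - nat k" using 2 m by (simp add: nat_diff_distrib)
    ultimately show ?thesis using 2 by (simp add: bin_def m binomial_gbinomial[symmetric])
  next
    case 3
    then have "m < nat k" by (simp add: m)
    then have "m choose nat k = 0" by (rule binomial_eq_0)
    with 3 show ?thesis by (simp add: bin_def m binomial_gbinomial[symmetric])
  qed
qed

lemma bin_eq_0: "0 \<le> k \<Longrightarrow> k < i \<Longrightarrow> bin k i = 0"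
  using bin_symmetric[of k i] by simp

definition sgn_of :: "int \<Rightarrow> complex" where
  "sgn_of k = (if even k then 1 else - 1)"

lemma sgn_of_square [simp]: "sgn_of k * sgn_of k = 1"
  by (simp add: sgn_of_def)

lemma sgn_of_add: "sgn_of (k + l) = sgn_of k * sgn_of l"
  by (auto simp: sgn_of_def)

lemma sgn_of_1 [simp]: "sgn_of 1 = - 1" by (simp add: sgn_of_def)

lemma bin_negate: "bin a k = sgn_of k * bin (k - a - 1) k"
proof (cases "k < 0")
  case False
  then obtain n where "k = int n" using nonneg_int_cases by (metis not_less)
  then show ?thesis
    using gbinomial_negated_upper[of "of_int a :: complex" n]
    by (simp add: bin_def sgn_of_def minus_one_power_iff)
qed simp

text \<open>
  Both expansions of \<open>(x\<^sub>1 - x\<^sub>2)\<^sup>n\<close> are compared here, coefficient by coefficient; this is the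
  numerical content of the three-term identity between the delta functions (\<open>defect_T\<close>).
\<close>

lemma bin_three_term: "bin r (r - k) + sgn_of k * bin (k - 1 - r) (- 1 - r) = bin r k"
proof (cases "0 \<le> r")
  case True
  then show ?thesis using bin_symmetric[of r k] by simp
next
  case r: False
  show ?thesis
  proof (cases "r < k")
    case True
    have "bin (k - 1 - r) (- 1 - r) = bin (k - 1 - r) k"
      using bin_symmetric[of "k - 1 - r" k] True by simp
    also have "sgn_of k * \<dots> = bin r k"
      using bin_negate[of r k] by (simp add: algebra_simps)
    finally show ?thesis using True by simp
  next
    case False
    with r have k: "k < 0" by simp
    have "r - k - r - 1 = - 1 - k" by simp
    then have "bin r (r - k) = sgn_of (r - k) * bin (- 1 - k) (r - k)"
      using bin_negate[of r "r - k"] by metis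
    also have "bin (- 1 - k) (r - k) = bin (- 1 - k) (- 1 - r)"
      using bin_symmetric[of "- 1 - k" "r - k"] k by (simp add: algebra_simps)
    also have "\<dots> = sgn_of (- 1 - r) * bin (k - 1 - r) (- 1 - r)"
      using bin_negate[of "- 1 - k" "- 1 - r"] by (simp add: algebra_simps)
    finally show ?thesis using k by (simp add: sgn_of_def)
  qed
qed

lemma Sum_any_shift: "Sum_any (\<lambda>k::int. f (k + c)) = Sum_any f"
  by (rule sym, rule Sum_any.reindex_cong[where l = "\<lambda>k. k + c"]) (auto intro: bij_betw_byWitness[where f' = "\<lambda>k. k - c"])

lemma Sum_any_reflect: "Sum_any (\<lambda>k::int. f (c - k)) = Sum_any f"
  by (rule sym, rule Sum_any.reindex_cong[where l = "\<lambda>k. c - k"]) (auto intro: bij_betw_byWitness[where f' = "\<lambda>k. c - k"])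

section \<open>Formal distributions and linear forms\<close>

definition low :: "int \<Rightarrow> (int \<Rightarrow> 'b::zero) \<Rightarrow> bool" where
  "low N F \<longleftrightarrow> (\<forall>i<N. F i = 0)"

definition trunc2 :: "(int \<Rightarrow> int \<Rightarrow> 'b::zero) \<Rightarrow> bool" where
  "trunc2 F \<longleftrightarrow> (\<exists>K L. \<forall>k l. k < K \<or> l < L \<longrightarrow> F k l = 0)"

definition trunc3 :: "(int \<Rightarrow> int \<Rightarrow> int \<Rightarrow> 'b::zero) \<Rightarrow> bool" where
  "trunc3 F \<longleftrightarrow> (\<exists>K L M. \<forall>k l m. k < K \<or> l < L \<or> m < M \<longrightarrow> F k l m = 0)"

lemma trunc2E:
  assumes "trunc2 F"
  obtains K L where "\<And>k l. k < K \<or> l < L \<Longrightarrow> F k l = 0"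
  using assms unfolding trunc2_def by metis

lemma trunc3E:
  assumes "trunc3 F"
  obtains K L M where "\<And>k l m. k < K \<or> l < L \<or> m < M \<Longrightarrow> F k l m = 0"
  using assms unfolding trunc3_def by metis

lemma trunc2I: "(\<And>k l. k < K \<or> l < L \<Longrightarrow> F k l = 0) \<Longrightarrow> trunc2 F"
  unfolding trunc2_def by metis

lemma trunc3I: "(\<And>k l m. k < K \<or> l < L \<or> m < M \<Longrightarrow> F k l m = 0) \<Longrightarrow> trunc3 F"
  unfolding trunc3_def by metis

lemma lowD: "low N F \<Longrightarrow> i < N \<Longrightarrow> F i = 0"
  by (simp add: low_def)

lemma trunc2_add:
  fixes F Y :: "int \<Rightarrow> int \<Rightarrow> 'b::ab_group_add"
  assumes "trunc2 F" "trunc2 Y" shows "trunc2 (F + Y)"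
proof -
  obtain K L where F: "\<And>k l. k < K \<or> l < L \<Longrightarrow> F k l = 0" by (rule trunc2E[OF assms(1)]) blast
  obtain K' L' where Y: "\<And>k l. k < K' \<or> l < L' \<Longrightarrow> Y k l = 0" by (rule trunc2E[OF assms(2)]) blast
  show ?thesis unfolding trunc2_def
    by (rule exI[of _ "min K K'"], rule exI[of _ "min L L'"]) (auto simp: F Y)
qed

locale formal_series = vector_space scale
  for scale :: "complex \<Rightarrow> 'w::ab_group_add \<Rightarrow> 'w" (infixr "*s" 75)
begin

lemma scale_Sum_any: "c *s Sum_any f = Sum_any (\<lambda>k. c *s f k)"
proof (cases "c = 0")
  case False
  then show ?thesis by (simp add: Sum_any.expand_set scale_sum_right)
qed simp

text \<open>
  Multiplication by the linear forms \<open>a x\<^sub>1 + b x\<^sub>2\<close> and \<open>a x\<^sub>1 + b x\<^sub>2 + c x\<^sub>3\<close>.  All polynomials that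
  are needed to make products of fields local split into linear forms.  Keeping them as lists of forms
  avoids polynomials in several variables, and a single form is easy to cancel or to invert.
\<close>

fun lin2 :: "complex \<times> complex \<Rightarrow> (int \<Rightarrow> int \<Rightarrow> 'w) \<Rightarrow> int \<Rightarrow> int \<Rightarrow> 'w" where
  "lin2 (a, b) F i j = a *s F (i - 1) j + b *s F i (j - 1)"

fun lin3 :: "complex \<times> complex \<times> complex \<Rightarrow> (int \<Rightarrow> int \<Rightarrow> int \<Rightarrow> 'w) \<Rightarrow> int \<Rightarrow> int \<Rightarrow> int \<Rightarrow> 'w" where
  "lin3 (a, b, c) F i j k = a *s F (i - 1) j k + b *s F i (j - 1) k + c *s F i j (k - 1)"

abbreviation lins2 where "lins2 \<equiv> foldr lin2"
abbreviation lins3 where "lins3 \<equiv> foldr lin3"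

lemma lin2_zero [simp]: "lin2 f 0 = 0" by (cases f) (simp add: fun_eq_iff)
lemma lin3_zero [simp]: "lin3 f 0 = 0" by (cases f) (simp add: fun_eq_iff)
lemma lin2_add: "lin2 f (F + Y) = lin2 f F + lin2 f Y"
  by (cases f) (simp add: fun_eq_iff scale_right_distrib algebra_simps)
lemma lin2_diff: "lin2 f (F - Y) = lin2 f F - lin2 f Y"
  by (cases f) (simp add: fun_eq_iff scale_right_diff_distrib algebra_simps)
lemma lin3_diff: "lin3 f (F - Y) = lin3 f F - lin3 f Y"
  by (cases f) (simp add: fun_eq_iff scale_right_diff_distrib algebra_simps)
lemma lin2_scale: "lin2 f (\<lambda>i j. c *s F i j) = (\<lambda>i j. c *s lin2 f F i j)"
  by (cases f) (simp add: fun_eq_iff scale_right_distrib mult.commute)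
lemma lin2_commute: "lin2 f (lin2 g F) = lin2 g (lin2 f F)"
  by (cases f; cases g) (simp add: fun_eq_iff scale_right_distrib algebra_simps)
lemma lin3_commute: "lin3 f (lin3 g F) = lin3 g (lin3 f F)"
  by (cases f; cases g) (simp add: fun_eq_iff scale_right_distrib algebra_simps)

lemma lins2_zero [simp]: "lins2 fs 0 = 0" by (induction fs) (simp_all only: foldr.simps id_apply comp_apply lin2_zero lin3_zero)
lemma lins3_zero [simp]: "lins3 fs 0 = 0" by (induction fs) (simp_all only: foldr.simps id_apply comp_apply lin2_zero lin3_zero)
lemma lins2_add: "lins2 fs (F + Y) = lins2 fs F + lins2 fs Y" by (induction fs) (simp_all only: foldr.simps id_apply comp_apply lin2_add)
lemma lins2_diff: "lins2 fs (F - Y) = lins2 fs F - lins2 fs Y" by (induction fs) (simp_all only: foldr.simps id_apply comp_apply lin2_diff)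
lemma lins3_diff: "lins3 fs (F - Y) = lins3 fs F - lins3 fs Y" by (induction fs) (simp_all only: foldr.simps id_apply comp_apply lin3_diff)
lemma lins2_scale: "lins2 fs (\<lambda>i j. c *s F i j) = (\<lambda>i j. c *s lins2 fs F i j)"
  by (induction fs) (simp_all only: foldr.simps id_apply comp_apply lin2_scale)
lemma lins2_append: "lins2 (fs @ gs) F = lins2 fs (lins2 gs F)" by simp
lemma lin2_lins2: "lin2 f (lins2 gs F) = lins2 gs (lin2 f F)"
  by (induction gs) (simp_all only: foldr.simps id_apply comp_apply list.map lin2_commute)
lemma lin3_lins3: "lin3 f (lins3 gs F) = lins3 gs (lin3 f F)"
  by (induction gs) (simp_all only: foldr.simps id_apply comp_apply list.map lin3_commute)
lemma lins2_commute: "lins2 fs (lins2 gs F) = lins2 gs (lins2 fs F)"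
  by (induction fs) (simp_all only: foldr.simps id_apply comp_apply list.map lin2_lins2)
lemma lins3_commute: "lins3 fs (lins3 gs F) = lins3 gs (lins3 fs F)"
  by (induction fs) (simp_all only: foldr.simps id_apply comp_apply list.map lin3_lins3)

lemma lin2_trunc2: assumes "trunc2 F" shows "trunc2 (lin2 f F)"
proof -
  obtain K L where F: "\<And>k l. k < K \<or> l < L \<Longrightarrow> F k l = 0" by (rule trunc2E[OF assms(1)]) blast
  show ?thesis unfolding trunc2_def
    by (rule exI[of _ "K"], rule exI[of _ "L"], cases f) (simp add: F)
qed

lemma lins2_trunc2: "trunc2 F \<Longrightarrow> trunc2 (lins2 fs F)"
  by (induction fs) (simp_all only: foldr.simps id_apply comp_apply lin2_trunc2)

lemma lin2_low: "low N F \<Longrightarrow> low N (lin2 f F)"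
  by (cases f) (auto simp: low_def fun_eq_iff)
lemma lins2_low: "low N F \<Longrightarrow> low N (lins2 fs F)"
  by (induction fs) (simp_all only: foldr.simps id_apply comp_apply lin2_low)
lemma lin3_low: "low N F \<Longrightarrow> low N (lin3 f F)"
  by (cases f) (auto simp: low_def fun_eq_iff)
lemma lins3_low: "low N F \<Longrightarrow> low N (lins3 fs F)"
  by (induction fs) (simp_all only: foldr.simps id_apply comp_apply lin3_low)

declare lin2.simps [simp del] lin3.simps [simp del]

subsection \<open>The substitution \<open>x\<^sub>1 = x\<^sub>2 + x\<^sub>0\<close>\<close>

text \<open>
  The expansion of \<open>F(x\<^sub>2 + x\<^sub>0, x\<^sub>2)\<close> in nonnegative powers of \<open>x\<^sub>0\<close>; the indices are the
  exponents of \<open>x\<^sub>0\<close> and \<open>x\<^sub>2\<close>.  The sum is finite as soon as \<open>F\<close> is truncated in both variables.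
\<close>

definition T :: "(int \<Rightarrow> int \<Rightarrow> 'w) \<Rightarrow> int \<Rightarrow> int \<Rightarrow> 'w" where
  "T F i p = Sum_any (\<lambda>k. bin k i *s F k (p + i - k))"

lemma T_negative: "i < 0 \<Longrightarrow> T F i p = 0"
  by (simp add: T_def)

lemma T_low: "low 0 (T F)"
  by (auto simp: low_def T_negative fun_eq_iff)

lemma T_0: "T 0 = 0"
  by (simp add: T_def fun_eq_iff)

lemma T_sum:
  assumes "\<And>k l. k < K \<or> l < L \<Longrightarrow> F k l = 0" "A \<le> K" "p + i - L \<le> B"
  shows "T F i p = (\<Sum>k\<in>{A..B}. bin k i *s F k (p + i - k))"
  unfolding T_def
proof (rule Sum_any.expand_superset)
  show "{k. bin k i *s F k (p + i - k) \<noteq> 0} \<subseteq> {A..B}"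
  proof
    fix k assume "k \<in> {k. bin k i *s F k (p + i - k) \<noteq> 0}"
    then have "F k (p + i - k) \<noteq> 0" by auto
    then have "\<not> k < K" "\<not> p + i - k < L" using assms(1) by blast+
    then show "k \<in> {A..B}" using assms(2,3) by auto
  qed
qed simp

lemma T_finite:
  assumes "trunc2 F"
  shows "finite {k. c k *s F k (p - k) \<noteq> 0}"
proof -
  obtain K L where F: "\<And>k l. k < K \<or> l < L \<Longrightarrow> F k l = 0" by (rule trunc2E[OF assms(1)]) blast
  have "{k. c k *s F k (p - k) \<noteq> 0} \<subseteq> {K..p-L}"
  proof
    fix k assume "k \<in> {k. c k *s F k (p - k) \<noteq> 0}"
    then have "F k (p - k) \<noteq> 0" by auto
    then have "\<not> k < K" "\<not> p - k < L" using F by blast+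
    then show "k \<in> {K..p - L}" by auto
  qed
  then show ?thesis by (rule finite_subset) simp
qed

lemma T_bound:
  assumes "\<And>k l. k < K \<or> l < L \<Longrightarrow> F k l = 0" "p + i < K + L"
  shows "T F i p = 0"
  using T_sum[where F = F and K = K and L = L and A = K and B = "p + i - L" and i = i and p = p] assms by simp

lemma T_add:
  assumes "trunc2 F" "trunc2 Y" shows "T (F + Y) = T F + T Y"
proof (intro ext)
  fix i p
  show "T (F + Y) i p = (T F + T Y) i p"
    using Sum_any.distrib[OF T_finite[OF assms(1)] T_finite[OF assms(2)], of "\<lambda>k. bin k i" "p + i" "\<lambda>k. bin k i" "p+i"]
    by (simp add: T_def scale_right_distrib)
qed

lemma T_scale: "T (\<lambda>k l. c *s F k l) = (\<lambda>i p. c *s T F i p)"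
  by (simp add: T_def scale_Sum_any mult.commute fun_eq_iff)

text \<open>
  The form \<open>a x\<^sub>1 + b x\<^sub>2\<close> becomes \<open>a x\<^sub>0 + (a + b) x\<^sub>2\<close> under \<open>x\<^sub>1 = x\<^sub>2 + x\<^sub>0\<close>.
\<close>

fun subst2 :: "complex \<times> complex \<Rightarrow> complex \<times> complex" where
  "subst2 (a, b) = (a, a + b)"

text \<open>
  Substitution is multiplicative; for linear forms this is Pascal's rule.
\<close>

lemma T_lin2:
  assumes "trunc2 F" shows "T (lin2 f F) = lin2 (subst2 f) (T F)"
proof (cases f)
  case (Pair a b)
  show ?thesis unfolding Pair
  proof (intro ext)
    fix i p :: int
    define n where "n = p - 1 + i"
    have fin: "finite {k. c k *s F k (n - k) \<noteq> 0}" for c by (rule T_finite[OF assms])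
    have fin': "finite {k. a *s c k *s F k (n - k) \<noteq> 0}" for a c
      using fin[of "\<lambda>k. a * c k"] by simp
    have *: "Sum_any (\<lambda>k. bin k i *s a *s F (k - 1) (p + i - k))
        = Sum_any (\<lambda>k. a *s bin k i *s F k (n - k)) + Sum_any (\<lambda>k. a *s bin k (i - 1) *s F k (n - k))"
    proof -
      define g where "g k = bin k i *s a *s F (k - 1) (p + i - k)" for k
      have "Sum_any (\<lambda>k. bin k i *s a *s F (k - 1) (p + i - k)) = Sum_any (\<lambda>k. g (k + 1))"
        unfolding Sum_any_shift by (rule Sum_any.cong) (simp only: g_def)
      also have "\<dots> = Sum_any (\<lambda>k. a *s bin k i *s F k (n - k) + a *s bin k (i - 1) *s F k (n - k))"
      proof (rule Sum_any.cong)
        fix k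
        have e: "p + i - (k + 1) = n - k" by (simp add: n_def)
        show "g (k + 1) = a *s bin k i *s F k (n - k) + a *s bin k (i - 1) *s F k (n - k)"
          unfolding g_def e
          by (simp add: bin_Pascal scale_left_distrib scale_right_distrib mult.commute distrib_left)
      qed
      also have "\<dots> = Sum_any (\<lambda>k. a *s bin k i *s F k (n - k)) + Sum_any (\<lambda>k. a *s bin k (i - 1) *s F k (n - k))"
        by (rule Sum_any.distrib) (rule fin')+
      finally show ?thesis .
    qed
    have finb: "finite {k. bin k i *s b *s F k (p + i - k - 1) \<noteq> 0}"
      using fin[of "\<lambda>k. bin k i * b"] by (simp add: n_def algebra_simps)
    have fina: "finite {k. bin k i *s a *s F (k - 1) (p + i - k) \<noteq> 0}"
    proof -
      have "trunc2 (\<lambda>k l. F (k - 1) l)"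
        using assms unfolding trunc2_def by (metis less_diff_eq diff_less_eq)
      from T_finite[OF this, of "\<lambda>k. bin k i * a" "p + i"] show ?thesis by simp
    qed
    have "T (lin2 (a, b) F) i p
       = Sum_any (\<lambda>k. bin k i *s a *s F (k - 1) (p + i - k)) + Sum_any (\<lambda>k. bin k i *s b *s F k (p + i - k - 1))"
      unfolding T_def lin2.simps scale_right_distrib by (rule Sum_any.distrib[OF fina finb])
    also have "Sum_any (\<lambda>k. bin k i *s b *s F k (p + i - k - 1)) = Sum_any (\<lambda>k. b *s bin k i *s F k (n - k))"
      by (rule Sum_any.cong) (simp add: n_def algebra_simps)
    finally have "T (lin2 (a, b) F) i p = a *s Sum_any (\<lambda>k. bin k i *s F k (n - k))
       + a *s Sum_any (\<lambda>k. bin k (i - 1) *s F k (n - k)) + b *s Sum_any (\<lambda>k. bin k i *s F k (n - k))"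
      unfolding * scale_Sum_any .
    also have "Sum_any (\<lambda>k. bin k i *s F k (n - k)) = T F i (p - 1)"
      by (simp add: T_def n_def)
    also have "Sum_any (\<lambda>k. bin k (i - 1) *s F k (n - k)) = T F (i - 1) p"
      unfolding T_def n_def by (rule Sum_any.cong) (simp add: algebra_simps)
    finally have q: "T (lin2 (a, b) F) i p = a *s T F i (p - 1) + a *s T F (i - 1) p + b *s T F i (p - 1)" .
    show "T (lin2 (a, b) F) i p = lin2 (subst2 (a, b)) (T F) i p"
      unfolding q by (simp add: lin2.simps scale_left_distrib)
  qed
qed

lemma T_lins2: "trunc2 F \<Longrightarrow> T (lins2 fs F) = lins2 (map subst2 fs) (T F)"
  by (induction fs) (simp_all only: foldr.simps id_apply comp_apply list.map T_lin2 lins2_trunc2)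

subsection \<open>Substitutions in three variables\<close>

text \<open>
  The substitutions \<open>x\<^sub>1 = x\<^sub>2 + z\<close>, \<open>x\<^sub>2 = x\<^sub>3 + y\<close> and \<open>x\<^sub>1 = x\<^sub>3 + t\<close>.  In the result, the variable that
  has been substituted gives way to the new variable \<open>z\<close>, \<open>y\<close> or \<open>t\<close> in the same position.
\<close>

definition T12 :: "(int \<Rightarrow> int \<Rightarrow> int \<Rightarrow> 'w) \<Rightarrow> int \<Rightarrow> int \<Rightarrow> int \<Rightarrow> 'w" where
  "T12 F i p k = T (\<lambda>a b. F a b k) i p"

definition T23 :: "(int \<Rightarrow> int \<Rightarrow> int \<Rightarrow> 'w) \<Rightarrow> int \<Rightarrow> int \<Rightarrow> int \<Rightarrow> 'w" where
  "T23 F k = T (F k)"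

definition T13 :: "(int \<Rightarrow> int \<Rightarrow> int \<Rightarrow> 'w) \<Rightarrow> int \<Rightarrow> int \<Rightarrow> int \<Rightarrow> 'w" where
  "T13 F i k p = T (\<lambda>a b. F a k b) i p"

fun subst12 :: "complex \<times> complex \<times> complex \<Rightarrow> complex \<times> complex \<times> complex" where
  "subst12 (a, b, c) = (a, a + b, c)"
fun subst23 :: "complex \<times> complex \<times> complex \<Rightarrow> complex \<times> complex \<times> complex" where
  "subst23 (a, b, c) = (a, b, b + c)"
fun subst13 :: "complex \<times> complex \<times> complex \<Rightarrow> complex \<times> complex \<times> complex" where
  "subst13 (a, b, c) = (a, b, a + c)"

text \<open>Truncation in two of the three variables, not uniformly in the remaining one.\<close>

definition trunc12 :: "(int \<Rightarrow> int \<Rightarrow> int \<Rightarrow> 'w) \<Rightarrow> bool" where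
  "trunc12 F \<longleftrightarrow> (\<forall>k. trunc2 (\<lambda>a b. F a b k))"
definition trunc23 :: "(int \<Rightarrow> int \<Rightarrow> int \<Rightarrow> 'w) \<Rightarrow> bool" where
  "trunc23 F \<longleftrightarrow> (\<forall>k. trunc2 (F k))"
definition trunc13 :: "(int \<Rightarrow> int \<Rightarrow> int \<Rightarrow> 'w) \<Rightarrow> bool" where
  "trunc13 F \<longleftrightarrow> (\<forall>k. trunc2 (\<lambda>a b. F a k b))"

lemma trunc2_scale: "trunc2 F \<Longrightarrow> trunc2 (\<lambda>k l. c *s F k l)"
  unfolding trunc2_def by (metis scale_zero_right)

lemma lin3_slice23: "lin3 (a, b, c) F k = (\<lambda>p q. a *s F (k - 1) p q) + lin2 (b, c) (F k)"
  by (simp add: fun_eq_iff lin3.simps lin2.simps algebra_simps)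
lemma lin3_slice12: "(\<lambda>p q. lin3 (a, b, c) F p q k) = (\<lambda>p q. c *s F p q (k - 1)) + lin2 (a, b) (\<lambda>p q. F p q k)"
  by (simp add: fun_eq_iff lin3.simps lin2.simps algebra_simps)
lemma lin3_slice13: "(\<lambda>p q. lin3 (a, b, c) F p k q) = (\<lambda>p q. b *s F p (k - 1) q) + lin2 (a, c) (\<lambda>p q. F p k q)"
  by (simp add: fun_eq_iff lin3.simps lin2.simps algebra_simps)

lemma trunc23_lin3: "trunc23 F \<Longrightarrow> trunc23 (lin3 f F)"
  by (cases f) (simp add: trunc23_def lin3_slice23 trunc2_add trunc2_scale lin2_trunc2)
lemma trunc12_lin3: "trunc12 F \<Longrightarrow> trunc12 (lin3 f F)"
  by (cases f) (simp add: trunc12_def lin3_slice12 trunc2_add trunc2_scale lin2_trunc2)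
lemma trunc23_lins3: "trunc23 F \<Longrightarrow> trunc23 (lins3 fs F)"
  by (induction fs) (simp_all only: foldr.simps id_apply comp_apply trunc23_lin3)
lemma trunc12_lins3: "trunc12 F \<Longrightarrow> trunc12 (lins3 fs F)"
  by (induction fs) (simp_all only: foldr.simps id_apply comp_apply trunc12_lin3)
lemma T23_lin3:
  assumes "trunc23 F" shows "T23 (lin3 f F) = lin3 (subst23 f) (T23 F)"
proof (cases f)
  case (fields a b c)
  show ?thesis
  proof (rule ext)
    fix k
    have t: "trunc2 (F k)" for k using assms by (simp add: trunc23_def)
    have "T (lin3 (a, b, c) F k) = (\<lambda>i p. a *s T (F (k - 1)) i p) + lin2 (b, b + c) (T (F k))"
      unfolding lin3_slice23 by (simp add: T_add trunc2_scale lin2_trunc2 t T_scale T_lin2)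
    then show "T23 (lin3 f F) k = lin3 (subst23 f) (T23 F) k"
      by (simp add: T23_def fields lin3_slice23)
  qed
qed

lemma T12_lin3:
  assumes "trunc12 F" shows "T12 (lin3 f F) = lin3 (subst12 f) (T12 F)"
proof (cases f)
  case (fields a b c)
  show ?thesis
  proof (intro ext)
    fix i p k
    have t: "trunc2 (\<lambda>x y. F x y k)" for k using assms by (simp add: trunc12_def)
    have "T (\<lambda>x y. lin3 (a, b, c) F x y k)
        = (\<lambda>i p. c *s T (\<lambda>x y. F x y (k - 1)) i p) + lin2 (a, a + b) (T (\<lambda>x y. F x y k))"
      unfolding lin3_slice12 by (simp add: T_add trunc2_scale lin2_trunc2 t T_scale T_lin2)
    then show "T12 (lin3 f F) i p k = lin3 (subst12 f) (T12 F) i p k"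
      by (simp add: T12_def fields lin3.simps lin2.simps algebra_simps)
  qed
qed

lemma T23_lins3: "trunc23 F \<Longrightarrow> T23 (lins3 fs F) = lins3 (map subst23 fs) (T23 F)"
  by (induction fs) (simp_all only: foldr.simps id_apply comp_apply list.map T23_lin3 trunc23_lins3)
lemma T12_lins3: "trunc12 F \<Longrightarrow> T12 (lins3 fs F) = lins3 (map subst12 fs) (T12 F)"
  by (induction fs) (simp_all only: foldr.simps id_apply comp_apply list.map T12_lin3 trunc12_lins3)
lemma T23_bound:
  assumes "\<And>k l m. k < K \<or> l < L \<or> m < M \<Longrightarrow> F k l m = 0"
    and "k < K \<or> i < 0 \<or> p + i < L + M"
  shows "T23 F k i p = 0"
proof -
  consider "k < K" | "i < 0" | "p + i < L + M" using assms(2) by blast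
  then show ?thesis
  proof cases
    case 1 then have "F k = 0" using assms(1) by (simp add: fun_eq_iff)
    then show ?thesis by (simp add: T23_def T_0)
  next
    case 2 then show ?thesis by (simp add: T23_def T_negative)
  next
    case 3
    then show ?thesis unfolding T23_def using assms(1) by (intro T_bound[of L M]) auto
  qed
qed

lemma T12_bound:
  assumes "\<And>k l m. k < K \<or> l < L \<or> m < M \<Longrightarrow> F k l m = 0"
    and "k < M \<or> i < 0 \<or> p + i < K + L"
  shows "T12 F i p k = 0"
proof -
  consider "k < M" | "i < 0" | "p + i < K + L" using assms(2) by blast
  then show ?thesis
  proof cases
    case 1 then have "(\<lambda>a b. F a b k) = 0" using assms(1) by (simp add: fun_eq_iff)
    then show ?thesis by (simp add: T12_def T_0)
  next
    case 2 then show ?thesis by (simp add: T12_def T_negative)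
  next
    case 3
    then show ?thesis unfolding T12_def using assms(1) by (intro T_bound[of K L]) auto
  qed
qed

lemma T13_bound:
  assumes "\<And>k l m. k < K \<or> l < L \<or> m < M \<Longrightarrow> F k l m = 0"
    and "k < L \<or> i < 0 \<or> p + i < K + M"
  shows "T13 F i k p = 0"
proof -
  consider "k < L" | "i < 0" | "p + i < K + M" using assms(2) by blast
  then show ?thesis
  proof cases
    case 1 then have "(\<lambda>a b. F a k b) = 0" using assms(1) by (simp add: fun_eq_iff)
    then show ?thesis by (simp add: T13_def T_0)
  next
    case 2 then show ?thesis by (simp add: T13_def T_negative)
  next
    case 3
    then show ?thesis unfolding T13_def using assms(1) by (intro T_bound[of K M]) auto
  qed
qed

lemma trunc23_T12: assumes "trunc3 F" shows "trunc23 (T12 F)"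
proof -
  obtain K L M where F: "\<And>k l m. k < K \<or> l < L \<or> m < M \<Longrightarrow> F k l m = 0" by (rule trunc3E[OF assms(1)]) blast
  show ?thesis unfolding trunc23_def
  proof
    fix i show "trunc2 (T12 F i)"
      by (rule trunc2I[of "K + L - i" M], rule T12_bound, rule F) auto
  qed
qed

lemma trunc13_T23: assumes "trunc3 F" shows "trunc13 (T23 F)"
proof -
  obtain K L M where F: "\<And>k l m. k < K \<or> l < L \<or> m < M \<Longrightarrow> F k l m = 0" by (rule trunc3E[OF assms(1)]) blast
  show ?thesis unfolding trunc13_def
  proof
    fix i show "trunc2 (\<lambda>a b. T23 F a i b)"
      by (rule trunc2I[of "K" "L + M - i"], rule T23_bound, rule F) auto
  qed
qed

lemma T13_T23_sum:
  assumes F: "\<And>k l m. k < K \<or> l < L \<or> m < M \<Longrightarrow> F k l m = 0"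
    and B: "p + i + j - L - M \<le> B" "p + i + j - K - M \<le> C"
  shows "T13 (T23 F) i j p = (\<Sum>k\<in>{K..B}. \<Sum>l\<in>{L..C}. (bin k i * bin l j) *s F k l (p + i + j - k - l))"
    and "T23 (T13 F) i j p = (\<Sum>k\<in>{K..B}. \<Sum>l\<in>{L..C}. (bin k i * bin l j) *s F k l (p + i + j - k - l))"
proof -
  have s23: "T23 F k j r = (\<Sum>l\<in>{L..C'}. bin l j *s F k l (r + j - l))" if "r + j - M \<le> C'" for k r C'
    unfolding T23_def by (rule T_sum[of L M]) (auto intro: F that)
  have s13: "T13 F i l r = (\<Sum>k\<in>{K..B'}. bin k i *s F k l (r + i - k))" if "r + i - M \<le> B'" for l r B'
    unfolding T13_def by (rule T_sum[of K M]) (auto intro: F that)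
  have "T13 (T23 F) i j p = (\<Sum>k\<in>{K..B}. bin k i *s T23 F k j (p + i - k))"
    unfolding T13_def
    by (rule T_sum[of K "L + M - j"]) (use B in \<open>auto intro: T23_bound F\<close>)
  also have "\<dots> = (\<Sum>k\<in>{K..B}. bin k i *s (\<Sum>l\<in>{L..C}. bin l j *s F k l (p + i - k + j - l)))"
    by (rule sum.cong[OF refl]) (use B in \<open>auto simp: s23[where C' = C]\<close>)
  finally show "T13 (T23 F) i j p = (\<Sum>k\<in>{K..B}. \<Sum>l\<in>{L..C}. (bin k i * bin l j) *s F k l (p + i + j - k - l))"
    by (simp add: scale_sum_right algebra_simps)
  have "T23 (T13 F) i j p = (\<Sum>l\<in>{L..C}. bin l j *s T13 F i l (p + j - l))"
    unfolding T23_def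
    by (rule T_sum[of L "K + M - i"]) (use B in \<open>auto intro: T13_bound F\<close>)
  also have "\<dots> = (\<Sum>l\<in>{L..C}. bin l j *s (\<Sum>k\<in>{K..B}. bin k i *s F k l (p + j - l + i - k)))"
    by (rule sum.cong[OF refl]) (use B in \<open>auto simp: s13[where B' = B]\<close>)
  also have "\<dots> = (\<Sum>l\<in>{L..C}. \<Sum>k\<in>{K..B}. (bin k i * bin l j) *s F k l (p + i + j - k - l))"
    by (simp add: scale_sum_right algebra_simps)
  also have "\<dots> = (\<Sum>k\<in>{K..B}. \<Sum>l\<in>{L..C}. (bin k i * bin l j) *s F k l (p + i + j - k - l))"
    by (rule sum.swap)
  finally show "T23 (T13 F) i j p = (\<Sum>k\<in>{K..B}. \<Sum>l\<in>{L..C}. (bin k i * bin l j) *s F k l (p + i + j - k - l))" .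
qed

lemma T13_T23_negative: "i < 0 \<or> j < 0 \<Longrightarrow> T13 (T23 F) i j p = 0"
  by (auto simp: T13_def T23_def T_def)

lemma T13_T23: assumes "trunc3 F" shows "T13 (T23 F) = T23 (T13 F)"
proof (intro ext)
  fix i j p :: int
  obtain K L M where F: "\<And>k l m. k < K \<or> l < L \<or> m < M \<Longrightarrow> F k l m = 0" by (rule trunc3E[OF assms(1)]) blast
  show "T13 (T23 F) i j p = T23 (T13 F) i j p"
    using T13_T23_sum[where F = F and K = K and L = L and M = M and p = p and i = i and j = j, OF _ order_refl order_refl] F by simp
qed

text \<open>
  Substituting \<open>x\<^sub>1 = x\<^sub>2 + z\<close> and then \<open>x\<^sub>2 = x\<^sub>3 + y\<close> amounts to substituting
  \<open>x\<^sub>1 = x\<^sub>3 + t\<close>, \<open>x\<^sub>2 = x\<^sub>3 + y\<close> and then \<open>t = y + z\<close>.  On monomials this is the equality of two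
  expansions of \<open>(x\<^sub>3 + y + z)\<^sup>k (x\<^sub>3 + y)\<^sup>l\<close>, which the Vandermonde convolution and the
  trinomial revision provide.
\<close>

lemma T23_T12: assumes "trunc3 F" shows "T23 (T12 F) = T12 (T13 (T23 F))"
proof (intro ext)
  fix i j p :: int
  obtain K L M where F: "\<And>k l m. k < K \<or> l < L \<or> m < M \<Longrightarrow> F k l m = 0" by (rule trunc3E[OF assms(1)]) blast
  define N where "N = p + i + j"
  define B where "B = N - L - M"
  define C where "C = N - K - M"
  let ?S = "\<lambda>c. (\<Sum>k\<in>{K..B}. \<Sum>l\<in>{L..C}. c k l *s F k l (N - k - l))"
  show "T23 (T12 F) i j p = T12 (T13 (T23 F)) i j p"
  proof (cases "0 \<le> i \<and> 0 \<le> j")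
    case True
    have s12: "T12 F i r m = (\<Sum>k\<in>{K..B}. bin k i *s F k (r + i - k) m)" if "r + i - L \<le> B" for r m
      unfolding T12_def by (rule T_sum[of K L]) (auto intro: F that)
    have "T23 (T12 F) i j p = (\<Sum>r\<in>{K + L - i..p + j - M}. bin r j *s T12 F i r (p + j - r))"
      unfolding T23_def by (rule T_sum[of "K + L - i" M]) (auto intro: T12_bound F)
    also have "\<dots> = (\<Sum>r\<in>{K + L - i..p + j - M}. \<Sum>k\<in>{K..B}. (bin r j * bin k i) *s F k (r + i - k) (p + j - r))"
    proof (rule sum.cong[OF refl])
      fix r assume r: "r \<in> {K + L - i..p + j - M}"
      then have "r + i - L \<le> B" by (simp add: B_def N_def)
      from s12[OF this] show "bin r j *s T12 F i r (p + j - r) = (\<Sum>k\<in>{K..B}. (bin r j * bin k i) *s F k (r + i - k) (p + j - r))"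
        by (simp add: scale_sum_right)
    qed
    also have "\<dots> = (\<Sum>k\<in>{K..B}. \<Sum>r\<in>{K + L - i..p + j - M}. (bin r j * bin k i) *s F k (r + i - k) (p + j - r))"
      by (rule sum.swap)
    also have "\<dots> = ?S (\<lambda>k l. bin (k + l - i) j * bin k i)"
    proof (rule sum.cong[OF refl])
      fix k assume k: "k \<in> {K..B}"
      let ?f = "\<lambda>r. (bin r j * bin k i) *s F k (r + i - k) (p + j - r)"
      have "(\<Sum>r\<in>{K + L - i..p + j - M}. ?f r) = (\<Sum>r\<in>{k + L - i..p + j - M}. ?f r)"
        using k by (intro sum.mono_neutral_right) (auto intro!: F)
      also have "\<dots> = (\<Sum>l\<in>{L..p + j + i - k - M}. (bin (k + l - i) j * bin k i) *s F k l (N - k - l))"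
        by (rule sum.reindex_bij_witness[of _ "\<lambda>l. k + l - i" "\<lambda>r. r + i - k"]) (auto simp: N_def algebra_simps)
      also have "\<dots> = (\<Sum>l\<in>{L..C}. (bin (k + l - i) j * bin k i) *s F k l (N - k - l))"
        using k by (intro sum.mono_neutral_left) (auto simp: C_def N_def intro!: F)
      finally show "(\<Sum>r\<in>{K + L - i..p + j - M}. ?f r) = (\<Sum>l\<in>{L..C}. (bin (k + l - i) j * bin k i) *s F k l (N - k - l))" .
    qed
    also have "\<dots> = ?S (\<lambda>k l. \<Sum>s\<in>{0..j}. bin (i + s) i * (bin k (i + s) * bin l (j - s)))"
    proof -
      have "bin (k + l - i) j * bin k i = (\<Sum>s\<in>{0..j}. bin (i + s) i * (bin k (i + s) * bin l (j - s)))" for k l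
      proof -
        have "bin (k + l - i) j = bin ((k - i) + l) j" by (simp add: algebra_simps)
        also have "\<dots> = (\<Sum>s\<in>{0..j}. bin (k - i) s * bin l (j - s))" by (rule bin_Vandermonde)
        finally have "bin (k + l - i) j * bin k i = (\<Sum>s\<in>{0..j}. bin k i * bin (k - i) s * bin l (j - s))"
          by (simp add: sum_distrib_left sum_distrib_right mult.commute mult.left_commute)
        also have "\<dots> = (\<Sum>s\<in>{0..j}. bin (i + s) i * (bin k (i + s) * bin l (j - s)))"
          using True by (intro sum.cong refl) (simp add: bin_trinomial)
        finally show ?thesis .
      qed
      then show ?thesis by simp
    qed
    also have "\<dots> = (\<Sum>s\<in>{0..j}. bin (i + s) i *s ?S (\<lambda>k l. bin k (i + s) * bin l (j - s)))"
    proof -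
      have "?S (\<lambda>k l. \<Sum>s\<in>{0..j}. bin (i + s) i * (bin k (i + s) * bin l (j - s)))
        = (\<Sum>k\<in>{K..B}. \<Sum>l\<in>{L..C}. \<Sum>s\<in>{0..j}. (bin (i + s) i * (bin k (i + s) * bin l (j - s))) *s F k l (N - k - l))"
        by (simp only: scale_sum_left)
      also have "\<dots> = (\<Sum>k\<in>{K..B}. \<Sum>s\<in>{0..j}. \<Sum>l\<in>{L..C}. (bin (i + s) i * (bin k (i + s) * bin l (j - s))) *s F k l (N - k - l))"
        by (intro sum.cong refl sum.swap)
      also have "\<dots> = (\<Sum>s\<in>{0..j}. \<Sum>k\<in>{K..B}. \<Sum>l\<in>{L..C}. (bin (i + s) i * (bin k (i + s) * bin l (j - s))) *s F k l (N - k - l))"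
        by (rule sum.swap)
      finally show ?thesis by (simp add: scale_sum_right)
    qed
    also have "\<dots> = (\<Sum>s\<in>{0..j}. bin (i + s) i *s T13 (T23 F) (i + s) (j - s) p)"
    proof (intro sum.cong refl)
      fix s
      have "p + (i + s) + (j - s) = N" by (simp add: N_def)
      then show "bin (i + s) i *s ?S (\<lambda>k l. bin k (i + s) * bin l (j - s)) = bin (i + s) i *s T13 (T23 F) (i + s) (j - s) p"
        using T13_T23_sum(1)[where F = F and K = K and L = L and M = M and p = p and i = "i + s" and j = "j - s" and B = B and C = C] F by (simp add: B_def C_def)
    qed
    also have "\<dots> = (\<Sum>k\<in>{i..i+j}. bin k i *s T13 (T23 F) k (j + i - k) p)"
      by (rule sum.reindex_bij_witness[of _ "\<lambda>k. k - i" "\<lambda>s. i + s"]) (auto simp: algebra_simps)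
    also have "\<dots> = (\<Sum>k\<in>{0..i+j}. bin k i *s T13 (T23 F) k (j + i - k) p)"
    proof (rule sum.mono_neutral_left)
      show "\<forall>k\<in>{0..i + j} - {i..i + j}. bin k i *s T13 (T23 F) k (j + i - k) p = 0"
      proof
        fix k assume "k \<in> {0..i + j} - {i..i + j}"
        then have "0 \<le> k" "k < i" by auto
        then have "bin k i = 0" using bin_symmetric[of k i] by simp
        then show "bin k i *s T13 (T23 F) k (j + i - k) p = 0" by simp
      qed
    qed (use True in auto)
    also have "\<dots> = T12 (T13 (T23 F)) i j p"
      unfolding T12_def
      by (rule T_sum[symmetric, of 0 0]) (simp_all add: T13_T23_negative add.commute)
    finally show ?thesis .
  next
    case False
    have j: "T12 (T13 (T23 F)) i j p = 0" if "j < 0"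
      unfolding T12_def
      by (subst T_sum[where K = 0 and L = 0 and A = 0 and B = "i + j"])
        (use that in \<open>simp_all add: T13_T23_negative bin_eq_0 sum.neutral\<close>)
    show ?thesis using False j by (auto simp: T23_def T_negative T12_def T_def)
  qed
qed

subsection \<open>Cancelling and inverting linear forms\<close>

text \<open>
  Among the distributions that are truncated in the first variable, a linear form is not a zero
  divisor: solving for the rows in increasing order leaves no freedom.
\<close>

lemma lin2_cancel:
  assumes "low N F" "lin2 f F = 0" "f \<noteq> (0, 0)"
  shows "F = 0"
proof (cases f)
  case (Pair a b)
  have eq: "a *s F (i - 1) p + b *s F i (p - 1) = 0" for i p
    using fun_cong[OF fun_cong[OF assms(2)], of i p] by (simp add: Pair lin2.simps)
  show ?thesis
  proof (cases "b = 0")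
    case True
    with assms(3) Pair have "a \<noteq> 0" by simp
    then have "F i p = 0" for i p using eq[of "i + 1" p] True by simp
    then show ?thesis by (simp add: fun_eq_iff)
  next
    case False
    have "\<forall>i < N + int n. F i = 0" for n
    proof (induction n)
      case 0
      then show ?case using assms(1) by (simp add: low_def)
    next
      case (Suc n)
      show ?case
      proof (intro allI impI)
        fix i assume i: "i < N + int (Suc n)"
        then have "F (i - 1) = 0" by (intro Suc.IH[rule_format]) simp
        then have "b *s F i (p - 1) = 0" for p using eq[of i p] by simp
        then have "F i (p - 1) = 0" for p using False by simp
        then have "F i p = 0" for p by (metis add_diff_cancel_right')
        then show "F i = 0" by (simp add: fun_eq_iff)
      qed
    qed
    note * = this
    show ?thesis
    proof
      fix i show "F i = 0 i" using *[of "nat (i - N + 1)"] by (simp add: zero_fun_def)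
    qed
  qed
qed

lemma lins2_cancel:
  assumes "low N F" "lins2 fs F = 0" "\<forall>f\<in>set fs. f \<noteq> (0, 0)"
  shows "F = 0"
  using assms(2,3)
proof (induction fs)
  case (Cons f fs)
  have "lins2 fs F = 0"
    proof (rule lin2_cancel[OF lins2_low[OF assms(1)]])
    show "lin2 f (lins2 fs F) = 0" using Cons.prems(1) by (simp only: foldr.simps comp_apply)
    show "f \<noteq> (0, 0)" using Cons.prems(2) by (metis list.set_intros(1))
  qed
  then show ?case using Cons.IH Cons.prems(2) by (metis list.set_intros(2))
qed (simp only: foldr.simps id_apply)

lemma lin3_cancel:
  assumes "low N F" "\<And>i. \<exists>M. low M (F i)" "lin3 f F = 0" "f \<noteq> (0, 0, 0)"
  shows "F = 0"
proof (cases f)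
  case (fields a b c)
  have eq: "(\<lambda>p q. a *s F (k - 1) p q) + lin2 (b, c) (F k) = 0" for k
    using fun_cong[OF assms(3), of k] by (simp add: fields lin3_slice23)
  show ?thesis
  proof (cases "(b, c) = (0, 0)")
    case True
    with assms(4) fields have "a \<noteq> 0" by simp
    then have "F i p q = 0" for i p q
      using fun_cong[OF fun_cong[OF eq[of "i + 1"]], of p q] True by (simp add: lin2.simps)
    then show ?thesis by (simp add: fun_eq_iff)
  next
    case False
    have "\<forall>i < N + int n. F i = 0" for n
    proof (induction n)
      case 0
      then show ?case using assms(1) by (simp add: low_def)
    next
      case (Suc n)
      show ?case
      proof (intro allI impI)
        fix i assume i: "i < N + int (Suc n)"
        then have "F (i - 1) = 0" by (intro Suc.IH[rule_format]) simp
        then have "lin2 (b, c) (F i) = 0" using eq[of i] by (simp add: fun_eq_iff)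
        moreover obtain M where "low M (F i)" using assms(2) by blast
        ultimately show "F i = 0" using lin2_cancel False by blast
      qed
    qed
    note * = this
    show ?thesis
    proof
      fix i show "F i = 0 i" using *[of "nat (i - N + 1)"] by (simp add: zero_fun_def)
    qed
  qed
qed

text \<open>
  Bounded below in the first variable, and in the second one for each power of the first: the support
  condition that is satisfied by iterated products of fields.
\<close>

definition low2 :: "int \<Rightarrow> (int \<Rightarrow> int \<Rightarrow> int \<Rightarrow> 'w) \<Rightarrow> bool" where
  "low2 N F \<longleftrightarrow> low N F \<and> (\<forall>i. \<exists>M. low M (F i))"

lemma low2_lin3: assumes "low2 N F" shows "low2 N (lin3 f F)"
proof -
  have "\<exists>M. low M (lin3 f F i)" for i
  proof -
    obtain M where M: "low M (F i)" using assms by (auto simp: low2_def)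
    obtain M' where M': "low M' (F (i - 1))" using assms by (auto simp: low2_def)
    have "low (min M M') (lin3 f F i)"
      using M M' by (cases f) (simp add: low_def fun_eq_iff lin3.simps)
    then show ?thesis ..
  qed
  then show ?thesis using assms lin3_low by (auto simp: low2_def)
qed

lemma low2_lins3: "low2 N F \<Longrightarrow> low2 N (lins3 fs F)"
  by (induction fs) (simp_all only: foldr.simps id_apply comp_apply low2_lin3)

lemma lins3_cancel:
  assumes "low2 N F" "lins3 fs F = 0" "\<forall>f\<in>set fs. f \<noteq> (0, 0, 0)"
  shows "F = 0"
  using assms(2,3)
proof (induction fs)
  case (Cons f fs)
  have "lins3 fs F = 0"
    proof (rule lin3_cancel[where f = f and N = N])
    show "lin3 f (lins3 fs F) = 0" using Cons.prems(1) by (simp only: foldr.simps comp_apply)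
    show "f \<noteq> (0, 0, 0)" using Cons.prems(2) by (metis list.set_intros(1))
  qed (use low2_lins3[OF assms(1), of fs] in \<open>simp_all only: low2_def\<close>)
  then show ?case using Cons.IH Cons.prems(2) by (metis list.set_intros(2))
qed (simp only: foldr.simps id_apply)

fun e12 :: "complex \<times> complex \<Rightarrow> complex \<times> complex \<times> complex" where "e12 (a, b) = (a, b, 0)"
fun e13 :: "complex \<times> complex \<Rightarrow> complex \<times> complex \<times> complex" where "e13 (a, b) = (a, 0, b)"
fun e23 :: "complex \<times> complex \<Rightarrow> complex \<times> complex \<times> complex" where "e23 (a, b) = (0, a, b)"

lemma lins3_e12: "lins3 (map e12 fs) F i j k = lins2 fs (\<lambda>i j. F i j k) i j"
proof -
  have "(\<lambda>i j. lins3 (map e12 fs) F i j k) = lins2 fs (\<lambda>i j. F i j k)"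
  proof (induction fs)
    case (Cons f fs)
    show ?case
      by (cases f) (simp only: list.map foldr.simps comp_apply e12.simps lin3_slice12 Cons.IH, simp add: fun_eq_iff)
  qed (simp only: list.map foldr.simps id_apply)
  then show ?thesis by (simp add: fun_eq_iff)
qed

lemma lins3_e13: "lins3 (map e13 fs) F i j k = lins2 fs (\<lambda>i k. F i j k) i k"
proof -
  have "(\<lambda>i k. lins3 (map e13 fs) F i j k) = lins2 fs (\<lambda>i k. F i j k)"
  proof (induction fs)
    case (Cons f fs)
    show ?case
      by (cases f) (simp only: list.map foldr.simps comp_apply e13.simps lin3_slice13 Cons.IH, simp add: fun_eq_iff)
  qed (simp only: list.map foldr.simps id_apply)
  then show ?thesis by (simp add: fun_eq_iff)
qed

lemma lins3_e23: "lins3 (map e23 fs) F i = lins2 fs (F i)"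
proof (induction fs)
  case (Cons f fs)
  show ?case
    by (cases f) (simp only: list.map foldr.simps comp_apply e23.simps lin3_slice23 Cons.IH, simp add: fun_eq_iff)
qed (simp only: list.map foldr.simps id_apply)

text \<open>
  If a distribution that is truncated in the first variable has a multiple by a linear form whose rows
  are truncated, its own rows are truncated, by induction on the row.  This is what makes the
  coefficients of a product of fields lower truncated.
\<close>

lemma lin2_rows:
  assumes "low N F" "f \<noteq> (0, 0)" "\<And>i. \<exists>M. low M (lin2 f F i)"
  shows "\<exists>M. low M (F i)"
proof (cases f)
  case (Pair a b)
  show ?thesis
  proof (cases "b = 0")
    case True
    with assms(2) Pair have a: "a \<noteq> 0" by simp
    obtain M where M: "low M (lin2 f F (i + 1))" using assms(3) by blast
    have "low M (F i)" unfolding low_def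
    proof (intro allI impI)
      fix p assume "p < M"
      from lowD[OF M this] show "F i p = 0" using a True Pair by (simp add: lin2.simps)
    qed
    then show ?thesis ..
  next
    case False
    have "\<forall>i < N + int n. \<exists>M. low M (F i)" for n
    proof (induction n)
      case 0
      then show ?case using assms(1) by (auto simp: low_def)
    next
      case (Suc n)
      show ?case
      proof (intro allI impI)
        fix i assume i: "i < N + int (Suc n)"
        then have "\<exists>M. low M (F (i - 1))" by (intro Suc.IH[rule_format]) simp
        then obtain M' where M': "low M' (F (i - 1))" ..
        obtain M where M: "low M (lin2 f F i)" using assms(3) by blast
        have "low (min M M' - 1) (F i)" unfolding low_def
        proof (intro allI impI)
          fix p assume "p < min M M' - 1"
          then have "p + 1 < M" "p + 1 < M'" by auto
          from lowD[OF M this(1)] lowD[OF M' this(2)] show "F i p = 0"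
            using False Pair by (simp add: lin2.simps)
        qed
        then show "\<exists>M. low M (F i)" ..
      qed
    qed
    from this[of "nat (i - N + 1)"] show ?thesis by simp
  qed
qed

lemma lins2_rows:
  assumes "low N F" "\<forall>f\<in>set fs. f \<noteq> (0, 0)" "\<And>i. \<exists>M. low M (lins2 fs F i)"
  shows "\<exists>M. low M (F i)"
  using assms(2,3)
proof (induction fs arbitrary: i)
  case (Cons f fs)
  show ?case
  proof (rule Cons.IH)
    show "\<forall>f\<in>set fs. f \<noteq> (0, 0)" using Cons.prems(1) by (metis list.set_intros(2))
    show "\<exists>M. low M (lins2 fs F i)" for i
    proof (rule lin2_rows[OF lins2_low[OF assms(1)]])
      show "f \<noteq> (0, 0)" using Cons.prems(1) by (metis list.set_intros(1))
      show "\<exists>M. low M (lin2 f (lins2 fs F) i)" for i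
        using Cons.prems(2)[of i] by (simp only: foldr.simps comp_apply)
    qed
  qed
qed (simp only: foldr.simps id_apply)

text \<open>
  If the form involves the third variable, its inverse can be expanded in nonnegative powers of the
  first two.  The series below is the geometric series of the operator \<open>K\<close>; each coefficient receives
  only finitely many contributions, because \<open>K\<close> raises the total degree in the first two variables.
\<close>

lemma lin3_invert:
  assumes c: "c \<noteq> 0" and G: "\<And>i j. i < M \<or> j < N \<Longrightarrow> G i j = 0"
  shows "\<exists>Y. (\<forall>i j. i < M \<or> j < N \<longrightarrow> Y i j = 0) \<and> lin3 (a, b, c) Y = G"
proof -
  define K where "K Y i j p = (- (1 / c)) *s (a *s Y (i - 1) j (p + 1) + b *s Y i (j - 1) (p + 1))"
    for Y :: "int \<Rightarrow> int \<Rightarrow> int \<Rightarrow> 'w" and i j p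
  define Z where "Z n = (K ^^ n) (\<lambda>i j p. (1 / c) *s G i j (p + 1))" for n
  have Z0: "Z n i j p = 0" if "i < M \<or> j < N \<or> i + j < M + N + int n" for n i j p
    using that
  proof (induction n arbitrary: i j p)
    case 0
    then have "i < M \<or> j < N" by auto
    then show ?case by (simp add: Z_def G)
  next
    case (Suc n)
    have "Z n (i - 1) j (p + 1) = 0" "Z n i (j - 1) (p + 1) = 0"
      by (rule Suc.IH; use Suc.prems in auto)+
    then show ?case by (simp add: Z_def K_def)
  qed
  define Y where "Y i j p = (\<Sum>n<nat (i + j - M - N + 1). Z n i j p)" for i j p
  have Y: "Y i j p = (\<Sum>n<B. Z n i j p)" if "nat (i + j - M - N + 1) \<le> B" for i j p B
    unfolding Y_def using that by (intro sum.mono_neutral_left) (auto intro!: Z0)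
  have "lin3 (a, b, c) Y i j p = G i j p" for i j p
  proof -
    define B where "B = nat (i + j - M - N + 1)"
    have "Y i j (p - 1) = (\<Sum>n<Suc B. Z n i j (p - 1))" by (rule Y) (simp add: B_def)
    also have "\<dots> = Z 0 i j (p - 1) + (\<Sum>n<B. Z (Suc n) i j (p - 1))"
      by (rule sum.lessThan_Suc_shift)
    also have "(\<Sum>n<B. Z (Suc n) i j (p - 1)) = (- (1 / c)) *s (a *s (\<Sum>n<B. Z n (i - 1) j p) + b *s (\<Sum>n<B. Z n i (j - 1) p))"
      by (simp only: Z_def K_def funpow.simps comp_apply scale_sum_right[symmetric] sum.distrib diff_add_cancel)
    also have "(\<Sum>n<B. Z n (i - 1) j p) = Y (i - 1) j p" by (rule Y[symmetric]) (simp add: B_def)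
    also have "(\<Sum>n<B. Z n i (j - 1) p) = Y i (j - 1) p" by (rule Y[symmetric]) (simp add: B_def)
    finally have "c *s Y i j (p - 1) = c *s Z 0 i j (p - 1) - (a *s Y (i - 1) j p + b *s Y i (j - 1) p)"
      using c by (simp add: scale_right_distrib scale_right_diff_distrib)
    then show ?thesis using c by (simp add: lin3.simps Z_def)
  qed
  then have "lin3 (a, b, c) Y = G" by (simp add: fun_eq_iff)
  moreover have "\<forall>i j. i < M \<or> j < N \<longrightarrow> Y i j = 0"
    by (auto simp: Y_def fun_eq_iff intro!: sum.neutral Z0)
  ultimately show ?thesis by blast
qed

text \<open>
  A form \<open>a x\<^sub>0 + b x\<^sub>2\<close> can be divided out by expanding in nonnegative powers of \<open>x\<^sub>0\<close>, or by
  shifting if \<open>b = 0\<close>; the shift costs one power of \<open>x\<^sub>0\<close>.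
\<close>

lemma lin2_invert:
  assumes "f \<noteq> (0, 0)" and "low N G"
  shows "\<exists>Y. low (N - 1) Y \<and> lin2 f Y = G"
proof (cases f)
  case (Pair a b)
  show ?thesis
  proof (cases "b = 0")
    case True
    with assms(1) Pair have "a \<noteq> 0" by simp
    then have "lin2 f (\<lambda>i p. (1 / a) *s G (i + 1) p) = G"
      using True Pair by (simp add: fun_eq_iff lin2.simps)
    moreover have "low (N - 1) (\<lambda>i p. (1 / a) *s G (i + 1) p)"
      using assms(2) by (auto simp: low_def fun_eq_iff)
    ultimately show ?thesis by blast
  next
    case False
    have "\<exists>Y. (\<forall>i j. i < N \<or> j < 0 \<longrightarrow> Y i j = 0) \<and> lin3 (a, 0, b) Y = (\<lambda>i j p. if j = 0 then G i p else 0)"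
      by (rule lin3_invert[OF False]) (use assms(2) in \<open>auto simp: low_def fun_eq_iff\<close>)
    then obtain Y where Y: "\<And>i j. i < N \<or> j < 0 \<Longrightarrow> Y i j = 0"
      "lin3 (a, 0, b) Y = (\<lambda>i j p. if j = 0 then G i p else 0)" by blast
    have "lin2 f (\<lambda>i p. Y i 0 p) i p = G i p" for i p
      using fun_cong[OF fun_cong[OF fun_cong[OF Y(2), of i], of 0], of p] Pair
      by (simp add: lin2.simps lin3.simps)
    moreover have "low (N - 1) (\<lambda>i p. Y i 0 p)" using Y(1) by (auto simp: low_def fun_eq_iff)
    ultimately show ?thesis by (intro exI[of _ "\<lambda>i p. Y i 0 p"]) (simp add: fun_eq_iff)
  qed
qed

lemma lins2_invert:
  assumes "\<forall>f\<in>set fs. f \<noteq> (0, 0)" and "low N G"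
  shows "\<exists>Y. low (N - int (length fs)) Y \<and> lins2 fs Y = G"
  using assms
proof (induction fs arbitrary: G N)
  case Nil
  then show ?case by (auto simp: id_def)
next
  case (Cons f fs)
  obtain Z where Z: "low (N - 1) Z" "lin2 f Z = G"
    using lin2_invert[of f N G] Cons.prems by (metis list.set_intros(1))
  obtain Y where "low (N - 1 - int (length fs)) Y" "lins2 fs Y = Z"
    using Cons.IH[OF _ Z(1)] Cons.prems(1) by (metis list.set_intros(2))
  moreover have "N - 1 - int (length fs) = N - int (length (f # fs))" by simp
  ultimately show ?case using Z by (intro exI[of _ Y]) (simp only: foldr.simps comp_apply)
qed

text \<open>
  Forms that can be divided out within the distributions bounded in the first two variables: those
  which involve the third variable, and the monomials in the first two.
\<close>

definition invertible :: "complex \<times> complex \<times> complex \<Rightarrow> bool" where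
  "invertible f \<longleftrightarrow> (case f of (a, b, c) \<Rightarrow> c \<noteq> 0 \<or> (a \<noteq> 0) \<noteq> (b \<noteq> 0))"

lemma lin3_invertible:
  assumes "invertible f" and G: "\<And>i j. i < M \<or> j < N \<Longrightarrow> G i j = 0"
  shows "\<exists>Y. (\<forall>i j. i < M - 1 \<or> j < N - 1 \<longrightarrow> Y i j = 0) \<and> lin3 f Y = G"
proof (cases f)
  case (fields a b c)
  consider "c \<noteq> 0" | "c = 0" "a = 0" "b \<noteq> 0" | "c = 0" "a \<noteq> 0" "b = 0"
    using assms(1) by (auto simp: invertible_def fields)
  then show ?thesis
  proof cases
    case 1
    obtain Y where Y: "\<And>i j. i < M \<or> j < N \<Longrightarrow> Y i j = 0" "lin3 (a, b, c) Y = G"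
      using lin3_invert[OF 1, of M N G a b] G by blast
    have "\<forall>i j. i < M - 1 \<or> j < N - 1 \<longrightarrow> Y i j = 0"
      by (intro allI impI Y(1)) auto
    then show ?thesis using Y(2) fields by blast
  next
    case 2
    show ?thesis
      by (rule exI[of _ "\<lambda>i j p. (1 / b) *s G i (j + 1) p"])
        (use G 2 fields in \<open>auto simp: fun_eq_iff lin3.simps\<close>)
  next
    case 3
    show ?thesis
      by (rule exI[of _ "\<lambda>i j p. (1 / a) *s G (i + 1) j p"])
        (use G 3 fields in \<open>auto simp: fun_eq_iff lin3.simps\<close>)
  qed
qed

lemma lins3_invertible:
  assumes "\<forall>f\<in>set fs. invertible f" and "\<And>i j. i < M \<or> j < N \<Longrightarrow> G i j = 0"
  shows "\<exists>K L Y. (\<forall>i j. i < K \<or> j < L \<longrightarrow> Y i j = 0) \<and> lins3 fs Y = G"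
  using assms
proof (induction fs arbitrary: G M N)
  case Nil
  then show ?case by (metis foldr.simps(1) id_apply)
next
  case (Cons f fs)
  obtain Z where Z: "\<And>i j. i < M - 1 \<or> j < N - 1 \<Longrightarrow> Z i j = 0" "lin3 f Z = G"
    using lin3_invertible[of f M N G] Cons.prems by (metis list.set_intros(1))
  have "\<exists>K L Y. (\<forall>i j. i < K \<or> j < L \<longrightarrow> Y i j = 0) \<and> lins3 fs Y = Z"
    by (rule Cons.IH[OF _ Z(1)]) (use Cons.prems(1) in \<open>metis list.set_intros(2)\<close>, assumption)
  then obtain K L Y where "\<forall>i j. i < K \<or> j < L \<longrightarrow> Y i j = 0" "lins3 fs Y = Z" by blast
  then show ?case using Z(2) by (intro exI[of _ K] exI[of _ L] exI[of _ Y]) (simp only: foldr.simps comp_apply)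
qed

subsection \<open>The three terms of the Jacobi identity\<close>

text \<open>
  All three delta functions are expansions of powers of binomials, so the three terms of the Jacobi
  identity are sums of this shape, with the upper argument \<open>x\<close> depending on the term.
\<close>

definition bsum :: "(int \<Rightarrow> int) \<Rightarrow> (int \<Rightarrow> 'w) \<Rightarrow> 'w" where
  "bsum x g = Sum_any (\<lambda>j. bin (x j) j *s g j)"

definition above :: "(int \<Rightarrow> 'w) \<Rightarrow> bool" where
  "above g \<longleftrightarrow> (\<exists>U. \<forall>j>U. g j = 0)"

lemma bsum_finite:
  assumes "above g" shows "finite {j. bin (x j) j *s g j \<noteq> 0}"
proof -
  obtain U where U: "\<And>j. j > U \<Longrightarrow> g j = 0" using assms by (auto simp: above_def)
  have "{j. bin (x j) j *s g j \<noteq> 0} \<subseteq> {0..U}"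
    using U by (auto simp: not_less[symmetric])
  then show ?thesis by (rule finite_subset) simp
qed

lemma above_scale: "above g \<Longrightarrow> above (\<lambda>j. a *s g j)"
  unfolding above_def by (metis scale_zero_right)

lemma above_shift: assumes "above g" shows "above (\<lambda>j. g (j + 1))"
proof -
  obtain U where U: "\<And>j. j > U \<Longrightarrow> g j = 0" using assms by (auto simp: above_def)
  then show ?thesis unfolding above_def by (intro exI[of _ U]) auto
qed

lemma bsum_add:
  "above g \<Longrightarrow> above h \<Longrightarrow> bsum x (\<lambda>j. g j + h j) = bsum x g + bsum x h"
  unfolding bsum_def scale_right_distrib by (rule Sum_any.distrib) (rule bsum_finite, assumption)+

lemma bsum_scale: "bsum x (\<lambda>j. a *s g j) = a *s bsum x g"
  unfolding bsum_def scale_Sum_any by (rule Sum_any.cong) (simp add: mult.commute)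

lemma bsum_lin:
  assumes "above g" "above h"
  shows "bsum x (\<lambda>j. a *s g j + b *s h j) = a *s bsum x g + b *s bsum x h"
  unfolding bsum_scale[symmetric] using assms by (intro bsum_add above_scale)

lemma bsum_shift: "bsum x (\<lambda>j. g (j + 1)) = Sum_any (\<lambda>j. bin (x (j - 1)) (j - 1) *s g j)"
  using Sum_any_shift[of "\<lambda>j. bin (x (j - 1)) (j - 1) *s g j" 1] by (simp add: bsum_def)

lemma shift_finite:
  assumes "above g" shows "finite {j. bin (y j) (j - 1) *s g j \<noteq> 0}"
proof -
  obtain U where U: "\<And>j. j > U \<Longrightarrow> g j = 0" using assms by (auto simp: above_def)
  have "{j. bin (y j) (j - 1) *s g j \<noteq> 0} \<subseteq> {0..U}"
    using U by (auto simp: not_less[symmetric])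
  then show ?thesis by (rule finite_subset) simp
qed

text \<open>
  Pascal's rule in the two shapes in which it occurs: with a constant upper argument for the third term,
  and with an upper argument that grows with the summation index for the first two.
\<close>

lemma bsum_Pascal:
  assumes "above g"
  shows "bsum (\<lambda>_. x) (\<lambda>j. g (j + 1)) + bsum (\<lambda>_. x) g = bsum (\<lambda>_. x + 1) g"
  unfolding bsum_shift bsum_def
  by (subst Sum_any.distrib[symmetric, OF shift_finite[OF assms] bsum_finite[OF assms]])
    (rule Sum_any.cong, simp add: bin_Pascal scale_left_distrib)

lemma bsum_Pascal':
  assumes "above g"
  shows "bsum (\<lambda>j. k - 1 + j) g + bsum (\<lambda>j. k + j) (\<lambda>j. g (j + 1)) = bsum (\<lambda>j. k + j) g"
proof -
  have "bin (k + j) j = bin (k - 1 + j) j + bin (k + (j - 1)) (j - 1)" for j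
    using bin_Pascal[of "k - 1 + j" j] by (simp add: algebra_simps)
  then have *: "bin (k + j) j *s g j = bin (k - 1 + j) j *s g j + bin (k + (j - 1)) (j - 1) *s g j" for j
    unfolding scale_left_distrib[symmetric] by (rule arg_cong)
  show ?thesis
    unfolding bsum_shift bsum_def
    by (subst Sum_any.distrib[symmetric, OF bsum_finite[OF assms] shift_finite[OF assms]])
      (rule Sum_any.cong, rule *[symmetric])
qed

text \<open>
  The products of a distribution with the three delta functions
  \<open>x\<^sub>0\<^sup>-\<^sup>1 \<delta>((x\<^sub>1 - x\<^sub>2) / x\<^sub>0)\<close>, \<open>x\<^sub>0\<^sup>-\<^sup>1 \<delta>((x\<^sub>2 - x\<^sub>1) / -x\<^sub>0)\<close> and
  \<open>x\<^sub>2\<^sup>-\<^sup>1 \<delta>((x\<^sub>1 - x\<^sub>0) / x\<^sub>2)\<close>, the last of which equals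
  \<open>x\<^sub>1\<^sup>-\<^sup>1 \<delta>((x\<^sub>2 + x\<^sub>0) / x\<^sub>1)\<close>.  The argument of \<open>d12\<close> and \<open>d21\<close> is a distribution in
  \<open>x\<^sub>1, x\<^sub>2\<close>, that of \<open>d10\<close> one in \<open>x\<^sub>0, x\<^sub>2\<close>.
\<close>

definition d12 :: "(int \<Rightarrow> int \<Rightarrow> 'w) \<Rightarrow> int \<Rightarrow> int \<Rightarrow> int \<Rightarrow> 'w" where
  "d12 A k0 k1 k2 = bsum (\<lambda>j. k0 + j) (\<lambda>j. A (k1 + k0 + 1 + j) (k2 - j))"

definition d21 :: "(int \<Rightarrow> int \<Rightarrow> 'w) \<Rightarrow> int \<Rightarrow> int \<Rightarrow> int \<Rightarrow> 'w" where
  "d21 A k0 k1 k2 = sgn_of (k0 + 1) *s bsum (\<lambda>j. k0 + j) (\<lambda>j. A (k1 - j) (k2 + k0 + 1 + j))"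

definition d10 :: "(int \<Rightarrow> int \<Rightarrow> 'w) \<Rightarrow> int \<Rightarrow> int \<Rightarrow> int \<Rightarrow> 'w" where
  "d10 A k0 k1 k2 = bsum (\<lambda>_. - k1 - 1) (\<lambda>j. A (k0 - j) (k2 + 1 + j + k1))"

text \<open>
  The Jacobi identity states that this vanishes.
\<close>

definition defect ::
  "(int \<Rightarrow> int \<Rightarrow> 'w) \<Rightarrow> (int \<Rightarrow> int \<Rightarrow> 'w) \<Rightarrow> (int \<Rightarrow> int \<Rightarrow> 'w) \<Rightarrow> int \<Rightarrow> int \<Rightarrow> int \<Rightarrow> 'w" where
  "defect A B C k0 k1 k2 = d12 A k0 k1 k2 - d21 B k0 k1 k2 - d10 C k0 k1 k2"

definition bounded1 :: "(int \<Rightarrow> int \<Rightarrow> 'w) \<Rightarrow> bool" where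
  "bounded1 A \<longleftrightarrow> (\<exists>K. \<forall>k l. k < K \<longrightarrow> A k l = 0)"
definition bounded2 :: "(int \<Rightarrow> int \<Rightarrow> 'w) \<Rightarrow> bool" where
  "bounded2 A \<longleftrightarrow> (\<exists>L. \<forall>k l. l < L \<longrightarrow> A k l = 0)"

lemma bounded2_above: assumes "bounded2 A" shows "above (\<lambda>j. A (f j) (k - j))"
proof -
  obtain L where "\<And>k l. l < L \<Longrightarrow> A k l = 0" using assms by (auto simp: bounded2_def)
  then show ?thesis unfolding above_def by (intro exI[of _ "k - L"]) auto
qed

lemma bounded1_above: assumes "bounded1 A" shows "above (\<lambda>j. A (k - j) (f j))"
proof -
  obtain L where "\<And>k l. k < L \<Longrightarrow> A k l = 0" using assms by (auto simp: bounded1_def)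
  then show ?thesis unfolding above_def by (intro exI[of _ "k - L"]) auto
qed

lemma d12_lin2:
  assumes "bounded2 A" shows "d12 (lin2 f A) k0 = lin2 f (d12 A k0)"
proof (cases f, intro ext)
  fix a b k1 k2 assume f: "f = (a, b)"
  have 1: "above (\<lambda>j. A (k1 + k0 + 1 + j - 1) (k2 - j))" by (rule bounded2_above[OF assms])
  have 2: "above (\<lambda>j. A (k1 + k0 + 1 + j) (k2 - j - 1))"
    using bounded2_above[OF assms, of "\<lambda>j. k1 + k0 + 1 + j" "k2 - 1"] by (simp add: diff_diff_eq add.commute)
  show "d12 (lin2 f A) k0 k1 k2 = lin2 f (d12 A k0) k1 k2"
    unfolding d12_def f lin2.simps bsum_lin[OF 1 2] by (simp add: algebra_simps)
qed

lemma d21_lin2: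
  assumes "bounded1 A" shows "d21 (lin2 f A) k0 = lin2 f (d21 A k0)"
proof (cases f, intro ext)
  fix a b k1 k2 assume f: "f = (a, b)"
  have 1: "above (\<lambda>j. A (k1 - j) (k2 + k0 + 1 + j - 1))" by (rule bounded1_above[OF assms])
  have 2: "above (\<lambda>j. A (k1 - j - 1) (k2 + k0 + 1 + j))"
    using bounded1_above[OF assms, of "k1 - 1" "\<lambda>j. k2 + k0 + 1 + j"] by (simp add: diff_diff_eq add.commute)
  show "d21 (lin2 f A) k0 k1 k2 = lin2 f (d21 A k0) k1 k2"
    unfolding d21_def f lin2.simps bsum_lin[OF 2 1] by (simp add: algebra_simps)
qed

lemma d10_lin2:
  assumes "bounded1 C" shows "d10 (lin2 (subst2 f) C) k0 = lin2 f (d10 C k0)"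
proof (cases f, intro ext)
  fix a b k1 k2 assume f: "f = (a, b)"
  define g where "g j = C (k0 - j) (k2 + k1 + j)" for j
  have g: "above g" unfolding g_def by (rule bounded1_above[OF assms])
  have "d10 (lin2 (subst2 f) C) k0 k1 k2 = bsum (\<lambda>_. - k1 - 1) (\<lambda>j. a *s g (j + 1) + (a + b) *s g j)"
    unfolding d10_def by (rule arg_cong[where f = "bsum _"]) (simp add: fun_eq_iff f lin2.simps g_def algebra_simps)
  also have "\<dots> = a *s (bsum (\<lambda>_. - k1 - 1) (\<lambda>j. g (j + 1)) + bsum (\<lambda>_. - k1 - 1) g) + b *s bsum (\<lambda>_. - k1 - 1) g"
    unfolding bsum_lin[OF above_shift[OF g] g] by (simp add: algebra_simps)
  also have "\<dots> = a *s bsum (\<lambda>_. - (k1 - 1) - 1) g + b *s bsum (\<lambda>_. - k1 - 1) g"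
    unfolding bsum_Pascal[OF g] by simp
  also have "\<dots> = lin2 f (d10 C k0) k1 k2"
    by (simp add: f lin2.simps d10_def g_def[abs_def] algebra_simps)
  finally show "d10 (lin2 (subst2 f) C) k0 k1 k2 = lin2 f (d10 C k0) k1 k2" .
qed

text \<open>
  In the presence of the third delta function \<open>x\<^sub>1\<close> may be replaced by \<open>x\<^sub>2 + x\<^sub>0\<close>, so all
  three terms can be multiplied by the same form.
\<close>

lemma defect_lin2:
  assumes "bounded2 A" "bounded1 B" "bounded1 C"
  shows "defect (lin2 f A) (lin2 f B) (lin2 (subst2 f) C) k0 = lin2 f (defect A B C k0)"
proof -
  have "defect A B C k0 = d12 A k0 - d21 B k0 - d10 C k0" for A B C
    by (simp add: defect_def fun_eq_iff)
  then show ?thesis by (simp add: d12_lin2 d21_lin2 d10_lin2 assms lin2_diff)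
qed

text \<open>
  The first two delta functions allow \<open>x\<^sub>1 - x\<^sub>2\<close> to be replaced by \<open>x\<^sub>0\<close>.  Hence powers of
  this form, unlike other forms, can be cancelled from the Jacobi identity.
\<close>

lemma defect_shift:
  assumes A: "bounded2 A" and B: "bounded1 B" and C: "bounded1 C"
  shows "defect (lin2 (a, - a) A) (lin2 (a, - a) B) (lin2 (a, 0) C) k0 k1 k2 = a *s defect A B C (k0 - 1) k1 k2"
proof -
  define g where "g j = A (k1 + k0 + j) (k2 - j)" for j
  have g: "above g" unfolding g_def by (rule bounded2_above[OF A])
  have "d12 (lin2 (a, - a) A) k0 k1 k2 = bsum (\<lambda>j. k0 + j) (\<lambda>j. a *s g j + (- a) *s g (j + 1))"
    unfolding d12_def by (rule arg_cong[where f = "bsum _"]) (simp add: fun_eq_iff lin2.simps g_def algebra_simps)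
  also have "\<dots> = a *s (bsum (\<lambda>j. k0 + j) g - bsum (\<lambda>j. k0 + j) (\<lambda>j. g (j + 1)))"
    unfolding bsum_lin[OF g above_shift[OF g]] by (simp add: scale_right_diff_distrib)
  also have "\<dots> = a *s bsum (\<lambda>j. k0 - 1 + j) g"
    unfolding bsum_Pascal'[OF g, of k0, symmetric] by simp
  also have "\<dots> = a *s d12 A (k0 - 1) k1 k2"
    by (simp add: d12_def g_def[abs_def] algebra_simps)
  finally have 1: "d12 (lin2 (a, - a) A) k0 k1 k2 = a *s d12 A (k0 - 1) k1 k2" .
  define h where "h j = B (k1 - j) (k2 + k0 + j)" for j
  have h: "above h" unfolding h_def by (rule bounded1_above[OF B])
  have "bsum (\<lambda>j. k0 + j) (\<lambda>j. lin2 (a, - a) B (k1 - j) (k2 + k0 + 1 + j)) = bsum (\<lambda>j. k0 + j) (\<lambda>j. a *s h (j + 1) + (- a) *s h j)"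
    by (rule arg_cong[where f = "bsum _"]) (simp add: fun_eq_iff lin2.simps h_def algebra_simps)
  also have "\<dots> = (- a) *s (bsum (\<lambda>j. k0 + j) h - bsum (\<lambda>j. k0 + j) (\<lambda>j. h (j + 1)))"
    unfolding bsum_lin[OF above_shift[OF h] h] by (simp add: scale_right_diff_distrib)
  also have "\<dots> = (- a) *s bsum (\<lambda>j. k0 - 1 + j) h"
    unfolding bsum_Pascal'[OF h, of k0, symmetric] by simp
  finally have 2: "d21 (lin2 (a, - a) B) k0 k1 k2 = a *s d21 B (k0 - 1) k1 k2"
    by (simp add: d21_def h_def[abs_def] algebra_simps sgn_of_add)
  have 3: "d10 (lin2 (a, 0) C) k0 k1 k2 = a *s d10 C (k0 - 1) k1 k2"
  proof -
    have "lin2 (a, 0) C i p = a *s C (i - 1) p" for i p by (simp add: lin2.simps)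
    then show ?thesis by (simp add: d10_def bsum_scale algebra_simps)
  qed
  show ?thesis by (simp add: defect_def 1 2 3 scale_right_diff_distrib)
qed

text \<open>
  The three-term identity of the delta functions: applied to one distribution that is truncated in both
  variables, the difference of the first two equals the third after the substitution.
\<close>

lemma defect_T:
  assumes "trunc2 D" shows "defect D D (T D) = 0"
proof (intro ext)
  fix k0 k1 k2 :: int
  obtain K L where D: "\<And>k l. k < K \<or> l < L \<Longrightarrow> D k l = 0" by (rule trunc2E[OF assms(1)]) blast
  define n where "n = k1 + k2 + k0 + 1"
  have fin: "Sum_any (\<lambda>m. c m *s D m (n - m)) = (\<Sum>m\<in>{K..n - L}. c m *s D m (n - m))" for c
  proof (rule Sum_any.expand_superset)
    show "{m. c m *s D m (n - m) \<noteq> 0} \<subseteq> {K..n - L}"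
    proof
      fix m assume "m \<in> {m. c m *s D m (n - m) \<noteq> 0}"
      then have "\<not> (m < K \<or> n - m < L)" using D by force
      then show "m \<in> {K..n - L}" by auto
    qed
  qed simp
  define g where "g m = bin (m - k1 - 1) (m - k1 - 1 - k0) *s D m (n - m)" for m
  have "d12 D k0 k1 k2 = Sum_any (\<lambda>j. g (j + (k1 + k0 + 1)))"
    unfolding d12_def bsum_def
  proof (rule Sum_any.cong)
    fix j
    have e: "j + (k1 + k0 + 1) - k1 - 1 = k0 + j" "k0 + j - k0 = j" "k1 + k0 + 1 + j = j + (k1 + k0 + 1)"
      "n - (j + (k1 + k0 + 1)) = k2 - j" by (simp_all add: n_def)
    show "bin (k0 + j) j *s D (k1 + k0 + 1 + j) (k2 - j) = g (j + (k1 + k0 + 1))"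
      unfolding g_def e ..
  qed
  then have 1: "d12 D k0 k1 k2 = (\<Sum>m\<in>{K..n - L}. bin (m - k1 - 1) (m - k1 - 1 - k0) *s D m (n - m))"
    unfolding Sum_any_shift unfolding g_def[abs_def] fin .
  define h where "h m = bin (k0 - 1 - (m - k1 - 1)) (- 1 - (m - k1 - 1)) *s D m (n - m)" for m
  have "bsum (\<lambda>j. k0 + j) (\<lambda>j. D (k1 - j) (k2 + k0 + 1 + j)) = Sum_any (\<lambda>j. h (k1 - j))"
    unfolding bsum_def
  proof (rule Sum_any.cong)
    fix j
    have e: "k0 - 1 - (k1 - j - k1 - 1) = k0 + j" "- 1 - (k1 - j - k1 - 1) = j" "n - (k1 - j) = k2 + k0 + 1 + j"
      by (simp_all add: n_def)
    show "bin (k0 + j) j *s D (k1 - j) (k2 + k0 + 1 + j) = h (k1 - j)"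
      unfolding h_def e ..
  qed
  then have 2: "d21 D k0 k1 k2 = sgn_of (k0 + 1) *s (\<Sum>m\<in>{K..n - L}. bin (k0 - 1 - (m - k1 - 1)) (- 1 - (m - k1 - 1)) *s D m (n - m))"
    unfolding d21_def Sum_any_reflect unfolding h_def[abs_def] fin by (rule arg_cong)
  have "d10 (T D) k0 k1 k2 = (\<Sum>l\<in>{0..k0}. bin (- k1 - 1) l *s T D (k0 - l) (k2 + 1 + l + k1))"
    unfolding d10_def bsum_def by (rule Sum_any.expand_superset) (auto simp: not_less[symmetric] T_negative)
  also have "\<dots> = (\<Sum>l\<in>{0..k0}. \<Sum>m\<in>{K..n - L}. (bin (- k1 - 1) l * bin m (k0 - l)) *s D m (n - m))"
  proof (intro sum.cong refl)
    fix l
    have n: "k2 + 1 + l + k1 + (k0 - l) = n" by (simp add: n_def)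
    have tn: "T D (k0 - l) (k2 + 1 + l + k1) = (\<Sum>m\<in>{K..n - L}. bin m (k0 - l) *s D m (n - m))"
      unfolding T_def n by (rule fin)
    show "bin (- k1 - 1) l *s T D (k0 - l) (k2 + 1 + l + k1) = (\<Sum>m\<in>{K..n - L}. (bin (- k1 - 1) l * bin m (k0 - l)) *s D m (n - m))"
      unfolding tn scale_sum_right scale_scale ..
  qed
  also have "\<dots> = (\<Sum>m\<in>{K..n - L}. \<Sum>l\<in>{0..k0}. (bin (- k1 - 1) l * bin m (k0 - l)) *s D m (n - m))"
    by (rule sum.swap)
  also have "\<dots> = (\<Sum>m\<in>{K..n - L}. bin (m - k1 - 1) k0 *s D m (n - m))"
  proof (intro sum.cong refl)
    fix m
    have e: "- k1 - 1 + m = m - k1 - 1" by simp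
    show "(\<Sum>l\<in>{0..k0}. (bin (- k1 - 1) l * bin m (k0 - l)) *s D m (n - m)) = bin (m - k1 - 1) k0 *s D m (n - m)"
      unfolding scale_sum_left[symmetric] bin_Vandermonde[of "- k1 - 1" m k0, symmetric] e ..
  qed
  finally have 3: "d10 (T D) k0 k1 k2 = (\<Sum>m\<in>{K..n - L}. bin (m - k1 - 1) k0 *s D m (n - m))" .
  have "bin (m - k1 - 1) k0 = bin (m - k1 - 1) (m - k1 - 1 - k0) - sgn_of (k0 + 1) * bin (k0 - 1 - (m - k1 - 1)) (- 1 - (m - k1 - 1))" for m
    using bin_three_term[of "m - k1 - 1" k0] by (simp add: sgn_of_add)
  then have "d10 (T D) k0 k1 k2 = d12 D k0 k1 k2 - d21 D k0 k1 k2"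
    unfolding 1 2 3 by (simp only: scale_left_diff_distrib sum_subtractf scale_sum_right scale_scale)
  then show "defect D D (T D) k0 k1 k2 = 0 k0 k1 k2" by (simp add: defect_def)
qed

text \<open>
  The coefficient of \<open>x\<^sub>1\<^sup>-\<^sup>1\<close> recovers the third term of the Jacobi identity.
\<close>

lemma d10_residue: "d10 C k0 (- 1) k2 = C k0 k2"
proof -
  have "d10 C k0 (- 1) k2 = Sum_any (\<lambda>j. bin 0 j *s C (k0 - j) (k2 + 1 + j + - 1))"
    by (simp only: d10_def bsum_def minus_minus diff_self)
  also have "\<dots> = (\<Sum>j\<in>{0}. bin 0 j *s C (k0 - j) (k2 + 1 + j + - 1))"
    by (rule Sum_any.expand_superset) (auto simp: bin_0_left split: if_splits)
  finally show ?thesis by simp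
qed

section \<open>Fields and their products\<close>

definition is_field :: "(int \<Rightarrow> 'w \<Rightarrow> 'w) \<Rightarrow> bool" where
  "is_field \<alpha> \<longleftrightarrow> (\<forall>k. Vector_Spaces.linear scale scale (\<alpha> k)) \<and> (\<forall>w. \<exists>N. \<forall>k<N. \<alpha> k w = 0)"

lemma linear_scale_iff:
  "Vector_Spaces.linear scale scale f \<longleftrightarrow> (\<forall>x y. f (x + y) = f x + f y) \<and> (\<forall>c x. f (c *s x) = c *s f x)"
  using vector_space_axioms by (auto simp: linear_iff_module_hom module_hom_iff module_axioms)

lemma is_fieldI:
  assumes "\<And>k x y. \<alpha> k (x + y) = \<alpha> k x + \<alpha> k y" "\<And>k c x. \<alpha> k (c *s x) = c *s \<alpha> k x"
    and "\<And>w. \<exists>N. \<forall>k<N. \<alpha> k w = 0"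
  shows "is_field \<alpha>"
  using assms by (simp add: is_field_def linear_scale_iff)

lemma field_add: "is_field \<alpha> \<Longrightarrow> \<alpha> k (x + y) = \<alpha> k x + \<alpha> k y"
  by (simp add: is_field_def linear_scale_iff)
lemma field_scale: "is_field \<alpha> \<Longrightarrow> \<alpha> k (c *s x) = c *s \<alpha> k x"
  by (simp add: is_field_def linear_scale_iff)
lemma field_zero: "is_field \<alpha> \<Longrightarrow> \<alpha> k 0 = 0"
  using field_add[of \<alpha> k 0 0] by simp
lemma field_sum: "is_field \<alpha> \<Longrightarrow> \<alpha> k (\<Sum>x\<in>S. f x) = (\<Sum>x\<in>S. \<alpha> k (f x))"
  by (induction S rule: infinite_finite_induct) (simp_all add: field_zero field_add)
lemma field_low: assumes "is_field \<alpha>" obtains N where "\<And>k. k < N \<Longrightarrow> \<alpha> k w = 0"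
  using assms unfolding is_field_def by metis

lemma field_lin2: "is_field \<alpha> \<Longrightarrow> lin2 f (\<lambda>l m. \<alpha> k (F l m)) = (\<lambda>l m. \<alpha> k (lin2 f F l m))"
  by (cases f) (simp add: fun_eq_iff lin2.simps field_add field_scale)
lemma field_lins2: "is_field \<alpha> \<Longrightarrow> lins2 fs (\<lambda>l m. \<alpha> k (F l m)) = (\<lambda>l m. \<alpha> k (lins2 fs F l m))"
  by (induction fs) (simp_all only: foldr.simps id_apply comp_apply field_lin2)

lemma field_T:
  assumes "is_field \<alpha>" "trunc2 F" shows "T (\<lambda>l m. \<alpha> k (F l m)) = (\<lambda>i p. \<alpha> k (T F i p))"
proof (intro ext)
  fix i p
  obtain K L where F: "\<And>k l. k < K \<or> l < L \<Longrightarrow> F k l = 0" by (rule trunc2E[OF assms(2)]) blast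
  then have F': "\<And>x l. x < K \<or> l < L \<Longrightarrow> \<alpha> k (F x l) = 0" using field_zero[OF assms(1)] by simp
  have 1: "T F i p = (\<Sum>x\<in>{K..p + i - L}. bin x i *s F x (p + i - x))"
    by (rule T_sum[of K L]) (simp_all add: F)
  have 2: "T (\<lambda>l m. \<alpha> k (F l m)) i p = (\<Sum>x\<in>{K..p + i - L}. bin x i *s \<alpha> k (F x (p + i - x)))"
    by (rule T_sum[of K L]) (simp_all add: F')
  show "T (\<lambda>l m. \<alpha> k (F l m)) i p = \<alpha> k (T F i p)"
    unfolding 1 2 by (simp add: field_sum field_scale assms(1))
qed

abbreviation comp2 :: "(int \<Rightarrow> 'w \<Rightarrow> 'w) \<Rightarrow> (int \<Rightarrow> 'w \<Rightarrow> 'w) \<Rightarrow> 'w \<Rightarrow> int \<Rightarrow> int \<Rightarrow> 'w" where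
  "comp2 \<alpha> \<beta> w \<equiv> \<lambda>k l. \<alpha> k (\<beta> l w)"
abbreviation comp2' :: "(int \<Rightarrow> 'w \<Rightarrow> 'w) \<Rightarrow> (int \<Rightarrow> 'w \<Rightarrow> 'w) \<Rightarrow> 'w \<Rightarrow> int \<Rightarrow> int \<Rightarrow> 'w" where
  "comp2' \<alpha> \<beta> w \<equiv> \<lambda>k l. \<beta> l (\<alpha> k w)"

definition nonzero_forms :: "(complex \<times> complex) list \<Rightarrow> bool" where
  "nonzero_forms fs \<longleftrightarrow> (\<forall>f\<in>set fs. f \<noteq> (0, 0))"

lemma nonzero_forms_append [simp]: "nonzero_forms (fs @ gs) \<longleftrightarrow> nonzero_forms fs \<and> nonzero_forms gs"
  by (auto simp: nonzero_forms_def)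

lemma nonzero_forms_subst [simp]: "nonzero_forms (map subst2 fs) \<longleftrightarrow> nonzero_forms fs"
  by (force simp: nonzero_forms_def)

text \<open>
  Quasi locality: the commutator is annihilated by a product of nonzero linear forms, which need not be
  multiples of \<open>x\<^sub>1 - x\<^sub>2\<close>.
\<close>

definition quasi_local :: "(complex \<times> complex) list \<Rightarrow> (int \<Rightarrow> 'w \<Rightarrow> 'w) \<Rightarrow> (int \<Rightarrow> 'w \<Rightarrow> 'w) \<Rightarrow> bool" where
  "quasi_local fs \<alpha> \<beta> \<longleftrightarrow> nonzero_forms fs \<and> (\<forall>w. lins2 fs (comp2 \<alpha> \<beta> w) = lins2 fs (comp2' \<alpha> \<beta> w))"

lemma quasi_local_append: "nonzero_forms gs \<Longrightarrow> quasi_local fs \<alpha> \<beta> \<Longrightarrow> quasi_local (gs @ fs) \<alpha> \<beta>"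
  by (simp add: quasi_local_def)

lemma quasi_local_append2:
  assumes "nonzero_forms gs" "quasi_local fs \<alpha> \<beta>" shows "quasi_local (fs @ gs) \<alpha> \<beta>"
proof -
  have "lins2 (fs @ gs) F = lins2 (gs @ fs) F" for F
    unfolding lins2_append by (rule lins2_commute)
  then show ?thesis using quasi_local_append[OF assms] unfolding quasi_local_def nonzero_forms_append by metis
qed

lemma lins2_swap: "lins2 (map prod.swap fs) (\<lambda>l k. F k l) l k = lins2 fs F k l"
proof -
  have "lins2 (map prod.swap fs) (\<lambda>l k. F k l) = (\<lambda>l k. lins2 fs F k l)"
  proof (induction fs)
    case (Cons f fs)
    show ?case
      by (cases f) (simp only: list.map foldr.simps comp_apply Cons.IH, simp add: fun_eq_iff lin2.simps add.commute)
  qed (simp only: list.map foldr.simps id_apply)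
  then show ?thesis by simp
qed

lemma quasi_local_sym:
  assumes "quasi_local fs \<alpha> \<beta>" shows "quasi_local (map prod.swap fs) \<beta> \<alpha>"
proof -
  have "nonzero_forms (map prod.swap fs)" using assms by (force simp: quasi_local_def nonzero_forms_def)
  moreover have "lins2 (map prod.swap fs) (comp2 \<beta> \<alpha> w) = lins2 (map prod.swap fs) (comp2' \<beta> \<alpha> w)" for w
  proof (intro ext)
    fix l k
    show "lins2 (map prod.swap fs) (comp2 \<beta> \<alpha> w) l k = lins2 (map prod.swap fs) (comp2' \<beta> \<alpha> w) l k"
      using assms lins2_swap[of fs "comp2 \<alpha> \<beta> w" l k] lins2_swap[of fs "comp2' \<alpha> \<beta> w" l k]
      by (simp add: quasi_local_def)
  qed
  ultimately show ?thesis by (simp add: quasi_local_def)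
qed

lemma bounded1_lin2: assumes "bounded1 F" shows "bounded1 (lin2 f F)"
proof -
  obtain K where "\<And>k l. k < K \<Longrightarrow> F k l = 0" using assms by (auto simp: bounded1_def)
  then show ?thesis unfolding bounded1_def by (intro exI[of _ K]) (cases f, simp add: lin2.simps)
qed
lemma bounded2_lin2: assumes "bounded2 F" shows "bounded2 (lin2 f F)"
proof -
  obtain K where "\<And>k l. l < K \<Longrightarrow> F k l = 0" using assms by (auto simp: bounded2_def)
  then show ?thesis unfolding bounded2_def by (intro exI[of _ K]) (cases f, simp add: lin2.simps)
qed
lemma bounded1_lins2: "bounded1 F \<Longrightarrow> bounded1 (lins2 fs F)"
  by (induction fs) (simp_all only: foldr.simps id_apply comp_apply bounded1_lin2)
lemma bounded2_lins2: "bounded2 F \<Longrightarrow> bounded2 (lins2 fs F)"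
  by (induction fs) (simp_all only: foldr.simps id_apply comp_apply bounded2_lin2)

lemma bounded_trunc2: assumes "bounded1 F" "bounded2 F" shows "trunc2 F"
proof -
  obtain K where "\<And>k l. k < K \<Longrightarrow> F k l = 0" using assms by (auto simp: bounded1_def)
  moreover obtain L where "\<And>k l. l < L \<Longrightarrow> F k l = 0" using assms by (auto simp: bounded2_def)
  ultimately show ?thesis by (intro trunc2I[of K L]) auto
qed

lemma bounded2_comp2:
  assumes "is_field \<alpha>" "is_field \<beta>" shows "bounded2 (comp2 \<alpha> \<beta> w)"
proof -
  obtain N where "\<And>k. k < N \<Longrightarrow> \<beta> k w = 0" using field_low[OF assms(2)] by metis
  then show ?thesis unfolding bounded2_def by (intro exI[of _ N]) (simp add: field_zero[OF assms(1)])
qed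

lemma bounded1_comp2':
  assumes "is_field \<alpha>" "is_field \<beta>" shows "bounded1 (comp2' \<alpha> \<beta> w)"
proof -
  obtain N where "\<And>k. k < N \<Longrightarrow> \<alpha> k w = 0" using field_low[OF assms(1)] by metis
  then show ?thesis unfolding bounded1_def by (intro exI[of _ N]) (simp add: field_zero[OF assms(2)])
qed

text \<open>
  One order of the factors bounds the exponent of \<open>x\<^sub>2\<close>, the other order that of \<open>x\<^sub>1\<close>.
\<close>

lemma quasi_local_trunc2:
  assumes "is_field \<alpha>" "is_field \<beta>" "quasi_local fs \<alpha> \<beta>"
  shows "trunc2 (lins2 fs (comp2 \<alpha> \<beta> w))"
proof (rule bounded_trunc2)
  have "bounded1 (lins2 fs (comp2' \<alpha> \<beta> w))" using assms by (intro bounded1_lins2 bounded1_comp2')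
  then show "bounded1 (lins2 fs (comp2 \<alpha> \<beta> w))" using assms(3) by (simp add: quasi_local_def)
qed (use assms in \<open>intro bounded2_lins2 bounded2_comp2\<close>)

text \<open>
  \<open>C i\<close> is the coefficient of \<open>x\<^sub>0\<^sup>i\<close> in the product \<open>\<alpha>(x\<^sub>2 + x\<^sub>0) \<beta>(x\<^sub>2)\<close>.  The substitution makes
  sense only after multiplication by forms that make the two fields commute; these are divided out
  again in the distributions truncated in \<open>x\<^sub>0\<close>.  The bound \<open>N\<close> is uniform in the vector.
\<close>

definition prod_via ::
  "(complex \<times> complex) list \<Rightarrow> int \<Rightarrow> (int \<Rightarrow> 'w \<Rightarrow> 'w) \<Rightarrow> (int \<Rightarrow> 'w \<Rightarrow> 'w) \<Rightarrow> (int \<Rightarrow> int \<Rightarrow> 'w \<Rightarrow> 'w) \<Rightarrow> bool" where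
  "prod_via fs N \<alpha> \<beta> C \<longleftrightarrow> quasi_local fs \<alpha> \<beta> \<and> low N C \<and>
     (\<forall>w. T (lins2 fs (comp2 \<alpha> \<beta> w)) = lins2 (map subst2 fs) (\<lambda>i p. C i p w))"

definition is_prod :: "(int \<Rightarrow> 'w \<Rightarrow> 'w) \<Rightarrow> (int \<Rightarrow> 'w \<Rightarrow> 'w) \<Rightarrow> (int \<Rightarrow> int \<Rightarrow> 'w \<Rightarrow> 'w) \<Rightarrow> bool" where
  "is_prod \<alpha> \<beta> C \<longleftrightarrow> (\<exists>fs N. prod_via fs N \<alpha> \<beta> C)"

lemma prod_via_append:
  assumes "is_field \<alpha>" "is_field \<beta>" "prod_via fs N \<alpha> \<beta> C" "nonzero_forms gs"
  shows "prod_via (gs @ fs) N \<alpha> \<beta> C"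
proof -
  have ql: "quasi_local fs \<alpha> \<beta>" using assms(3) by (simp add: prod_via_def)
  have "T (lins2 (gs @ fs) (comp2 \<alpha> \<beta> w)) = lins2 (map subst2 (gs @ fs)) (\<lambda>i p. C i p w)" for w
    using assms(3) unfolding lins2_append T_lins2[OF quasi_local_trunc2[OF assms(1,2) ql]] map_append
    by (simp add: prod_via_def)
  then show ?thesis using assms quasi_local_append[OF assms(4) ql] by (simp only: prod_via_def) simp
qed

lemma prod_via_append2:
  assumes "is_field \<alpha>" "is_field \<beta>" "prod_via fs N \<alpha> \<beta> C" "nonzero_forms gs"
  shows "prod_via (fs @ gs) N \<alpha> \<beta> C"
proof -
  have "lins2 (fs @ gs) F = lins2 (gs @ fs) F" "lins2 (map subst2 (fs @ gs)) F = lins2 (map subst2 (gs @ fs)) F" for F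
    unfolding lins2_append map_append by (rule lins2_commute)+
  moreover have "quasi_local (fs @ gs) \<alpha> \<beta>" using assms by (intro quasi_local_append2) (simp_all add: prod_via_def)
  ultimately show ?thesis using prod_via_append[OF assms] by (simp only: prod_via_def) simp
qed

lemma low_slice: "low N C \<Longrightarrow> low N (\<lambda>i p. C i p w)"
  by (auto simp: low_def fun_eq_iff)

text \<open>
  The forms used for the two products can be combined, and then cancelled.
\<close>

lemma is_prod_unique:
  assumes "is_field \<alpha>" "is_field \<beta>" "is_prod \<alpha> \<beta> C" "is_prod \<alpha> \<beta> C'"
  shows "C = C'"
proof -
  obtain fs N where 1: "prod_via fs N \<alpha> \<beta> C" using assms by (auto simp: is_prod_def)
  obtain fs' N' where 2: "prod_via fs' N' \<alpha> \<beta> C'" using assms by (auto simp: is_prod_def)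
  have nz: "nonzero_forms fs" "nonzero_forms fs'" using 1 2 by (auto simp: prod_via_def quasi_local_def)
  have 3: "prod_via (fs @ fs') N \<alpha> \<beta> C" by (rule prod_via_append2[OF assms(1,2) 1 nz(2)])
  have 4: "prod_via (fs @ fs') N' \<alpha> \<beta> C'" by (rule prod_via_append[OF assms(1,2) 2 nz(1)])
  have "(\<lambda>i p. C i p w) - (\<lambda>i p. C' i p w) = 0" for w
  proof (rule lins2_cancel)
    show "low (min N N') ((\<lambda>i p. C i p w) - (\<lambda>i p. C' i p w))"
      using 3 4 by (auto simp: prod_via_def low_def fun_eq_iff)
    show "lins2 (map subst2 (fs @ fs')) ((\<lambda>i p. C i p w) - (\<lambda>i p. C' i p w)) = 0"
      using 3 4 unfolding lins2_diff by (simp only: prod_via_def) simp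
    show "\<forall>f\<in>set (map subst2 (fs @ fs')). f \<noteq> (0, 0)"
      using nz unfolding nonzero_forms_def[symmetric] nonzero_forms_subst by simp
  qed
  note eq = this
  have "C i p w = C' i p w" for i p w
    using fun_cong[OF fun_cong[OF eq[of w], of i], of p] by simp
  then show ?thesis by (simp add: fun_eq_iff)
qed

lemma is_prod_exists:
  assumes "is_field \<alpha>" "is_field \<beta>" "quasi_local fs \<alpha> \<beta>"
  shows "\<exists>C. is_prod \<alpha> \<beta> C"
proof -
  have nz: "\<forall>f\<in>set (map subst2 fs). f \<noteq> (0, 0)"
    using assms(3) unfolding nonzero_forms_def[symmetric] nonzero_forms_subst by (simp add: quasi_local_def)
  let ?N = "0 - int (length (map subst2 fs))"
  have "\<exists>Y. low ?N Y \<and> lins2 (map subst2 fs) Y = T (lins2 fs (comp2 \<alpha> \<beta> w))" for w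
    by (rule lins2_invert[OF nz T_low])
  then obtain Y where Y: "\<And>w. low ?N (Y w)" "\<And>w. lins2 (map subst2 fs) (Y w) = T (lins2 fs (comp2 \<alpha> \<beta> w))"
    by metis
  have "prod_via fs ?N \<alpha> \<beta> (\<lambda>i p w. Y w i p)"
    using Y(1) assms(3) by (auto simp: prod_via_def low_def fun_eq_iff Y(2)[unfolded fun_eq_iff])
  then show ?thesis by (auto simp: is_prod_def)
qed

lemma is_prod_low: assumes "is_prod \<alpha> \<beta> C" obtains N where "low N C"
  using assms by (auto simp: is_prod_def prod_via_def)

text \<open>
  Both sides of each linearity condition agree after multiplication by the forms, hence agree;
  truncation is \<open>lins2_rows\<close>.
\<close>

lemma is_prod_field:
  assumes "is_field \<alpha>" "is_field \<beta>" "is_prod \<alpha> \<beta> C"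
  shows "is_field (C i)"
proof -
  obtain fs N where 1: "prod_via fs N \<alpha> \<beta> C" using assms by (auto simp: is_prod_def)
  have ql: "quasi_local fs \<alpha> \<beta>" and lo: "low N C"
    and C: "\<And>w. T (lins2 fs (comp2 \<alpha> \<beta> w)) = lins2 (map subst2 fs) (\<lambda>i p. C i p w)"
    using 1 by (auto simp: prod_via_def)
  have nz: "\<forall>f\<in>set (map subst2 fs). f \<noteq> (0, 0)"
    using ql unfolding nonzero_forms_def[symmetric] nonzero_forms_subst by (simp add: quasi_local_def)
  have tr: "trunc2 (lins2 fs (comp2 \<alpha> \<beta> w))" for w by (rule quasi_local_trunc2[OF assms(1,2) ql])
  have low: "low N (\<lambda>i p. C i p w)" for w by (rule low_slice[OF lo])
  show ?thesis
  proof (rule is_fieldI)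
    fix k x y
    have "(\<lambda>i p. C i p (x + y)) - ((\<lambda>i p. C i p x) + (\<lambda>i p. C i p y)) = 0"
    proof (rule lins2_cancel[OF _ _ nz])
      show "low N ((\<lambda>i p. C i p (x + y)) - ((\<lambda>i p. C i p x) + (\<lambda>i p. C i p y)))"
        using low by (auto simp: low_def fun_eq_iff)
      have "comp2 \<alpha> \<beta> (x + y) = comp2 \<alpha> \<beta> x + comp2 \<alpha> \<beta> y"
        by (simp add: fun_eq_iff field_add assms)
      then have "T (lins2 fs (comp2 \<alpha> \<beta> (x + y))) = T (lins2 fs (comp2 \<alpha> \<beta> x)) + T (lins2 fs (comp2 \<alpha> \<beta> y))"
        by (simp only: lins2_add T_add tr)
      then show "lins2 (map subst2 fs) ((\<lambda>i p. C i p (x + y)) - ((\<lambda>i p. C i p x) + (\<lambda>i p. C i p y))) = 0"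
        unfolding lins2_diff lins2_add C[symmetric] by simp
    qed
    from fun_cong[OF fun_cong[OF this, of i], of k] show "C i k (x + y) = C i k x + C i k y" by simp
  next
    fix k c x
    have "(\<lambda>i p. C i p (c *s x)) - (\<lambda>i p. c *s C i p x) = 0"
    proof (rule lins2_cancel[OF _ _ nz])
      show "low N ((\<lambda>i p. C i p (c *s x)) - (\<lambda>i p. c *s C i p x))"
        using low by (auto simp: low_def fun_eq_iff)
      have "comp2 \<alpha> \<beta> (c *s x) = (\<lambda>k l. c *s comp2 \<alpha> \<beta> x k l)"
        by (simp add: fun_eq_iff field_scale assms)
      then have "T (lins2 fs (comp2 \<alpha> \<beta> (c *s x))) = (\<lambda>i p. c *s T (lins2 fs (comp2 \<alpha> \<beta> x)) i p)"
        by (simp only: lins2_scale T_scale)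
      then show "lins2 (map subst2 fs) ((\<lambda>i p. C i p (c *s x)) - (\<lambda>i p. c *s C i p x)) = 0"
        unfolding lins2_diff lins2_scale C[symmetric] by simp
    qed
    from fun_cong[OF fun_cong[OF this, of i], of k] show "C i k (c *s x) = c *s C i k x" by simp
  next
    fix w
    have "\<exists>M. low M (C' i)" if C': "C' = (\<lambda>i p. C i p w)" for C'
    proof (rule lins2_rows[OF _ nz])
      show "low N C'" unfolding C' by (rule low)
      fix i
      obtain K L where D: "\<And>k l. k < K \<or> l < L \<Longrightarrow> lins2 fs (comp2 \<alpha> \<beta> w) k l = 0"
        by (rule trunc2E[OF tr]) blast
      show "\<exists>M. low M (lins2 (map subst2 fs) C' i)" unfolding C' C[symmetric] low_def
        by (intro exI[of _ "K + L - i"] allI impI T_bound[of K L] D) auto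
    qed
    then show "\<exists>N. \<forall>k<N. C i k w = 0" by (simp add: low_def)
  qed
qed

definition prd :: "(int \<Rightarrow> 'w \<Rightarrow> 'w) \<Rightarrow> (int \<Rightarrow> 'w \<Rightarrow> 'w) \<Rightarrow> int \<Rightarrow> int \<Rightarrow> 'w \<Rightarrow> 'w" where
  "prd \<alpha> \<beta> = (SOME C. is_prod \<alpha> \<beta> C)"

lemma is_prod_prd:
  "is_field \<alpha> \<Longrightarrow> is_field \<beta> \<Longrightarrow> quasi_local fs \<alpha> \<beta> \<Longrightarrow> is_prod \<alpha> \<beta> (prd \<alpha> \<beta>)"
  unfolding prd_def by (metis is_prod_exists someI_ex)

lemma prd_eq: "is_field \<alpha> \<Longrightarrow> is_field \<beta> \<Longrightarrow> is_prod \<alpha> \<beta> C \<Longrightarrow> prd \<alpha> \<beta> = C"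
  using is_prod_unique unfolding prd_def by (metis someI_ex)

text \<open>Fields that commute can be expanded without multiplying by forms.\<close>

lemma is_prod_T:
  assumes "\<And>w. comp2 \<alpha> \<beta> w = comp2' \<alpha> \<beta> w"
  shows "is_prod \<alpha> \<beta> (\<lambda>i p w. T (comp2 \<alpha> \<beta> w) i p)"
proof -
  have "prod_via [] 0 \<alpha> \<beta> (\<lambda>i p w. T (comp2 \<alpha> \<beta> w) i p)"
    using assms by (simp add: prod_via_def quasi_local_def nonzero_forms_def low_def T_negative fun_eq_iff)
  then show ?thesis unfolding is_prod_def by blast
qed

section \<open>Products of three fields\<close>

abbreviation comp3 :: "(int \<Rightarrow> 'w \<Rightarrow> 'w) \<Rightarrow> (int \<Rightarrow> 'w \<Rightarrow> 'w) \<Rightarrow> (int \<Rightarrow> 'w \<Rightarrow> 'w) \<Rightarrow> 'w \<Rightarrow> int \<Rightarrow> int \<Rightarrow> int \<Rightarrow> 'w" where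
  "comp3 \<alpha> \<beta> \<gamma> w \<equiv> \<lambda>k l m. \<alpha> k (\<beta> l (\<gamma> m w))"

text \<open>
  Exchanging the first two variables reduces statements about the substitution \<open>x\<^sub>1 = x\<^sub>3 + t\<close> to those
  about \<open>x\<^sub>2 = x\<^sub>3 + y\<close>.
\<close>

definition swap12 :: "(int \<Rightarrow> int \<Rightarrow> int \<Rightarrow> 'w) \<Rightarrow> int \<Rightarrow> int \<Rightarrow> int \<Rightarrow> 'w" where
  "swap12 F i j k = F j i k"

fun sw12 :: "complex \<times> complex \<times> complex \<Rightarrow> complex \<times> complex \<times> complex" where
  "sw12 (a, b, c) = (b, a, c)"

lemma swap12_swap12 [simp]: "swap12 (swap12 F) = F"
  by (simp add: swap12_def fun_eq_iff)

lemma lin3_swap12: "lin3 (sw12 f) (swap12 F) = swap12 (lin3 f F)"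
  by (cases f) (simp add: swap12_def fun_eq_iff lin3.simps add.commute add.left_commute)

lemma lins3_swap12: "lins3 (map sw12 fs) (swap12 F) = swap12 (lins3 fs F)"
  by (induction fs) (simp_all only: list.map foldr.simps id_apply comp_apply lin3_swap12)

lemma T13_swap12: "T13 F = swap12 (T23 (swap12 F))"
proof -
  have e: "swap12 F k = (\<lambda>a. F a k)" for k by (intro ext) (simp add: swap12_def)
  show ?thesis
  proof (intro ext)
    fix i k p
    have "T23 (swap12 F) k i p = T (\<lambda>a. F a k) i p" unfolding T23_def e ..
    then show "T13 F i k p = swap12 (T23 (swap12 F)) i k p" by (simp add: T13_def swap12_def[of "T23 _"])
  qed
qed

lemma T23_swap12: "T23 (swap12 F) = swap12 (T13 F)"
  unfolding T13_swap12 swap12_swap12 ..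

lemma T13_of_swap12: "T13 (swap12 F) = swap12 (T23 F)"
  unfolding T13_swap12 swap12_swap12 ..

lemma trunc23_swap12: "trunc13 F \<Longrightarrow> trunc23 (swap12 F)"
  by (simp add: trunc13_def trunc23_def swap12_def[abs_def])

lemma trunc3_swap12: assumes "trunc3 F" shows "trunc3 (swap12 F)"
proof -
  obtain K L M where "\<And>k l m. k < K \<or> l < L \<or> m < M \<Longrightarrow> F k l m = 0" by (rule trunc3E[OF assms(1)]) blast
  then show ?thesis by (intro trunc3I[of L K M]) (auto simp: swap12_def)
qed

lemma lins3_append: "lins3 (fs @ gs) F = lins3 fs (lins3 gs F)"
  by simp

lemma lins3_agree:
  assumes "\<And>i. i \<le> n \<Longrightarrow> F i = G i" "i \<le> n"
  shows "lins3 fs F i = lins3 fs G i"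
  using assms(2)
proof (induction fs arbitrary: i)
  case Nil
  then show ?case using assms(1) by (simp only: foldr.simps id_apply)
next
  case (Cons f fs)
  have "lins3 fs F i = lins3 fs G i" "lins3 fs F (i - 1) = lins3 fs G (i - 1)"
    using Cons by simp_all
  then have "lin3 f (lins3 fs F) i = lin3 f (lins3 fs G) i"
    by (cases f) (simp add: fun_eq_iff lin3.simps)
  then show ?case by (simp only: foldr.simps comp_apply)
qed

lemma map_subst23_e23: "map subst23 (map e23 fs) = map e23 (map subst2 fs)"
  by auto
lemma map_subst12_e12: "map subst12 (map e12 fs) = map e12 (map subst2 fs)"
  by auto

text \<open>
  Let \<open>S\<close> be a family of products of two fields, whose first variable is only a parameter, and let
  a product of linear forms in all variables make \<open>S\<close> expandable at \<open>x\<^sub>2 = x\<^sub>3 + y\<close>.  The number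
  of forms needed for the single members of the family may be unbounded, but only finitely many
  members contribute to a given power of the first variable; so the additional forms that the
  definition of the products requires may be inserted and cancelled again.
\<close>

lemma T23_family:
  assumes fields: "\<And>i. is_field (A i)" "\<And>i. is_field (B i)"
    and prods: "\<And>i. is_prod (A i) (B i) (Z i)"
    and S0: "\<And>i k l. i < N \<Longrightarrow> A i k (B i l w) = 0"
    and Z0: "\<And>i. i < N \<Longrightarrow> Z i = 0"
    and tr: "trunc23 (lins3 fs (\<lambda>i k l. A i k (B i l w)))"
  shows "T23 (lins3 fs (\<lambda>i k l. A i k (B i l w))) = lins3 (map subst23 fs) (\<lambda>i j p. Z i j p w)"
proof
  define S where "S = (\<lambda>i k l. A i k (B i l w))"
  define V where "V = (\<lambda>i j p. Z i j p w)"
  fix n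
  \<comment> \<open>Forms that serve for finitely many members at once.\<close>
  have "\<exists>hs. \<forall>i\<in>I. \<exists>M. prod_via hs M (A i) (B i) (Z i)" if "finite I" for I
    using that
  proof (induction I)
    case (insert i I)
    then obtain hs where hs: "\<And>i. i \<in> I \<Longrightarrow> \<exists>M. prod_via hs M (A i) (B i) (Z i)" by blast
    obtain gs M where gs: "prod_via gs M (A i) (B i) (Z i)" using prods[of i] by (auto simp: is_prod_def)
    show ?case
    proof (cases "I = {}")
      case True then show ?thesis using gs by auto
    next
      case False
      then have nz: "nonzero_forms hs" "nonzero_forms gs"
        using hs gs by (auto simp: prod_via_def quasi_local_def)
      have "\<exists>M. prod_via (hs @ gs) M (A i') (B i') (Z i')" if i': "i' \<in> insert i I" for i'
      proof (cases "i' = i")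
        case True
        then show ?thesis using prod_via_append[OF fields gs nz(1)] by blast
      next
        case False
        then obtain M' where "prod_via hs M' (A i') (B i') (Z i')" using i' hs by blast
        from prod_via_append2[OF fields this nz(2)] show ?thesis by blast
      qed
      then show ?thesis by blast
    qed
  qed auto
  from this[of "insert n {N..n}"] obtain hs
    where hs: "\<And>i. i \<in> insert n {N..n} \<Longrightarrow> \<exists>M. prod_via hs M (A i) (B i) (Z i)"
    by (metis finite_insert finite_atLeastAtMost_int)
  have nz: "nonzero_forms hs" using hs[of n] by (auto simp: prod_via_def quasi_local_def)
  \<comment> \<open>Cutting off the rows above \<open>n\<close> leaves a family for which \<open>hs\<close> is sufficient, and does not change
    row \<open>n\<close> of any multiple by forms.\<close>
  define S' where "S' i = (if i \<le> n then S i else 0)" for i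
  define V' where "V' i = (if i \<le> n then V i else 0)" for i
  have S0': "S i = 0" "V i = 0" if "i < N" for i
    using S0 Z0 that by (simp_all add: S_def V_def fun_eq_iff)
  have slice: "trunc2 (lins2 hs (S' i)) \<and> T (lins2 hs (S' i)) = lins2 (map subst2 hs) (V' i)" for i
  proof (cases "i < N \<or> n < i")
    case True
    then have "S' i = 0" "V' i = 0" using S0' by (auto simp: S'_def V'_def)
    then show ?thesis by (simp add: T_0 lins2_zero[unfolded zero_fun_def] trunc2_def)
  next
    case False
    then obtain M where M: "prod_via hs M (A i) (B i) (Z i)" using hs[of i] by auto
    have "trunc2 (lins2 hs (comp2 (A i) (B i) w))"
      by (rule quasi_local_trunc2[OF fields]) (use M in \<open>simp add: prod_via_def\<close>)
    moreover have "T (lins2 hs (comp2 (A i) (B i) w)) = lins2 (map subst2 hs) (\<lambda>j p. Z i j p w)"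
      using M by (simp add: prod_via_def)
    moreover have "S' i = comp2 (A i) (B i) w" "V' i = (\<lambda>j p. Z i j p w)"
      using False by (simp_all add: S'_def V'_def S_def V_def)
    ultimately show ?thesis by simp
  qed
  have tr': "trunc23 (lins3 (map e23 hs) S')"
    using slice by (simp add: trunc23_def lins3_e23)
  have T': "T23 (lins3 (map e23 hs) S') = lins3 (map e23 (map subst2 hs)) V'"
    using slice by (simp only: T23_def lins3_e23 fun_eq_iff) simp
  have "lins2 (map subst2 hs) (T23 (lins3 fs S) n) = lins3 (map e23 (map subst2 hs)) (T23 (lins3 fs S)) n"
    unfolding lins3_e23 ..
  also have "\<dots> = T23 (lins3 (map e23 hs) (lins3 fs S)) n"
    unfolding T23_lins3[OF tr[folded S_def]] map_subst23_e23 ..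
  also have "\<dots> = T23 (lins3 fs (lins3 (map e23 hs) S')) n"
  proof -
    have "lins3 (map e23 hs) S i = lins3 (map e23 hs) S' i" if "i \<le> n" for i
      by (rule lins3_agree[of n]) (use that in \<open>auto simp: S'_def\<close>)
    then have "lins3 fs (lins3 (map e23 hs) S) n = lins3 fs (lins3 (map e23 hs) S') n"
      by (rule lins3_agree[of n]) auto
    then show ?thesis unfolding T23_def lins3_commute[of "map e23 hs" fs] by (rule arg_cong)
  qed
  also have "\<dots> = lins3 (map subst23 fs) (lins3 (map e23 (map subst2 hs)) V') n"
    unfolding T23_lins3[OF tr'] T' ..
  also have "\<dots> = lins3 (map subst23 fs) (lins3 (map e23 (map subst2 hs)) V) n"
  proof -
    have "lins3 (map e23 (map subst2 hs)) V' i = lins3 (map e23 (map subst2 hs)) V i" if "i \<le> n" for i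
      by (rule lins3_agree[of n]) (use that in \<open>auto simp: V'_def\<close>)
    then show ?thesis by (rule lins3_agree[of n]) auto
  qed
  also have "\<dots> = lins2 (map subst2 hs) (lins3 (map subst23 fs) V n)"
    unfolding lins3_commute[of "map subst23 fs" "map e23 (map subst2 hs)"] lins3_e23 ..
  finally have eq: "lins2 (map subst2 hs) (T23 (lins3 fs S) n - lins3 (map subst23 fs) V n) = 0"
    unfolding lins2_diff by simp
  have "low2 N V"
  proof -
    have "\<exists>M. low M (V i)" for i
      using is_prod_low[OF prods[of i]] low_slice[of _ "Z i" w] unfolding V_def by metis
    moreover have "low N V" using S0' by (auto simp: low_def)
    ultimately show ?thesis by (simp add: low2_def)
  qed
  from low2_lins3[OF this] obtain M where M: "low M (lins3 (map subst23 fs) V n)" unfolding low2_def by blast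
  have "T23 (lins3 fs S) n - lins3 (map subst23 fs) V n = 0"
  proof (rule lins2_cancel[OF _ eq])
    show "low (min 0 M) (T23 (lins3 fs S) n - lins3 (map subst23 fs) V n)"
      using M by (auto simp: low_def T23_def T_negative fun_eq_iff)
    show "\<forall>f\<in>set (map subst2 hs). f \<noteq> (0, 0)"
      using nz unfolding nonzero_forms_def[symmetric] nonzero_forms_subst .
  qed
  then have "T23 (lins3 fs S) n = lins3 (map subst23 fs) V n" by (simp only: eq_iff_diff_eq_0[symmetric])
  then show "T23 (lins3 fs (\<lambda>i k l. A i k (B i l w))) n = lins3 (map subst23 fs) (\<lambda>i j p. Z i j p w) n"
    unfolding S_def V_def .
qed

lemma is_prod_zero_left: "is_field \<beta> \<Longrightarrow> is_prod 0 \<beta> C \<Longrightarrow> C = 0"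
proof -
  assume b: "is_field \<beta>" and C: "is_prod 0 \<beta> C"
  have z: "is_field 0" by (rule is_fieldI) auto
  have "T (\<lambda>k l. 0) = 0" using T_0 by (simp add: zero_fun_def)
  then have "is_prod 0 \<beta> 0" using is_prod_T[of 0 \<beta>] by (simp add: field_zero[OF b] zero_fun_def)
  then show ?thesis using is_prod_unique[OF z b C] by simp
qed

lemma is_prod_zero_right: "is_field \<alpha> \<Longrightarrow> is_prod \<alpha> 0 C \<Longrightarrow> C = 0"
proof -
  assume b: "is_field \<alpha>" and C: "is_prod \<alpha> 0 C"
  have z: "is_field 0" by (rule is_fieldI) auto
  have "T (\<lambda>k l. 0) = 0" using T_0 by (simp add: zero_fun_def)
  then have "is_prod \<alpha> 0 0" using is_prod_T[of \<alpha> 0] by (simp add: field_zero[OF b] zero_fun_def)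
  then show ?thesis using is_prod_unique[OF b z C] by simp
qed

text \<open>
  Expanding a product of three fields at \<open>x\<^sub>1 = x\<^sub>2 + z\<close>, with the third field as a spectator.
\<close>

lemma T12_comp3:
  assumes fields: "is_field \<alpha>" "is_field \<beta>" "is_field \<gamma>" and C: "prod_via hs N \<alpha> \<beta> C"
  shows "T12 (lins3 (gs @ map e12 hs) (comp3 \<alpha> \<beta> \<gamma> w))
       = lins3 (map subst12 (gs @ map e12 hs)) (\<lambda>i l m. C i l (\<gamma> m w))"
proof -
  have tr2: "trunc2 (lins2 hs (comp2 \<alpha> \<beta> v))" for v
    by (rule quasi_local_trunc2[OF fields(1,2)]) (use C in \<open>simp add: prod_via_def\<close>)
  have slice: "(\<lambda>k l. lins3 (map e12 hs) (comp3 \<alpha> \<beta> \<gamma> w) k l m) = lins2 hs (comp2 \<alpha> \<beta> (\<gamma> m w))" for m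
    by (simp add: fun_eq_iff lins3_e12)
  have tr: "trunc12 (lins3 (map e12 hs) (comp3 \<alpha> \<beta> \<gamma> w))"
    using tr2 by (simp add: trunc12_def slice)
  have "T12 (lins3 (map e12 hs) (comp3 \<alpha> \<beta> \<gamma> w)) i l m = lins3 (map e12 (map subst2 hs)) (\<lambda>i l m. C i l (\<gamma> m w)) i l m" for i l m
  proof -
    have "T (lins2 hs (comp2 \<alpha> \<beta> (\<gamma> m w))) = lins2 (map subst2 hs) (\<lambda>i p. C i p (\<gamma> m w))"
      using C by (simp add: prod_via_def)
    then show ?thesis unfolding T12_def slice by (simp only: lins3_e12)
  qed
  then have "T12 (lins3 (map e12 hs) (comp3 \<alpha> \<beta> \<gamma> w)) = lins3 (map subst12 (map e12 hs)) (\<lambda>i l m. C i l (\<gamma> m w))"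
    unfolding map_subst12_e12 by (simp only: fun_eq_iff) simp
  then show ?thesis unfolding lins3_append map_append T12_lins3[OF tr] by (rule arg_cong)
qed

text \<open>
  The spectator may also act last.
\<close>

lemma T12_comp3':
  assumes fields: "is_field \<alpha>" "is_field \<beta>" "is_field \<gamma>" and C: "prod_via hs N \<alpha> \<beta> C"
  shows "T12 (lins3 (gs @ map e12 hs) (\<lambda>k l m. \<gamma> m (\<alpha> k (\<beta> l w))))
       = lins3 (map subst12 (gs @ map e12 hs)) (\<lambda>i l m. \<gamma> m (C i l w))"
proof -
  have tr2: "trunc2 (lins2 hs (comp2 \<alpha> \<beta> w))"
    by (rule quasi_local_trunc2[OF fields(1,2)]) (use C in \<open>simp add: prod_via_def\<close>)
  let ?D = "lins3 (map e12 hs) (\<lambda>k l m. \<gamma> m (\<alpha> k (\<beta> l w)))"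
  have slice: "(\<lambda>k l. ?D k l m) = (\<lambda>k l. \<gamma> m (lins2 hs (comp2 \<alpha> \<beta> w) k l))" for m
    by (simp add: fun_eq_iff lins3_e12 field_lins2[OF fields(3)])
  have tr: "trunc12 ?D"
    unfolding trunc12_def slice using tr2 by (auto simp: trunc2_def field_zero[OF fields(3)]) (metis field_zero[OF fields(3)])
  have "T12 ?D i l m = lins3 (map e12 (map subst2 hs)) (\<lambda>i l m. \<gamma> m (C i l w)) i l m" for i l m
  proof -
    have "T (lins2 hs (comp2 \<alpha> \<beta> w)) = lins2 (map subst2 hs) (\<lambda>i p. C i p w)"
      using C by (simp add: prod_via_def)
    then show ?thesis unfolding T12_def slice field_T[OF fields(3) tr2] by (simp only: lins3_e12 field_lins2[OF fields(3)])
  qed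
  then have "T12 ?D = lins3 (map subst12 (map e12 hs)) (\<lambda>i l m. \<gamma> m (C i l w))"
    unfolding map_subst12_e12 by (simp only: fun_eq_iff) simp
  then show ?thesis unfolding lins3_append map_append T12_lins3[OF tr] by (rule arg_cong)
qed

lemma T23_comp3:
  assumes fields: "is_field \<alpha>" "is_field \<beta>" "is_field \<gamma>" and C: "prod_via hs N \<beta> \<gamma> E"
  shows "T23 (lins3 (gs @ map e23 hs) (comp3 \<alpha> \<beta> \<gamma> w))
       = lins3 (map subst23 (gs @ map e23 hs)) (\<lambda>k j p. \<alpha> k (E j p w))"
proof -
  have tr2: "trunc2 (lins2 hs (comp2 \<beta> \<gamma> w))"
    by (rule quasi_local_trunc2[OF fields(2,3)]) (use C in \<open>simp add: prod_via_def\<close>)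
  let ?D = "lins3 (map e23 hs) (comp3 \<alpha> \<beta> \<gamma> w)"
  have slice: "?D k = (\<lambda>l m. \<alpha> k (lins2 hs (comp2 \<beta> \<gamma> w) l m))" for k
    by (simp add: fun_eq_iff lins3_e23 field_lins2[OF fields(1)])
  have tr: "trunc23 ?D"
    unfolding trunc23_def slice using tr2 by (auto simp: trunc2_def field_zero[OF fields(1)]) (metis field_zero[OF fields(1)])
  have "T23 ?D k = lins3 (map e23 (map subst2 hs)) (\<lambda>k j p. \<alpha> k (E j p w)) k" for k
  proof -
    have "T (lins2 hs (comp2 \<beta> \<gamma> w)) = lins2 (map subst2 hs) (\<lambda>i p. E i p w)"
      using C by (simp add: prod_via_def)
    then show ?thesis unfolding T23_def slice field_T[OF fields(1) tr2] by (simp only: lins3_e23 field_lins2[OF fields(1)])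
  qed
  then have "T23 ?D = lins3 (map subst23 (map e23 hs)) (\<lambda>k j p. \<alpha> k (E j p w))"
    unfolding map_subst23_e23 by (rule ext)
  then show ?thesis unfolding lins3_append map_append T23_lins3[OF tr] by (rule arg_cong)
qed

text \<open>Expanding first at \<open>x\<^sub>2 = x\<^sub>3 + y\<close> and then at \<open>x\<^sub>1 = x\<^sub>3 + t\<close>.\<close>

lemma T13_T23_comp3:
  assumes fields: "is_field \<alpha>" "is_field \<beta>" "is_field \<gamma>" and E: "prod_via hs N \<beta> \<gamma> E"
    and G: "\<And>j. is_prod \<alpha> (E j) (G j)"
    and tr: "trunc3 (lins3 (gs @ map e23 hs) (comp3 \<alpha> \<beta> \<gamma> w))"
  shows "T13 (T23 (lins3 (gs @ map e23 hs) (comp3 \<alpha> \<beta> \<gamma> w)))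
       = lins3 (map subst13 (map subst23 (gs @ map e23 hs))) (\<lambda>i j p. G j i p w)"
proof -
  let ?fs = "map subst23 (gs @ map e23 hs)"
  have isE: "is_prod \<beta> \<gamma> E" using E by (auto simp: is_prod_def)
  have fE: "is_field (E j)" for j by (rule is_prod_field[OF fields(2,3) isE])
  have E0: "E j = 0" if "j < N" for j using E that by (simp add: prod_via_def low_def)
  have G0: "G j = 0" if "j < N" for j
    by (rule is_prod_zero_right[OF fields(1)]) (use G[of j] E0[OF that] in simp)
  define H where "H = (\<lambda>k j p. \<alpha> k (E j p w))"
  define D where "D = lins3 (gs @ map e23 hs) (comp3 \<alpha> \<beta> \<gamma> w)"
  have TD: "T23 D = lins3 ?fs H"
    unfolding D_def H_def by (rule T23_comp3[OF fields E])
  have sH: "swap12 H = (\<lambda>j k p. \<alpha> k (E j p w))" by (simp add: H_def swap12_def fun_eq_iff)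
  have "trunc23 (swap12 (T23 D))"
    by (rule trunc23_swap12[OF trunc13_T23]) (use tr in \<open>simp only: D_def\<close>)
  then have tr': "trunc23 (lins3 (map sw12 ?fs) (\<lambda>j k p. \<alpha> k (E j p w)))"
    unfolding TD lins3_swap12[symmetric] sH .
  have "T23 (lins3 (map sw12 ?fs) (\<lambda>j k p. \<alpha> k (E j p w))) = lins3 (map subst23 (map sw12 ?fs)) (\<lambda>j i p. G j i p w)"
    by (rule T23_family[where N = N and A = "\<lambda>_. \<alpha>" and B = E, OF fields(1) fE G _ _ tr'])
      (simp_all add: E0 G0 field_zero[OF fields(1)])
  moreover have "T13 (T23 D) = swap12 (T23 (lins3 (map sw12 ?fs) (\<lambda>j k p. \<alpha> k (E j p w))))"
    unfolding T13_swap12 TD lins3_swap12[of ?fs H, unfolded sH] ..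
  ultimately have "T13 (T23 D) = swap12 (lins3 (map subst23 (map sw12 ?fs)) (\<lambda>j i p. G j i p w))"
    by (simp only:)
  also have "\<dots> = lins3 (map sw12 (map subst23 (map sw12 ?fs))) (swap12 (\<lambda>j i p. G j i p w))"
    unfolding lins3_swap12 ..
  also have "map sw12 (map subst23 (map sw12 ?fs)) = map subst13 ?fs" by auto
  also have "swap12 (\<lambda>j i p. G j i p w) = (\<lambda>i j p. G j i p w)" by (simp add: swap12_def fun_eq_iff)
  finally show ?thesis unfolding D_def .
qed

text \<open>Expanding first at \<open>x\<^sub>1 = x\<^sub>2 + z\<close> and then at \<open>x\<^sub>2 = x\<^sub>3 + y\<close>.\<close>

lemma T23_T12_comp3:
  assumes fields: "is_field \<alpha>" "is_field \<beta>" "is_field \<gamma>" and C: "prod_via hs N \<alpha> \<beta> C"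
    and Z: "\<And>i. is_prod (C i) \<gamma> (Z i)"
    and tr: "trunc3 (lins3 (gs @ map e12 hs) (comp3 \<alpha> \<beta> \<gamma> w))"
  shows "T23 (T12 (lins3 (gs @ map e12 hs) (comp3 \<alpha> \<beta> \<gamma> w)))
       = lins3 (map subst23 (map subst12 (gs @ map e12 hs))) (\<lambda>i j p. Z i j p w)"
proof -
  let ?fs = "map subst12 (gs @ map e12 hs)"
  have isC: "is_prod \<alpha> \<beta> C" using C by (auto simp: is_prod_def)
  have fC: "is_field (C j)" for j by (rule is_prod_field[OF fields(1,2) isC])
  have C0: "C j = 0" if "j < N" for j using C that by (simp add: prod_via_def low_def)
  have Z0: "Z j = 0" if "j < N" for j
    by (rule is_prod_zero_left[OF fields(3)]) (use Z[of j] C0[OF that] in simp)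
  have TD: "T12 (lins3 (gs @ map e12 hs) (comp3 \<alpha> \<beta> \<gamma> w)) = lins3 ?fs (\<lambda>i l m. C i l (\<gamma> m w))"
    by (rule T12_comp3[OF fields C])
  have "trunc23 (T12 (lins3 (gs @ map e12 hs) (comp3 \<alpha> \<beta> \<gamma> w)))" by (rule trunc23_T12[OF tr])
  from this[unfolded TD]
  show ?thesis unfolding TD
    by (rule T23_family[where N = N and A = C and B = "\<lambda>_. \<gamma>", rotated 5, OF _ fC fields(3) Z])
      (simp_all add: C0 Z0)
qed

subsection \<open>Reordering the factors\<close>

lemma quasi_local_lins3_12:
  assumes "quasi_local hs \<alpha> \<beta>"
  shows "lins3 (map e12 hs) (\<lambda>k l m. \<alpha> k (\<beta> l (v m))) = lins3 (map e12 hs) (\<lambda>k l m. \<beta> l (\<alpha> k (v m)))"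
  using assms by (simp add: fun_eq_iff lins3_e12 quasi_local_def)

lemma quasi_local_lins3_23:
  assumes "quasi_local hs \<beta> \<gamma>" "is_field \<alpha>"
  shows "lins3 (map e23 hs) (\<lambda>k l m. \<alpha> k (\<beta> l (\<gamma> m w))) = lins3 (map e23 hs) (\<lambda>k l m. \<alpha> k (\<gamma> m (\<beta> l w)))"
proof -
  have "lins2 hs (\<lambda>l m. \<alpha> k (\<beta> l (\<gamma> m w))) = lins2 hs (\<lambda>l m. \<alpha> k (\<gamma> m (\<beta> l w)))" for k
    unfolding field_lins2[OF assms(2)] using assms(1) by (simp add: quasi_local_def)
  then show ?thesis by (simp add: fun_eq_iff lins3_e23)
qed

lemma quasi_local_lins3_13:
  assumes "quasi_local hs \<alpha> \<gamma>"
  shows "lins3 (map e13 hs) (\<lambda>k l m. \<alpha> k (\<gamma> m (v l))) = lins3 (map e13 hs) (\<lambda>k l m. \<gamma> m (\<alpha> k (v l)))"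
  using assms by (simp add: fun_eq_iff lins3_e13 quasi_local_def)

lemma quasi_local_lins3_13':
  assumes "quasi_local hs \<alpha> \<gamma>" "is_field \<beta>"
  shows "lins3 (map e13 hs) (\<lambda>k l m. \<beta> l (\<alpha> k (\<gamma> m w))) = lins3 (map e13 hs) (\<lambda>k l m. \<beta> l (\<gamma> m (\<alpha> k w)))"
proof -
  have "lins2 hs (\<lambda>k m. \<beta> l (\<alpha> k (\<gamma> m w))) = lins2 hs (\<lambda>k m. \<beta> l (\<gamma> m (\<alpha> k w)))" for l
    unfolding field_lins2[OF assms(2)] using assms(1) by (simp add: quasi_local_def)
  then show ?thesis by (simp add: fun_eq_iff lins3_e13)
qed

lemma lins3_low_1: "(\<And>k l m. k < N \<Longrightarrow> F k l m = 0) \<Longrightarrow> k < N \<Longrightarrow> lins3 fs F k l m = 0"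
  using lins3_low[of N F fs] by (simp add: low_def fun_eq_iff)

lemma lins3_low_2: "(\<And>k l m. l < N \<Longrightarrow> F k l m = 0) \<Longrightarrow> l < N \<Longrightarrow> lins3 fs F k l m = 0"
proof (induction fs arbitrary: k l m)
  case (Cons f fs)
  then show ?case by (cases f) (simp add: lin3.simps)
qed (simp only: foldr.simps id_apply)

lemma lins3_low_3: "(\<And>k l m. m < N \<Longrightarrow> F k l m = 0) \<Longrightarrow> m < N \<Longrightarrow> lins3 fs F k l m = 0"
proof (induction fs arbitrary: k l m)
  case (Cons f fs)
  then show ?case by (cases f) (simp add: lin3.simps)
qed (simp only: foldr.simps id_apply)

text \<open>
  Multiplied by forms for all three pairs, the product of three pairwise quasi local fields does
  not depend on the order of the factors, so that each variable is bounded by the field acting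
  first in a suitable order.
\<close>

lemma comp3_reorder:
  assumes fields: "is_field \<alpha>" "is_field \<beta>" "is_field \<gamma>"
    and ql: "quasi_local h12 \<alpha> \<beta>" "quasi_local h13 \<alpha> \<gamma>" "quasi_local h23 \<beta> \<gamma>"
  defines "fs \<equiv> map e12 h12 @ map e13 h13 @ map e23 h23"
  shows "lins3 fs (comp3 \<alpha> \<beta> \<gamma> w) = lins3 fs (\<lambda>k l m. \<gamma> m (\<alpha> k (\<beta> l w)))"
    and "trunc3 (lins3 fs (comp3 \<alpha> \<beta> \<gamma> w))"
proof -
  have c12: "lins3 fs F = lins3 (map e13 h13) (lins3 (map e23 h23) (lins3 (map e12 h12) F))" for F
    unfolding fs_def lins3_append by (metis lins3_commute)
  have c13: "lins3 fs F = lins3 (map e12 h12) (lins3 (map e23 h23) (lins3 (map e13 h13) F))" for F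
    unfolding fs_def lins3_append by (metis lins3_commute)
  have c23: "lins3 fs F = lins3 (map e12 h12) (lins3 (map e13 h13) (lins3 (map e23 h23) F))" for F
    unfolding fs_def lins3_append ..
  have 1: "lins3 fs (comp3 \<alpha> \<beta> \<gamma> w) = lins3 fs (\<lambda>k l m. \<beta> l (\<alpha> k (\<gamma> m w)))"
    unfolding c12 quasi_local_lins3_12[OF ql(1), of "\<lambda>m. \<gamma> m w"] ..
  have 2: "lins3 fs (\<lambda>k l m. \<beta> l (\<alpha> k (\<gamma> m w))) = lins3 fs (\<lambda>k l m. \<beta> l (\<gamma> m (\<alpha> k w)))"
    unfolding c13 quasi_local_lins3_13'[OF ql(2) fields(2)] ..
  have 3: "lins3 fs (comp3 \<alpha> \<beta> \<gamma> w) = lins3 fs (\<lambda>k l m. \<alpha> k (\<gamma> m (\<beta> l w)))"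
    unfolding c23 quasi_local_lins3_23[OF ql(3) fields(1)] ..
  also have 4: "\<dots> = lins3 fs (\<lambda>k l m. \<gamma> m (\<alpha> k (\<beta> l w)))"
    unfolding c13 quasi_local_lins3_13[OF ql(2), of "\<lambda>l. \<beta> l w"] ..
  finally show "lins3 fs (comp3 \<alpha> \<beta> \<gamma> w) = lins3 fs (\<lambda>k l m. \<gamma> m (\<alpha> k (\<beta> l w)))" .
  obtain K where K: "\<And>k. k < K \<Longrightarrow> \<alpha> k w = 0" using field_low[OF fields(1)] by metis
  obtain L where L: "\<And>k. k < L \<Longrightarrow> \<beta> k w = 0" using field_low[OF fields(2)] by metis
  obtain M where M: "\<And>k. k < M \<Longrightarrow> \<gamma> k w = 0" using field_low[OF fields(3)] by metis
  note z = field_zero[OF fields(1)] field_zero[OF fields(2)] field_zero[OF fields(3)]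
  show "trunc3 (lins3 fs (comp3 \<alpha> \<beta> \<gamma> w))"
  proof (rule trunc3I)
    fix k l m assume "k < K \<or> l < L \<or> m < M"
    then consider "k < K" | "l < L" | "m < M" by blast
    then show "lins3 fs (comp3 \<alpha> \<beta> \<gamma> w) k l m = 0"
    proof cases
      case 1 show ?thesis unfolding \<open>lins3 fs (comp3 \<alpha> \<beta> \<gamma> w) = lins3 fs (\<lambda>k l m. \<beta> l (\<alpha> k (\<gamma> m w)))\<close> 2
        by (rule lins3_low_1[OF _ 1]) (simp add: K z)
    next
      case 2 show ?thesis unfolding 3
        by (rule lins3_low_2[OF _ 2]) (simp add: L z)
    next
      case 3 show ?thesis
        by (rule lins3_low_3[OF _ 3]) (simp add: M z)
    qed
  qed
qed

subsection \<open>Products of quasi local fields are quasi local\<close>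

text \<open>
  A Dong type argument.  If the rows of the multiples by a form in three variables are killed by forms in
  the last two variables, the same holds for the rows of the distributions themselves: row \<open>i\<close> of the multiple differs from a two-variable multiple of row \<open>i\<close> by a multiple of row
  \<open>i - 1\<close>, and the forms that kill the latter are available by induction.  The forms must not depend
  on the vector, whence the set \<open>\<F>\<close> of distributions.
\<close>

lemma rows_killed:
  assumes g: "g \<noteq> (0, 0, 0)" and lowF: "\<And>F. F \<in> \<F> \<Longrightarrow> low N F"
    and kill: "\<And>i. \<exists>hs. nonzero_forms hs \<and> (\<forall>F\<in>\<F>. lins2 hs (lin3 g F i) = 0)"
  shows "\<exists>hs. nonzero_forms hs \<and> (\<forall>F\<in>\<F>. lins2 hs (F i) = 0)"
proof (cases g)
  case (fields a b c)
  show ?thesis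
  proof (cases "(b, c) = (0, 0)")
    case True
    with g fields have a: "a \<noteq> 0" by simp
    obtain hs where hs: "nonzero_forms hs" "\<And>F. F \<in> \<F> \<Longrightarrow> lins2 hs (lin3 g F (i + 1)) = 0" using kill by blast
    have "lins2 hs (F i) = 0" if "F \<in> \<F>" for F
    proof -
      have "lin3 g F (i + 1) = (\<lambda>p q. a *s F i p q)" using True fields by (simp add: fun_eq_iff lin3.simps)
      then have "(\<lambda>p q. a *s lins2 hs (F i) p q) = 0" using hs(2)[OF that] by (simp only: lins2_scale)
      then show ?thesis using a by (simp add: fun_eq_iff)
    qed
    then show ?thesis using hs(1) by blast
  next
    case False
    have "\<forall>i < N + int n. \<exists>hs. nonzero_forms hs \<and> (\<forall>F\<in>\<F>. lins2 hs (F i) = 0)" for n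
    proof (induction n)
      case 0
      show ?case
      proof (intro allI impI exI conjI ballI)
        fix i F assume "i < N + int 0" "F \<in> \<F>"
        then have "F i = 0" by (intro lowD[OF lowF]) simp_all
        then show "lins2 [] (F i) = 0" by (simp only: foldr.simps id_apply)
      qed (simp add: nonzero_forms_def)
    next
      case (Suc n)
      show ?case
      proof (intro allI impI)
        fix i assume "i < N + int (Suc n)"
        then have "i - 1 < N + int n" by simp
        then obtain hs' where hs': "nonzero_forms hs'" "\<And>F. F \<in> \<F> \<Longrightarrow> lins2 hs' (F (i - 1)) = 0" using Suc.IH by blast
        obtain hs where hs: "nonzero_forms hs" "\<And>F. F \<in> \<F> \<Longrightarrow> lins2 hs (lin3 g F i) = 0" using kill by blast
        have "lins2 (hs @ hs' @ [(b, c)]) (F i) = 0" if F: "F \<in> \<F>" for F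
        proof -
          have "lin2 (b, c) (F i) = lin3 g F i - (\<lambda>p q. a *s F (i - 1) p q)"
            unfolding fields lin3_slice23 by simp
          then have "lins2 (hs @ hs' @ [(b, c)]) (F i) = lins2 hs (lins2 hs' (lin3 g F i)) - (\<lambda>p q. a *s lins2 hs (lins2 hs' (F (i - 1))) p q)"
            by (simp only: lins2_append foldr.simps id_apply comp_apply lins2_diff lins2_scale)
          also have "\<dots> = 0"
            unfolding lins2_commute[of hs hs' "lin3 g F i"] hs'(2)[OF F] hs(2)[OF F] lins2_zero by (simp add: fun_eq_iff)
          finally show ?thesis .
        qed
        moreover have "nonzero_forms (hs @ hs' @ [(b, c)])" using hs(1) hs'(1) False by (auto simp: nonzero_forms_def)
        ultimately show "\<exists>hs. nonzero_forms hs \<and> (\<forall>F\<in>\<F>. lins2 hs (F i) = 0)" by blast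
      qed
    qed
    from this[of "nat (i - N + 1)"] show ?thesis by simp
  qed
qed

lemma rows_killed_list:
  assumes "\<forall>g\<in>set gs. g \<noteq> (0, 0, 0)" and lowF: "\<And>F. F \<in> \<F> \<Longrightarrow> low N F"
    and kill: "\<And>F. F \<in> \<F> \<Longrightarrow> lins3 gs F = 0"
  shows "\<exists>hs. nonzero_forms hs \<and> (\<forall>F\<in>\<F>. lins2 hs (F i) = 0)"
proof -
  have "\<exists>hs. nonzero_forms hs \<and> (\<forall>F\<in>\<F>. lins2 hs (F i) = 0)"
    if "\<And>i. \<exists>hs. nonzero_forms hs \<and> (\<forall>F\<in>\<F>. lins2 hs (lins3 gs F i) = 0)" for i
    using assms(1) that
  proof (induction gs arbitrary: i)
    case Nil
    then show ?case by (simp only: foldr.simps id_apply)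
  next
    case (Cons g gs)
    show ?case
    proof (rule Cons.IH)
      show "\<forall>g\<in>set gs. g \<noteq> (0, 0, 0)" using Cons.prems(1) by (metis list.set_intros(2))
      fix i
      have "\<exists>hs. nonzero_forms hs \<and> (\<forall>F\<in>lins3 gs ` \<F>. lins2 hs (F i) = 0)"
      proof (rule rows_killed[of g _ N])
        show "g \<noteq> (0, 0, 0)" using Cons.prems(1) by (metis list.set_intros(1))
        show "low N F" if "F \<in> lins3 gs ` \<F>" for F using that lins3_low lowF by blast
        show "\<exists>hs. nonzero_forms hs \<and> (\<forall>F\<in>lins3 gs ` \<F>. lins2 hs (lin3 g F i) = 0)" for i
          using Cons.prems(2)[of i] unfolding ball_simps foldr.simps comp_apply .
      qed
      then show "\<exists>hs. nonzero_forms hs \<and> (\<forall>F\<in>\<F>. lins2 hs (lins3 gs F i) = 0)" unfolding ball_simps .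
    qed
  qed
  moreover have "\<exists>hs. nonzero_forms hs \<and> (\<forall>F\<in>\<F>. lins2 hs (lins3 gs F i) = 0)" for i
  proof (intro exI[of _ "[]"] conjI ballI)
    fix F assume "F \<in> \<F>"
    then show "lins2 [] (lins3 gs F i) = 0" unfolding kill[OF \<open>F \<in> \<F>\<close>] by (simp add: zero_fun_def)
  qed (simp add: nonzero_forms_def)
  ultimately show ?thesis by blast
qed

lemma nonzero_form3:
  assumes "nonzero_forms h12" "nonzero_forms h13" "nonzero_forms h23"
    and "f \<in> set (map e12 h12 @ map e13 h13 @ map e23 h23)"
  shows "f \<noteq> (0, 0, 0)"
  using assms by (force simp: nonzero_forms_def)

text \<open>
  The analogue of Dong's lemma.  Multiplied by forms for all three pairs, the product of the three fields
  does not depend on their order.  Expanding at \<open>x\<^sub>1 = x\<^sub>2 + z\<close> gives forms in \<open>z, x\<^sub>2, x\<^sub>3\<close> that kill the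
  commutator of the whole product with \<open>\<gamma>\<close>, from which \<open>rows_killed\<close> extracts the coefficient of
  \<open>z\<^sup>i\<close>.
\<close>

theorem prod_quasi_local:
  assumes fields: "is_field \<alpha>" "is_field \<beta>" "is_field \<gamma>"
    and ql: "quasi_local h12 \<alpha> \<beta>" "quasi_local h13 \<alpha> \<gamma>" "quasi_local h23 \<beta> \<gamma>"
    and C: "is_prod \<alpha> \<beta> C"
  shows "\<exists>hs. quasi_local hs (C i) \<gamma>"
proof -
  obtain h N where h: "prod_via h N \<alpha> \<beta> C" using C by (auto simp: is_prod_def)
  then have qlh: "quasi_local h \<alpha> \<beta>" by (simp add: prod_via_def)
  define gs where "gs = map e13 h13 @ map e23 h23"
  define fs where "fs = gs @ map e12 h"
  have fs: "lins3 (map e12 h @ map e13 h13 @ map e23 h23) F = lins3 fs F" for F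
    unfolding fs_def gs_def lins3_append by (metis lins3_commute)
  define \<F> where "\<F> = range (\<lambda>w. (\<lambda>i l m. C i l (\<gamma> m w)) - (\<lambda>i l m. \<gamma> m (C i l w)))"
  have "\<exists>hs. nonzero_forms hs \<and> (\<forall>F\<in>\<F>. lins2 hs (F i) = 0)"
  proof (rule rows_killed_list[where gs = "map subst12 fs" and N = N])
    have "f \<noteq> (0, 0, 0)" if "f \<in> set fs" for f
      by (rule nonzero_form3[of h h13 h23]) (use that ql qlh in \<open>auto simp: quasi_local_def fs_def gs_def\<close>)
    then show "\<forall>g\<in>set (map subst12 fs). g \<noteq> (0, 0, 0)" by force
    fix F assume "F \<in> \<F>"
    then obtain w where F: "F = (\<lambda>i l m. C i l (\<gamma> m w)) - (\<lambda>i l m. \<gamma> m (C i l w))" by (auto simp: \<F>_def)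
    show "low N F" using h field_zero[OF fields(3)] by (auto simp: F prod_via_def low_def fun_eq_iff)
    have "lins3 fs (comp3 \<alpha> \<beta> \<gamma> w) = lins3 fs (\<lambda>k l m. \<gamma> m (\<alpha> k (\<beta> l w)))"
      using comp3_reorder(1)[OF fields qlh ql(2,3), of w] unfolding fs .
    then have "T12 (lins3 fs (comp3 \<alpha> \<beta> \<gamma> w)) = T12 (lins3 fs (\<lambda>k l m. \<gamma> m (\<alpha> k (\<beta> l w))))" by (rule arg_cong)
    then show "lins3 (map subst12 fs) F = 0"
      unfolding F lins3_diff fs_def T12_comp3[OF fields h] T12_comp3'[OF fields h] by (simp only: diff_self)
  qed
  then obtain hs where hs: "nonzero_forms hs" "\<And>F. F \<in> \<F> \<Longrightarrow> lins2 hs (F i) = 0" by blast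
  have "lins2 hs (comp2 (C i) \<gamma> w) - lins2 hs (comp2' (C i) \<gamma> w) = 0" for w
  proof -
    define F where "F = (\<lambda>i l m. C i l (\<gamma> m w)) - (\<lambda>i l m. \<gamma> m (C i l w))"
    have "F \<in> \<F>" unfolding \<F>_def F_def by (rule rangeI)
    then have "lins2 hs (F i) = 0" by (rule hs(2))
    moreover have "F i = comp2 (C i) \<gamma> w - comp2' (C i) \<gamma> w" by (simp add: F_def fun_eq_iff)
    ultimately show ?thesis by (simp only: lins2_diff)
  qed
  then show ?thesis using hs(1) unfolding quasi_local_def by (intro exI[of _ hs]) simp
qed

subsection \<open>The Jacobi identity for products of fields\<close>

lemma lins3_partition: "lins3 fs F = lins3 (filter P fs) (lins3 (filter (\<lambda>f. \<not> P f) fs) F)"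
proof (induction fs)
  case Nil
  then show ?case by simp
next
  case (Cons f fs)
  show ?case
  proof (cases "P f")
    case True
    then show ?thesis using Cons by (simp only: filter.simps foldr.simps comp_apply if_True not_True_eq_False if_False)
  next
    case False
    then have "lins3 (filter P (f # fs)) (lins3 (filter (\<lambda>f. \<not> P f) (f # fs)) F)
       = lins3 (filter P fs) (lin3 f (lins3 (filter (\<lambda>f. \<not> P f) fs) F))"
      by (simp only: filter.simps foldr.simps comp_apply if_True not_False_eq_True if_False)
    also have "\<dots> = lin3 f (lins3 fs F)" unfolding lin3_lins3[symmetric] Cons.IH[symmetric] ..
    finally show ?thesis by (simp only: foldr.simps comp_apply)
  qed
qed

text \<open>
  The effect of \<open>x\<^sub>1 = x\<^sub>3 + t\<close>, \<open>x\<^sub>2 = x\<^sub>3 + y\<close> on forms.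
\<close>

definition subst123 :: "complex \<times> complex \<times> complex \<Rightarrow> complex \<times> complex \<times> complex" where
  "subst123 f = subst13 (subst23 f)"

lemma subst123_eq: "subst123 (a, b, c) = (a, b, a + b + c)"
  by (simp add: subst123_def)

lemma swap12_lins3_subst: "sw12 (subst13 (subst23 (sw12 f))) = subst123 f"
  by (cases f) (simp add: subst123_def add.left_commute)

lemma subst23_subst12: "subst23 (subst12 f) = subst12 (subst123 f)"
  by (cases f) (simp add: subst123_def)

lemma defect_shifts:
  assumes "bounded2 A" "bounded1 B" "bounded1 C"
    and "\<forall>f\<in>set hs. \<exists>a. a \<noteq> 0 \<and> f = (a, - a)"
    and "defect (lins2 hs A) (lins2 hs B) (lins2 (map subst2 hs) C) = 0"
  shows "defect A B C = 0"
  using assms(4,5)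
proof (induction hs)
  case Nil
  then show ?case by (simp only: list.map foldr.simps id_apply)
next
  case (Cons f hs)
  obtain a where a: "a \<noteq> 0" "f = (a, - a)" using Cons.prems(1) by (metis list.set_intros(1))
  let ?A = "lins2 hs A" let ?B = "lins2 hs B" let ?C = "lins2 (map subst2 hs) C"
  have s: "subst2 (a, - a) = (a, 0)" by simp
  have d: "defect (lin2 (a, - a) ?A) (lin2 (a, - a) ?B) (lin2 (a, 0) ?C) = 0"
    using Cons.prems(2) unfolding list.map foldr.simps comp_apply a(2) s .
  have "a *s defect ?A ?B ?C (k0 - 1) k1 k2 = 0" for k0 k1 k2
    unfolding defect_shift[OF bounded2_lins2[OF assms(1)] bounded1_lins2[OF assms(2)] bounded1_lins2[OF assms(3)], symmetric] d
    by simp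
  then have "defect ?A ?B ?C (k0 + 1 - 1) k1 k2 = 0" for k0 k1 k2 using a(1) by (metis scale_eq_0_iff)
  then have "defect ?A ?B ?C k0 k1 k2 = 0" for k0 k1 k2 by simp
  then have "defect ?A ?B ?C = 0" by (simp add: fun_eq_iff)
  then show ?case using Cons.IH Cons.prems(1) by (metis list.set_intros(2))
qed

text \<open>
  Expanding the product of three fields at \<open>x\<^sub>1 = x\<^sub>3 + t\<close>, \<open>x\<^sub>2 = x\<^sub>3 + y\<close> gives both iterated
  products up to the same linear forms in \<open>t, y, x\<^sub>3\<close>, and expanding the result at \<open>t = y + z\<close>
  gives the third one.  Forms which involve \<open>x\<^sub>3\<close>, or only one of \<open>t\<close> and \<open>y\<close>, are invertible;
  the remaining ones are multiples of \<open>t - y\<close>, which the delta functions turn into a power of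
  \<open>z\<close>.  So the Jacobi identity of the three products follows from the identity of the delta functions.
\<close>

theorem field_jacobi:
  assumes fields: "is_field \<alpha>" "is_field \<beta>" "is_field \<gamma>"
    and C: "is_prod \<alpha> \<beta> C" and E: "is_prod \<beta> \<gamma> E" and F: "is_prod \<alpha> \<gamma> F"
    and G: "\<And>j. is_prod \<alpha> (E j) (G j)" and G': "\<And>i. is_prod \<beta> (F i) (G' i)" and Z: "\<And>i. is_prod (C i) \<gamma> (Z i)"
  shows "defect (\<lambda>i j. G j i p w) (\<lambda>i j. G' i j p w) (\<lambda>i j. Z i j p w) = 0"
proof -
  obtain h12 N12 where h12: "prod_via h12 N12 \<alpha> \<beta> C" using C by (auto simp: is_prod_def)
  obtain h13 N13 where h13: "prod_via h13 N13 \<alpha> \<gamma> F" using F by (auto simp: is_prod_def)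
  obtain h23 N23 where h23: "prod_via h23 N23 \<beta> \<gamma> E" using E by (auto simp: is_prod_def)
  have ql: "quasi_local h12 \<alpha> \<beta>" "quasi_local h13 \<alpha> \<gamma>" "quasi_local h23 \<beta> \<gamma>"
    using h12 h13 h23 by (simp_all add: prod_via_def)
  have nz: "nonzero_forms h12" "nonzero_forms h13" "nonzero_forms h23" using ql by (simp_all add: quasi_local_def)
  define fs where "fs = map e12 h12 @ map e13 h13 @ map e23 h23"
  define D where "D = lins3 fs (comp3 \<alpha> \<beta> \<gamma> w)"
  have trD: "trunc3 D" unfolding D_def fs_def by (rule comp3_reorder(2)[OF fields ql])
  define Gw where "Gw = (\<lambda>i j p. G j i p w)"
  define Gw' where "Gw' = (\<lambda>i j p. G' i j p w)"
  define Zw where "Zw = (\<lambda>i j p. Z i j p w)"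
  define X3 where "X3 = T13 (T23 D)"
  define fs' where "fs' = map subst123 fs"
  have perm: "lins3 (map h fs) V = lins3 (map h (map e13 h13 @ map e23 h23)) (lins3 (map h (map e12 h12)) V)"
    "lins3 (map h fs) V = lins3 (map h (map e12 h12 @ map e23 h23)) (lins3 (map h (map e13 h13)) V)" for h V
    unfolding fs_def lins3_append map_append by (metis lins3_commute)+
  have perm': "lins3 fs V = lins3 (map e13 h13 @ map e23 h23) (lins3 (map e12 h12) V)"
    "lins3 fs V = lins3 (map e12 h12 @ map e23 h23) (lins3 (map e13 h13) V)" for V
    unfolding fs_def lins3_append by (metis lins3_commute)+
  \<comment> \<open>The three iterated products are all obtained from \<open>X3\<close>.\<close>
  have XG: "X3 = lins3 fs' Gw"
  proof -
    have "lins3 ((map e12 h12 @ map e13 h13) @ map e23 h23) V = lins3 fs V" for V by (simp add: fs_def)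
    moreover have "map subst13 (map subst23 ((map e12 h12 @ map e13 h13) @ map e23 h23)) = fs'"
      by (simp add: fs'_def fs_def subst123_def)
    ultimately show ?thesis
      using T13_T23_comp3[OF fields h23 G, of "map e12 h12 @ map e13 h13" w] trD
      unfolding X3_def D_def Gw_def by (simp only:)
  qed
  have XZ: "T12 X3 = lins3 (map subst12 fs') Zw"
  proof -
    have e: "lins3 ((map e13 h13 @ map e23 h23) @ map e12 h12) V = lins3 fs V" for V
      unfolding perm'(1) lins3_append ..
    have "T12 X3 = T23 (T12 D)" unfolding X3_def T23_T12[OF trD] ..
    also have "\<dots> = lins3 (map subst23 (map subst12 ((map e13 h13 @ map e23 h23) @ map e12 h12))) Zw"
      using T23_T12_comp3[OF fields h12 Z, of "map e13 h13 @ map e23 h23" w] trD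
      unfolding e D_def Zw_def by (simp only:)
    also have "\<dots> = lins3 (map subst12 fs') Zw"
    proof -
      let ?h = "subst12 \<circ> subst123"
      have h: "map subst23 (map subst12 gs) = map ?h gs" for gs by (simp add: subst23_subst12)
      have "lins3 (map ?h ((map e13 h13 @ map e23 h23) @ map e12 h12)) Zw = lins3 (map ?h fs) Zw"
        unfolding perm(1) by (simp only: map_append lins3_append)
      then show ?thesis unfolding h fs'_def unfolding map_map .
    qed
    finally show ?thesis .
  qed
  have XG': "X3 = lins3 fs' Gw'"
  proof -
    let ?gs = "map sw12 (map e12 h12 @ map e23 h23)"
    have sw13: "map sw12 (map e13 h13) = map e23 h13" by auto
    have e: "lins3 (?gs @ map e23 h13) (comp3 \<beta> \<alpha> \<gamma> w) = swap12 D"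
    proof -
      have "comp3 \<beta> \<alpha> \<gamma> w = swap12 (\<lambda>k l m. \<beta> l (\<alpha> k (\<gamma> m w)))" by (simp add: swap12_def fun_eq_iff)
      then have "lins3 (?gs @ map e23 h13) (comp3 \<beta> \<alpha> \<gamma> w) = swap12 (lins3 fs (\<lambda>k l m. \<beta> l (\<alpha> k (\<gamma> m w))))"
        unfolding sw13[symmetric] lins3_append lins3_swap12 perm'(2) by (simp only: lins3_swap12 lins3_append)
      also have "lins3 fs (\<lambda>k l m. \<beta> l (\<alpha> k (\<gamma> m w))) = D"
        unfolding D_def perm'(1) quasi_local_lins3_12[OF ql(1), of "\<lambda>m. \<gamma> m w"] ..
      finally show ?thesis .
    qed
    have tr: "trunc3 (lins3 (?gs @ map e23 h13) (comp3 \<beta> \<alpha> \<gamma> w))"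
      unfolding e by (rule trunc3_swap12[OF trD])
    have "T13 (T23 (swap12 D)) = lins3 (map subst13 (map subst23 (?gs @ map e23 h13))) (\<lambda>i j p. G' j i p w)"
      using T13_T23_comp3[OF fields(2,1,3) h13 G' tr] unfolding e .
    moreover have "T13 (T23 (swap12 D)) = swap12 X3"
      unfolding X3_def T13_T23[OF trD] T23_swap12 T13_of_swap12 ..
    ultimately have "X3 = swap12 (lins3 (map subst13 (map subst23 (?gs @ map e23 h13))) (\<lambda>i j p. G' j i p w))"
      by (metis swap12_swap12)
    also have "\<dots> = lins3 (map sw12 (map subst13 (map subst23 (?gs @ map e23 h13)))) (swap12 (\<lambda>i j p. G' j i p w))"
      unfolding lins3_swap12 ..
    also have "swap12 (\<lambda>i j p. G' j i p w) = Gw'" by (simp add: Gw'_def swap12_def fun_eq_iff)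
    also have "map sw12 (map subst13 (map subst23 (?gs @ map e23 h13)))
        = map subst123 (map e12 h12 @ map e23 h23) @ map subst123 (map e13 h13)"
    proof -
      have m: "map sw12 (map subst13 (map subst23 (map sw12 gs))) = map subst123 gs" for gs
        by (simp add: swap12_lins3_subst)
      have g: "?gs @ map e23 h13 = map sw12 ((map e12 h12 @ map e23 h23) @ map e13 h13)"
        unfolding sw13[symmetric] map_append ..
      show ?thesis unfolding g m by (rule map_append)
    qed
    also have "lins3 \<dots> Gw' = lins3 fs' Gw'"
      unfolding fs'_def perm(2) lins3_append ..
    finally show ?thesis .
  qed
  have nz3: "f \<noteq> (0, 0, 0)" if "f \<in> set fs" for f
    using nonzero_form3[OF nz] that unfolding fs_def by blast
  have nz': "f \<noteq> (0, 0, 0)" if "f \<in> set fs'" for f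
    using nz3 that by (force simp: fs'_def subst123_eq)
  define f1 where "f1 = filter invertible fs'"
  define f0 where "f0 = filter (\<lambda>f. \<not> invertible f) fs'"
  have split: "lins3 fs' V = lins3 f1 (lins3 f0 V)" for V
    unfolding f1_def f0_def by (rule lins3_partition)
  have split': "lins3 (map subst12 fs') V = lins3 (map subst12 f1) (lins3 (map subst12 f0) V)" for V
  proof -
    have "lins3 (map subst12 gs) V = lins3 (map subst12 (filter P gs)) (lins3 (map subst12 (filter (\<lambda>f. \<not> P f) gs)) V)" for P gs
    proof (induction gs)
      case (Cons g gs)
      then show ?case
        by (cases "P g") (simp_all only: list.map filter.simps foldr.simps comp_apply if_True if_False not_True_eq_False not_False_eq_True
          lin3_lins3[symmetric])
    qed (simp only: list.map filter.simps foldr.simps id_apply)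
    then show ?thesis unfolding f1_def f0_def .
  qed
  define hs where "hs = map (\<lambda>(a, b, c). (a, b)) f0"
  \<comment> \<open>A form \<open>a x\<^sub>1 + b x\<^sub>2 + c x\<^sub>3\<close> in \<open>fs\<close> has a vanishing coefficient; if its image
    \<open>a t + b y + (a + b + c) x\<^sub>3\<close> is not invertible, the vanishing one is \<open>c\<close>, and \<open>b = - a\<close>.\<close>
  have f0_form: "\<exists>a. a \<noteq> 0 \<and> f = (a, - a, 0)" if "f \<in> set f0" for f
  proof -
    from that obtain a b c where g: "(a, b, c) \<in> set fs" "f = (a, b, a + b + c)" and ni: "\<not> invertible f"
      by (auto simp: f0_def fs'_def subst123_eq)
    have "a + b + c = 0" "(a \<noteq> 0) = (b \<noteq> 0)" using ni by (auto simp: g(2) invertible_def)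
    moreover have "a = 0 \<or> b = 0 \<or> c = 0" using g(1) by (auto simp: fs_def)
    moreover have "(a, b, c) \<noteq> (0, 0, 0)" by (rule nz3[OF g(1)])
    ultimately have "c = 0" "a \<noteq> 0" by auto
    with \<open>a + b + c = 0\<close> have "b = - a" by (simp add: add_eq_0_iff)
    then show ?thesis using \<open>a \<noteq> 0\<close> \<open>c = 0\<close> g(2) by auto
  qed
  have f0_hs: "f0 = map e12 hs"
    unfolding hs_def map_map by (rule map_idI[symmetric]) (use f0_form in force)
  have hs_form: "\<forall>f\<in>set hs. \<exists>a. a \<noteq> 0 \<and> f = (a, - a)"
    unfolding hs_def using f0_form by force
  have X0: "X3 i j = 0" if "i < 0 \<or> j < 0" for i j
    using that unfolding X3_def by (simp add: fun_eq_iff T13_T23_negative)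
  have "\<forall>f\<in>set f1. invertible f" by (simp add: f1_def)
  \<comment> \<open>Dividing by the invertible forms gives a distribution \<open>Y\<close> bounded in \<open>t\<close> and \<open>y\<close>, which both
    iterated products equal up to the forms \<open>a (t - y)\<close>.\<close>
  from lins3_invertible[OF this, of 0 0 X3] X0 obtain K L Y
    where Y: "\<And>i j. i < K \<or> j < L \<Longrightarrow> Y i j = 0" "lins3 f1 Y = X3" by blast
  have f1_nz: "\<forall>f\<in>set f1. f \<noteq> (0, 0, 0)" using nz' by (auto simp: f1_def)
  have fE: "is_field (E j)" for j by (rule is_prod_field[OF fields(2,3) E])
  have fF: "is_field (F j)" for j by (rule is_prod_field[OF fields(1,3) F])
  have G0: "G j = 0" if "j < N23" for j
    by (rule is_prod_zero_right[OF fields(1)]) (use G[of j] h23 that in \<open>simp add: prod_via_def low_def\<close>)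
  have G0': "G' i = 0" if "i < N13" for i
    by (rule is_prod_zero_right[OF fields(2)]) (use G'[of i] h13 that in \<open>simp add: prod_via_def low_def\<close>)
  have Z0: "Z i = 0" if "i < N12" for i
    by (rule is_prod_zero_left[OF fields(3)]) (use Z[of i] h12 that in \<open>simp add: prod_via_def low_def\<close>)
  have low2I: "low2 (min M N) (V - Y')"
    if V0: "\<And>i. i < M \<Longrightarrow> V i = 0" and V: "\<And>i. \<exists>M. low M (V i)" and Y': "low2 N Y'" for M N V Y'
  proof -
    have "\<exists>M. low M (V i - Y' i)" for i
    proof -
      obtain M1 where 1: "low M1 (V i)" using V by blast
      obtain M2 where 2: "low M2 (Y' i)" using Y' unfolding low2_def by blast
      have "low (min M1 M2) (V i - Y' i)" using 1 2 by (simp add: low_def fun_eq_iff)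
      then show ?thesis ..
    qed
    then show ?thesis using V0 Y' by (simp add: low2_def low_def)
  qed
  have rowsI: "\<exists>M. low M (\<lambda>j p. Q j p w)" if "is_prod a b Q" for a b Q
    using is_prod_low[OF that] low_slice by metis
  have GY: "lins3 f0 Gw = Y"
  proof -
    have eq: "lins3 (map sw12 f1) (lins3 (map sw12 f0) (swap12 Gw) - swap12 Y) = 0"
      unfolding lins3_diff lins3_swap12 split[symmetric] XG[symmetric] Y(2) by simp
    have lowG: "low2 N23 (swap12 Gw)"
      using rowsI[OF G] G0 by (auto simp: low2_def low_def swap12_def Gw_def fun_eq_iff)
    have lowY: "low2 L (swap12 Y)"
      unfolding low2_def low_def by (auto simp: swap12_def fun_eq_iff Y(1) intro!: exI[of _ K])
    have "lins3 (map sw12 f0) (swap12 Gw) - swap12 Y = 0"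
    proof (rule lins3_cancel[OF _ eq])
      show "low2 (min N23 L) (lins3 (map sw12 f0) (swap12 Gw) - swap12 Y)"
        by (rule low2I[OF _ _ lowY]) (use low2_lins3[OF lowG, of "map sw12 f0"] in \<open>auto simp: low2_def low_def\<close>)
      show "\<forall>f\<in>set (map sw12 f1). f \<noteq> (0, 0, 0)" using f1_nz by force
    qed
    then have "swap12 (lins3 f0 Gw) = swap12 Y" unfolding lins3_swap12 by simp
    then show ?thesis by (metis swap12_swap12)
  qed
  have lowY: "low2 K Y"
    unfolding low2_def low_def using Y(1) by (auto intro!: exI[of _ L])
  have GY': "lins3 f0 Gw' = Y"
  proof -
    have eq: "lins3 f1 (lins3 f0 Gw' - Y) = 0"
      unfolding lins3_diff split[symmetric] XG'[symmetric] Y(2) by simp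
    have lowG: "low2 N13 Gw'"
      using rowsI[OF G'] G0' by (auto simp: low2_def low_def Gw'_def fun_eq_iff)
    have "lins3 f0 Gw' - Y = 0"
    proof (rule lins3_cancel[OF _ eq f1_nz])
      show "low2 (min N13 K) (lins3 f0 Gw' - Y)"
        by (rule low2I[OF _ _ lowY]) (use low2_lins3[OF lowG, of f0] in \<open>auto simp: low2_def low_def\<close>)
    qed
    then show ?thesis by simp
  qed
  have trY: "trunc12 Y" unfolding trunc12_def
    by (intro allI trunc2I[of K L]) (simp add: Y(1))
  have ZY: "T12 Y = lins3 (map subst12 f0) Zw"
  proof -
    have "lins3 (map subst12 f1) (T12 Y) = T12 X3" unfolding T12_lins3[OF trY, symmetric] Y(2) ..
    then have eq: "lins3 (map subst12 f1) (lins3 (map subst12 f0) Zw - T12 Y) = 0"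
      unfolding lins3_diff split'[symmetric] XZ by simp
    have lowZ: "low2 N12 Zw"
      using rowsI[OF Z] Z0 by (auto simp: low2_def low_def Zw_def fun_eq_iff)
    have lowT: "low2 0 (T12 Y)"
    proof -
      have "low (K + L - i) (T12 Y i)" for i
        unfolding low_def
      proof (intro allI impI ext)
        fix j p assume "j < K + L - i"
        then show "T12 Y i j p = 0 p" unfolding T12_def zero_fun_apply
          by (intro T_bound[of K L]) (simp_all add: Y(1))
      qed
      then show ?thesis by (auto simp: low2_def low_def T12_def T_negative fun_eq_iff)
    qed
    have "lins3 (map subst12 f0) Zw - T12 Y = 0"
    proof (rule lins3_cancel[OF _ eq])
      show "low2 (min N12 0) (lins3 (map subst12 f0) Zw - T12 Y)"
        by (rule low2I[OF _ _ lowT]) (use low2_lins3[OF lowZ, of "map subst12 f0"] in \<open>auto simp: low2_def low_def\<close>)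
      show "\<forall>f\<in>set (map subst12 f1). f \<noteq> (0, 0, 0)" using f1_nz by force
    qed
    then show ?thesis by simp
  qed
  define Yp where "Yp = (\<lambda>i j. Y i j p)"
  have 1: "lins2 hs (\<lambda>i j. G j i p w) = Yp"
    using GY lins3_e12[of hs Gw] by (simp add: f0_hs Yp_def Gw_def fun_eq_iff)
  have 2: "lins2 hs (\<lambda>i j. G' i j p w) = Yp"
    using GY' lins3_e12[of hs Gw'] by (simp add: f0_hs Yp_def Gw'_def fun_eq_iff)
  have 3: "lins2 (map subst2 hs) (\<lambda>i j. Z i j p w) = T Yp"
  proof (intro ext)
    fix i j
    have "T Yp i j = T12 Y i j p" by (simp add: T12_def Yp_def)
    then show "lins2 (map subst2 hs) (\<lambda>i j. Z i j p w) i j = T Yp i j"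
      unfolding ZY f0_hs map_subst12_e12 lins3_e12 by (simp add: Zw_def)
  qed
  have trp: "trunc2 Yp" using trY by (simp add: trunc12_def Yp_def)
  show ?thesis
  proof (rule defect_shifts[OF _ _ _ hs_form])
    show "bounded2 (\<lambda>i j. G j i p w)" unfolding bounded2_def using G0 by (auto intro!: exI[of _ N23])
    show "bounded1 (\<lambda>i j. G' i j p w)" unfolding bounded1_def using G0' by (auto intro!: exI[of _ N13])
    show "bounded1 (\<lambda>i j. Z i j p w)" unfolding bounded1_def using Z0 by (auto intro!: exI[of _ N12])
    show "defect (lins2 hs (\<lambda>i j. G j i p w)) (lins2 hs (\<lambda>i j. G' i j p w)) (lins2 (map subst2 hs) (\<lambda>i j. Z i j p w)) = 0"
      unfolding 1 2 3 by (rule defect_T[OF trp])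
  qed
qed

section \<open>Linearity of products and the identity field\<close>

text \<open>
  The product can be computed with any forms that make the fields commute.
\<close>

lemma prod_via_any_forms:
  assumes "is_field \<alpha>" "is_field \<beta>" "is_prod \<alpha> \<beta> C" "quasi_local fs \<alpha> \<beta>"
  shows "\<exists>N. prod_via fs N \<alpha> \<beta> C"
proof -
  obtain hs N where h: "prod_via hs N \<alpha> \<beta> C" using assms(3) by (auto simp: is_prod_def)
  have qh: "quasi_local hs \<alpha> \<beta>" and lo: "low N C" using h by (auto simp: prod_via_def)
  have "T (lins2 fs (comp2 \<alpha> \<beta> w)) - lins2 (map subst2 fs) (\<lambda>i p. C i p w) = 0" for w
  proof (rule lins2_cancel)
    have "lins2 (map subst2 hs) (T (lins2 fs (comp2 \<alpha> \<beta> w))) = T (lins2 hs (lins2 fs (comp2 \<alpha> \<beta> w)))"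
      using T_lins2[OF quasi_local_trunc2[OF assms(1,2,4)]] by simp
    also have "\<dots> = T (lins2 fs (lins2 hs (comp2 \<alpha> \<beta> w)))"
      by (subst lins2_commute) (rule refl)
    also have "\<dots> = lins2 (map subst2 fs) (T (lins2 hs (comp2 \<alpha> \<beta> w)))"
      by (rule T_lins2[OF quasi_local_trunc2[OF assms(1,2) qh]])
    also have "T (lins2 hs (comp2 \<alpha> \<beta> w)) = lins2 (map subst2 hs) (\<lambda>i p. C i p w)"
      using h by (simp add: prod_via_def)
    also have "lins2 (map subst2 fs) \<dots> = lins2 (map subst2 hs) (lins2 (map subst2 fs) (\<lambda>i p. C i p w))"
      by (rule lins2_commute)
    finally show "lins2 (map subst2 hs) (T (lins2 fs (comp2 \<alpha> \<beta> w)) - lins2 (map subst2 fs) (\<lambda>i p. C i p w)) = 0"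
      unfolding lins2_diff by simp
    show "\<forall>f\<in>set (map subst2 hs). f \<noteq> (0, 0)"
      using qh unfolding nonzero_forms_def[symmetric] nonzero_forms_subst by (simp add: quasi_local_def)
    show "low (min 0 N) (T (lins2 fs (comp2 \<alpha> \<beta> w)) - lins2 (map subst2 fs) (\<lambda>i p. C i p w))"
      using lins2_low[OF low_slice[OF lo, of w], of "map subst2 fs"] by (auto simp: low_def T_negative fun_eq_iff)
  qed
  then have "prod_via fs N \<alpha> \<beta> C" using lo assms(4) by (simp add: prod_via_def)
  then show ?thesis by blast
qed

lemma comp2_add_left: "comp2 (\<alpha> + \<alpha>') \<beta> w = comp2 \<alpha> \<beta> w + comp2 \<alpha>' \<beta> w"
  by (simp add: fun_eq_iff)

lemma is_field_plus:
  assumes "is_field \<alpha>" "is_field \<beta>" shows "is_field (\<alpha> + \<beta>)"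
proof (rule is_fieldI)
  fix w
  obtain M where M: "\<And>k. k < M \<Longrightarrow> \<alpha> k w = 0" using field_low[OF assms(1)] by metis
  obtain N where N: "\<And>k. k < N \<Longrightarrow> \<beta> k w = 0" using field_low[OF assms(2)] by metis
  show "\<exists>N. \<forall>k<N. (\<alpha> + \<beta>) k w = 0" by (intro exI[of _ "min M N"]) (simp add: M N)
qed (simp_all add: field_add field_scale assms scale_right_distrib)

lemma is_field_scale:
  assumes "is_field \<alpha>" shows "is_field (\<lambda>k w. c *s \<alpha> k w)"
proof (rule is_fieldI)
  fix w
  obtain M where M: "\<And>k. k < M \<Longrightarrow> \<alpha> k w = 0" using field_low[OF assms(1)] by metis
  show "\<exists>N. \<forall>k<N. c *s \<alpha> k w = 0" by (intro exI[of _ M]) (simp add: M)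
qed (simp_all add: field_add field_scale assms scale_right_distrib mult.commute)

lemma is_field_0: "is_field 0"
  by (rule is_fieldI) auto

lemma quasi_local_plus_left:
  assumes "is_field \<beta>" "quasi_local fs \<alpha> \<beta>" "quasi_local fs \<alpha>' \<beta>"
  shows "quasi_local fs (\<alpha> + \<alpha>') \<beta>"
proof -
  have "comp2' (\<alpha> + \<alpha>') \<beta> w = comp2' \<alpha> \<beta> w + comp2' \<alpha>' \<beta> w" for w
    by (simp add: fun_eq_iff field_add[OF assms(1)])
  then show ?thesis using assms(2,3) by (simp add: quasi_local_def comp2_add_left lins2_add del: plus_fun_apply)
qed

lemma prod_via_plus_left:
  assumes "is_field \<alpha>" "is_field \<alpha>'" "is_field \<beta>" "prod_via fs N \<alpha> \<beta> C" "prod_via fs N' \<alpha>' \<beta> C'"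
  shows "prod_via fs (min N N') (\<alpha> + \<alpha>') \<beta> (C + C')"
proof -
  have ql: "quasi_local fs \<alpha> \<beta>" "quasi_local fs \<alpha>' \<beta>" using assms(4,5) by (auto simp: prod_via_def)
  have "T (lins2 fs (comp2 (\<alpha> + \<alpha>') \<beta> w)) = lins2 (map subst2 fs) (\<lambda>i p. (C + C') i p w)" for w
  proof -
    have "T (lins2 fs (comp2 (\<alpha> + \<alpha>') \<beta> w)) = T (lins2 fs (comp2 \<alpha> \<beta> w)) + T (lins2 fs (comp2 \<alpha>' \<beta> w))"
      unfolding comp2_add_left lins2_add
      by (rule T_add) (use ql assms quasi_local_trunc2 in blast)+
    also have "\<dots> = lins2 (map subst2 fs) (\<lambda>i p. C i p w) + lins2 (map subst2 fs) (\<lambda>i p. C' i p w)"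
      using assms(4,5) by (simp add: prod_via_def)
    also have "\<dots> = lins2 (map subst2 fs) (\<lambda>i p. (C + C') i p w)"
      unfolding lins2_add[symmetric] by (rule arg_cong[where f = "lins2 _"]) (simp add: fun_eq_iff)
    finally show ?thesis .
  qed
  moreover have "low (min N N') (C + C')" using assms(4,5) by (simp add: prod_via_def low_def)
  ultimately show ?thesis using quasi_local_plus_left[OF assms(3) ql] unfolding prod_via_def by blast
qed

lemma is_prod_plus_left:
  assumes "is_field \<alpha>" "is_field \<alpha>'" "is_field \<beta>" "is_prod \<alpha> \<beta> C" "is_prod \<alpha>' \<beta> C'"
  shows "is_prod (\<alpha> + \<alpha>') \<beta> (C + C')"
proof -
  obtain fs N where 1: "prod_via fs N \<alpha> \<beta> C" using assms by (auto simp: is_prod_def)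
  obtain fs' N' where 2: "prod_via fs' N' \<alpha>' \<beta> C'" using assms by (auto simp: is_prod_def)
  have nz: "nonzero_forms fs" "nonzero_forms fs'" using 1 2 by (auto simp: prod_via_def quasi_local_def)
  from prod_via_plus_left[OF assms(1-3) prod_via_append2[OF assms(1,3) 1 nz(2)] prod_via_append[OF assms(2,3) 2 nz(1)]]
  show ?thesis unfolding is_prod_def by blast
qed

lemma quasi_local_plus_right:
  assumes "is_field \<alpha>" "quasi_local fs \<alpha> \<beta>" "quasi_local fs \<alpha> \<beta>'"
  shows "quasi_local fs \<alpha> (\<beta> + \<beta>')"
  using quasi_local_sym[OF quasi_local_plus_left[OF assms(1) quasi_local_sym[OF assms(2)] quasi_local_sym[OF assms(3)]]]
  by simp

lemma is_prod_plus_right: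
  assumes "is_field \<alpha>" "is_field \<beta>" "is_field \<beta>'" "is_prod \<alpha> \<beta> C" "is_prod \<alpha> \<beta>' C'"
  shows "is_prod \<alpha> (\<beta> + \<beta>') (C + C')"
proof -
  obtain fs1 N1 where 1: "prod_via fs1 N1 \<alpha> \<beta> C" using assms by (auto simp: is_prod_def)
  obtain fs2 N2 where 2: "prod_via fs2 N2 \<alpha> \<beta>' C'" using assms by (auto simp: is_prod_def)
  have nz: "nonzero_forms fs1" "nonzero_forms fs2" using 1 2 by (auto simp: prod_via_def quasi_local_def)
  define fs where "fs = fs1 @ fs2"
  have 3: "prod_via fs N1 \<alpha> \<beta> C" unfolding fs_def by (rule prod_via_append2[OF assms(1,2) 1 nz(2)])
  have 4: "prod_via fs N2 \<alpha> \<beta>' C'" unfolding fs_def by (rule prod_via_append[OF assms(1,3) 2 nz(1)])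
  have ql: "quasi_local fs \<alpha> \<beta>" "quasi_local fs \<alpha> \<beta>'" using 3 4 by (auto simp: prod_via_def)
  have "T (lins2 fs (comp2 \<alpha> (\<beta> + \<beta>') w)) = lins2 (map subst2 fs) (\<lambda>i p. (C + C') i p w)" for w
  proof -
    have "comp2 \<alpha> (\<beta> + \<beta>') w = comp2 \<alpha> \<beta> w + comp2 \<alpha> \<beta>' w"
      by (simp add: fun_eq_iff field_add[OF assms(1)])
    then have "T (lins2 fs (comp2 \<alpha> (\<beta> + \<beta>') w)) = T (lins2 fs (comp2 \<alpha> \<beta> w) + lins2 fs (comp2 \<alpha> \<beta>' w))"
      by (simp only: lins2_add)
    also have "\<dots> = T (lins2 fs (comp2 \<alpha> \<beta> w)) + T (lins2 fs (comp2 \<alpha> \<beta>' w))"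
      by (rule T_add) (use ql assms quasi_local_trunc2 in blast)+
    also have "\<dots> = lins2 (map subst2 fs) (\<lambda>i p. C i p w) + lins2 (map subst2 fs) (\<lambda>i p. C' i p w)"
      using 3 4 by (simp add: prod_via_def)
    also have "\<dots> = lins2 (map subst2 fs) (\<lambda>i p. (C + C') i p w)"
      unfolding lins2_add[symmetric] by (rule arg_cong[where f = "lins2 _"]) (simp add: fun_eq_iff)
    finally show ?thesis .
  qed
  moreover have "low (min N1 N2) (C + C')" using 3 4 by (simp add: prod_via_def low_def)
  ultimately have "prod_via fs (min N1 N2) \<alpha> (\<beta> + \<beta>') (C + C')"
    using quasi_local_plus_right[OF assms(1) ql] unfolding prod_via_def by blast
  then show ?thesis unfolding is_prod_def by blast
qed

lemma quasi_local_scale_left: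
  assumes "is_field \<beta>" "quasi_local fs \<alpha> \<beta>"
  shows "quasi_local fs (\<lambda>k w. c *s \<alpha> k w) \<beta>"
  using assms by (simp add: quasi_local_def field_scale lins2_scale)

lemma quasi_local_scale_right:
  assumes "is_field \<alpha>" "quasi_local fs \<alpha> \<beta>"
  shows "quasi_local fs \<alpha> (\<lambda>k w. c *s \<beta> k w)"
  using assms by (simp add: quasi_local_def field_scale lins2_scale)

lemma is_prod_scale_left:
  assumes "is_field \<beta>" "is_prod \<alpha> \<beta> C"
  shows "is_prod (\<lambda>k w. c *s \<alpha> k w) \<beta> (\<lambda>i p w. c *s C i p w)"
proof -
  obtain fs N where 1: "prod_via fs N \<alpha> \<beta> C" using assms by (auto simp: is_prod_def)
  then have "prod_via fs N (\<lambda>k w. c *s \<alpha> k w) \<beta> (\<lambda>i p w. c *s C i p w)"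
    using quasi_local_scale_left[OF assms(1), of fs \<alpha> c]
    by (simp add: prod_via_def lins2_scale T_scale low_def fun_eq_iff)
  then show ?thesis unfolding is_prod_def by blast
qed

lemma is_prod_scale_right:
  assumes "is_field \<alpha>" "is_prod \<alpha> \<beta> C"
  shows "is_prod \<alpha> (\<lambda>k w. c *s \<beta> k w) (\<lambda>i p w. c *s C i p w)"
proof -
  obtain fs N where 1: "prod_via fs N \<alpha> \<beta> C" using assms by (auto simp: is_prod_def)
  then have "prod_via fs N \<alpha> (\<lambda>k w. c *s \<beta> k w) (\<lambda>i p w. c *s C i p w)"
    using quasi_local_scale_right[OF assms(1), of fs \<beta> c]
    by (simp add: prod_via_def lins2_scale T_scale low_def fun_eq_iff field_scale[OF assms(1)])
  then show ?thesis unfolding is_prod_def by blast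
qed

definition id_field :: "int \<Rightarrow> 'w \<Rightarrow> 'w" where
  "id_field k w = (if k = 0 then w else 0)"

lemma is_field_id: "is_field id_field"
proof (rule is_fieldI)
  fix w show "\<exists>N. \<forall>k<N. id_field k w = 0" by (intro exI[of _ 0]) (simp add: id_field_def)
qed (simp_all add: id_field_def)

lemma Sum_any_single: "Sum_any (\<lambda>k. if k = c then f k else 0) = f c"
proof -
  have "Sum_any (\<lambda>k. if k = c then f k else 0) = (\<Sum>k\<in>{c}. if k = c then f k else 0)"
    by (rule Sum_any.expand_superset) (auto split: if_splits)
  then show ?thesis by simp
qed

lemma is_prod_id_left:
  assumes "is_field \<beta>"
  shows "is_prod id_field \<beta> (\<lambda>i p w. if i = 0 then \<beta> p w else 0)"
proof -
  have "is_prod id_field \<beta> (\<lambda>i p w. T (comp2 id_field \<beta> w) i p)"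
    by (rule is_prod_T) (simp add: fun_eq_iff id_field_def field_zero[OF assms])
  moreover have "T (comp2 id_field \<beta> w) i p = (if i = 0 then \<beta> p w else 0)" for i p w
  proof -
    have "T (comp2 id_field \<beta> w) i p = Sum_any (\<lambda>k. if k = 0 then bin k i *s \<beta> (p + i - k) w else 0)"
      unfolding T_def by (rule Sum_any.cong) (simp add: id_field_def)
    then show ?thesis unfolding Sum_any_single by (simp add: bin_0_left)
  qed
  ultimately show ?thesis by simp
qed

lemma is_prod_id_right:
  assumes "is_field \<alpha>"
  shows "is_prod \<alpha> id_field (\<lambda>i p w. bin (p + i) i *s \<alpha> (p + i) w)"
proof -
  have "is_prod \<alpha> id_field (\<lambda>i p w. T (comp2 \<alpha> id_field w) i p)"
    by (rule is_prod_T) (simp add: fun_eq_iff id_field_def field_zero[OF assms])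
  moreover have "T (comp2 \<alpha> id_field w) i p = bin (p + i) i *s \<alpha> (p + i) w" for i p w
  proof -
    have "T (comp2 \<alpha> id_field w) i p = Sum_any (\<lambda>k. if k = p + i then bin k i *s \<alpha> k w else 0)"
      unfolding T_def by (rule Sum_any.cong) (simp add: id_field_def field_zero[OF assms])
    then show ?thesis unfolding Sum_any_single .
  qed
  ultimately show ?thesis by simp
qed

section \<open>Fields whose commutators are sums of poles\<close>

text \<open>
  Up to the factor \<open>c\<close>, the coefficient of \<open>x\<^sub>1\<^sup>k x\<^sub>2\<^sup>l\<close> in the derivative of
  \<open>x\<^sub>1\<^sup>-\<^sup>1 \<delta>(y / x\<^sub>1)\<close> with respect to \<open>y\<close> at \<open>y = c x\<^sub>2\<close>: the difference of the two expansions
  of a double pole at \<open>x\<^sub>1 = c x\<^sub>2\<close>.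
\<close>

definition pole :: "complex \<Rightarrow> int \<Rightarrow> int \<Rightarrow> complex" where
  "pole c k l = (if k + l = - 2 then of_int (- k - 1) * c powi (- k - 1) else 0)"

lemma pole_killed:
  assumes "c \<noteq> 0" shows "lin2 (1, - c) (lin2 (1, - c) (\<lambda>k l. pole c k l *s v)) = 0"
proof -
  have 1: "lin2 (1, - c) (\<lambda>k l. pole c k l *s v) = (\<lambda>k l. if k + l = - 1 then c powi (- k) *s v else 0)"
  proof (intro ext)
    fix k l
    have c: "c * c powi (- k - 1) = c powi (- k)" using assms by (simp add: power_int_diff)
    have k: "- (k - 1) - 1 = - k" by simp
    show "lin2 (1, - c) (\<lambda>k l. pole c k l *s v) k l = (if k + l = - 1 then c powi (- k) *s v else 0)"
    proof (cases "k + l = - 1")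
      case True
      then have "lin2 (1, - c) (\<lambda>k l. pole c k l *s v) k l
        = (of_int (- k) * c powi (- k) - of_int (- k - 1) * (c * c powi (- k - 1))) *s v"
        unfolding lin2.simps pole_def k by (simp add: scale_left_diff_distrib mult.left_commute)
      also have "of_int (- k) * c powi (- k) - of_int (- k - 1) * (c * c powi (- k - 1)) = c powi (- k)"
        unfolding c by (simp add: left_diff_distrib)
      finally show ?thesis using True by simp
    qed (simp add: lin2.simps pole_def)
  qed
  show ?thesis unfolding 1
  proof (intro ext)
    fix k l
    have c: "c powi (1 - k) = c * c powi (- k)" using assms by (simp add: power_int_diff power_int_minus field_simps)
    show "lin2 (1, - c) (\<lambda>k l. if k + l = - 1 then c powi (- k) *s v else 0) k l = 0 k l"
      by (cases "k + l = 0") (simp_all only: lin2.simps, simp_all add: c)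
  qed
qed

text \<open>
  The part with negative powers of \<open>x\<^sub>1\<close> is the expansion of \<open>(x\<^sub>1 - x\<^sub>2)\<^sup>-\<^sup>2\<close> in nonnegative powers of
  \<open>x\<^sub>2\<close>.
\<close>

lemma pole_1_half:
  "lin2 (1, - 1) (lin2 (1, - 1) (\<lambda>k l. (if k < 0 then pole 1 k l else 0) *s v))
   = (\<lambda>k l. if k = 0 \<and> l = 0 then v else 0)"
proof -
  have 1: "lin2 (1, - 1) (\<lambda>k l. (if k < 0 then pole 1 k l else 0) *s v) = (\<lambda>k l. if k + l = - 1 \<and> k < 0 then v else 0)"
    by (intro ext) (auto simp: lin2.simps pole_def algebra_simps)
  show ?thesis unfolding 1
    by (intro ext) (auto simp: lin2.simps)
qed

definition pole_forms :: "(complex \<times> complex) list \<Rightarrow> (complex \<times> complex) list" where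
  "pole_forms xs = concat (map (\<lambda>(h, c). [(1, - c), (1, - c)]) xs)"

definition poles :: "(complex \<times> complex) list \<Rightarrow> int \<Rightarrow> int \<Rightarrow> complex" where
  "poles xs k l = (\<Sum>(h, c)\<leftarrow>xs. h * pole c k l)"

lemma poles_killed:
  assumes "\<forall>(h, c)\<in>set xs. c \<noteq> 0"
  shows "lins2 (pole_forms xs) (\<lambda>k l. poles xs k l *s v) = 0"
  using assms
proof (induction xs)
  case Nil
  then show ?case by (simp add: pole_forms_def poles_def zero_fun_def)
next
  case (Cons hc xs)
  obtain h c where hc: "hc = (h, c)" by (cases hc)
  have c: "c \<noteq> 0" using Cons.prems by (simp add: hc)
  have "(\<lambda>k l. poles (hc # xs) k l *s v) = (\<lambda>k l. pole c k l *s (h *s v)) + (\<lambda>k l. poles xs k l *s v)"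
    by (simp add: fun_eq_iff poles_def hc scale_left_distrib mult.commute)
  moreover have "lins2 (pole_forms (hc # xs)) F = lin2 (1, - c) (lin2 (1, - c) (lins2 (pole_forms xs) F))" for F
    by (simp add: pole_forms_def hc)
  moreover have "lin2 (1, - c) (lin2 (1, - c) (lins2 (pole_forms xs) (\<lambda>k l. pole c k l *s (h *s v)))) = 0"
    unfolding lin2_lins2 pole_killed[OF c] lins2_zero ..
  moreover have "lins2 (pole_forms xs) (\<lambda>k l. poles xs k l *s v) = 0" by (rule Cons.IH) (use Cons.prems in simp)
  ultimately show ?case by (simp only: lins2_add lin2_add lin2_zero add_0)
qed

lemma nonzero_pole_forms: "nonzero_forms (pole_forms xs)"
  by (auto simp: nonzero_forms_def pole_forms_def)

text \<open>
  A form \<open>a x\<^sub>0 + b x\<^sub>2\<close> with \<open>b \<noteq> 0\<close> does not vanish at \<open>x\<^sub>0 = 0\<close>, so multiplying by it preserves the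
  order in \<open>x\<^sub>0\<close>.
\<close>

lemma low_cancel:
  assumes "low N F" "b \<noteq> 0" "low M (lin2 (a, b) F)"
  shows "low M F"
proof -
  have "\<forall>i < N + int n. i < M \<longrightarrow> F i = 0" for n
  proof (induction n)
    case 0
    then show ?case using assms(1) by (simp add: low_def)
  next
    case (Suc n)
    show ?case
    proof (intro allI impI ext)
      fix i p assume i: "i < N + int (Suc n)" "i < M"
      then have "F (i - 1) = 0" by (intro Suc.IH[rule_format]) auto
      moreover have "lin2 (a, b) F i (p + 1) = 0" using lowD[OF assms(3) i(2)] by simp
      ultimately show "F i p = 0 p" using assms(2) by (simp add: lin2.simps)
    qed
  qed
  note * = this
  show ?thesis unfolding low_def
  proof (intro allI impI)
    fix i assume "i < M"
    then show "F i = 0" by (intro *[of "nat (i - N + 1)", rule_format]) auto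
  qed
qed

lemma lows_cancel:
  assumes "low N F" "\<forall>f\<in>set fs. snd f \<noteq> 0" "low M (lins2 fs F)"
  shows "low M F"
  using assms(2,3)
proof (induction fs)
  case (Cons f fs)
  obtain a b where f: "f = (a, b)" by (cases f)
  have "low M (lins2 fs F)"
    by (rule low_cancel[OF lins2_low[OF assms(1)], where a = a and b = b]) (use Cons.prems in \<open>simp_all add: f\<close>)
  then show ?case using Cons by simp
qed (simp add: id_def)

lemma poles_quasi_local:
  assumes "\<forall>(h, c)\<in>set xs. c \<noteq> 0" and comm: "\<And>k l w. \<alpha> k (\<beta> l w) - \<beta> l (\<alpha> k w) = poles xs k l *s w"
  shows "quasi_local (pole_forms xs) \<alpha> \<beta>"
proof -
  have "lins2 (pole_forms xs) (comp2 \<alpha> \<beta> w) = lins2 (pole_forms xs) (comp2' \<alpha> \<beta> w)" for w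
  proof -
    have "comp2 \<alpha> \<beta> w = (\<lambda>k l. poles xs k l *s w) + comp2' \<alpha> \<beta> w"
      by (simp add: fun_eq_iff comm[symmetric])
    then show ?thesis by (simp only: lins2_add poles_killed[OF assms(1)] add_0)
  qed
  then show ?thesis by (simp add: quasi_local_def nonzero_pole_forms)
qed

text \<open>
  If the commutator is a sum of double poles at \<open>x\<^sub>1 = c x\<^sub>2\<close>, only the poles with \<open>c = 1\<close> contribute
  to the singular part of the product at \<open>x\<^sub>1 = x\<^sub>2\<close>.  Indeed, removing the expansion \<open>P\<close> of
  \<open>H (x\<^sub>1 - x\<^sub>2)\<^sup>-\<^sup>2\<close> from \<open>\<alpha>(x\<^sub>1) \<beta>(x\<^sub>2)\<close> leaves a distribution that the forms for the other poles make
  truncated.  Its expansion at \<open>x\<^sub>1 = x\<^sub>2 + x\<^sub>0\<close> is regular, and these forms do not vanish at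
  \<open>x\<^sub>0 = 0\<close>; so the singular part is that of \<open>H x\<^sub>0\<^sup>-\<^sup>2\<close>.
\<close>

lemma poles_singular_part:
  assumes fields: "is_field \<alpha>" "is_field \<beta>" and nz: "\<forall>(h, c)\<in>set xs. c \<noteq> 0"
    and comm: "\<And>k l w. \<alpha> k (\<beta> l w) - \<beta> l (\<alpha> k w) = poles xs k l *s w"
    and C: "is_prod \<alpha> \<beta> C" and i: "i < 0"
  shows "C i p w = (if i = - 2 \<and> p = 0 then (\<Sum>(h, c)\<leftarrow>xs. if c = 1 then h else 0) *s w else 0)"
proof -
  define H where "H = (\<Sum>(h, c)\<leftarrow>xs. if c = 1 then h else 0)"
  define ys where "ys = filter (\<lambda>(h, c). c \<noteq> 1) xs"
  define gs where "gs = pole_forms ys"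
  define fs where "fs = (1, - 1) # (1, - 1) # gs"
  define P where "P = (\<lambda>k l. (if k < 0 then pole 1 k l else 0) *s (H *s w))"
  define Q where "Q = (\<lambda>k l. (if k < 0 then 0 else pole 1 k l) *s (H *s w))"
  define A where "A = comp2 \<alpha> \<beta> w"
  define B where "B = comp2' \<alpha> \<beta> w"
  define D where "D = lins2 gs (A - P)"
  have poles_split: "poles xs k l = H * pole 1 k l + poles ys k l" for k l
    unfolding H_def ys_def poles_def by (induction xs) (auto simp: algebra_simps)
  have nzy: "\<forall>(h, c)\<in>set ys. c \<noteq> 0" using nz by (auto simp: ys_def)
  have comm': "A - P = B + Q + (\<lambda>k l. poles ys k l *s w)"
  proof (intro ext)
    fix k l
    have "A k l = B k l + (poles ys k l *s w + (pole 1 k l * H) *s w)"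
      using comm[of k l w] unfolding poles_split scale_left_distrib by (simp add: A_def B_def algebra_simps)
    then show "(A - P) k l = (B + Q + (\<lambda>k l. poles ys k l *s w)) k l"
      by (simp add: P_def Q_def)
  qed
  have DB: "D = lins2 gs (B + Q)"
    unfolding D_def comm' lins2_add gs_def poles_killed[OF nzy] by simp
  have fsA: "lins2 fs A = lins2 [(1, - 1), (1, - 1)] D + lins2 gs (\<lambda>k l. if k = 0 \<and> l = 0 then H *s w else 0)"
  proof -
    have "lins2 fs A = lins2 fs (A - P) + lins2 fs P" unfolding lins2_add[symmetric] by simp
    then have "lins2 fs A = lins2 [(1, - 1), (1, - 1)] (lins2 gs (A - P)) + lin2 (1, - 1) (lin2 (1, - 1) (lins2 gs P))"
      by (simp only: fs_def foldr.simps comp_apply id_apply)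
    also have "lin2 (1, - 1) (lin2 (1, - 1) (lins2 gs P)) = lins2 gs (lin2 (1, - 1) (lin2 (1, - 1) P))"
      by (simp only: lin2_lins2)
    also have "lin2 (1, - 1) (lin2 (1, - 1) P) = (\<lambda>k l. if k = 0 \<and> l = 0 then H *s w else 0)"
      unfolding P_def by (rule pole_1_half)
    finally show ?thesis by (simp only: D_def)
  qed
  have trD: "trunc2 D"
  proof (rule bounded_trunc2)
    have "bounded2 A" unfolding A_def by (rule bounded2_comp2[OF fields])
    then obtain L where L: "\<And>k l. l < L \<Longrightarrow> A k l = 0" by (auto simp: bounded2_def)
    have "bounded2 (A - P)" unfolding bounded2_def
      by (intro exI[of _ "min L (- 1)"]) (auto simp: L P_def pole_def)
    then show "bounded2 D" unfolding D_def by (rule bounded2_lins2)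
    have "bounded1 B" unfolding B_def by (rule bounded1_comp2'[OF fields])
    then obtain K where K: "\<And>k l. k < K \<Longrightarrow> B k l = 0" by (auto simp: bounded1_def)
    have "bounded1 (B + Q)" unfolding bounded1_def
      by (intro exI[of _ "min K 0"]) (auto simp: K Q_def)
    then show "bounded1 D" unfolding DB by (rule bounded1_lins2)
  qed
  define \<Delta> where "\<Delta> = (\<lambda>(k::int) (l::int). if k = 0 \<and> l = 0 then H *s w else 0)"
  define \<Delta>2 where "\<Delta>2 = (\<lambda>(k::int) (l::int). if k = - 2 \<and> l = 0 then H *s w else 0)"
  have tr\<Delta>: "trunc2 \<Delta>" unfolding \<Delta>_def by (rule trunc2I[of 0 0]) auto
  have T\<Delta>: "T \<Delta> = lins2 [(1, 0), (1, 0)] \<Delta>2"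
  proof (intro ext)
    fix i p
    have "T \<Delta> i p = Sum_any (\<lambda>k. if k = 0 then bin k i *s (if p + i = 0 then H *s w else 0) else 0)"
      unfolding T_def by (rule Sum_any.cong) (auto simp: \<Delta>_def)
    then show "T \<Delta> i p = lins2 [(1, 0), (1, 0)] \<Delta>2 i p"
      unfolding Sum_any_single by (auto simp: \<Delta>2_def lin2.simps bin_0_left)
  qed
  have qfs: "quasi_local fs \<alpha> \<beta>"
  proof -
    have nzf: "nonzero_forms fs" using nonzero_pole_forms[of ys] by (simp add: fs_def gs_def nonzero_forms_def)
    have "lins2 fs (comp2 \<alpha> \<beta> v) = lins2 fs (comp2' \<alpha> \<beta> v)" for v
    proof -
      have "comp2 \<alpha> \<beta> v = (\<lambda>k l. pole 1 k l *s (H *s v)) + (\<lambda>k l. poles ys k l *s v) + comp2' \<alpha> \<beta> v"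
        using comm unfolding poles_split by (simp add: fun_eq_iff scale_left_distrib algebra_simps)
      moreover have "lins2 fs (\<lambda>k l. poles ys k l *s v) = 0"
        unfolding fs_def gs_def foldr.simps comp_apply poles_killed[OF nzy] lin2_zero ..
      moreover have "lins2 fs (\<lambda>k l. pole 1 k l *s (H *s v)) = 0"
        unfolding fs_def foldr.simps comp_apply lin2_lins2 pole_killed[of 1, simplified] lins2_zero ..
      ultimately show ?thesis by (simp only: lins2_add add_0)
    qed
    then show ?thesis using nzf by (simp add: quasi_local_def)
  qed
  obtain N where N: "prod_via fs N \<alpha> \<beta> C" using prod_via_any_forms[OF fields C qfs] by blast
  define Cw where "Cw = (\<lambda>i p. C i p w)"
  have lowC: "low N Cw" unfolding Cw_def by (rule low_slice) (use N in \<open>simp add: prod_via_def\<close>)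
  have sfs: "map subst2 fs = [(1, 0), (1, 0)] @ map subst2 gs" by (simp add: fs_def)
  have "lins2 (map subst2 fs) Cw = T (lins2 fs A)" using N by (simp add: prod_via_def Cw_def A_def)
  also have "\<dots> = T (lins2 [(1, - 1), (1, - 1)] D) + T (lins2 gs \<Delta>)"
    unfolding fsA \<Delta>_def[symmetric] by (rule T_add) (intro lins2_trunc2 trD tr\<Delta>)+
  also have "T (lins2 [(1, - 1), (1, - 1)] D) = lins2 [(1, 0), (1, 0)] (T D)"
    unfolding T_lins2[OF trD] by simp
  also have "T (lins2 gs \<Delta>) = lins2 [(1, 0), (1, 0)] (lins2 (map subst2 gs) \<Delta>2)"
    unfolding T_lins2[OF tr\<Delta>] T\<Delta> by (rule lins2_commute)
  finally have c: "lins2 [(1, 0), (1, 0)] (lins2 (map subst2 gs) (Cw - \<Delta>2) - T D) = 0"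
    unfolding sfs lins2_append lins2_diff by (simp only: add_diff_cancel_right' diff_self)
  have low2: "low (min N (- 2)) (Cw - \<Delta>2)"
    using lowC by (auto simp: low_def \<Delta>2_def fun_eq_iff)
  have l: "low (min N (- 2)) (lins2 (map subst2 gs) (Cw - \<Delta>2) - T D)"
    using lins2_low[OF low2, of "map subst2 gs"] by (auto simp: low_def T_negative fun_eq_iff)
  have "lins2 (map subst2 gs) (Cw - \<Delta>2) - T D = 0"
    by (rule lins2_cancel[OF l c]) simp
  then have "lins2 (map subst2 gs) (Cw - \<Delta>2) = T D" by simp
  then have "low 0 (lins2 (map subst2 gs) (Cw - \<Delta>2))" by (simp add: T_low)
  moreover have "\<forall>f\<in>set (map subst2 gs). snd f \<noteq> 0"
    by (auto simp: gs_def pole_forms_def ys_def)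
  ultimately have "low 0 (Cw - \<Delta>2)" using lows_cancel[OF low2] by blast
  then have "(Cw - \<Delta>2) i p = 0" using i by (simp add: low_def)
  then show ?thesis by (simp add: Cw_def \<Delta>2_def H_def)
qed

section \<open>Multiplication of distributions\<close>

text \<open>
  The product of distributions with values in a type; it is defined whenever the sums are finite, and
  then agrees with \<^const>\<open>dist_mult\<close> transported along a linear map.
\<close>

definition dmul :: "complex distribution \<Rightarrow> 'w distribution \<Rightarrow> 'w distribution" where
  "dmul D A k = Sum_any (\<lambda>j. D j *s A (k - j))"

definition multipliable :: "complex distribution \<Rightarrow> ('b::zero) distribution \<Rightarrow> bool" where
  "multipliable D A \<longleftrightarrow> (\<forall>k. finite {j. D j \<noteq> 0 \<and> A (k - j) \<noteq> 0})"

lemma finite_multipliable: "finite {j. D j \<noteq> 0} \<Longrightarrow> multipliable D A"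
  unfolding multipliable_def by (intro allI, erule rev_finite_subset) auto

lemma dmul_sum: "finite S \<Longrightarrow> {j. D j \<noteq> 0} \<subseteq> S \<Longrightarrow> dmul D A k = (\<Sum>j\<in>S. D j *s A (k - j))"
  unfolding dmul_def by (rule Sum_any.expand_superset) auto

lemma dmul_diff:
  assumes "finite {j. D j \<noteq> 0}" shows "dmul D (\<lambda>k. A k - B k) k = dmul D A k - dmul D B k"
  by (simp add: dmul_sum[OF assms order_refl] scale_right_diff_distrib sum_subtractf)

text \<open>
  A polynomial may be moved across a delta function.
\<close>

lemma dmul_commute:
  assumes "finite {j. F j \<noteq> 0}" "multipliable D A"
  shows "multipliable D (dmul F A)" "dmul D (dmul F A) = dmul F (dmul D A)"
proof -
  let ?S = "{j. F j \<noteq> 0}"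
  have fin: "finite {j. D j \<noteq> 0 \<and> A (k - i - j) \<noteq> 0}" for i k using assms(2) unfolding multipliable_def by blast
  have sub: "{j. D j \<noteq> 0 \<and> dmul F A (k - j) \<noteq> 0} \<subseteq> (\<Union>i\<in>?S. {j. D j \<noteq> 0 \<and> A (k - i - j) \<noteq> 0})" for k
  proof
    fix j assume j: "j \<in> {j. D j \<noteq> 0 \<and> dmul F A (k - j) \<noteq> 0}"
    then have "(\<Sum>i\<in>?S. F i *s A (k - j - i)) \<noteq> 0" by (simp add: dmul_sum[OF assms(1) order_refl])
    then obtain i where i: "i \<in> ?S" "F i *s A (k - j - i) \<noteq> 0" by (meson sum.neutral)
    have "k - j - i = k - i - j" by (simp add: diff_diff_eq add.commute)
    with i(2) have "A (k - i - j) \<noteq> 0" by (metis scale_zero_right)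
    then show "j \<in> (\<Union>i\<in>?S. {j. D j \<noteq> 0 \<and> A (k - i - j) \<noteq> 0})"
      using i(1) j by blast
  qed
  have fin2: "finite (\<Union>i\<in>?S. {j. D j \<noteq> 0 \<and> A (k - i - j) \<noteq> 0})" for k using assms(1) fin by blast
  show "multipliable D (dmul F A)" unfolding multipliable_def using finite_subset[OF sub fin2] by blast
  show "dmul D (dmul F A) = dmul F (dmul D A)"
  proof
    fix k
    let ?J = "\<Union>i\<in>?S. {j. D j \<noteq> 0 \<and> A (k - i - j) \<noteq> 0}"
    have "dmul D (dmul F A) k = (\<Sum>j\<in>?J. D j *s dmul F A (k - j))"
      unfolding dmul_def[of D] by (rule Sum_any.expand_superset[OF fin2]) (use sub[of k] in force)
    also have "\<dots> = (\<Sum>j\<in>?J. \<Sum>i\<in>?S. F i *s D j *s A (k - i - j))"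
      by (simp add: dmul_sum[OF assms(1) order_refl] scale_sum_right mult.commute diff_diff_eq add.commute)
    also have "\<dots> = (\<Sum>i\<in>?S. \<Sum>j\<in>?J. F i *s D j *s A (k - i - j))" by (rule sum.swap)
    also have "\<dots> = (\<Sum>i\<in>?S. F i *s dmul D A (k - i))"
    proof (intro sum.cong refl)
      fix i assume i: "i \<in> ?S"
      have "dmul D A (k - i) = (\<Sum>j\<in>?J. D j *s A (k - i - j))"
        unfolding dmul_def[of D] by (rule Sum_any.expand_superset[OF fin2]) (use i in auto)
      then show "(\<Sum>j\<in>?J. F i *s D j *s A (k - i - j)) = F i *s dmul D A (k - i)"
        by (simp only: scale_sum_right)
    qed
    also have "\<dots> = dmul F (dmul D A) k" by (simp add: dmul_sum[OF assms(1) order_refl])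
    finally show "dmul D (dmul F A) k = dmul F (dmul D A) k" .
  qed
qed

text \<open>Transport of \<^const>\<open>dist_mult\<close> along a linear map.\<close>

lemma dist_mult_linear:
  assumes M: "Module.module complex_ring M"
    and add: "\<And>x y. x \<in> carrier M \<Longrightarrow> y \<in> carrier M \<Longrightarrow> L (x \<oplus>\<^bsub>M\<^esub> y) = L x + L y"
    and smult: "\<And>c x. x \<in> carrier M \<Longrightarrow> L (c \<odot>\<^bsub>M\<^esub> x) = c *s L x"
    and A: "\<And>j. A j \<in> carrier M"
    and fin: "finite {j. D j \<noteq> 0 \<and> A (k - j) \<noteq> \<zero>\<^bsub>M\<^esub>}"
  shows "dist_mult M D A k \<in> carrier M" "L (dist_mult M D A k) = dmul D (\<lambda>k. L (A k)) k"
proof -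
  interpret M: Module.module complex_ring M by (rule M)
  have C: "c \<in> carrier complex_ring" for c by (simp add: ring_of_type_algebra_def)
  have L0: "L \<zero>\<^bsub>M\<^esub> = 0"
    using add[of "\<zero>\<^bsub>M\<^esub>" "\<zero>\<^bsub>M\<^esub>"] by simp
  have cl: "D j \<odot>\<^bsub>M\<^esub> A (k - j) \<in> carrier M" for j by (intro M.smult_closed C A)
  have sum: "(\<Oplus>\<^bsub>M\<^esub>j\<in>S. D j \<odot>\<^bsub>M\<^esub> A (k - j)) \<in> carrier M \<and>
      L (\<Oplus>\<^bsub>M\<^esub>j\<in>S. D j \<odot>\<^bsub>M\<^esub> A (k - j)) = (\<Sum>j\<in>S. D j *s L (A (k - j)))" if "finite S" for S
    using that
  proof (induction S)
    case empty
    then show ?case by (simp add: L0)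
  next
    case (insert x S)
    then show ?case using cl by (simp add: M.finsum_insert M.finsum_closed add smult A)
  qed
  let ?S = "{j. D j \<noteq> 0 \<and> A (k - j) \<noteq> \<zero>\<^bsub>M\<^esub>}"
  show "dist_mult M D A k \<in> carrier M" using sum[OF fin] by (simp add: dist_mult_def)
  have "dmul D (\<lambda>k. L (A k)) k = (\<Sum>j\<in>?S. D j *s L (A (k - j)))"
    unfolding dmul_def by (rule Sum_any.expand_superset[OF fin]) (auto simp: L0)
  then show "L (dist_mult M D A k) = dmul D (\<lambda>k. L (A k)) k" using sum[OF fin] by (simp add: dist_mult_def)
qed

lemma Sum_any_inj:
  assumes "inj g" "\<And>x. f x \<noteq> 0 \<Longrightarrow> x \<in> range g"
  shows "Sum_any f = Sum_any (\<lambda>j. f (g j))"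
proof -
  have "{x. f x \<noteq> 0} = g ` {j. f (g j) \<noteq> 0}" using assms(2) by force
  then have "Sum_any f = sum f (g ` {j. f (g j) \<noteq> 0})" by (simp add: Sum_any.expand_set)
  also have "\<dots> = (\<Sum>j | f (g j) \<noteq> 0. f (g j))"
    using assms(1) by (simp add: sum.reindex inj_on_subset[OF _ subset_UNIV] comp_def)
  finally show ?thesis by (simp add: Sum_any.expand_set)
qed

abbreviation at0 :: "(int \<Rightarrow> int \<Rightarrow> 'b::zero) \<Rightarrow> 'b distribution" where
  "at0 A \<equiv> (\<lambda>(k0, k1, k2). if k0 = 0 then A k1 k2 else 0)"
abbreviation at1 :: "(int \<Rightarrow> int \<Rightarrow> 'b::zero) \<Rightarrow> 'b distribution" where
  "at1 A \<equiv> (\<lambda>(k0, k1, k2). if k1 = 0 then A k0 k2 else 0)"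

lemma sgn_of_nat: "0 \<le> j \<Longrightarrow> sgn_of j = (- 1) ^ nat j"
  by (auto simp: sgn_of_def minus_one_power_iff even_nat_iff)

lemma sgn_of_powi: "sgn_of j = (- 1) powi j"
  by (auto simp: sgn_of_def power_int_minus_one_minus power_int_minus_left)

lemma diff_pow_bin: "diff_pow n (n - j) j = bin (j - n - 1) j"
proof (cases "0 \<le> j")
  case True
  have "bin (j - n - 1) j = sgn_of j * bin n j" using bin_negate[of "j - n - 1" j] by simp
  then show ?thesis using True by (simp add: diff_pow_def bin_def sgn_of_nat)
qed (simp add: diff_pow_def)

lemma diff_pow_eq_0: "i + j \<noteq> n \<Longrightarrow> diff_pow n i j = 0"
  by (simp add: diff_pow_def)

lemma dmul_delta_12: "dmul delta_12 (at0 A) (k0, k1, k2) = d12 A k0 k1 k2"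
proof -
  define g where "g j = (k0, - k0 - 1 - j, j)" for j :: int
  have "dmul delta_12 (at0 A) (k0, k1, k2) = Sum_any (\<lambda>j. delta_12 (g j) *s at0 A ((k0, k1, k2) - g j))"
    unfolding dmul_def
  proof (rule Sum_any_inj)
    show "inj g" by (auto simp: inj_def g_def)
    fix x assume x: "delta_12 x *s at0 A ((k0, k1, k2) - x) \<noteq> 0"
    obtain x0 x1 x2 where x': "x = (x0, x1, x2)" by (cases x)
    have "x0 = k0" "x1 + x2 = - x0 - 1" using x diff_pow_eq_0[of x1 x2 "- x0 - 1"]
      by (auto simp: x' delta_12_def split: if_splits)
    then show "x \<in> range g" by (auto simp: x' g_def image_iff intro!: exI[of _ x2])
  qed
  also have "\<dots> = Sum_any (\<lambda>j. bin (k0 + j) j *s A (k1 + k0 + 1 + j) (k2 - j))"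
  proof (rule Sum_any.cong)
    fix j
    have "k1 - (- k0 - 1 - j) = k1 + k0 + 1 + j" "j - (- k0 - 1) - 1 = k0 + j" by simp_all
    then show "delta_12 (g j) *s at0 A ((k0, k1, k2) - g j) = bin (k0 + j) j *s A (k1 + k0 + 1 + j) (k2 - j)"
      by (simp only: g_def delta_12_def prod.case diff_Pair diff_self refl if_True diff_pow_bin)
  qed
  finally show ?thesis by (simp add: d12_def bsum_def)
qed

lemma dmul_delta_21: "dmul delta_21 (at0 A) (k0, k1, k2) = d21 A k0 k1 k2"
proof -
  define g where "g j = (k0, j, - k0 - 1 - j)" for j :: int
  have "dmul delta_21 (at0 A) (k0, k1, k2) = Sum_any (\<lambda>j. delta_21 (g j) *s at0 A ((k0, k1, k2) - g j))"
    unfolding dmul_def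
  proof (rule Sum_any_inj)
    show "inj g" by (auto simp: inj_def g_def)
    fix x assume x: "delta_21 x *s at0 A ((k0, k1, k2) - x) \<noteq> 0"
    obtain x0 x1 x2 where x': "x = (x0, x1, x2)" by (cases x)
    have "x0 = k0" "x2 + x1 = - x0 - 1" using x diff_pow_eq_0[of x2 x1 "- x0 - 1"]
      by (auto simp: x' delta_21_def split: if_splits)
    then show "x \<in> range g" by (auto simp: x' g_def image_iff intro!: exI[of _ x1])
  qed
  also have "\<dots> = Sum_any (\<lambda>j. sgn_of (k0 + 1) *s bin (k0 + j) j *s A (k1 - j) (k2 + k0 + 1 + j))"
  proof (rule Sum_any.cong)
    fix j
    have "k2 - (- k0 - 1 - j) = k2 + k0 + 1 + j" "j - (- k0 - 1) - 1 = k0 + j" by simp_all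
    moreover have "(- 1) powi (- k0 - 1) = sgn_of (k0 + 1)" unfolding sgn_of_powi[symmetric] by (simp add: sgn_of_def)
    ultimately show "delta_21 (g j) *s at0 A ((k0, k1, k2) - g j) = sgn_of (k0 + 1) *s bin (k0 + j) j *s A (k1 - j) (k2 + k0 + 1 + j)"
      by (simp only: g_def delta_21_def prod.case diff_Pair diff_self refl if_True diff_pow_bin scale_scale)
  qed
  finally show ?thesis unfolding d21_def bsum_def scale_Sum_any .
qed

lemma dmul_delta_10: "dmul delta_10 (at1 A) (k0, k1, k2) = d10 A k0 k1 k2"
proof -
  define g where "g j = (j, k1, - 1 - j - k1)" for j :: int
  have "dmul delta_10 (at1 A) (k0, k1, k2) = Sum_any (\<lambda>j. delta_10 (g j) *s at1 A ((k0, k1, k2) - g j))"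
    unfolding dmul_def
  proof (rule Sum_any_inj)
    show "inj g" by (auto simp: inj_def g_def)
    fix x assume x: "delta_10 x *s at1 A ((k0, k1, k2) - x) \<noteq> 0"
    obtain x0 x1 x2 where x': "x = (x0, x1, x2)" by (cases x)
    have "x1 = k1" "x1 + x0 = - x2 - 1" using x diff_pow_eq_0[of x1 x0 "- x2 - 1"]
      by (auto simp: x' delta_10_def split: if_splits)
    then show "x \<in> range g" by (auto simp: x' g_def image_iff intro!: exI[of _ x0])
  qed
  also have "\<dots> = Sum_any (\<lambda>j. bin (- k1 - 1) j *s A (k0 - j) (k2 + 1 + j + k1))"
  proof (rule Sum_any.cong)
    fix j
    have e: "k2 - (- 1 - j - k1) = k2 + 1 + j + k1" "j - (k1 + j) - 1 = - k1 - 1" "- (- 1 - j - k1) - 1 = k1 + j" by simp_all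
    have "diff_pow (k1 + j) k1 j = bin (j - (k1 + j) - 1) j" using diff_pow_bin[of "k1 + j" j] by simp
    then show "delta_10 (g j) *s at1 A ((k0, k1, k2) - g j) = bin (- k1 - 1) j *s A (k0 - j) (k2 + 1 + j + k1)"
      by (simp only: g_def delta_10_def prod.case diff_Pair diff_self refl if_True e)
  qed
  finally show ?thesis by (simp add: d10_def bsum_def)
qed

lemma multipliable_12:
  assumes "\<And>k l. l < N \<Longrightarrow> A k l = 0"
  shows "multipliable delta_12 (at0 A)"
  unfolding multipliable_def
proof (intro allI, clarify)
  fix k0 k1 k2 :: int
  have "{j. delta_12 j \<noteq> 0 \<and> at0 A ((k0, k1, k2) - j) \<noteq> 0} \<subseteq> (\<lambda>j. (k0, - k0 - 1 - j, j)) ` {0..k2 - N}"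
  proof clarify
    fix j0 j1 j2 assume "delta_12 (j0, j1, j2) \<noteq> 0" "at0 A ((k0, k1, k2) - (j0, j1, j2)) \<noteq> 0"
    moreover from this(2) have "\<not> k2 - j2 < N" using assms by (auto split: if_splits)
    ultimately have "j0 = k0" "0 \<le> j2" "j1 = - k0 - 1 - j2" "j2 \<le> k2 - N"
      by (auto simp: delta_12_def diff_pow_def split: if_splits)
    then show "(j0, j1, j2) \<in> (\<lambda>j. (k0, - k0 - 1 - j, j)) ` {0..k2 - N}" by auto
  qed
  then show "finite {j. delta_12 j \<noteq> 0 \<and> at0 A ((k0, k1, k2) - j) \<noteq> 0}" by (rule finite_subset) simp
qed

lemma multipliable_21:
  assumes "\<And>k l. k < N \<Longrightarrow> A k l = 0"
  shows "multipliable delta_21 (at0 A)"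
  unfolding multipliable_def
proof (intro allI, clarify)
  fix k0 k1 k2 :: int
  have "{j. delta_21 j \<noteq> 0 \<and> at0 A ((k0, k1, k2) - j) \<noteq> 0} \<subseteq> (\<lambda>j. (k0, j, - k0 - 1 - j)) ` {0..k1 - N}"
  proof clarify
    fix j0 j1 j2 assume "delta_21 (j0, j1, j2) \<noteq> 0" "at0 A ((k0, k1, k2) - (j0, j1, j2)) \<noteq> 0"
    moreover from this(2) have "\<not> k1 - j1 < N" using assms by (auto split: if_splits)
    ultimately have "j0 = k0" "0 \<le> j1" "j2 = - k0 - 1 - j1" "j1 \<le> k1 - N"
      by (auto simp: delta_21_def diff_pow_def split: if_splits)
    then show "(j0, j1, j2) \<in> (\<lambda>j. (k0, j, - k0 - 1 - j)) ` {0..k1 - N}" by auto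
  qed
  then show "finite {j. delta_21 j \<noteq> 0 \<and> at0 A ((k0, k1, k2) - j) \<noteq> 0}" by (rule finite_subset) simp
qed

lemma multipliable_10:
  assumes "\<And>k l. k < N \<Longrightarrow> A k l = 0"
  shows "multipliable delta_10 (at1 A)"
  unfolding multipliable_def
proof (intro allI, clarify)
  fix k0 k1 k2 :: int
  have "{j. delta_10 j \<noteq> 0 \<and> at1 A ((k0, k1, k2) - j) \<noteq> 0} \<subseteq> (\<lambda>j. (j, k1, - 1 - j - k1)) ` {0..k0 - N}"
  proof clarify
    fix j0 j1 j2 assume "delta_10 (j0, j1, j2) \<noteq> 0" "at1 A ((k0, k1, k2) - (j0, j1, j2)) \<noteq> 0"
    moreover from this(2) have "\<not> k0 - j0 < N" using assms by (auto split: if_splits)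
    ultimately have "j1 = k1" "0 \<le> j0" "j2 = - 1 - j0 - k1" "j0 \<le> k0 - N"
      by (auto simp: delta_10_def diff_pow_def split: if_splits)
    then show "(j0, j1, j2) \<in> (\<lambda>j. (j, k1, - 1 - j - k1)) ` {0..k0 - N}" by auto
  qed
  then show "finite {j. delta_10 j \<noteq> 0 \<and> at1 A ((k0, k1, k2) - j) \<noteq> 0}" by (rule finite_subset) simp
qed

lemma poly_dist_finite: "finite {j. poly_dist f j \<noteq> 0}"
proof -
  let ?S = "\<Union>i\<in>{..degree f}. (\<lambda>j. (0::int, int i, int j)) ` {..degree (Polynomial.coeff f i)}"
  have "{j. poly_dist f j \<noteq> 0} \<subseteq> ?S"
  proof clarify
    fix j0 j1 j2 assume "poly_dist f (j0, j1, j2) \<noteq> 0"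
    then have 0: "j0 = 0" "0 \<le> j1" "0 \<le> j2" and c: "Polynomial.coeff (Polynomial.coeff f (nat j1)) (nat j2) \<noteq> 0"
      by (auto simp: poly_dist_def split: if_splits)
    from c have "nat j2 \<le> degree (Polynomial.coeff f (nat j1))" by (rule le_degree)
    moreover from c have "Polynomial.coeff f (nat j1) \<noteq> 0" by auto
    then have "nat j1 \<le> degree f" by (rule le_degree)
    ultimately have "(0, int (nat j1), int (nat j2)) \<in> ?S" by blast
    then show "(j0, j1, j2) \<in> ?S" using 0 by simp
  qed
  then show ?thesis by (rule finite_subset) auto
qed

section \<open>The Jacobi identity in components\<close>

lemma module_of_type_simps [simp]:
  "carrier (module_of_type scale) = UNIV" "\<zero>\<^bsub>module_of_type scale\<^esub> = 0"
  "x \<oplus>\<^bsub>module_of_type scale\<^esub> y = x + y" "c \<odot>\<^bsub>module_of_type scale\<^esub> x = c *s x"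
  by (simp_all add: module_of_type_def)

lemma cring_complex: "cring complex_ring"
  by (rule cring_from_type_algebra)

lemma module_of_type_module: "Module.module complex_ring (module_of_type scale)"
proof (rule Module.moduleI[OF cring_complex])
  show "abelian_group (module_of_type scale)"
  proof (rule abelian_groupI)
    fix x assume "x \<in> carrier (module_of_type scale)"
    show "\<exists>y\<in>carrier (module_of_type scale). y \<oplus>\<^bsub>module_of_type scale\<^esub> x = \<zero>\<^bsub>module_of_type scale\<^esub>"
      by (rule bexI[of _ "- x"]) auto
  qed (auto simp: add.assoc add.commute)
qed (auto simp: ring_of_type_algebra_def scale_left_distrib scale_right_distrib)

lemma module_of_type_minus: "x \<ominus>\<^bsub>module_of_type scale\<^esub> y = x - y"
proof -
  interpret W: Module.module complex_ring "module_of_type scale" by (rule module_of_type_module)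
  have "\<ominus>\<^bsub>module_of_type scale\<^esub> y = - y"
    by (rule W.minus_equality) auto
  then show ?thesis by (simp add: a_minus_def)
qed

lemma quasi_jacobi_iff:
  assumes A: "\<And>k l. l < N1 \<Longrightarrow> YW u k (YW v l w) = 0"
    and B: "\<And>k l. k < N2 \<Longrightarrow> YW v l (YW u k w) = 0"
    and C: "\<And>k l. k < N3 \<Longrightarrow> YW (Y u k v) l w = 0"
  shows "quasi_jacobi Y (module_of_type scale) YW f u v w \<longleftrightarrow>
    (\<forall>k. dmul (poly_dist f) (\<lambda>(k0, k1, k2).
       defect (\<lambda>k l. YW u k (YW v l w)) (\<lambda>k l. YW v l (YW u k w)) (\<lambda>k l. YW (Y u k v) l w) k0 k1 k2) k = 0)"
proof -
  define A' where "A' = at0 (\<lambda>k l. YW u k (YW v l w))"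
  define B' where "B' = at0 (\<lambda>k l. YW v l (YW u k w))"
  define C' where "C' = at1 (\<lambda>k l. YW (Y u k v) l w)"
  have mA: "multipliable delta_12 A'" unfolding A'_def by (rule multipliable_12[of N1]) (rule A)
  have mB: "multipliable delta_21 B'" unfolding B'_def by (rule multipliable_21[of N2]) (rule B)
  have mC: "multipliable delta_10 C'" unfolding C'_def by (rule multipliable_10[of N3]) (rule C)
  have dm: "dist_mult (module_of_type scale) D E k = dmul D E k" if "multipliable D E" for D E k
    by (rule dist_mult_linear(2)[OF module_of_type_module, where L = "\<lambda>x. x"]) (use that in \<open>auto simp only: multipliable_def module_of_type_simps UNIV_I\<close>)
  have dmf: "dist_mult (module_of_type scale) (poly_dist f) E = dmul (poly_dist f) E" for E
    by (rule ext) (rule dm[OF finite_multipliable[OF poly_dist_finite]])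
  have dm2: "dist_mult (module_of_type scale) D (dist_mult (module_of_type scale) (poly_dist f) E) k
      = dmul (poly_dist f) (dmul D E) k" if "multipliable D E" for D E k
    unfolding dmf dm[OF dmul_commute(1)[OF poly_dist_finite that]] dmul_commute(2)[OF poly_dist_finite that] ..
  have "quasi_jacobi Y (module_of_type scale) YW f u v w \<longleftrightarrow>
     (\<forall>k. dmul (poly_dist f) (dmul delta_12 A') k - dmul (poly_dist f) (dmul delta_21 B') k
        = dmul (poly_dist f) (dmul delta_10 C') k)"
    unfolding quasi_jacobi_def Let_def module_of_type_simps module_of_type_minus
      A'_def[symmetric] B'_def[symmetric] C'_def[symmetric] dm2[OF mA] dm2[OF mB] dm2[OF mC] ..
  also have "\<dots> \<longleftrightarrow> (\<forall>k. dmul (poly_dist f) (\<lambda>k. dmul delta_12 A' k - dmul delta_21 B' k - dmul delta_10 C' k) k = 0)"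
    unfolding dmul_diff[OF poly_dist_finite] by simp
  also have "(\<lambda>k. dmul delta_12 A' k - dmul delta_21 B' k - dmul delta_10 C' k) = (\<lambda>(k0, k1, k2).
       defect (\<lambda>k l. YW u k (YW v l w)) (\<lambda>k l. YW v l (YW u k w)) (\<lambda>k l. YW (Y u k v) l w) k0 k1 k2)"
    by (simp add: fun_eq_iff A'_def B'_def C'_def dmul_delta_12 dmul_delta_21 dmul_delta_10 defect_def)
  finally show ?thesis .
qed

text \<open>
  The carrier of a vertex algebra is a set, not a type; its Jacobi identity is used only through its images
  under linear maps into a type.
\<close>

lemma vertex_algebra_jacobi:
  assumes V: "vertex_algebra V Y vac"
    and add: "\<And>x y. x \<in> carrier V \<Longrightarrow> y \<in> carrier V \<Longrightarrow> L (x \<oplus>\<^bsub>V\<^esub> y) = L x + L y"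
    and smult: "\<And>c x. x \<in> carrier V \<Longrightarrow> L (c \<odot>\<^bsub>V\<^esub> x) = c *s L x"
    and mem: "u \<in> carrier V" "v \<in> carrier V" "w \<in> carrier V"
  shows "defect (\<lambda>k l. L (Y u k (Y v l w))) (\<lambda>k l. L (Y v l (Y u k w))) (\<lambda>k l. L (Y (Y u k v) l w)) = 0"
proof -
  have M: "Module.module complex_ring V" and vm: "vertex_map V V Y"
    and jac: "quasi_jacobi Y V Y 1 u v w" using V mem by (auto simp: vertex_algebra_def)
  interpret V: Module.module complex_ring V by (rule M)
  have cl: "Y a k b \<in> carrier V" if "a \<in> carrier V" "b \<in> carrier V" for a k b
    using vm that by (auto simp: vertex_map_def)
  have low: "\<exists>N. \<forall>k<N. Y a k b = \<zero>\<^bsub>V\<^esub>" if "a \<in> carrier V" "b \<in> carrier V" for a b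
    using vm that by (auto simp: vertex_map_def)
  have C: "c \<in> carrier complex_ring" for c by (simp add: ring_of_type_algebra_def)
  have Yz: "Y a k \<zero>\<^bsub>V\<^esub> = \<zero>\<^bsub>V\<^esub>" if a: "a \<in> carrier V" for a k
  proof -
    have "Y a k (\<zero>\<^bsub>V\<^esub> \<oplus>\<^bsub>V\<^esub> \<zero>\<^bsub>V\<^esub>) = Y a k \<zero>\<^bsub>V\<^esub> \<oplus>\<^bsub>V\<^esub> Y a k \<zero>\<^bsub>V\<^esub>" using vm a unfolding vertex_map_def by blast
    then show ?thesis using cl[OF a V.zero_closed, of k] by (simp add: V.add.l_cancel_one)
  qed
  have zY: "Y \<zero>\<^bsub>V\<^esub> k b = \<zero>\<^bsub>V\<^esub>" if b: "b \<in> carrier V" for b k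
  proof -
    have "Y (\<zero>\<^bsub>V\<^esub> \<oplus>\<^bsub>V\<^esub> \<zero>\<^bsub>V\<^esub>) k b = Y \<zero>\<^bsub>V\<^esub> k b \<oplus>\<^bsub>V\<^esub> Y \<zero>\<^bsub>V\<^esub> k b" using vm b unfolding vertex_map_def by blast
    then show ?thesis using cl[OF V.zero_closed b, of k] by (simp add: V.add.l_cancel_one)
  qed
  have L0: "L \<zero>\<^bsub>V\<^esub> = 0" using add[of "\<zero>\<^bsub>V\<^esub>" "\<zero>\<^bsub>V\<^esub>"] by simp
  have Lm: "L (x \<ominus>\<^bsub>V\<^esub> y) = L x - L y" if "x \<in> carrier V" "y \<in> carrier V" for x y
  proof -
    have "x = (x \<ominus>\<^bsub>V\<^esub> y) \<oplus>\<^bsub>V\<^esub> y" using that by (simp add: a_minus_def V.a_assoc V.l_neg)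
    then have "L x = L (x \<ominus>\<^bsub>V\<^esub> y) + L y" using add[of "x \<ominus>\<^bsub>V\<^esub> y" y] that by simp
    then show ?thesis by simp
  qed
  define A where "A = (\<lambda>(k0, k1, k2). if k0 = (0::int) then Y u k1 (Y v k2 w) else \<zero>\<^bsub>V\<^esub>)"
  define B where "B = (\<lambda>(k0, k1, k2). if k0 = (0::int) then Y v k2 (Y u k1 w) else \<zero>\<^bsub>V\<^esub>)"
  define D where "D = (\<lambda>(k0, k1, k2). if k1 = (0::int) then Y (Y u k0 v) k2 w else \<zero>\<^bsub>V\<^esub>)"
  obtain N1 where N1: "\<And>k. k < N1 \<Longrightarrow> Y v k w = \<zero>\<^bsub>V\<^esub>" using low mem by metis
  obtain N2 where N2: "\<And>k. k < N2 \<Longrightarrow> Y u k w = \<zero>\<^bsub>V\<^esub>" using low mem by metis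
  obtain N3 where N3: "\<And>k. k < N3 \<Longrightarrow> Y u k v = \<zero>\<^bsub>V\<^esub>" using low mem by metis
  have ABD: "A j \<in> carrier V" "B j \<in> carrier V" "D j \<in> carrier V" for j
    by (cases j; auto simp: A_def B_def D_def cl mem)+
  have one: "poly_dist 1 j = (if j = 0 then 1 else 0)" for j
    by (cases j) (auto simp: poly_dist_def zero_prod_def coeff_1 nat_eq_iff)
  have pd1: "dist_mult V (poly_dist 1) E = E" if E: "\<And>j. E j \<in> carrier V" for E
  proof
    fix k
    have 1: "1 \<odot>\<^bsub>V\<^esub> E k = E k" using V.smult_one[OF E[of k]] by (simp add: ring_of_type_algebra_def)
    show "dist_mult V (poly_dist 1) E k = E k"
    proof (cases "E k = \<zero>\<^bsub>V\<^esub>")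
      case True
      then have e: "{j. poly_dist 1 j \<noteq> 0 \<and> E (k - j) \<noteq> \<zero>\<^bsub>V\<^esub>} = {}" by (auto simp: one)
      show ?thesis unfolding dist_mult_def e using True by simp
    next
      case False
      then have "{j. poly_dist 1 j \<noteq> 0 \<and> E (k - j) \<noteq> \<zero>\<^bsub>V\<^esub>} = {0}" by (auto simp: one)
      then show ?thesis using E 1 by (simp add: dist_mult_def one V.finsum_insert)
    qed
  qed
  have finA: "finite {j. delta_12 j \<noteq> 0 \<and> A (k - j) \<noteq> \<zero>\<^bsub>V\<^esub>}" for k
  proof -
    have "multipliable delta_12 (at0 (\<lambda>k l. of_bool (Y u k (Y v l w) \<noteq> \<zero>\<^bsub>V\<^esub>) :: complex))"
      by (rule multipliable_12[of N1]) (simp add: N1 Yz mem)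
    then have "finite {j. delta_12 j \<noteq> 0 \<and> at0 (\<lambda>k l. of_bool (Y u k (Y v l w) \<noteq> \<zero>\<^bsub>V\<^esub>) :: complex) (k - j) \<noteq> 0}"
      unfolding multipliable_def by (rule spec)
    then show ?thesis by (rule rev_finite_subset) (auto simp: A_def split: prod.splits if_splits)
  qed
  have finB: "finite {j. delta_21 j \<noteq> 0 \<and> B (k - j) \<noteq> \<zero>\<^bsub>V\<^esub>}" for k
  proof -
    have "multipliable delta_21 (at0 (\<lambda>k l. of_bool (Y v l (Y u k w) \<noteq> \<zero>\<^bsub>V\<^esub>) :: complex))"
      by (rule multipliable_21[of N2]) (simp add: N2 Yz mem)
    then have "finite {j. delta_21 j \<noteq> 0 \<and> at0 (\<lambda>k l. of_bool (Y v l (Y u k w) \<noteq> \<zero>\<^bsub>V\<^esub>) :: complex) (k - j) \<noteq> 0}"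
      unfolding multipliable_def by (rule spec)
    then show ?thesis by (rule rev_finite_subset) (auto simp: B_def split: prod.splits if_splits)
  qed
  have finD: "finite {j. delta_10 j \<noteq> 0 \<and> D (k - j) \<noteq> \<zero>\<^bsub>V\<^esub>}" for k
  proof -
    have "multipliable delta_10 (at1 (\<lambda>k l. of_bool (Y (Y u k v) l w \<noteq> \<zero>\<^bsub>V\<^esub>) :: complex))"
      by (rule multipliable_10[of N3]) (simp add: N3 zY mem)
    then have "finite {j. delta_10 j \<noteq> 0 \<and> at1 (\<lambda>k l. of_bool (Y (Y u k v) l w \<noteq> \<zero>\<^bsub>V\<^esub>) :: complex) (k - j) \<noteq> 0}"
      unfolding multipliable_def by (rule spec)
    then show ?thesis by (rule rev_finite_subset) (auto simp: D_def split: prod.splits if_splits)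
  qed
  have lA: "dist_mult V delta_12 A k \<in> carrier V" "L (dist_mult V delta_12 A k) = dmul delta_12 (\<lambda>k. L (A k)) k" for k
    by (rule dist_mult_linear[where L = L, OF M _ _ ABD(1) finA]; simp add: add smult)+
  have lB: "dist_mult V delta_21 B k \<in> carrier V" "L (dist_mult V delta_21 B k) = dmul delta_21 (\<lambda>k. L (B k)) k" for k
    by (rule dist_mult_linear[where L = L, OF M _ _ ABD(2) finB]; simp add: add smult)+
  have lD: "L (dist_mult V delta_10 D k) = dmul delta_10 (\<lambda>k. L (D k)) k" for k
    by (rule dist_mult_linear[where L = L, OF M _ _ ABD(3) finD]; simp add: add smult)
  have "dist_mult V delta_12 A k \<ominus>\<^bsub>V\<^esub> dist_mult V delta_21 B k = dist_mult V delta_10 D k" for k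
    using jac unfolding quasi_jacobi_def Let_def A_def[symmetric] B_def[symmetric] D_def[symmetric]
      pd1[OF ABD(1)] pd1[OF ABD(2)] pd1[OF ABD(3)] by blast
  then have eq: "dmul delta_12 (\<lambda>k. L (A k)) k - dmul delta_21 (\<lambda>k. L (B k)) k = dmul delta_10 (\<lambda>k. L (D k)) k" for k
    unfolding lA(2)[symmetric] lB(2)[symmetric] lD[symmetric] Lm[OF lA(1) lB(1), symmetric] by simp
  have LA: "(\<lambda>k. L (A k)) = at0 (\<lambda>k l. L (Y u k (Y v l w)))" by (auto simp: fun_eq_iff A_def L0)
  have LB: "(\<lambda>k. L (B k)) = at0 (\<lambda>k l. L (Y v l (Y u k w)))" by (auto simp: fun_eq_iff B_def L0)
  have LD: "(\<lambda>k. L (D k)) = at1 (\<lambda>k l. L (Y (Y u k v) l w))" by (auto simp: fun_eq_iff D_def L0)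
  show ?thesis
  proof (intro ext)
    fix k0 k1 k2
    show "defect (\<lambda>k l. L (Y u k (Y v l w))) (\<lambda>k l. L (Y v l (Y u k w))) (\<lambda>k l. L (Y (Y u k v) l w)) k0 k1 k2 = 0 k0 k1 k2"
      using eq[of "(k0, k1, k2)"] unfolding LA LB LD dmul_delta_12 dmul_delta_21 dmul_delta_10 by (simp add: defect_def)
  qed
qed

section \<open>Polynomials acting on distributions\<close>

text \<open>
  The form \<open>a x\<^sub>1 + b x\<^sub>2\<close> as a polynomial in \<open>x\<^sub>1\<close> over the polynomials in \<open>x\<^sub>2\<close>.
\<close>

definition form_poly :: "complex \<times> complex \<Rightarrow> complex poly poly" where
  "form_poly f = [:[:0, snd f:], [:fst f:]:]"

definition forms_poly :: "(complex \<times> complex) list \<Rightarrow> complex poly poly" where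
  "forms_poly fs = prod_list (map form_poly fs)"

lemma forms_poly_nonzero: "nonzero_forms fs \<Longrightarrow> forms_poly fs \<noteq> 0"
  unfolding forms_poly_def prod_list_zero_iff by (force simp: nonzero_forms_def form_poly_def)

lemma poly_dist_add: "poly_dist (f + g) k = poly_dist f k + poly_dist g k"
  by (cases k) (simp add: poly_dist_def)

lemma poly_dist_pCons_0: "poly_dist (pCons 0 f) k = poly_dist f (k - (0, 1, 0))"
proof (cases k)
  case (fields k0 k1 k2)
  show ?thesis
  proof (cases "1 \<le> k1")
    case True
    then obtain n where "nat k1 = Suc n" "nat (k1 - 1) = n" by (metis Suc_nat_eq_nat_zadd1 diff_add_cancel add.commute diff_ge_0_iff_ge)
    then show ?thesis using True by (simp add: fields poly_dist_def)
  next
    case False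
    then show ?thesis by (cases "k1 = 0") (simp_all add: fields poly_dist_def)
  qed
qed

lemma poly_dist_smult_x: "poly_dist (Polynomial.smult [:0, 1:] f) k = poly_dist f (k - (0, 0, 1))"
proof (cases k)
  case (fields k0 k1 k2)
  show ?thesis
  proof (cases "1 \<le> k2")
    case True
    then obtain n where "nat k2 = Suc n" "nat (k2 - 1) = n" by (metis Suc_nat_eq_nat_zadd1 diff_add_cancel add.commute diff_ge_0_iff_ge)
    then show ?thesis using True by (simp add: fields poly_dist_def)
  next
    case False
    then show ?thesis by (cases "k2 = 0") (simp_all add: fields poly_dist_def)
  qed
qed

lemma poly_dist_smult_const: "poly_dist (Polynomial.smult [:c:] f) k = c * poly_dist f k"
  by (cases k) (simp add: poly_dist_def)

lemma poly_dist_form: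
  "poly_dist (form_poly (a, b) * f) k = a * poly_dist f (k - (0, 1, 0)) + b * poly_dist f (k - (0, 0, 1))"
proof -
  have "form_poly (a, b) * f = pCons 0 (Polynomial.smult [:a:] f) + Polynomial.smult [:b:] (Polynomial.smult [:0, 1:] f)"
    by (simp add: form_poly_def add.commute)
  then show ?thesis
    by (simp only: poly_dist_add poly_dist_pCons_0 poly_dist_smult_const poly_dist_smult_x)
qed

lemma dmul_add_left:
  assumes "finite {j. D j \<noteq> 0}" "finite {j. E j \<noteq> 0}"
  shows "dmul (\<lambda>j. D j + E j) A k = dmul D A k + dmul E A k"
proof -
  let ?S = "{j. D j \<noteq> 0} \<union> {j. E j \<noteq> 0}"
  have S: "finite ?S" using assms by simp
  have "{j. D j + E j \<noteq> 0} \<subseteq> ?S" by auto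
  then show ?thesis
    by (simp add: dmul_sum[OF S] scale_left_distrib sum.distrib)
qed

lemma dmul_scale_left: "dmul (\<lambda>j. c * D j) A k = c *s dmul D A k"
  by (simp add: dmul_def scale_Sum_any)

lemma dmul_shift: "dmul (\<lambda>j. D (j - e)) A k = dmul D (\<lambda>k. A (k - e)) k"
proof -
  have "dmul (\<lambda>j. D (j - e)) A k = Sum_any (\<lambda>j. D (j + e - e) *s A (k - (j + e)))"
    unfolding dmul_def
  proof (rule Sum_any_inj)
    show "inj (\<lambda>j. j + e)" by simp
    fix x show "x \<in> range (\<lambda>j. j + e)" by (rule range_eqI[of _ _ "x - e"]) simp
  qed
  then show ?thesis by (simp add: dmul_def diff_diff_eq)
qed

lemma shift_finite_dist:
  fixes D :: "complex distribution"
  assumes "finite {j. D j \<noteq> 0}" shows "finite {j. c * D (j - e) \<noteq> (0::complex)}"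
proof -
  have "{j. c * D (j - e) \<noteq> 0} \<subseteq> (\<lambda>j. j + e) ` {j. D j \<noteq> 0}"
  proof
    fix j assume "j \<in> {j. c * D (j - e) \<noteq> 0}"
    then show "j \<in> (\<lambda>j. j + e) ` {j. D j \<noteq> 0}" by (intro image_eqI[of _ _ "j - e"]) auto
  qed
  then show ?thesis using assms finite_subset by blast
qed

lemma dmul_add: assumes "finite {j. D j \<noteq> 0}"
  shows "dmul D (\<lambda>k. A k + B k) k = dmul D A k + dmul D B k"
  by (simp add: dmul_sum[OF assms order_refl] scale_right_distrib sum.distrib)

lemma dmul_scale: "dmul D (\<lambda>k. c *s A k) k = c *s dmul D A k"
  by (simp add: dmul_def scale_Sum_any mult.commute)

lemma dmul_form:
  "dmul (poly_dist (form_poly (a, b) * f)) A k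
   = dmul (poly_dist f) (\<lambda>k. a *s A (k - (0, 1, 0)) + b *s A (k - (0, 0, 1))) k"
proof -
  have "poly_dist (form_poly (a, b) * f) = (\<lambda>j. a * poly_dist f (j - (0, 1, 0)) + b * poly_dist f (j - (0, 0, 1)))"
    by (simp add: fun_eq_iff poly_dist_form)
  then show ?thesis
    by (simp only: dmul_add_left[OF shift_finite_dist[OF poly_dist_finite] shift_finite_dist[OF poly_dist_finite]]
        dmul_scale_left dmul_shift dmul_add[OF poly_dist_finite] dmul_scale)
qed

abbreviation dist3 :: "(int \<Rightarrow> int \<Rightarrow> int \<Rightarrow> 'w) \<Rightarrow> 'w distribution" where
  "dist3 J \<equiv> (\<lambda>(k0, k1, k2). J k0 k1 k2)"

lemma dmul_form_dist3:
  "dmul (poly_dist (form_poly g * f)) (dist3 J) = dmul (poly_dist f) (dist3 (\<lambda>k0. lin2 g (J k0)))"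
proof (rule ext)
  fix k
  obtain a b where g: "g = (a, b)" by (cases g)
  have "(\<lambda>k. a *s dist3 J (k - (0, 1, 0)) + b *s dist3 J (k - (0, 0, 1))) = dist3 (\<lambda>k0. lin2 g (J k0))"
    by (simp add: fun_eq_iff g lin2.simps)
  then show "dmul (poly_dist (form_poly g * f)) (dist3 J) k = dmul (poly_dist f) (dist3 (\<lambda>k0. lin2 g (J k0))) k"
    unfolding g dmul_form by simp
qed

lemma dmul_forms_dist3:
  "dmul (poly_dist (forms_poly fs * f)) (dist3 J) = dmul (poly_dist f) (dist3 (\<lambda>k0. lins2 fs (J k0)))"
proof (induction fs arbitrary: J)
  case Nil
  then show ?case by (simp add: forms_poly_def)
next
  case (Cons g fs)
  have "forms_poly (g # fs) * f = form_poly g * (forms_poly fs * f)" by (simp add: forms_poly_def mult.assoc)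
  then have "dmul (poly_dist (forms_poly (g # fs) * f)) (dist3 J) = dmul (poly_dist f) (dist3 (\<lambda>k0. lins2 fs (lin2 g (J k0))))"
    by (simp only: dmul_form_dist3 Cons.IH)
  then show ?case by (simp only: foldr.simps comp_apply lin2_lins2)
qed

lemma dmul_1: "dmul (poly_dist 1) A = A"
proof (rule ext)
  fix k
  have one: "poly_dist 1 j = (if j = 0 then 1 else 0)" for j
    by (cases j) (auto simp: poly_dist_def zero_prod_def coeff_1 nat_eq_iff)
  have "dmul (poly_dist 1) A k = (\<Sum>j\<in>{0}. poly_dist 1 j *s A (k - j))"
    by (rule dmul_sum) (auto simp: one)
  then show "dmul (poly_dist 1) A k = A k" by (simp add: one)
qed

lemma defect_lins2:
  assumes "bounded2 A" "bounded1 B" "bounded1 C"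
  shows "defect (lins2 fs A) (lins2 fs B) (lins2 (map subst2 fs) C) k0 = lins2 fs (defect A B C k0)"
proof (induction fs)
  case (Cons f fs)
  show ?case
    unfolding list.map foldr.simps comp_apply
      defect_lin2[OF bounded2_lins2[OF assms(1)] bounded1_lins2[OF assms(2)] bounded1_lins2[OF assms(3)]] Cons.IH ..
qed (simp only: list.map foldr.simps id_apply)

text \<open>
  If the third term is the product of the two fields, the forms which make them commute turn the quasi
  Jacobi identity into the three-term identity of the delta functions.
\<close>

theorem quasi_jacobi_prod:
  assumes fields: "is_field (YW u)" "is_field (YW v)" and C: "is_prod (YW u) (YW v) (\<lambda>i. YW (Y u i v))"
  shows "\<exists>f. f \<noteq> 0 \<and> (\<forall>w. quasi_jacobi Y (module_of_type scale) YW f u v w)"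
proof -
  obtain fs N where fs: "prod_via fs N (YW u) (YW v) (\<lambda>i. YW (Y u i v))" using C by (auto simp: is_prod_def)
  then have ql: "quasi_local fs (YW u) (YW v)" by (simp add: prod_via_def)
  have "quasi_jacobi Y (module_of_type scale) YW (forms_poly fs) u v w" for w
  proof -
    let ?A = "comp2 (YW u) (YW v) w" let ?B = "comp2' (YW u) (YW v) w" let ?C = "\<lambda>i p. YW (Y u i v) p w"
    have bA: "bounded2 ?A" and bB: "bounded1 ?B" by (rule bounded2_comp2[OF fields] bounded1_comp2'[OF fields])+
    then obtain N1 N2 where N: "\<And>k l. l < N1 \<Longrightarrow> ?A k l = 0" "\<And>k l. k < N2 \<Longrightarrow> ?B k l = 0"
      unfolding bounded1_def bounded2_def by metis
    have N3: "?C k l = 0" if "k < N" for k l using fs that by (simp add: prod_via_def low_def)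
    have bC: "bounded1 ?C" unfolding bounded1_def using N3 by blast
    have "lins2 fs (defect ?A ?B ?C k0) = 0" for k0
    proof -
      have "lins2 fs (defect ?A ?B ?C k0) = defect (lins2 fs ?A) (lins2 fs ?B) (lins2 (map subst2 fs) ?C) k0"
        by (rule defect_lins2[OF bA bB bC, symmetric])
      also have "lins2 (map subst2 fs) ?C = T (lins2 fs ?A)" using fs by (simp add: prod_via_def)
      also have "lins2 fs ?B = lins2 fs ?A" using ql by (simp add: quasi_local_def)
      finally show ?thesis unfolding defect_T[OF quasi_local_trunc2[OF fields ql]] zero_fun_apply .
    qed
    then have "dmul (poly_dist (forms_poly fs)) (dist3 (defect ?A ?B ?C)) k = 0" for k
      using dmul_forms_dist3[of fs 1 "defect ?A ?B ?C"] by (cases k) (simp add: dmul_1)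
    then show ?thesis
      by (subst quasi_jacobi_iff[of N1 YW u v w N2 N Y]) (use N N3 in auto)
  qed
  moreover have "forms_poly fs \<noteq> 0" by (rule forms_poly_nonzero) (use ql in \<open>simp add: quasi_local_def\<close>)
  ultimately show ?thesis by blast
qed

subsection \<open>Cancelling a polynomial against the third delta function\<close>

text \<open>
  Multiplication by a polynomial in one variable.
\<close>

definition uact :: "complex poly \<Rightarrow> (int \<Rightarrow> 'w) \<Rightarrow> int \<Rightarrow> 'w" where
  "uact h y m = Sum_any (\<lambda>n. Polynomial.coeff h n *s y (m - int n))"

lemma uact_finite: "finite {n. Polynomial.coeff h n *s y (m - int n) \<noteq> 0}"
  by (rule finite_subset[of _ "{..degree h}"]) (auto intro: le_degree)

lemma uact_add: "uact (h + h') y m = uact h y m + uact h' y m"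
  unfolding uact_def coeff_add scale_left_distrib by (rule Sum_any.distrib) (rule uact_finite)+

lemma uact_pCons: "uact (pCons 0 h) y m = uact h y (m - 1)"
proof -
  have "uact (pCons 0 h) y m = Sum_any (\<lambda>n. Polynomial.coeff (pCons 0 h) (Suc n) *s y (m - int (Suc n)))"
    unfolding uact_def
  proof (rule Sum_any_inj)
    fix x assume "Polynomial.coeff (pCons 0 h) x *s y (m - int x) \<noteq> 0"
    then show "x \<in> range Suc" by (cases x) auto
  qed simp
  then show ?thesis by (simp add: uact_def algebra_simps)
qed

text \<open>
  On distributions \<open>x\<^sub>1\<^sup>-\<^sup>1 \<delta>(x\<^sub>2 / x\<^sub>1) y(x\<^sub>2)\<close>, which are supported on the diagonal, \<open>f(x\<^sub>1, x\<^sub>2)\<close> acts as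
  \<open>f(x\<^sub>2, x\<^sub>2)\<close>.
\<close>

lemma dmul_diagonal:
  "dmul (poly_dist f) (\<lambda>(k0, k1, k2). y (k1 + k2)) (k0, k1, k2) = uact (poly f [:0, 1:]) y (k1 + k2)"
proof (induction f arbitrary: k1)
  case 0
  have "poly_dist 0 = (\<lambda>k. 0)" by (simp add: fun_eq_iff poly_dist_def)
  then show ?case by (simp add: dmul_def uact_def)
next
  case (pCons c f)
  let ?A = "\<lambda>(k0::int, k1, k2). y (k1 + k2)"
  have "pCons c f = [:c:] + pCons 0 f" by simp
  then have e: "poly_dist (pCons c f) = (\<lambda>j. poly_dist [:c:] j + 1 * poly_dist f (j - (0, 1, 0)))"
    by (simp only: fun_eq_iff poly_dist_add poly_dist_pCons_0 mult_1) simp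
  have "dmul (poly_dist (pCons c f)) ?A (k0, k1, k2)
    = dmul (poly_dist [:c:]) ?A (k0, k1, k2) + dmul (poly_dist f) (\<lambda>k. ?A (k - (0, 1, 0))) (k0, k1, k2)"
    unfolding e
    by (subst dmul_add_left[OF poly_dist_finite shift_finite_dist[OF poly_dist_finite]]) (simp only: mult_1 dmul_shift)
  also have "dmul (poly_dist f) (\<lambda>k. ?A (k - (0, 1, 0))) (k0, k1, k2) = dmul (poly_dist f) ?A (k0, k1 - 1, k2)"
    unfolding dmul_def
  proof (rule Sum_any.cong)
    fix j
    show "poly_dist f j *s ?A ((k0, k1, k2) - j - (0, 1, 0)) = poly_dist f j *s ?A ((k0, k1 - 1, k2) - j)"
      by (cases j) (simp add: algebra_simps)
  qed
  also have "\<dots> = uact (poly f [:0, 1:]) y (k1 + k2 - 1)"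
    using pCons.IH[of "k1 - 1"] by (simp add: algebra_simps)
  also have "dmul (poly_dist [:c:]) ?A (k0, k1, k2) = uact c y (k1 + k2)"
  proof -
    define g where "g n = (0::int, 0::int, int n)" for n
    have "dmul (poly_dist [:c:]) ?A (k0, k1, k2) = Sum_any (\<lambda>n. poly_dist [:c:] (g n) *s ?A ((k0, k1, k2) - g n))"
      unfolding dmul_def
    proof (rule Sum_any_inj)
      show "inj g" by (auto simp: inj_def g_def)
      fix x assume x: "poly_dist [:c:] x *s ?A ((k0, k1, k2) - x) \<noteq> 0"
      obtain x0 x1 x2 where x': "x = (x0, x1, x2)" by (cases x)
      have "x0 = 0" "0 \<le> x1" "0 \<le> x2" and n: "Polynomial.coeff [:c:] (nat x1) \<noteq> 0" using x
        by (auto simp: x' poly_dist_def split: if_splits)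
      moreover from n have "nat x1 = 0" by (cases "nat x1") auto
      ultimately have "x = g (nat x2)" by (simp add: x' g_def)
      then show "x \<in> range g" by blast
    qed
    then show ?thesis by (simp add: uact_def g_def poly_dist_def algebra_simps)
  qed
  also have "uact c y (k1 + k2) + uact (poly f [:0, 1:]) y (k1 + k2 - 1) = uact (poly (pCons c f) [:0, 1:]) y (k1 + k2)"
    by (simp add: uact_add uact_pCons)
  finally show ?case .
qed

lemma uact_cancel:
  assumes "h \<noteq> 0" "\<And>k. k < M \<Longrightarrow> y k = 0" "\<And>m. uact h y m = 0"
  shows "y k = 0"
proof -
  define n0 where "n0 = (LEAST n. Polynomial.coeff h n \<noteq> 0)"
  have ex: "\<exists>n. Polynomial.coeff h n \<noteq> 0" using assms(1) by (simp add: poly_eq_iff)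
  have n0: "Polynomial.coeff h n0 \<noteq> 0" "\<And>n. n < n0 \<Longrightarrow> Polynomial.coeff h n = 0"
    unfolding n0_def using LeastI_ex[OF ex] not_less_Least by blast+
  have "\<forall>k < M + int n. y k = 0" for n
  proof (induction n)
    case 0
    then show ?case using assms(2) by simp
  next
    case (Suc n)
    show ?case
    proof (intro allI impI)
      fix k assume k: "k < M + int (Suc n)"
      have "uact h y (k + int n0) = (\<Sum>n\<in>{n0}. Polynomial.coeff h n *s y (k + int n0 - int n))"
        unfolding uact_def
      proof (rule Sum_any.expand_superset)
        show "{n. Polynomial.coeff h n *s y (k + int n0 - int n) \<noteq> 0} \<subseteq> {n0}"
        proof
          fix n assume n: "n \<in> {n. Polynomial.coeff h n *s y (k + int n0 - int n) \<noteq> 0}"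
          then have "\<not> n < n0" using n0(2) by auto
          moreover have "\<not> n0 < n" using n Suc.IH k by auto
          ultimately show "n \<in> {n0}" by simp
        qed
      qed simp
      then show "y k = 0" using assms(3)[of "k + int n0"] n0(1) by simp
    qed
  qed
  from this[of "nat (k - M + 1)"] show ?thesis by simp
qed

text \<open>
  Write \<open>f = (x\<^sub>1 - x\<^sub>2)\<^sup>s f\<^sub>1\<close> with \<open>f\<^sub>1(x, x) \<noteq> 0\<close>.  In front of the third delta function
  \<open>x\<^sub>1 - x\<^sub>2\<close> acts as the invertible variable \<open>x\<^sub>0\<close>, so \<open>f\<^sub>1\<close> alone annihilates the third term.  The
  coefficient of the lowest power of \<open>x\<^sub>0\<close> is supported on the diagonal, where \<open>f\<^sub>1\<close> acts as the nonzero
  polynomial \<open>f\<^sub>1(x, x)\<close>; hence it vanishes, and induction on the power of \<open>x\<^sub>0\<close> gives the claim.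
\<close>

theorem dmul_d10_cancel:
  assumes "f \<noteq> 0" and C: "low N C" "\<And>i. \<exists>M. low M (C i)"
    and eq: "\<And>k. dmul (poly_dist f) (dist3 (d10 C)) k = 0"
  shows "C = 0"
proof -
  obtain f1 where f1: "f = [:- [:0, 1:], 1:] ^ order [:0, 1:] f * f1" "\<not> [:- [:0, 1:], 1:] dvd f1"
    using order_decomp[OF assms(1)] by blast
  define s where "s = order [:0, 1:] f"
  define h where "h = poly f1 [:0, 1:]"
  have h: "h \<noteq> 0" using f1(2) by (simp add: h_def poly_eq_0_iff_dvd)
  have bC: "bounded1 C" using C(1) unfolding bounded1_def low_def by (metis zero_fun_apply)
  have fp: "form_poly (1, - 1) = [:- [:0, 1:], 1:]" by (simp add: form_poly_def one_pCons)
  have shift: "lin2 (1, - 1) (d10 C k0) = d10 C (k0 - 1)" for k0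
  proof -
    have "lin2 (1, - 1) (d10 C k0) = d10 (lin2 (1, 0) C) k0"
      using d10_lin2[OF bC, of "(1, - 1)" k0] by simp
    also have "\<dots> = d10 C (k0 - 1)" by (simp add: fun_eq_iff d10_def lin2.simps algebra_simps)
    finally show ?thesis .
  qed
  have shift0: "dmul F (dist3 (\<lambda>k0. J (k0 + m))) (k0, k1, k2) = dmul F (dist3 J) (k0 + m, k1, k2)" for F J m k0 k1 k2
    unfolding dmul_def
  proof (rule Sum_any.cong)
    fix j
    show "F j *s dist3 (\<lambda>k0. J (k0 + m)) ((k0, k1, k2) - j) = F j *s dist3 J ((k0 + m, k1, k2) - j)"
      by (cases j) (simp add: algebra_simps)
  qed
  have "dmul (poly_dist ([:- [:0, 1:], 1:] ^ s * f1)) (dist3 (\<lambda>k0. d10 C (k0 + m)))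
      = dmul (poly_dist f1) (dist3 (\<lambda>k0. d10 C (k0 + (m - int s))))" for s m
  proof (induction s arbitrary: m)
    case (Suc s)
    have "dmul (poly_dist ([:- [:0, 1:], 1:] ^ Suc s * f1)) (dist3 (\<lambda>k0. d10 C (k0 + m)))
       = dmul (poly_dist ([:- [:0, 1:], 1:] ^ s * f1)) (dist3 (\<lambda>k0. lin2 (1, - 1) (d10 C (k0 + m))))"
      unfolding power_Suc mult.assoc fp[symmetric] dmul_form_dist3 ..
    also have "(\<lambda>k0. lin2 (1, - 1) (d10 C (k0 + m))) = (\<lambda>k0. d10 C (k0 + (m - 1)))"
      unfolding shift by (simp add: algebra_simps)
    also have "dmul (poly_dist ([:- [:0, 1:], 1:] ^ s * f1)) (dist3 \<dots>)
       = dmul (poly_dist f1) (dist3 (\<lambda>k0. d10 C (k0 + (m - 1 - int s))))" by (rule Suc.IH)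
    finally show ?case by (simp add: algebra_simps)
  qed simp
  note * = this[of s "int s", folded s_def]
  have eq1: "dmul (poly_dist f1) (dist3 (d10 C)) (k0, k1, k2) = 0" for k0 k1 k2
  proof -
    have "dmul (poly_dist f1) (dist3 (d10 C)) (k0, k1, k2) = dmul (poly_dist f1) (dist3 (\<lambda>k0. d10 C (k0 + (int s - int s)))) (k0, k1, k2)"
      by simp
    also have "\<dots> = dmul (poly_dist f) (dist3 (\<lambda>k0. d10 C (k0 + int s))) (k0, k1, k2)"
      unfolding *[symmetric] f1(1)[folded s_def, symmetric] ..
    also have "\<dots> = 0" unfolding shift0 by (rule eq)
    finally show ?thesis .
  qed
  have "\<forall>i < N + int n. C i = 0" for n
  proof (induction n)
    case 0
    then show ?case using C(1) by (simp add: low_def)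
  next
    case (Suc n)
    show ?case
    proof (intro allI impI)
      fix i assume i: "i < N + int (Suc n)"
      have d: "d10 C i a b = C i (a + b + 1)" for a b
      proof -
        have "d10 C i a b = (\<Sum>j\<in>{0}. bin (- a - 1) j *s C (i - j) (b + 1 + j + a))"
          unfolding d10_def bsum_def
        proof (rule Sum_any.expand_superset)
          show "{j. bin (- a - 1) j *s C (i - j) (b + 1 + j + a) \<noteq> 0} \<subseteq> {0}"
          proof
            fix j assume j: "j \<in> {j. bin (- a - 1) j *s C (i - j) (b + 1 + j + a) \<noteq> 0}"
            then have "\<not> j < 0" by auto
            moreover have "C (i - j) = 0" if "0 < j" using that i by (intro Suc.IH[rule_format]) simp
            then have "\<not> 0 < j" using j by auto
            ultimately show "j \<in> {0}" by simp
          qed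
        qed simp
        then show ?thesis by (simp add: algebra_simps)
      qed
      define y where "y p = C i (p + 1)" for p
      have "uact h y m = 0" for m
      proof -
        have "uact h y m = dmul (poly_dist f1) (\<lambda>(k0, k1, k2). y (k1 + k2)) (i, m, 0)"
          unfolding dmul_diagonal h_def by simp
        also have "\<dots> = dmul (poly_dist f1) (dist3 (d10 C)) (i, m, 0)"
          unfolding dmul_def
        proof (rule Sum_any.cong)
          fix j :: "int \<times> int \<times> int"
          obtain j0 j1 j2 where j: "j = (j0, j1, j2)" by (cases j)
          show "poly_dist f1 j *s (case (i, m, 0) - j of (k0, k1, k2) \<Rightarrow> y (k1 + k2)) = poly_dist f1 j *s dist3 (d10 C) ((i, m, 0) - j)"
          proof (cases "j0 = 0")
            case True
            then show ?thesis by (simp add: j d y_def)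
          next
            case False
            then have "poly_dist f1 j = 0" by (simp add: j poly_dist_def)
            then show ?thesis by simp
          qed
        qed
        finally show ?thesis using eq1 by simp
      qed
      moreover obtain M where "low M (C i)" using C(2) by blast
      then have "y k = 0" if "k < M - 1" for k using that by (simp add: y_def low_def)
      ultimately have "y k = 0" for k using uact_cancel[OF h] by blast
      then have "C i p = 0" for p using y_def[of "p - 1"] by simp
      then show "C i = 0" by (simp add: fun_eq_iff)
    qed
  qed
  note ** = this
  show ?thesis
  proof
    fix i show "C i = 0 i" using **[of "nat (i - N + 1)"] by (simp only: zero_fun_apply)
  qed
qed

section \<open>Uniqueness of the third term of the Jacobi identity\<close>

lemma dmul_lins2_zero:
  assumes D: "finite {j. D j \<noteq> 0}" and J: "\<And>k. dmul D (dist3 J) k = 0"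
  shows "dmul D (dist3 (\<lambda>k0. lins2 fs (J k0))) k = 0"
proof (induction fs arbitrary: k)
  case Nil
  show ?case using J by (simp only: foldr.simps id_apply)
next
  case (Cons g fs)
  obtain a b where g: "g = (a, b)" by (cases g)
  have sh: "dmul D (\<lambda>k. A (k - e)) k = dmul D A (k - e)" for A e k
    unfolding dmul_def by (simp add: diff_diff_eq add.commute)
  let ?A = "dist3 (\<lambda>k0. lins2 fs (J k0))"
  have "dist3 (\<lambda>k0. lins2 (g # fs) (J k0)) = (\<lambda>k. a *s ?A (k - (0, 1, 0)) + b *s ?A (k - (0, 0, 1)))"
    by (simp add: fun_eq_iff g lin2.simps)
  then have "dmul D (dist3 (\<lambda>k0. lins2 (g # fs) (J k0))) k
    = dmul D (\<lambda>k. a *s ?A (k - (0, 1, 0)) + b *s ?A (k - (0, 0, 1))) k" by (simp only:)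
  also have "\<dots> = a *s dmul D ?A (k - (0, 1, 0)) + b *s dmul D ?A (k - (0, 0, 1))"
    by (simp only: dmul_add[OF D] dmul_scale sh)
  finally show ?case unfolding Cons.IH by simp
qed

text \<open>
  The third term of a quasi Jacobi identity is determined by the first two.  The product of the fields
  satisfies such an identity with the forms \<open>fs\<close>, so the difference of the two candidates is annihilated
  by \<open>fs\<close> and the given polynomial together, and \<open>dmul_d10_cancel\<close> applies.
\<close>

lemma third_term_unique:
  assumes fields: "is_field \<alpha>" "is_field \<beta>" and C: "is_prod \<alpha> \<beta> C"
    and C1: "low N C1" "\<And>i. \<exists>M. low M (C1 i)"
    and f: "f \<noteq> 0" and eq: "\<And>k. dmul (poly_dist f) (dist3 (defect (comp2 \<alpha> \<beta> w) (comp2' \<alpha> \<beta> w) C1)) k = 0"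
  shows "C1 = (\<lambda>i p. C i p w)"
proof -
  obtain fs N0 where fs: "prod_via fs N0 \<alpha> \<beta> C" using C by (auto simp: is_prod_def)
  then have ql: "quasi_local fs \<alpha> \<beta>" and lowC: "low N0 C" by (simp_all add: prod_via_def)
  let ?A = "comp2 \<alpha> \<beta> w" let ?B = "comp2' \<alpha> \<beta> w"
  define C0 where "C0 = (\<lambda>i p. C i p w)"
  have bA: "bounded2 ?A" and bB: "bounded1 ?B" by (rule bounded2_comp2[OF fields] bounded1_comp2'[OF fields])+
  have bC0: "bounded1 C0" using low_slice[OF lowC, of w] unfolding C0_def bounded1_def low_def by (metis zero_fun_apply)
  have bC1: "bounded1 C1" using C1(1) unfolding bounded1_def low_def by (metis zero_fun_apply)
  have bD: "bounded1 (C1 - C0)"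
  proof -
    obtain K1 where K1: "\<And>k l. k < K1 \<Longrightarrow> C1 k l = 0" using bC1 by (auto simp: bounded1_def)
    obtain K2 where K2: "\<And>k l. k < K2 \<Longrightarrow> C0 k l = 0" using bC0 by (auto simp: bounded1_def)
    show ?thesis unfolding bounded1_def by (intro exI[of _ "min K1 K2"]) (simp add: K1 K2)
  qed
  have d0: "lins2 fs (defect ?A ?B C0 k0) = 0" for k0
  proof -
    have "lins2 fs (defect ?A ?B C0 k0) = defect (lins2 fs ?A) (lins2 fs ?B) (lins2 (map subst2 fs) C0) k0"
      by (rule defect_lins2[OF bA bB bC0, symmetric])
    also have "lins2 (map subst2 fs) C0 = T (lins2 fs ?A)" using fs by (simp add: prod_via_def C0_def)
    also have "lins2 fs ?B = lins2 fs ?A" using ql by (simp add: quasi_local_def)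
    finally show ?thesis unfolding defect_T[OF quasi_local_trunc2[OF fields ql]] zero_fun_apply .
  qed
  have d10d: "d10 (C1 - C0) k0 = defect ?A ?B C0 k0 - defect ?A ?B C1 k0" for k0
  proof (intro ext)
    fix k1 k2
    have "bsum x (\<lambda>j. (C1 - C0) (k0 - j) (h j)) = bsum x (\<lambda>j. C1 (k0 - j) (h j)) - bsum x (\<lambda>j. C0 (k0 - j) (h j))" for x h
    proof -
      have "bsum x (\<lambda>j. C1 (k0 - j) (h j)) = bsum x (\<lambda>j. (C1 - C0) (k0 - j) (h j) + C0 (k0 - j) (h j))" by simp
      also have "\<dots> = bsum x (\<lambda>j. (C1 - C0) (k0 - j) (h j)) + bsum x (\<lambda>j. C0 (k0 - j) (h j))"
        by (rule bsum_add[OF bounded1_above[OF bD] bounded1_above[OF bC0]])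
      finally show ?thesis by simp
    qed
    then show "d10 (C1 - C0) k0 k1 k2 = (defect ?A ?B C0 k0 - defect ?A ?B C1 k0) k1 k2"
      by (simp add: defect_def d10_def)
  qed
  have "C1 - C0 = 0"
  proof (rule dmul_d10_cancel)
    show "forms_poly fs * f \<noteq> 0" using f forms_poly_nonzero[of fs] ql by (simp add: quasi_local_def)
    show "low (min N N0) (C1 - C0)" using C1(1) low_slice[OF lowC, of w] by (simp add: low_def C0_def)
    have fC: "is_field (C i)" for i by (rule is_prod_field[OF fields C])
    show "\<exists>M. low M ((C1 - C0) i)" for i
    proof -
      obtain M1 where M1: "low M1 (C1 i)" using C1(2) by blast
      obtain M2 where M2: "\<And>p. p < M2 \<Longrightarrow> C i p w = 0" using field_low[OF fC] by metis
      show ?thesis using M1 M2 by (intro exI[of _ "min M1 M2"]) (simp add: low_def C0_def)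
    qed
    fix k
    have "dmul (poly_dist (forms_poly fs * f)) (dist3 (d10 (C1 - C0))) k
      = dmul (poly_dist f) (dist3 (\<lambda>k0. lins2 fs (d10 (C1 - C0) k0))) k" by (simp only: dmul_forms_dist3)
    also have "(\<lambda>k0. lins2 fs (d10 (C1 - C0) k0)) = (\<lambda>k0. - lins2 fs (defect ?A ?B C1 k0))"
      unfolding d10d lins2_diff d0 by simp
    also have "dmul (poly_dist f) (dist3 (\<lambda>k0. - lins2 fs (defect ?A ?B C1 k0))) k
      = dmul (poly_dist f) (\<lambda>k. (- 1) *s dist3 (\<lambda>k0. lins2 fs (defect ?A ?B C1 k0)) k) k"
      by (rule arg_cong[where f = "\<lambda>A. dmul _ A k"]) (auto simp: fun_eq_iff)
    also have "\<dots> = (- 1) *s dmul (poly_dist f) (dist3 (\<lambda>k0. lins2 fs (defect ?A ?B C1 k0))) k"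
      by (rule dmul_scale)
    also have "\<dots> = 0" by (simp add: dmul_lins2_zero[OF poly_dist_finite eq])
    finally show "dmul (poly_dist (forms_poly fs * f)) (dist3 (d10 (C1 - C0))) k = 0" .
  qed
  then show ?thesis by (simp add: C0_def)
qed

section \<open>The commutator of two products\<close>

lemma bsum_0: assumes "\<And>j. j \<noteq> 0 \<Longrightarrow> bin (x j) j *s g j = 0" shows "bsum x g = g 0"
proof -
  have "bsum x g = (\<Sum>j\<in>{0}. bin (x j) j *s g j)"
    unfolding bsum_def by (rule Sum_any.expand_superset) (use assms in auto)
  then show ?thesis by simp
qed

lemma d12_residue: "d12 A (- 1) k1 k2 = A k1 k2"
proof -
  have "d12 A (- 1) k1 k2 = A (k1 + - 1 + 1 + 0) (k2 - 0)"
    unfolding d12_def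
  proof (rule bsum_0)
    fix j :: int assume "j \<noteq> 0"
    then have "bin (- 1 + j) j = 0" by (cases "j < 0") (auto intro: bin_eq_0)
    then show "bin (- 1 + j) j *s A (k1 + - 1 + 1 + j) (k2 - j) = 0" by simp
  qed
  then show ?thesis by simp
qed

lemma d21_residue: "d21 A (- 1) k1 k2 = A k1 k2"
proof -
  have "bsum (\<lambda>j. - 1 + j) (\<lambda>j. A (k1 - j) (k2 + - 1 + 1 + j)) = A (k1 - 0) (k2 + - 1 + 1 + 0)"
  proof (rule bsum_0)
    fix j :: int assume "j \<noteq> 0"
    then have "bin (- 1 + j) j = 0" by (cases "j < 0") (auto intro: bin_eq_0)
    then show "bin (- 1 + j) j *s A (k1 - j) (k2 + - 1 + 1 + j) = 0" by simp
  qed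
  then show ?thesis by (simp add: d21_def sgn_of_def)
qed

lemma bin_1: "bin k 1 = of_int k" by (simp add: bin_def)

text \<open>
  Two fields whose product has the singular part \<open>h x\<^sub>0\<^sup>-\<^sup>2\<close> act on fields by operators which
  satisfy the relations of a Heisenberg algebra: take the coefficient of \<open>x\<^sub>0\<^sup>-\<^sup>1\<close> in the Jacobi identity
  of the products, to which only the singular part contributes.
\<close>

lemma prod_commutator:
  assumes fields: "is_field \<alpha>" "is_field \<beta>" "is_field \<gamma>"
    and C: "is_prod \<alpha> \<beta> C" and E: "is_prod \<beta> \<gamma> E" and F: "is_prod \<alpha> \<gamma> F"
    and G: "\<And>j. is_prod \<alpha> (E j) (G j)" and G': "\<And>i. is_prod \<beta> (F i) (G' i)"
    and Z: "\<And>i. \<exists>fs. quasi_local fs (C i) \<gamma>"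
    and sing: "\<And>i p w. i < 0 \<Longrightarrow> C i p w = (if i = - 2 \<and> p = 0 then h *s w else 0)"
  shows "G j i p w - G' i j p w = (if i + j = - 2 then (of_int (- i - 1) * h) *s \<gamma> p w else 0)"
proof -
  have fC: "is_field (C i)" for i by (rule is_prod_field[OF fields(1,2) C])
  have isZ: "is_prod (C i) \<gamma> (prd (C i) \<gamma>)" for i using Z[of i] is_prod_prd[OF fC fields(3)] by blast
  have Zneg: "prd (C i) \<gamma> = (if i = - 2 then (\<lambda>j p w. if j = 0 then h *s \<gamma> p w else 0) else 0)" if i: "i < 0" for i
  proof (cases "i = - 2")
    case True
    have "C i = (\<lambda>k w. h *s id_field k w)" using sing[OF i] True by (auto simp: fun_eq_iff id_field_def)
    then have "is_prod (C i) \<gamma> (\<lambda>j p w. h *s (if j = 0 then \<gamma> p w else 0))"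
      using is_prod_scale_left[OF fields(3) is_prod_id_left[OF fields(3)], of h] by simp
    from prd_eq[OF fC fields(3) this] show ?thesis using True by (auto simp: fun_eq_iff)
  next
    case False
    then have "C i = 0" using sing[OF i] by (simp add: fun_eq_iff)
    then have "prd (C i) \<gamma> = 0" using is_prod_zero_left[OF fields(3)] isZ[of i] by simp
    then show ?thesis using False by simp
  qed
  have "defect (\<lambda>i j. G j i p w) (\<lambda>i j. G' i j p w) (\<lambda>i j. prd (C i) \<gamma> j p w) (- 1) i j = 0"
    using field_jacobi[OF fields C E F G G' isZ, of p w] by simp
  then have "G j i p w - G' i j p w = d10 (\<lambda>i j. prd (C i) \<gamma> j p w) (- 1) i j"
    unfolding defect_def d12_residue d21_residue by simp
  also have "\<dots> = (\<Sum>l\<in>{1}. bin (- i - 1) l *s prd (C (- 1 - l)) \<gamma> (j + 1 + l + i) p w)"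
    unfolding d10_def bsum_def
  proof (rule Sum_any.expand_superset)
    show "{l. bin (- i - 1) l *s prd (C (- 1 - l)) \<gamma> (j + 1 + l + i) p w \<noteq> 0} \<subseteq> {1}"
    proof
      fix l assume l: "l \<in> {l. bin (- i - 1) l *s prd (C (- 1 - l)) \<gamma> (j + 1 + l + i) p w \<noteq> 0}"
      then have "0 \<le> l" by (metis (mono_tags) bin_negative mem_Collect_eq not_le scale_zero_left)
      then have "- 1 - l < 0" by simp
      from Zneg[OF this] l show "l \<in> {1}" by (auto split: if_splits)
    qed
  qed simp
  also have "\<dots> = (if i + j = - 2 then (of_int (- i - 1) * h) *s \<gamma> p w else 0)"
    using Zneg[of "- 2"] by (auto simp: bin_1)
  finally show ?thesis .
qed

end

section \<open>Linear extension\<close>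

lemma poly_mapping_add_induct:
  assumes "Q 0" "\<And>f g. Q f \<Longrightarrow> Q g \<Longrightarrow> Poly_Mapping.keys f \<inter> Poly_Mapping.keys g = {} \<Longrightarrow> Poly_Mapping.keys (f + g) = Poly_Mapping.keys f \<union> Poly_Mapping.keys g \<Longrightarrow> Q (f + g)" "\<And>k c. Q (Poly_Mapping.single k c)"
  shows "Q (f :: 'i \<Rightarrow>\<^sub>0 'a::ab_group_add)"
proof (induction f rule: Poly_Mapping.update_induct)
  case const
  then show ?case by (rule assms(1))
next
  case (update f a b)
  have e: "Poly_Mapping.update a b f = f + Poly_Mapping.single a b"
    by (rule poly_mapping_eqI) (use update(1) in \<open>auto simp: lookup_update lookup_add lookup_single when_def in_keys_iff\<close>)
  show ?case unfolding e
    by (rule assms(2)[OF update(3) assms(3)]) (use update(1,2) in \<open>auto simp: in_keys_iff lookup_add lookup_single when_def split: if_splits\<close>)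
qed

locale complex_space = vector_space scale for scale :: "complex \<Rightarrow> 'b \<Rightarrow> 'b::ab_group_add" (infixr "*s" 75)
begin

text \<open>
  The linear extension of a map on a basis.
\<close>

definition lext :: "('i \<Rightarrow> 'b) \<Rightarrow> ('i \<Rightarrow>\<^sub>0 complex) \<Rightarrow> 'b" where
  "lext \<phi> f = (\<Sum>i\<in>Poly_Mapping.keys f. Poly_Mapping.lookup f i *s \<phi> i)"

lemma lext_superset:
  shows "finite S \<Longrightarrow> Poly_Mapping.keys f \<subseteq> S \<Longrightarrow> lext \<phi> f = (\<Sum>i\<in>S. Poly_Mapping.lookup f i *s \<phi> i)"
  unfolding lext_def by (rule sum.mono_neutral_left) (auto simp: in_keys_iff)

lemma lext_0 [simp]: "lext \<phi> 0 = 0"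
  by (simp add: lext_def)

lemma lext_add: "lext \<phi> (f + g) = lext \<phi> f + lext \<phi> g"
proof -
  have S: "finite (Poly_Mapping.keys f \<union> Poly_Mapping.keys g)" by simp
  show ?thesis
    using Poly_Mapping.keys_add[of f g]
    by (simp add: lext_superset[OF S] lookup_add scale_left_distrib sum.distrib)
qed

lemma lext_uminus: "lext \<phi> (- f) = - lext \<phi> f"
proof -
  have "lext \<phi> (- f) + lext \<phi> f = 0" by (simp add: lext_add[symmetric])
  then show ?thesis by (simp add: eq_neg_iff_add_eq_0)
qed

lemma lext_diff: "lext \<phi> (f - g) = lext \<phi> f - lext \<phi> g"
  using lext_add[of \<phi> f "- g"] by (simp add: lext_uminus)

lemma lext_single [simp]: "lext \<phi> (Poly_Mapping.single i c) = c *s \<phi> i"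
  by (cases "c = 0") (simp_all add: lext_def)

lemma lext_scale:
  assumes "\<And>i. Poly_Mapping.lookup g i = c * Poly_Mapping.lookup f i" shows "lext \<phi> g = c *s lext \<phi> f"
proof -
  have "Poly_Mapping.keys g \<subseteq> Poly_Mapping.keys f" using assms by (auto simp: in_keys_iff)
  then show ?thesis by (simp add: lext_superset[OF finite_keys] lext_def[of _ f] assms scale_sum_right)
qed

end

lemma lookup_fin_scale: "Poly_Mapping.lookup (fin_scale (*) c f) i = c * Poly_Mapping.lookup f i"
  by (simp add: fin_scale_def Poly_Mapping.map.rep_eq when_def)

lemma vector_space_fin_scale: "vector_space (fin_scale (*) :: complex \<Rightarrow> ('i \<Rightarrow>\<^sub>0 complex) \<Rightarrow> _)"
  by standard (auto intro!: poly_mapping_eqI simp: lookup_fin_scale lookup_add algebra_simps)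

lemma fin_scale_single: "fin_scale (*) c (Poly_Mapping.single i d) = Poly_Mapping.single i (c * d)"
  by (rule poly_mapping_eqI) (simp add: lookup_fin_scale lookup_single when_def)

section \<open>Universal enveloping algebras\<close>

lemma ring_of_type_algebra_ring: "ring (ring_of_type_algebra :: 'a::ring_1 ring)"
proof (rule ringI)
  show "abelian_group (ring_of_type_algebra :: 'a ring)"
  proof (rule abelian_groupI)
    fix x :: 'a assume "x \<in> carrier ring_of_type_algebra"
    show "\<exists>y\<in>carrier ring_of_type_algebra. y \<oplus>\<^bsub>ring_of_type_algebra\<^esub> x = \<zero>\<^bsub>ring_of_type_algebra\<^esub>"
      by (rule bexI[of _ "- x"]) (auto simp: ring_of_type_algebra_def)
  qed (auto simp: ring_of_type_algebra_def add.assoc add.commute)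
  show "Group.monoid (ring_of_type_algebra :: 'a ring)"
    by (rule monoidI) (auto simp: ring_of_type_algebra_def mult.assoc)
qed (auto simp: ring_of_type_algebra_def distrib_left distrib_right)

text \<open>
  The module induced from the one-dimensional representation \<open>\<chi>\<close> of \<open>P\<close>.  Elements of the free algebra
  represent its vectors below, so that cosets of cosets are handled only once.
\<close>

locale induced =
  fixes s :: "complex \<Rightarrow> 'l \<Rightarrow> 'l::ab_group_add" and br :: "'l \<Rightarrow> 'l \<Rightarrow> 'l"
    and P :: "'l set" and \<chi> :: "'l \<Rightarrow> complex"
begin

abbreviation R :: "'l free_algebra ring" where "R \<equiv> ring_of_type_algebra"
abbreviation I where "I \<equiv> uea_ideal s br"
abbreviation U where "U \<equiv> uea s br"
abbreviation cl where "cl \<equiv> uea_class s br"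

lemma R_simps: "carrier R = UNIV" "x \<oplus>\<^bsub>R\<^esub> y = x + y" "x \<otimes>\<^bsub>R\<^esub> y = x * y" "\<zero>\<^bsub>R\<^esub> = 0" "\<one>\<^bsub>R\<^esub> = 1"
  by (simp_all add: ring_of_type_algebra_def)

sublocale R: ring R by (rule ring_of_type_algebra_ring)

definition gens :: "'l free_algebra set" where
  "gens = {letter (x + y) - letter x - letter y | x y. True} \<union>
      {letter (s c x) - scalar c * letter x | c x. True} \<union>
      {letter x * letter y - letter y * letter x - letter (br x y) | x y. True}"

lemma I_gens: "I = Idl\<^bsub>R\<^esub> gens" by (simp add: uea_ideal_def gens_def)

sublocale I: ideal I R
  unfolding I_gens by (rule R.genideal_ideal) (simp add: R_simps)

lemma gens_I: "g \<in> gens \<Longrightarrow> g \<in> I"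
  unfolding I_gens using R.genideal_self[of gens] by (auto simp: R_simps)

lemma I_0: "0 \<in> I" using I.zero_closed by (simp add: R_simps)
lemma I_add: "x \<in> I \<Longrightarrow> y \<in> I \<Longrightarrow> x + y \<in> I" using I.a_closed by (simp add: R_simps)
lemma I_left: "x \<in> I \<Longrightarrow> t * x \<in> I" using I.I_l_closed[of x t] by (simp add: R_simps)
lemma I_uminus: "x \<in> I \<Longrightarrow> - x \<in> I" using I_left[of x "- 1"] by simp
lemma I_diff: "x \<in> I \<Longrightarrow> y \<in> I \<Longrightarrow> x - y \<in> I" using I_add[of x "- y"] I_uminus by simp

lemma cl_eq: "cl t = {x + t | x. x \<in> I}"
  by (auto simp: uea_class_def a_r_coset_def' R_simps)

lemma cl_eq_iff: "cl t = cl t' \<longleftrightarrow> t - t' \<in> I"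
proof
  assume "cl t = cl t'"
  moreover have "t \<in> cl t" unfolding cl_eq using I_0 by force
  ultimately obtain x where "x \<in> I" "t = x + t'" unfolding cl_eq by blast
  then show "t - t' \<in> I" by simp
next
  assume d: "t - t' \<in> I"
  have "\<exists>y. x + t = y + t' \<and> y \<in> I" if "x \<in> I" for x
    by (rule exI[of _ "x + (t - t')"]) (use that d I_add in auto)
  moreover have "\<exists>y. x + t' = y + t \<and> y \<in> I" if "x \<in> I" for x
    by (rule exI[of _ "x - (t - t')"]) (use that d I_diff in auto)
  ultimately show "cl t = cl t'" unfolding cl_eq by blast
qed

lemma cl_self: "t \<in> cl t" unfolding cl_eq using I_0 by force

lemma U_carrier: "u \<in> carrier U \<longleftrightarrow> (\<exists>t. u = cl t)"
  by (auto simp: uea_def FactRing_def A_RCOSETS_def' uea_class_def R_simps)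

lemma cl_carrier [simp]: "cl t \<in> carrier U" by (auto simp: U_carrier)

lemma cl_add: "cl t \<oplus>\<^bsub>U\<^esub> cl t' = cl (t + t')"
  using I.a_rcos_sum[of t t'] by (simp add: uea_def FactRing_def uea_class_def R_simps)

lemma cl_mult: "cl t \<otimes>\<^bsub>U\<^esub> cl t' = cl (t * t')"
  using I.rcoset_mult_add[of t t'] by (simp add: uea_def FactRing_def uea_class_def R_simps)

lemma cl_one: "\<one>\<^bsub>U\<^esub> = cl 1"
  by (simp add: uea_def FactRing_def uea_class_def R_simps)

lemma cl_letter_add: "cl (letter (x + y)) = cl (letter x + letter y)"
proof -
  have "letter (x + y) - letter x - letter y \<in> I" by (rule gens_I) (auto simp: gens_def)
  then show ?thesis by (simp add: cl_eq_iff diff_diff_eq)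
qed

lemma cl_letter_scale: "cl (letter (s c x)) = cl (scalar c * letter x)"
proof -
  have "letter (s c x) - scalar c * letter x \<in> I" by (rule gens_I) (auto simp: gens_def)
  then show ?thesis by (simp add: cl_eq_iff)
qed

lemma scalar_commute: "scalar c * t = t * scalar c"
proof (induction t rule: poly_mapping_add_induct)
  case (2 f g)
  then show ?case by (simp add: distrib_left distrib_right)
qed (simp_all add: scalar_def mult_single mult.commute)

lemma scalar_mult_single: "scalar c * Poly_Mapping.single wd d = Poly_Mapping.single wd (c * d)"
  by (simp add: scalar_def mult_single)

lemma scalar_1: "scalar 1 = 1" by (simp add: scalar_def)

section \<open>Induced modules\<close>

abbreviation M where "M \<equiv> pretensor_module s br"
abbreviation J where "J \<equiv> tensor_relations s br P \<chi>"
abbreviation V where "V \<equiv> induced_module s br P \<chi>"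
abbreviation ic where "ic \<equiv> induced_class s br P \<chi>"
abbreviation fs where "fs \<equiv> (fin_scale (*) :: complex \<Rightarrow> 'l tensors \<Rightarrow> _)"

sublocale VT: complex_space "fin_scale (*) :: complex \<Rightarrow> 'l tensors \<Rightarrow> 'l tensors"
  unfolding complex_space_def by (rule vector_space_fin_scale)

definition rels :: "'l tensors set" where
  "rels = {pure (u \<oplus>\<^bsub>U\<^esub> v) z - pure u z - pure v z | u v z. u \<in> carrier U \<and> v \<in> carrier U} \<union>
      {pure u (y + z) - pure u y - pure u z | u y z. u \<in> carrier U} \<union>
      {pure (cl (scalar c) \<otimes>\<^bsub>U\<^esub> u) z - fin_scale (*) c (pure u z) | c u z. u \<in> carrier U} \<union>
      {pure u (c * z) - fin_scale (*) c (pure u z) | c u z. u \<in> carrier U} \<union>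
      {pure (u \<otimes>\<^bsub>U\<^esub> cl (letter b)) z - pure u (\<chi> b * z) | u b z. u \<in> carrier U \<and> b \<in> P}"

lemma J_eq: "J = VT.span rels"
  by (simp add: tensor_relations_def rels_def Let_def)

lemma J_0: "0 \<in> J" and J_add: "x \<in> J \<Longrightarrow> y \<in> J \<Longrightarrow> x + y \<in> J"
  and J_scale: "x \<in> J \<Longrightarrow> fs c x \<in> J" and J_diff: "x \<in> J \<Longrightarrow> y \<in> J \<Longrightarrow> x - y \<in> J"
  and J_rels: "x \<in> rels \<Longrightarrow> x \<in> J"
  unfolding J_eq by (rule VT.span_zero VT.span_add VT.span_scale VT.span_diff VT.span_base; assumption)+

lemma ic_eq: "ic f = {x + f | x. x \<in> J}"
  by (auto simp: induced_class_def a_r_coset_def' pretensor_module_def)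

lemma ic_self: "f \<in> ic f" unfolding ic_eq using J_0 by force

lemma ic_eq_iff: "ic f = ic g \<longleftrightarrow> f - g \<in> J"
proof
  assume "ic f = ic g"
  then obtain x where "x \<in> J" "f = x + g" using ic_self[of f] unfolding ic_eq by blast
  then show "f - g \<in> J" by simp
next
  assume d: "f - g \<in> J"
  have "\<exists>y. x + f = y + g \<and> y \<in> J" if "x \<in> J" for x
    by (rule exI[of _ "x + (f - g)"]) (use that d J_add in auto)
  moreover have "\<exists>y. x + g = y + f \<and> y \<in> J" if "x \<in> J" for x
    by (rule exI[of _ "x - (f - g)"]) (use that d J_diff in auto)
  ultimately show "ic f = ic g" unfolding ic_eq by blast
qed

definition supported :: "'l tensors \<Rightarrow> bool" where
  "supported f \<longleftrightarrow> Poly_Mapping.keys f \<subseteq> carrier U \<times> UNIV"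

lemma V_carrier: "v \<in> carrier V \<longleftrightarrow> (\<exists>f. supported f \<and> v = ic f)"
  by (auto simp: induced_module_def quotient_module_def A_RCOSETS_def' induced_class_def supported_def pretensor_module_def)

lemma V_add: "ic f \<oplus>\<^bsub>V\<^esub> ic g = ic (f + g)"
proof -
  have "ic f \<oplus>\<^bsub>V\<^esub> ic g = {x + y | x y. x \<in> ic f \<and> y \<in> ic g}"
    by (auto simp: induced_module_def quotient_module_def set_add_def' pretensor_module_def)
  also have "\<dots> = ic (f + g)"
  proof (intro equalityI subsetI)
    fix z assume "z \<in> {x + y | x y. x \<in> ic f \<and> y \<in> ic g}"
    then obtain x y where "x \<in> J" "y \<in> J" "z = (x + y) + (f + g)"
      unfolding ic_eq by (auto simp: algebra_simps)
    then show "z \<in> ic (f + g)" unfolding ic_eq using J_add by blast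
  next
    fix z assume "z \<in> ic (f + g)"
    then obtain x where x: "x \<in> J" "z = (x + f) + (0 + g)" unfolding ic_eq by (auto simp: algebra_simps)
    then have "x + f \<in> ic f" "0 + g \<in> ic g" unfolding ic_eq using J_0 by blast+
    then show "z \<in> {x + y | x y. x \<in> ic f \<and> y \<in> ic g}" using x(2) by blast
  qed
  finally show ?thesis .
qed

lemma V_smult: "c \<odot>\<^bsub>V\<^esub> ic f = ic (fs c f)"
proof -
  have e: "c \<odot>\<^bsub>V\<^esub> ic f = (\<Union>x\<in>ic f. ic (fs c x))"
    by (simp add: induced_module_def quotient_module_def induced_class_def) (simp add: pretensor_module_def)
  have "ic (fs c x) = ic (fs c f)" if "x \<in> ic f" for x
  proof -
    have "fs c x - fs c f = fs c (x - f)" by (simp add: VT.scale_right_diff_distrib)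
    moreover have "x - f \<in> J" using that unfolding ic_eq by auto
    ultimately show ?thesis unfolding ic_eq_iff using J_scale by simp
  qed
  then have "(\<Union>x\<in>ic f. ic (fs c x)) = (\<Union>x\<in>ic f. ic (fs c f))" by (rule SUP_cong[OF refl])
  also have "\<dots> = ic (fs c f)" using ic_self[of f] by blast
  finally show ?thesis unfolding e .
qed

lemma ic_add_left: "u \<in> carrier U \<Longrightarrow> v \<in> carrier U \<Longrightarrow> ic (pure (u \<oplus>\<^bsub>U\<^esub> v) z) = ic (pure u z + pure v z)"
  unfolding ic_eq_iff by (rule J_rels) (auto simp: rels_def diff_diff_eq)

lemma ic_scalar: "u \<in> carrier U \<Longrightarrow> ic (pure (cl (scalar c) \<otimes>\<^bsub>U\<^esub> u) z) = ic (fs c (pure u z))"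
  unfolding ic_eq_iff by (rule J_rels) (auto simp: rels_def)

lemma ic_scale_right: "u \<in> carrier U \<Longrightarrow> ic (pure u (c * z)) = ic (fs c (pure u z))"
  unfolding ic_eq_iff by (rule J_rels) (auto simp: rels_def)

lemma ic_balanced: "u \<in> carrier U \<Longrightarrow> b \<in> P \<Longrightarrow> ic (pure (u \<otimes>\<^bsub>U\<^esub> cl (letter b)) z) = ic (pure u (\<chi> b * z))"
  unfolding ic_eq_iff by (rule J_rels) (auto simp: rels_def)

subsection \<open>The action\<close>

definition lmul :: "'l free_algebra \<Rightarrow> 'l tensors \<Rightarrow> 'l tensors" where
  "lmul t = VT.lext (\<lambda>(u, z). pure (cl t \<otimes>\<^bsub>U\<^esub> u) z)"

lemma lmul_add: "lmul t (f + g) = lmul t f + lmul t g" by (simp add: lmul_def VT.lext_add)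
lemma lmul_diff: "lmul t (f - g) = lmul t f - lmul t g" by (simp add: lmul_def VT.lext_diff)
lemma lmul_scale: "lmul t (fs c f) = fs c (lmul t f)"
  unfolding lmul_def by (rule VT.lext_scale) (rule lookup_fin_scale)
lemma lmul_single: "lmul t (Poly_Mapping.single (u, z) c) = fs c (pure (cl t \<otimes>\<^bsub>U\<^esub> u) z)"
  by (simp add: lmul_def)
lemma lmul_pure: "lmul t (pure u z) = pure (cl t \<otimes>\<^bsub>U\<^esub> u) z"
  by (simp add: lmul_single)
lemma lmul_0: "lmul t 0 = 0" by (simp add: lmul_def)

text \<open>
  Left multiplication preserves the relations, because it commutes with the right action of \<open>P\<close>.
\<close>

lemma lmul_J: assumes "f \<in> J" shows "lmul t f \<in> J"
  using assms unfolding J_eq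
proof (induction f rule: VT.span_induct_alt)
  case base
  then show ?case using J_0 by (simp add: lmul_0 J_eq)
next
  case (step c x y)
  have "lmul t x \<in> rels"
  proof -
    have m: "cl t \<otimes>\<^bsub>U\<^esub> u \<in> carrier U" if "u \<in> carrier U" for u
      using that by (auto simp: U_carrier cl_mult)
    have d: "cl t \<otimes>\<^bsub>U\<^esub> (u \<oplus>\<^bsub>U\<^esub> v) = (cl t \<otimes>\<^bsub>U\<^esub> u) \<oplus>\<^bsub>U\<^esub> (cl t \<otimes>\<^bsub>U\<^esub> v)" if "u \<in> carrier U" "v \<in> carrier U" for u v
      using that by (auto simp: U_carrier cl_mult cl_add distrib_left)
    have sc: "cl t \<otimes>\<^bsub>U\<^esub> (cl (scalar c) \<otimes>\<^bsub>U\<^esub> u) = cl (scalar c) \<otimes>\<^bsub>U\<^esub> (cl t \<otimes>\<^bsub>U\<^esub> u)" if "u \<in> carrier U" for u c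
    proof -
      obtain t' where u: "u = cl t'" using \<open>u \<in> carrier U\<close> by (auto simp: U_carrier)
      have "t * (scalar c * t') = scalar c * (t * t')" by (metis mult.assoc scalar_commute)
      then show ?thesis by (simp only: u cl_mult)
    qed
    have a: "cl t \<otimes>\<^bsub>U\<^esub> (u \<otimes>\<^bsub>U\<^esub> cl (letter b)) = (cl t \<otimes>\<^bsub>U\<^esub> u) \<otimes>\<^bsub>U\<^esub> cl (letter b)" if "u \<in> carrier U" for u b
      using that by (auto simp: U_carrier cl_mult mult.assoc)
    consider (1) u v z where "u \<in> carrier U" "v \<in> carrier U" "x = pure (u \<oplus>\<^bsub>U\<^esub> v) z - pure u z - pure v z"
      | (2) u y z where "u \<in> carrier U" "x = pure u (y + z) - pure u y - pure u z"
      | (3) c u z where "u \<in> carrier U" "x = pure (cl (scalar c) \<otimes>\<^bsub>U\<^esub> u) z - fs c (pure u z)"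
      | (4) c u z where "u \<in> carrier U" "x = pure u (c * z) - fs c (pure u z)"
      | (5) u b z where "u \<in> carrier U" "b \<in> P" "x = pure (u \<otimes>\<^bsub>U\<^esub> cl (letter b)) z - pure u (\<chi> b * z)"
      using step(1) unfolding rels_def by blast
    then show ?thesis
    proof cases
      case 1
      have "lmul t x = pure ((cl t \<otimes>\<^bsub>U\<^esub> u) \<oplus>\<^bsub>U\<^esub> (cl t \<otimes>\<^bsub>U\<^esub> v)) z - pure (cl t \<otimes>\<^bsub>U\<^esub> u) z - pure (cl t \<otimes>\<^bsub>U\<^esub> v) z"
        unfolding 1(3) lmul_diff lmul_pure d[OF 1(1,2)] ..
      then show ?thesis using m[OF 1(1)] m[OF 1(2)] unfolding rels_def by blast
    next
      case 2
      have "lmul t x = pure (cl t \<otimes>\<^bsub>U\<^esub> u) (y + z) - pure (cl t \<otimes>\<^bsub>U\<^esub> u) y - pure (cl t \<otimes>\<^bsub>U\<^esub> u) z"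
        unfolding 2(2) lmul_diff lmul_pure ..
      then show ?thesis using m[OF 2(1)] unfolding rels_def by blast
    next
      case 3
      have "lmul t x = pure (cl (scalar c) \<otimes>\<^bsub>U\<^esub> (cl t \<otimes>\<^bsub>U\<^esub> u)) z - fs c (pure (cl t \<otimes>\<^bsub>U\<^esub> u) z)"
        unfolding 3(2) lmul_diff lmul_scale lmul_pure sc[OF 3(1)] ..
      then show ?thesis using m[OF 3(1)] unfolding rels_def by blast
    next
      case 4
      have "lmul t x = pure (cl t \<otimes>\<^bsub>U\<^esub> u) (c * z) - fs c (pure (cl t \<otimes>\<^bsub>U\<^esub> u) z)"
        unfolding 4(2) lmul_diff lmul_scale lmul_pure ..
      then show ?thesis using m[OF 4(1)] unfolding rels_def by blast
    next
      case 5
      have "lmul t x = pure ((cl t \<otimes>\<^bsub>U\<^esub> u) \<otimes>\<^bsub>U\<^esub> cl (letter b)) z - pure (cl t \<otimes>\<^bsub>U\<^esub> u) (\<chi> b * z)"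
        unfolding 5(3) lmul_diff lmul_pure a[OF 5(1)] ..
      then show ?thesis using m[OF 5(1)] 5(2) unfolding rels_def by blast
    qed
  qed
  then show ?case unfolding lmul_add lmul_scale
    by (rule VT.span_add[OF VT.span_scale[OF VT.span_base] step(2)])
qed

abbreviation ia where "ia \<equiv> induced_action s br P \<chi>"

lemma ia_ic: "ia x (ic f) = ic (lmul (letter x) f)"
proof -
  have "(\<Sum>(u, z)\<in>Poly_Mapping.keys g. fs (Poly_Mapping.lookup g (u, z)) (pure (cl (letter x) \<otimes>\<^bsub>U\<^esub> u) z)) = lmul (letter x) g" for g
    unfolding lmul_def VT.lext_def by (rule sum.cong) auto
  then have e: "ia x (ic f) = (\<Union>g\<in>ic f. ic (lmul (letter x) g))"
    by (simp only: induced_action_def)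
  have "ic (lmul (letter x) g) = ic (lmul (letter x) f)" if "g \<in> ic f" for g
  proof -
    have "g - f \<in> J" using that unfolding ic_eq by auto
    from lmul_J[OF this] show ?thesis unfolding ic_eq_iff lmul_diff[symmetric] .
  qed
  then have "(\<Union>g\<in>ic f. ic (lmul (letter x) g)) = (\<Union>g\<in>ic f. ic (lmul (letter x) f))" by (rule SUP_cong[OF refl])
  also have "\<dots> = ic (lmul (letter x) f)" using ic_self[of f] by blast
  finally show ?thesis unfolding e .
qed

definition vac where "vac = ic (pure \<one>\<^bsub>U\<^esub> 1)"

definition wd_class :: "'l free_algebra \<Rightarrow> 'l tensors set" where
  "wd_class t = ic (pure (cl t) 1)"

lemma supported_pure: "supported (pure (cl t) z)" by (simp add: supported_def)

lemma wd_class_carrier [simp]: "wd_class t \<in> carrier V"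
  unfolding wd_class_def V_carrier using supported_pure by blast

lemma wd_class_add: "wd_class (t + t') = wd_class t \<oplus>\<^bsub>V\<^esub> wd_class t'"
  unfolding wd_class_def cl_add[symmetric] V_add by (rule ic_add_left) auto

lemma wd_class_scalar: "wd_class (scalar c * t) = c \<odot>\<^bsub>V\<^esub> wd_class t"
  unfolding wd_class_def cl_mult[symmetric] V_smult by (rule ic_scalar) auto

lemma wd_class_letter: "wd_class (letter x * t) = ia x (wd_class t)"
  unfolding wd_class_def ia_ic lmul_pure cl_mult ..

lemma wd_class_1: "wd_class 1 = vac"
  by (simp add: wd_class_def vac_def cl_one)

lemma vac_carrier [simp]: "vac \<in> carrier V"
  unfolding wd_class_1[symmetric] by simp

lemma V_zero: "\<zero>\<^bsub>V\<^esub> = ic 0"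
  by (auto simp: induced_module_def quotient_module_def ic_eq)

text \<open>
  Every vector is of the form \<open>t \<otimes> 1\<close> with \<open>t\<close> in the free algebra, so the module is spanned by the
  words in \<open>L\<close> applied to the vacuum.
\<close>

lemma V_wd_class: assumes "v \<in> carrier V" shows "\<exists>t. v = wd_class t"
proof -
  obtain f where f: "supported f" "v = ic f" using assms by (auto simp: V_carrier)
  have "supported f \<Longrightarrow> \<exists>t. ic f = wd_class t"
  proof (induction f rule: poly_mapping_add_induct)
    case 1
    have "wd_class (scalar 0 * 1) = ic (fs 0 (pure (cl 1) 1))" unfolding wd_class_scalar unfolding wd_class_def V_smult ..
    also have "fs 0 (pure (cl 1) 1) = 0" by simp
    finally show ?case by metis
  next
    case (2 f g)
    then have "supported f" "supported g" by (auto simp: supported_def)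
    then obtain t t' where "ic f = wd_class t" "ic g = wd_class t'" using 2 by blast
    then have "ic (f + g) = wd_class (t + t')" unfolding V_add[symmetric] wd_class_add by simp
    then show ?case ..
  next
    case (3 k c)
    obtain u z where k: "k = (u, z)" by (cases k)
    show ?case
    proof (cases "c = 0")
      case True
      have "wd_class (scalar 0 * 1) = ic (fs 0 (pure (cl 1) 1))" unfolding wd_class_scalar unfolding wd_class_def V_smult ..
      also have "fs 0 (pure (cl 1) 1) = 0" by simp
      finally show ?thesis using True by (metis single_zero)
    next
      case False
      then have "u \<in> carrier U" using 3 by (auto simp: supported_def k)
      then obtain t where t: "u = cl t" by (auto simp: U_carrier)
      have "ic (Poly_Mapping.single k c) = ic (fs c (pure u z))" by (simp add: k fin_scale_single)
      also have "\<dots> = c \<odot>\<^bsub>V\<^esub> ic (pure u (z * 1))" by (simp add: V_smult)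
      also have "ic (pure u (z * 1)) = z \<odot>\<^bsub>V\<^esub> wd_class t"
        unfolding wd_class_def V_smult t by (rule ic_scale_right) simp
      also have "c \<odot>\<^bsub>V\<^esub> \<dots> = wd_class (scalar c * (scalar z * t))" unfolding wd_class_scalar ..
      finally show ?thesis ..
    qed
  qed
  then show ?thesis using f by simp
qed

lemma single_word: "Poly_Mapping.single (Word (x # xs)) 1 = letter x * Poly_Mapping.single (Word xs) 1"
  by (simp add: letter_def mult_single)

lemma wd_class_induct:
  assumes vac: "Q vac" and add: "\<And>v w. v \<in> carrier V \<Longrightarrow> w \<in> carrier V \<Longrightarrow> Q v \<Longrightarrow> Q w \<Longrightarrow> Q (v \<oplus>\<^bsub>V\<^esub> w)"
    and smult: "\<And>c v. v \<in> carrier V \<Longrightarrow> Q v \<Longrightarrow> Q (c \<odot>\<^bsub>V\<^esub> v)"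
    and act: "\<And>x v. v \<in> carrier V \<Longrightarrow> Q v \<Longrightarrow> Q (ia x v)"
    and v: "v \<in> carrier V"
  shows "Q v"
proof -
  have word: "Q (wd_class (Poly_Mapping.single (Word xs) 1))" for xs
  proof (induction xs)
    case Nil
    have "Poly_Mapping.single (Word []) 1 = (1 :: 'l free_algebra)" by (simp add: zero_word_def[symmetric])
    then show ?case using vac by (simp add: wd_class_1)
  next
    case (Cons x xs)
    then show ?case unfolding single_word wd_class_letter by (intro act) auto
  qed
  have "Q (wd_class t)" for t
  proof (induction t rule: poly_mapping_add_induct)
    case 1
    have "wd_class 0 = 0 \<odot>\<^bsub>V\<^esub> wd_class 1" unfolding wd_class_scalar[symmetric] by (simp add: scalar_def)
    then show ?case using smult[OF _ vac, of 0] by (simp add: wd_class_1)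
  next
    case (2 f g)
    then show ?case unfolding wd_class_add by (intro add) auto
  next
    case (3 k c)
    obtain xs where k: "k = Word xs" by (cases k)
    have "Poly_Mapping.single k c = scalar c * Poly_Mapping.single (Word xs) 1" by (simp add: k scalar_mult_single)
    then show ?case unfolding wd_class_scalar[symmetric] using smult[OF wd_class_carrier word, of c xs]
      by (simp add: wd_class_scalar)
  qed
  then show ?thesis using V_wd_class[OF v] by blast
qed

lemma ia_carrier: "v \<in> carrier V \<Longrightarrow> ia x v \<in> carrier V"
  using V_wd_class wd_class_letter wd_class_carrier by metis

lemma wd_class_cong: "cl t = cl t' \<Longrightarrow> wd_class t = wd_class t'"
  by (simp add: wd_class_def)

lemma cl_mult_cong: "cl t = cl t' \<Longrightarrow> cl (t * r) = cl (t' * r)"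
  by (metis cl_mult)

lemma ia_add_left: "v \<in> carrier V \<Longrightarrow> ia (x + y) v = ia x v \<oplus>\<^bsub>V\<^esub> ia y v"
proof -
  assume "v \<in> carrier V"
  then obtain t where t: "v = wd_class t" using V_wd_class by blast
  have "wd_class (letter (x + y) * t) = wd_class ((letter x + letter y) * t)"
    by (intro wd_class_cong cl_mult_cong cl_letter_add)
  then show ?thesis by (simp add: t wd_class_letter distrib_right wd_class_add)
qed

lemma ia_scale_left: "v \<in> carrier V \<Longrightarrow> ia (s c x) v = c \<odot>\<^bsub>V\<^esub> ia x v"
proof -
  assume "v \<in> carrier V"
  then obtain t where t: "v = wd_class t" using V_wd_class by blast
  have "wd_class (letter (s c x) * t) = wd_class ((scalar c * letter x) * t)"
    by (intro wd_class_cong cl_mult_cong cl_letter_scale)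
  then show ?thesis by (simp add: t wd_class_letter wd_class_scalar mult.assoc)
qed

lemma ia_add_right: "v \<in> carrier V \<Longrightarrow> w \<in> carrier V \<Longrightarrow> ia x (v \<oplus>\<^bsub>V\<^esub> w) = ia x v \<oplus>\<^bsub>V\<^esub> ia x w"
proof -
  assume "v \<in> carrier V" "w \<in> carrier V"
  then obtain t t' where t: "v = wd_class t" "w = wd_class t'" using V_wd_class by metis
  show ?thesis unfolding t wd_class_add[symmetric] wd_class_letter[symmetric] distrib_left ..
qed

lemma ia_scale_right: "v \<in> carrier V \<Longrightarrow> ia x (c \<odot>\<^bsub>V\<^esub> v) = c \<odot>\<^bsub>V\<^esub> ia x v"
proof -
  assume "v \<in> carrier V"
  then obtain t where t: "v = wd_class t" using V_wd_class by metis
  have "letter x * (scalar c * t) = scalar c * (letter x * t)"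
    by (metis mult.assoc scalar_commute)
  then show ?thesis unfolding t wd_class_scalar[symmetric] wd_class_letter[symmetric] by simp
qed

lemma ia_vac: assumes "b \<in> P" shows "ia b vac = \<chi> b \<odot>\<^bsub>V\<^esub> vac"
proof -
  have "ia b vac = ic (pure (cl 1 \<otimes>\<^bsub>U\<^esub> cl (letter b)) 1)"
    unfolding vac_def ia_ic lmul_pure cl_one cl_mult by simp
  also have "\<dots> = ic (pure (cl 1) (\<chi> b * 1))" by (rule ic_balanced) (auto simp: assms)
  also have "\<dots> = ic (fs (\<chi> b) (pure (cl 1) 1))" by (rule ic_scale_right) auto
  finally show ?thesis unfolding vac_def V_smult cl_one .
qed

lemma ia_commute: assumes v: "v \<in> carrier V" and br: "br x y = 0" shows "ia x (ia y v) = ia y (ia x v)"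
proof -
  obtain t where t: "v = wd_class t" using V_wd_class[OF v] by blast
  have "letter x * letter y - letter y * letter x - letter (br x y) \<in> I" by (rule gens_I) (unfold gens_def, blast)
  moreover have "letter 0 \<in> I"
  proof -
    have "letter (0 + 0) - letter 0 - letter 0 \<in> gens" unfolding gens_def by blast
    from I_uminus[OF gens_I[OF this]] show ?thesis by simp
  qed
  ultimately have "letter x * letter y - letter y * letter x - letter 0 + letter 0 \<in> I"
    using I_add br by metis
  then have "cl (letter x * letter y) = cl (letter y * letter x)" by (simp add: cl_eq_iff)
  then have "wd_class (letter x * letter y * t) = wd_class (letter y * letter x * t)"
    by (intro wd_class_cong cl_mult_cong)
  then show ?thesis by (simp add: t wd_class_letter mult.assoc)
qed

end

section \<open>The universal property of induced modules\<close>

text \<open>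
  A vector \<open>e0\<close> on which \<open>P\<close> acts through \<open>\<chi>\<close>, in a space \<open>G\<close> on which the bracket relations
  hold.  The space \<open>G\<close> is only a subset of a type, since products of fields behave well only for fields
  that are quasi local to the generators.
\<close>

locale induced_map = induced s br P \<chi> + E: complex_space sE
  for s :: "complex \<Rightarrow> 'l \<Rightarrow> 'l::ab_group_add" and br P \<chi> and sE :: "complex \<Rightarrow> 'e \<Rightarrow> 'e::ab_group_add" +
  fixes G :: "'e set" and act :: "'l \<Rightarrow> 'e \<Rightarrow> 'e" and e0 :: 'e
  assumes G0: "0 \<in> G" and G_add: "\<And>e e'. e \<in> G \<Longrightarrow> e' \<in> G \<Longrightarrow> e + e' \<in> G"
    and G_scale: "\<And>c e. e \<in> G \<Longrightarrow> sE c e \<in> G" and e0: "e0 \<in> G"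
    and act_G: "\<And>x e. e \<in> G \<Longrightarrow> act x e \<in> G"
    and act_add: "\<And>x e e'. e \<in> G \<Longrightarrow> e' \<in> G \<Longrightarrow> act x (e + e') = act x e + act x e'"
    and act_scale: "\<And>x c e. e \<in> G \<Longrightarrow> act x (sE c e) = sE c (act x e)"
    and act_add_left: "\<And>x y e. e \<in> G \<Longrightarrow> act (x + y) e = act x e + act y e"
    and act_scale_left: "\<And>c x e. e \<in> G \<Longrightarrow> act (s c x) e = sE c (act x e)"
    and act_bracket: "\<And>x y e. e \<in> G \<Longrightarrow> act (br x y) e = act x (act y e) - act y (act x e)"
    and act_e0: "\<And>b. b \<in> P \<Longrightarrow> act b e0 = sE (\<chi> b) e0"
begin

fun word_act :: "'l word \<Rightarrow> 'e \<Rightarrow> 'e" where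
  "word_act (Word xs) e = foldr act xs e"

definition alg_act :: "'l free_algebra \<Rightarrow> 'e \<Rightarrow> 'e" where
  "alg_act t e = E.lext (\<lambda>wd. word_act wd e) t"

lemma G_sum: "(\<And>i. i \<in> S \<Longrightarrow> g i \<in> G) \<Longrightarrow> sum g S \<in> G"
  by (induction S rule: infinite_finite_induct) (auto simp: G0 G_add)

lemma word_act_G: "e \<in> G \<Longrightarrow> word_act wd e \<in> G"
proof (cases wd)
  case (Word xs)
  assume "e \<in> G"
  then have "foldr act xs e \<in> G" by (induction xs) (auto simp: act_G)
  then show ?thesis by (simp add: Word)
qed

lemma word_act_plus: "word_act (wd + wd') e = word_act wd (word_act wd' e)"
  by (cases wd; cases wd') simp

lemma word_act_add: "e \<in> G \<Longrightarrow> e' \<in> G \<Longrightarrow> word_act wd (e + e') = word_act wd e + word_act wd e'"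
proof (cases wd)
  case (Word xs)
  assume G: "e \<in> G" "e' \<in> G"
  have "foldr act xs (e + e') = foldr act xs e + foldr act xs e'"
  proof (induction xs)
    case (Cons x xs)
    have "foldr act xs e \<in> G" "foldr act xs e' \<in> G" using word_act_G[of _ "Word xs"] G by simp_all
    then show ?case using Cons by (simp add: act_add)
  qed simp
  then show ?thesis by (simp add: Word)
qed

lemma word_act_scale: "e \<in> G \<Longrightarrow> word_act wd (sE c e) = sE c (word_act wd e)"
proof (cases wd)
  case (Word xs)
  assume G: "e \<in> G"
  have "foldr act xs (sE c e) = sE c (foldr act xs e)"
  proof (induction xs)
    case (Cons x xs)
    have "foldr act xs e \<in> G" using word_act_G[of _ "Word xs"] G by simp
    then show ?case using Cons by (simp add: act_scale)
  qed simp
  then show ?thesis by (simp add: Word)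
qed

lemma alg_act_G: "e \<in> G \<Longrightarrow> alg_act t e \<in> G"
  unfolding alg_act_def E.lext_def by (intro G_sum G_scale word_act_G)

lemma alg_act_add_left: "alg_act (t + t') e = alg_act t e + alg_act t' e"
  by (simp add: alg_act_def E.lext_add)
lemma alg_act_diff_left: "alg_act (t - t') e = alg_act t e - alg_act t' e"
  by (simp add: alg_act_def E.lext_diff)
lemma alg_act_single: "alg_act (Poly_Mapping.single wd c) e = sE c (word_act wd e)"
  by (simp add: alg_act_def)
lemma alg_act_letter: "alg_act (letter x) e = act x e"
  by (simp add: letter_def alg_act_single)
lemma alg_act_0_left: "alg_act 0 e = 0"
  by (simp add: alg_act_def)
lemma alg_act_scalar: "alg_act (scalar c) e = sE c e"
  by (simp add: scalar_def alg_act_single zero_word_def)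

lemma alg_act_add: "e \<in> G \<Longrightarrow> e' \<in> G \<Longrightarrow> alg_act t (e + e') = alg_act t e + alg_act t e'"
  unfolding alg_act_def E.lext_def by (simp add: word_act_add E.scale_right_distrib sum.distrib)
lemma alg_act_scale: "e \<in> G \<Longrightarrow> alg_act t (sE c e) = sE c (alg_act t e)"
  unfolding alg_act_def E.lext_def by (simp add: word_act_scale E.scale_sum_right mult.commute)
lemma alg_act_0: "alg_act t 0 = 0"
  using alg_act_add[OF G0 G0, of t] by simp

lemma alg_act_mult: assumes "e \<in> G" shows "alg_act (t * t') e = alg_act t (alg_act t' e)"
proof (induction t rule: poly_mapping_add_induct)
  case 1
  then show ?case by (simp add: alg_act_0_left)
next
  case (2 f g)
  then show ?case by (simp add: distrib_right alg_act_add_left)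
next
  case (3 k c)
  show ?case
  proof (induction t' rule: poly_mapping_add_induct)
    case 1
    then show ?case by (simp add: alg_act_0_left alg_act_0)
  next
    case (2 f g)
    then show ?case by (simp add: distrib_left alg_act_add_left alg_act_add alg_act_G assms)
  next
    case (3 l d)
    then show ?case by (simp add: mult_single alg_act_single word_act_plus word_act_scale word_act_G assms)
  qed
qed

text \<open>
  The elements of the free algebra that act by zero on \<open>G\<close> form an ideal, and it contains the relations.
\<close>

lemma alg_act_I: assumes t: "t \<in> I" and e: "e \<in> G" shows "alg_act t e = 0"
proof -
  let ?K = "{t. \<forall>e\<in>G. alg_act t e = 0}"
  have "ideal ?K R"
  proof (rule idealI[OF ring_of_type_algebra_ring])
    show "subgroup ?K (add_monoid R)"
    proof (rule group.subgroupI)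
      show "Group.group (add_monoid R)" by (rule R.a_group)
      show "?K \<noteq> {}" using alg_act_0_left by blast
      fix a assume a: "a \<in> ?K"
      have "inv\<^bsub>add_monoid R\<^esub> a = - a"
        using R.minus_equality[of "- a" a] by (simp add: R_simps a_inv_def)
      moreover have "- a \<in> ?K" using a alg_act_diff_left[of 0 a] by (simp add: alg_act_0_left)
      ultimately show "inv\<^bsub>add_monoid R\<^esub> a \<in> ?K" by simp
    qed (auto simp: R_simps alg_act_add_left)
  qed (auto simp: R_simps alg_act_mult alg_act_G alg_act_0)
  moreover have "gens \<subseteq> ?K"
    unfolding gens_def
    by (auto simp: alg_act_diff_left alg_act_letter act_add_left act_scale_left alg_act_mult alg_act_scalar act_bracket)
  ultimately have "I \<subseteq> ?K" unfolding I_gens by (rule R.genideal_minimal)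
  then show ?thesis using assms by blast
qed

definition coset_act :: "'l free_algebra set \<Rightarrow> 'e" where
  "coset_act u = alg_act (SOME t. t \<in> u) e0"

lemma coset_act_cl: "coset_act (cl t) = alg_act t e0"
proof -
  have "(SOME t'. t' \<in> cl t) \<in> cl t" by (rule someI[of _ t]) (rule cl_self)
  then obtain x where x: "x \<in> I" "(SOME t'. t' \<in> cl t) = x + t" unfolding cl_eq by blast
  then show ?thesis by (simp add: coset_act_def alg_act_add_left alg_act_I[OF x(1) e0])
qed

text \<open>
  The action on \<open>e0\<close> as a map on tensors.  It serves to show that the element \<open>t\<close> chosen in \<open>ind_map\<close>
  for a vector \<open>t \<otimes> 1\<close> does not matter.
\<close>

definition tensor_act :: "'l tensors \<Rightarrow> 'e" where
  "tensor_act = E.lext (\<lambda>(u, z). sE z (coset_act u))"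

lemma tensor_act_J: "f \<in> J \<Longrightarrow> tensor_act f = 0"
  unfolding J_eq
proof (induction f rule: VT.span_induct_alt)
  case base
  then show ?case by (simp add: tensor_act_def)
next
  case (step c x y)
  have p: "tensor_act (pure u z) = sE z (coset_act u)" for u z by (simp add: tensor_act_def)
  have d: "tensor_act (f - g) = tensor_act f - tensor_act g" for f g by (simp add: tensor_act_def E.lext_diff)
  have a: "tensor_act (f + g) = tensor_act f + tensor_act g" for f g by (simp add: tensor_act_def E.lext_add)
  have sc: "tensor_act (fs c f) = sE c (tensor_act f)" for c f
    unfolding tensor_act_def by (rule E.lext_scale) (rule lookup_fin_scale)
  have "tensor_act x = 0"
    using step(1) unfolding rels_def
    by (auto simp: U_carrier d p sc cl_add cl_mult coset_act_cl alg_act_add_left alg_act_mult e0 alg_act_scalar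
        alg_act_letter act_e0 alg_act_scale E.scale_right_distrib E.scale_left_distrib mult.commute)
  then show ?case using step by (simp add: a sc)
qed

definition ind_map :: "'l tensors set \<Rightarrow> 'e" where
  "ind_map v = alg_act (SOME t. v = wd_class t) e0"

lemma ind_map_wd_class: "ind_map (wd_class t) = alg_act t e0"
proof -
  let ?t = "SOME t'. wd_class t = wd_class t'"
  have "wd_class t = wd_class ?t" by (rule someI[of _ t]) (rule refl)
  then have "pure (cl t) 1 - pure (cl ?t) 1 \<in> J" by (simp add: wd_class_def ic_eq_iff)
  from tensor_act_J[OF this] show ?thesis
    by (simp add: ind_map_def tensor_act_def E.lext_diff coset_act_cl)
qed

text \<open>
  The universal property: the vacuum goes to \<open>e0\<close>, compatibly with the actions.
\<close>

theorem ind_map_properties: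
  shows "v \<in> carrier V \<Longrightarrow> ind_map v \<in> G"
    and "v \<in> carrier V \<Longrightarrow> w \<in> carrier V \<Longrightarrow> ind_map (v \<oplus>\<^bsub>V\<^esub> w) = ind_map v + ind_map w"
    and "v \<in> carrier V \<Longrightarrow> ind_map (c \<odot>\<^bsub>V\<^esub> v) = sE c (ind_map v)"
    and "v \<in> carrier V \<Longrightarrow> ind_map (ia x v) = act x (ind_map v)"
    and "ind_map vac = e0"
proof -
  show "v \<in> carrier V \<Longrightarrow> ind_map v \<in> G"
    using V_wd_class ind_map_wd_class alg_act_G[OF e0] by metis
  show "v \<in> carrier V \<Longrightarrow> w \<in> carrier V \<Longrightarrow> ind_map (v \<oplus>\<^bsub>V\<^esub> w) = ind_map v + ind_map w"
    using V_wd_class ind_map_wd_class alg_act_add_left wd_class_add by metis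
  show "v \<in> carrier V \<Longrightarrow> ind_map (c \<odot>\<^bsub>V\<^esub> v) = sE c (ind_map v)"
    using V_wd_class ind_map_wd_class alg_act_mult[OF e0] alg_act_scalar wd_class_scalar by metis
  show "v \<in> carrier V \<Longrightarrow> ind_map (ia x v) = act x (ind_map v)"
    using V_wd_class ind_map_wd_class alg_act_mult[OF e0] alg_act_letter wd_class_letter by metis
  show "ind_map vac = e0"
    using ind_map_wd_class[of 1] alg_act_scalar[of 1 e0] by (simp add: wd_class_1 scalar_1)
qed

end

section \<open>The generating fields of a restricted module\<close>

lemma power_int_eq_1_iff:
  assumes "q \<noteq> 0" "\<And>n::nat. n > 0 \<Longrightarrow> q ^ n \<noteq> (1::complex)"
  shows "q powi j = 1 \<longleftrightarrow> j = 0"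
proof -
  have "q powi j \<noteq> 1" if "j \<noteq> 0"
  proof (cases "j > 0")
    case True
    then have "q powi j = q ^ nat j" by (simp add: power_int_def)
    then show ?thesis using assms(2)[of "nat j"] True by simp
  next
    case False
    then have "q powi j = inverse (q ^ nat (- j))" using that by (simp add: power_int_def power_inverse)
    then show ?thesis using assms(2)[of "nat (- j)"] False that by simp
  qed
  then show ?thesis by auto
qed

lemma sum_list_sorted_keys: "(\<Sum>m\<leftarrow>sorted_list_of_set (Poly_Mapping.keys F). f m) = (\<Sum>m\<in>Poly_Mapping.keys F. f m)"
  for f :: "int \<Rightarrow> 'b::comm_monoid_add"
  by (subst sum_list_distinct_conv_sum_set) simp_all

lemma mode_add: "mode (a + b) n = mode a n + mode b n"
  by (simp add: mode_def single_add)

locale quasi_heisenberg_module = formal_series sW + H: vector_space sh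
  for sW :: "complex \<Rightarrow> 'w::ab_group_add \<Rightarrow> 'w" (infixr "*s" 75) and sh :: "complex \<Rightarrow> 'h::ab_group_add \<Rightarrow> 'h" +
  fixes B :: "'h \<Rightarrow> 'h \<Rightarrow> complex" and q :: complex and lev :: complex and \<rho> :: "'h loop_ext \<Rightarrow> 'w \<Rightarrow> 'w"
  assumes sym: "symmetric_bilinear sh B" and q_nz: "q \<noteq> 0" and q_power: "\<And>n::nat. n > 0 \<Longrightarrow> q ^ n \<noteq> 1"
    and module: "lie_module (loop_scale sh) (hq_bracket B q) sW \<rho>"
    and restricted: "restricted \<rho>" and level: "has_level sW \<rho> lev"
begin

lemma lookup_scale: "Poly_Mapping.lookup (fin_scale sh c F) m = sh c (Poly_Mapping.lookup F m)" for F :: "'i \<Rightarrow>\<^sub>0 'h"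
  by (simp add: fin_scale_def Poly_Mapping.map.rep_eq when_def)

lemma fin_scale_0: "fin_scale sh c 0 = (0 :: 'i \<Rightarrow>\<^sub>0 'h)"
  by (rule poly_mapping_eqI) (simp add: lookup_scale)

lemma lookup_scale2:
  "Poly_Mapping.lookup (fin_scale (fin_scale sh) c F) m = fin_scale sh c (Poly_Mapping.lookup F m)" for F :: "'i \<Rightarrow>\<^sub>0 'j \<Rightarrow>\<^sub>0 'h"
  by (simp add: fin_scale_0 fin_scale_def[of "fin_scale sh"] Poly_Mapping.map.rep_eq when_def)

lemma fin_scale_single_h: "fin_scale sh c (Poly_Mapping.single m a) = Poly_Mapping.single m (sh c a)"
  by (rule poly_mapping_eqI) (simp add: lookup_scale lookup_single when_def)

lemma rho_add: "\<rho> x (w + w') = \<rho> x w + \<rho> x w'" and rho_scale: "\<rho> x (c *s w) = c *s \<rho> x w"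
  and rho_add_left: "\<rho> (x + y) w = \<rho> x w + \<rho> y w" and rho_scale_left: "\<rho> (loop_scale sh c x) w = c *s \<rho> x w"
  and rho_bracket: "\<rho> (hq_bracket B q x y) w = \<rho> x (\<rho> y w) - \<rho> y (\<rho> x w)"
  using module unfolding lie_module_def linear_iff_module_hom module_hom_iff by blast+

lemma B_0: "B 0 b = 0" "B a 0 = 0"
proof -
  have "Vector_Spaces.linear sh (*) (B a)" for a using sym by (auto simp: symmetric_bilinear_def)
  then have 0: "B a 0 = 0" for a unfolding linear_iff_module_hom by (rule module_hom.zero)
  show "B a 0 = 0" by (rule 0)
  have "B 0 b = B b 0" using sym by (simp only: symmetric_bilinear_def)
  then show "B 0 b = 0" using 0 by simp
qed

lemma twisted_0: "twisted_field q sW \<rho> 0 m k w = 0"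
proof -
  have "mode (0::'h) n = loop_scale sh 0 0" for n
    by (simp add: mode_def loop_scale_def fin_scale_0 zero_prod_def)
  then have "\<rho> (mode (0::'h) n) w = 0 *s \<rho> 0 w" for n by (simp only: rho_scale_left)
  then show ?thesis by (simp add: twisted_field_def field_of_def)
qed

lemma twisted_add: "twisted_field q sW \<rho> (a + b) m k w = twisted_field q sW \<rho> a m k w + twisted_field q sW \<rho> b m k w"
  by (simp add: twisted_field_def field_of_def mode_add rho_add_left scale_right_distrib)

lemma twisted_scale: "twisted_field q sW \<rho> (sh c a) m k w = c *s twisted_field q sW \<rho> a m k w"
proof -
  have "mode (sh c a) n = loop_scale sh c (mode a n)" for n
    by (simp add: mode_def loop_scale_def fin_scale_single_h)
  then show ?thesis by (simp add: twisted_field_def field_of_def rho_scale_left mult.commute)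
qed

lemma twisted_field_is_field: "is_field (twisted_field q sW \<rho> a m)"
proof (rule is_fieldI)
  fix w
  obtain N where N: "\<And>n. n \<ge> N \<Longrightarrow> \<rho> (mode a n) w = 0" using restricted unfolding restricted_def by metis
  show "\<exists>N. \<forall>k<N. twisted_field q sW \<rho> a m k w = 0"
    by (intro exI[of _ "- N"]) (simp add: twisted_field_def field_of_def N)
qed (simp_all add: twisted_field_def field_of_def rho_add rho_scale scale_right_distrib mult.commute)

lemma hq_bracket_mode:
  "hq_bracket B q (mode a m) (mode b n) = loop_scale sh (if m + n = 0 then of_int m * B a b * (q powi m + q powi (- m)) else 0) central"
  by (cases "a = 0"; cases "b = 0") (simp_all add: hq_bracket_def mode_def loop_scale_def central_def fin_scale_0 B_0)

text \<open>
  The relations of the deformed algebra contain \<open>q\<^sup>i + q\<^sup>-\<^sup>i\<close>, so the generating functions have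
  two double poles, at \<open>x\<^sub>1 = q\<^sup>n\<^sup>-\<^sup>m\<^sup>+\<^sup>1 x\<^sub>2\<close> and \<open>x\<^sub>1 = q\<^sup>n\<^sup>-\<^sup>m\<^sup>-\<^sup>1 x\<^sub>2\<close>.
\<close>

lemma twisted_commutator:
  "twisted_field q sW \<rho> a m k (twisted_field q sW \<rho> b n l w) - twisted_field q sW \<rho> b n l (twisted_field q sW \<rho> a m k w)
   = poles [(lev * B a b, q powi (n - m + 1)), (lev * B a b, q powi (n - m - 1))] k l *s w"
proof -
  define i j where "i = - k - 1" and "j = - l - 1"
  define u v where "u = q powi m * (q powi m) powi k" and "v = q powi n * (q powi n) powi l"
  have "twisted_field q sW \<rho> a m k (twisted_field q sW \<rho> b n l w) - twisted_field q sW \<rho> b n l (twisted_field q sW \<rho> a m k w)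
    = (u * v) *s (\<rho> (mode a i) (\<rho> (mode b j) w) - \<rho> (mode b j) (\<rho> (mode a i) w))"
    by (simp add: twisted_field_def field_of_def rho_scale i_def j_def u_def v_def scale_right_diff_distrib mult.commute)
  also have "\<dots> = (u * v) *s \<rho> (hq_bracket B q (mode a i) (mode b j)) w" by (simp only: rho_bracket)
  also have "\<dots> = (u * v * ((if i + j = 0 then of_int i * B a b * (q powi i + q powi (- i)) else 0) * lev)) *s w"
    using level by (simp add: hq_bracket_mode rho_scale_left has_level_def)
  also have "u * v * ((if i + j = 0 then of_int i * B a b * (q powi i + q powi (- i)) else 0) * lev)
    = poles [(lev * B a b, q powi (n - m + 1)), (lev * B a b, q powi (n - m - 1))] k l"
  proof (cases "k + l = - 2")
    case True
    have u: "u = q powi (m * (k + 1))" unfolding u_def power_int_mult[symmetric]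
      using q_nz by (simp add: power_int_add[symmetric] algebra_simps)
    have v: "v = q powi (n * (l + 1))" unfolding v_def power_int_mult[symmetric]
      using q_nz by (simp add: power_int_add[symmetric] algebra_simps)
    have l: "l + 1 = - (k + 1)" using True by simp
    have 1: "u * v * q powi i = (q powi (n - m + 1)) powi (- k - 1)" "u * v * q powi (- i) = (q powi (n - m - 1)) powi (- k - 1)"
      unfolding u v l i_def power_int_mult[symmetric] using q_nz
      by (simp_all add: power_int_add[symmetric] algebra_simps)
    have "i + j = 0" using True by (simp add: i_def j_def)
    then have "u * v * ((if i + j = 0 then of_int i * B a b * (q powi i + q powi (- i)) else 0) * lev)
      = lev * B a b * of_int i * (u * v * q powi i + u * v * q powi (- i))" by (simp add: algebra_simps)
    then show ?thesis unfolding 1 using True by (simp add: poles_def pole_def i_def distrib_left mult.assoc)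
  next
    case False
    then show ?thesis by (simp add: poles_def pole_def i_def j_def)
  qed
  finally show ?thesis .
qed

text \<open>
  The field assigned to an element of \<open>\<hh>[\<int>]\<close>, the linear extension of \<open>a \<otimes> e\<^sup>m \<mapsto> a\<^sub>W(m, x)\<close>.
\<close>

definition gen :: "(int \<Rightarrow>\<^sub>0 'h) \<Rightarrow> int \<Rightarrow> 'w \<Rightarrow> 'w" where
  "gen F k w = (\<Sum>m\<in>Poly_Mapping.keys F. twisted_field q sW \<rho> (Poly_Mapping.lookup F m) m k w)"

lemma gen_superset:
  "finite S \<Longrightarrow> Poly_Mapping.keys F \<subseteq> S \<Longrightarrow> gen F k w = (\<Sum>m\<in>S. twisted_field q sW \<rho> (Poly_Mapping.lookup F m) m k w)"
  unfolding gen_def by (rule sum.mono_neutral_left) (auto simp: in_keys_iff twisted_0)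

lemma gen_add: "gen (F + F') = gen F + gen F'"
proof (intro ext)
  fix k w
  have S: "finite (Poly_Mapping.keys F \<union> Poly_Mapping.keys F')" by simp
  show "gen (F + F') k w = (gen F + gen F') k w"
    using Poly_Mapping.keys_add[of F F'] by (simp add: gen_superset[OF S] lookup_add twisted_add sum.distrib)
qed

lemma gen_scale: "gen (fin_scale sh c F) = (\<lambda>k w. c *s gen F k w)"
proof (intro ext)
  fix k w
  have "Poly_Mapping.keys (fin_scale sh c F) \<subseteq> Poly_Mapping.keys F" by (auto simp: in_keys_iff lookup_scale)
  from gen_superset[OF finite_keys this] show "gen (fin_scale sh c F) k w = c *s gen F k w"
    by (simp add: gen_def lookup_scale twisted_scale scale_sum_right)
qed

lemma gen_0: "gen 0 = 0" by (simp add: fun_eq_iff gen_def)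

lemma gen_single: "gen (Poly_Mapping.single m a) = twisted_field q sW \<rho> a m"
  by (cases "a = 0") (simp_all add: fun_eq_iff gen_def twisted_0)

lemma gen_field: "is_field (gen F)"
proof (induction F rule: poly_mapping_add_induct)
  case 1
  show ?case unfolding gen_0 by (rule is_field_0)
next
  case (2 f g)
  then show ?case unfolding gen_add by (intro is_field_plus)
next
  case (3 m a)
  show ?case unfolding gen_single by (rule twisted_field_is_field)
qed

definition gen_poles :: "(int \<Rightarrow>\<^sub>0 'h) \<Rightarrow> (int \<Rightarrow>\<^sub>0 'h) \<Rightarrow> (complex \<times> complex) list" where
  "gen_poles F F' = concat (map (\<lambda>m. concat (map (\<lambda>n. let h = lev * B (Poly_Mapping.lookup F m) (Poly_Mapping.lookup F' n)
     in [(h, q powi (n - m + 1)), (h, q powi (n - m - 1))])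
     (sorted_list_of_set (Poly_Mapping.keys F')))) (sorted_list_of_set (Poly_Mapping.keys F)))"

lemma gen_poles_nonzero: "\<forall>(h, c)\<in>set (gen_poles F F'). c \<noteq> 0"
  using q_nz by (auto simp: gen_poles_def Let_def)

lemma poles_concat: "poles (concat (map f xs)) k l = (\<Sum>x\<leftarrow>xs. poles (f x) k l)"
  by (induction xs) (simp_all add: poles_def)

lemma gen_commutator: "gen F k (gen F' l w) - gen F' l (gen F k w) = poles (gen_poles F F') k l *s w"
proof -
  have "gen F k (gen F' l w) - gen F' l (gen F k w)
    = (\<Sum>m\<in>Poly_Mapping.keys F. \<Sum>n\<in>Poly_Mapping.keys F'.
         poles [(lev * B (Poly_Mapping.lookup F m) (Poly_Mapping.lookup F' n), q powi (n - m + 1)),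
           (lev * B (Poly_Mapping.lookup F m) (Poly_Mapping.lookup F' n), q powi (n - m - 1))] k l *s w)"
    unfolding gen_def field_sum[OF twisted_field_is_field]
    by (subst sum.swap[of _ "Poly_Mapping.keys F"]) (simp only: sum_subtractf[symmetric] twisted_commutator sum.swap[of _ "Poly_Mapping.keys F"])
  also have "\<dots> = poles (gen_poles F F') k l *s w"
    by (simp only: gen_poles_def poles_concat sum_list_sorted_keys Let_def scale_sum_left)
  finally show ?thesis .
qed

lemma gen_quasi_local: "\<exists>fs. quasi_local fs (gen F) (gen F')"
  using poles_quasi_local[OF gen_poles_nonzero gen_commutator] by blast

text \<open>
  As \<open>q\<close> is not a root of unity, a pole lies on the diagonal only if \<open>m - n = 1\<close> or \<open>n - m = 1\<close>.  This is
  where the form on \<open>\<hh>[\<int>]\<close> comes from.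
\<close>

lemma gen_poles_at_1: "(\<Sum>(h, c)\<leftarrow>gen_poles F F'. if c = 1 then h else 0) = lev * hZ_form B F F'"
proof -
  have c: "(\<Sum>(h, c)\<leftarrow>concat (map f xs). if c = 1 then h else 0) = (\<Sum>x\<leftarrow>xs. \<Sum>(h, c)\<leftarrow>f x. if c = 1 then h else 0)"
    for f :: "int \<Rightarrow> (complex \<times> complex) list" and xs
    by (induction xs) simp_all
  have 1: "q powi j = 1 \<longleftrightarrow> j = 0" for j using power_int_eq_1_iff[OF q_nz q_power] .
  have h: "(\<Sum>(h, c)\<leftarrow>(let h = h in [(h, q powi (n - m + 1)), (h, q powi (n - m - 1))]). if c = 1 then h else 0)
    = h * (of_bool (m = n + 1) + of_bool (n = m + 1))" for h :: complex and m n
    by (auto simp: 1 Let_def)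
  show ?thesis
    by (simp only: gen_poles_def c h sum_list_sorted_keys hZ_form_def sum_distrib_left mult.assoc)
qed

section \<open>The space of fields local to the generators\<close>

text \<open>
  Only locality to the generating fields is required, not mutual locality of the elements; so this is a
  vector space, and it is closed under products with the generators by \<open>prod_quasi_local\<close>.
\<close>

definition local_fields :: "(int \<Rightarrow> 'w \<Rightarrow> 'w) set" where
  "local_fields = {\<alpha>. is_field \<alpha> \<and> (\<forall>F. \<exists>fs. quasi_local fs (gen F) \<alpha>)}"

definition scaleF :: "complex \<Rightarrow> (int \<Rightarrow> 'w \<Rightarrow> 'w) \<Rightarrow> int \<Rightarrow> 'w \<Rightarrow> 'w" where
  "scaleF c \<alpha> = (\<lambda>k w. c *s \<alpha> k w)"

lemma quasi_local_common:
  assumes "quasi_local fs \<alpha> \<beta>" "quasi_local fs' \<alpha>' \<beta>'"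
  shows "quasi_local (fs @ fs') \<alpha> \<beta>" "quasi_local (fs @ fs') \<alpha>' \<beta>'"
  using assms quasi_local_append[of fs fs'] quasi_local_append2[of fs' fs] by (simp_all add: quasi_local_def)

lemma local_fields_field: "\<alpha> \<in> local_fields \<Longrightarrow> is_field \<alpha>" by (simp add: local_fields_def)

lemma local_fields_prod: "\<alpha> \<in> local_fields \<Longrightarrow> is_prod (gen F) \<alpha> (prd (gen F) \<alpha>)"
  unfolding local_fields_def using is_prod_prd[OF gen_field] by blast

lemma local_fields_0: "0 \<in> local_fields"
proof -
  have "quasi_local [] (gen F) 0" for F
    by (simp add: quasi_local_def nonzero_forms_def fun_eq_iff field_zero[OF gen_field])
  then show ?thesis unfolding local_fields_def using is_field_0 by blast
qed

lemma local_fields_add: assumes "\<alpha> \<in> local_fields" "\<beta> \<in> local_fields" shows "\<alpha> + \<beta> \<in> local_fields"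
proof -
  have "\<exists>fs. quasi_local fs (gen F) (\<alpha> + \<beta>)" for F
  proof -
    obtain fs gs where "quasi_local fs (gen F) \<alpha>" "quasi_local gs (gen F) \<beta>" using assms unfolding local_fields_def by blast
    from quasi_local_plus_right[OF gen_field quasi_local_common[OF this]] show ?thesis ..
  qed
  then show ?thesis using assms is_field_plus by (simp add: local_fields_def)
qed

lemma local_fields_scale: "\<alpha> \<in> local_fields \<Longrightarrow> scaleF c \<alpha> \<in> local_fields"
  unfolding local_fields_def scaleF_def using is_field_scale quasi_local_scale_right[OF gen_field] by blast

lemma local_fields_id: "id_field \<in> local_fields"
proof -
  have "quasi_local [] (gen F) id_field" for F
    by (simp add: quasi_local_def nonzero_forms_def fun_eq_iff id_field_def field_zero[OF gen_field])
  then show ?thesis unfolding local_fields_def using is_field_id by blast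
qed

lemma local_fields_prd: assumes "\<alpha> \<in> local_fields" shows "prd (gen F) \<alpha> i \<in> local_fields"
proof -
  have "is_field (prd (gen F) \<alpha> i)" by (rule is_prod_field[OF gen_field local_fields_field[OF assms] local_fields_prod[OF assms]])
  moreover have "\<exists>fs. quasi_local fs (gen F') (prd (gen F) \<alpha> i)" for F'
  proof -
    obtain h12 h13 h23 where "quasi_local h12 (gen F) \<alpha>" "quasi_local h13 (gen F) (gen F')" "quasi_local h23 (gen F') \<alpha>"
      using assms gen_quasi_local unfolding local_fields_def by blast
    then have "\<exists>fs. quasi_local fs (prd (gen F) \<alpha> i) (gen F')"
      using prod_quasi_local[OF gen_field local_fields_field[OF assms] gen_field _ _ quasi_local_sym local_fields_prod[OF assms]] by blast
    then show ?thesis using quasi_local_sym by blast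
  qed
  ultimately show ?thesis by (simp add: local_fields_def)
qed

lemma local_fields_sum: "(\<And>i. i \<in> S \<Longrightarrow> f i \<in> local_fields) \<Longrightarrow> sum f S \<in> local_fields"
  by (induction S rule: infinite_finite_induct) (auto simp: local_fields_0 local_fields_add)

lemma prd_add_right: assumes "\<alpha> \<in> local_fields" "\<beta> \<in> local_fields" shows "prd (gen F) (\<alpha> + \<beta>) = prd (gen F) \<alpha> + prd (gen F) \<beta>"
  by (rule prd_eq[OF gen_field local_fields_field[OF local_fields_add[OF assms]]
      is_prod_plus_right[OF gen_field local_fields_field[OF assms(1)] local_fields_field[OF assms(2)] local_fields_prod[OF assms(1)] local_fields_prod[OF assms(2)]]])

lemma prd_scale_right: assumes "\<alpha> \<in> local_fields" shows "prd (gen F) (scaleF c \<alpha>) i = scaleF c (prd (gen F) \<alpha> i)"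
proof -
  have "prd (gen F) (scaleF c \<alpha>) = (\<lambda>i p w. c *s prd (gen F) \<alpha> i p w)"
    by (rule prd_eq[OF gen_field local_fields_field[OF local_fields_scale[OF assms]]])
      (unfold scaleF_def, rule is_prod_scale_right[OF gen_field local_fields_prod[OF assms]])
  then show ?thesis by (simp add: scaleF_def)
qed

lemma prd_add_left: assumes "\<alpha> \<in> local_fields" shows "prd (gen (F + F')) \<alpha> = prd (gen F) \<alpha> + prd (gen F') \<alpha>"
  unfolding gen_add
  by (rule prd_eq[OF is_field_plus[OF gen_field gen_field] local_fields_field[OF assms]
      is_prod_plus_left[OF gen_field gen_field local_fields_field[OF assms] local_fields_prod[OF assms] local_fields_prod[OF assms]]])

lemma prd_scale_left: assumes "\<alpha> \<in> local_fields" shows "prd (gen (fin_scale sh c F)) \<alpha> i = scaleF c (prd (gen F) \<alpha> i)"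
proof -
  have "prd (gen (fin_scale sh c F)) \<alpha> = (\<lambda>i p w. c *s prd (gen F) \<alpha> i p w)"
    unfolding gen_scale
    by (rule prd_eq[OF is_field_scale[OF gen_field] local_fields_field[OF assms] is_prod_scale_left[OF local_fields_field[OF assms] local_fields_prod[OF assms]]])
  then show ?thesis by (simp add: scaleF_def)
qed

lemma prd_0_left: assumes "\<alpha> \<in> local_fields" shows "prd (gen 0) \<alpha> i = 0"
proof -
  have "prd (gen 0) \<alpha> = 0"
    by (rule is_prod_zero_left[OF local_fields_field[OF assms]]) (use local_fields_prod[OF assms, of 0] in \<open>simp only: gen_0\<close>)
  then show ?thesis by (simp only: zero_fun_apply)
qed

lemma prd_0_right: "prd (gen F) 0 i = 0"
  unfolding is_prod_zero_right[OF gen_field local_fields_prod[OF local_fields_0]] zero_fun_apply ..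

lemma prd_sum_right: "(\<And>j. j \<in> S \<Longrightarrow> f j \<in> local_fields) \<Longrightarrow> prd (gen F) (sum f S) i = (\<Sum>j\<in>S. prd (gen F) (f j) i)"
  by (induction S rule: infinite_finite_induct) (auto simp: prd_0_right prd_add_right local_fields_sum)

lemma prd_commutator: assumes "\<alpha> \<in> local_fields"
  shows "prd (gen F) (prd (gen F') \<alpha> j) i - prd (gen F') (prd (gen F) \<alpha> i) j
    = scaleF (if i + j = - 2 then of_int (- i - 1) * (lev * hZ_form B F F') else 0) \<alpha>"
proof (intro ext)
  fix p w
  obtain fs where "quasi_local fs (gen F) (gen F')" using gen_quasi_local by blast
  from is_prod_prd[OF gen_field gen_field this] have C: "is_prod (gen F) (gen F') (prd (gen F) (gen F'))" .
  have Z: "\<exists>fs. quasi_local fs (prd (gen F) (gen F') i) \<alpha>" for i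
    using assms prod_quasi_local[OF gen_field gen_field local_fields_field[OF assms] _ _ _ C] gen_quasi_local
    unfolding local_fields_def by blast
  have "prd (gen F) (prd (gen F') \<alpha> j) i p w - prd (gen F') (prd (gen F) \<alpha> i) j p w
    = (if i + j = - 2 then (of_int (- i - 1) * (lev * hZ_form B F F')) *s \<alpha> p w else 0)"
    by (rule prod_commutator[where G = "\<lambda>j. prd (gen F) (prd (gen F') \<alpha> j)" and G' = "\<lambda>i. prd (gen F') (prd (gen F) \<alpha> i)",
        OF gen_field gen_field local_fields_field[OF assms] C local_fields_prod[OF assms] local_fields_prod[OF assms]
          local_fields_prod[OF local_fields_prd[OF assms]] local_fields_prod[OF local_fields_prd[OF assms]] Z])
      (simp only: poles_singular_part[OF gen_field gen_field gen_poles_nonzero gen_commutator C] gen_poles_at_1)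
  then show "(prd (gen F) (prd (gen F') \<alpha> j) i - prd (gen F') (prd (gen F) \<alpha> i) j) p w
    = scaleF (if i + j = - 2 then of_int (- i - 1) * (lev * hZ_form B F F') else 0) \<alpha> p w"
    by (simp add: scaleF_def)
qed

text \<open>
  The element \<open>a \<otimes> t\<^sup>n\<close> acts by the coefficient of \<open>x\<^sub>0\<^sup>-\<^sup>n\<^sup>-\<^sup>1\<close> in the product with the generating
  field of \<open>a\<close>, and the central element acts as the level.
\<close>

definition act :: "(int \<Rightarrow>\<^sub>0 'h) loop_ext \<Rightarrow> (int \<Rightarrow> 'w \<Rightarrow> 'w) \<Rightarrow> int \<Rightarrow> 'w \<Rightarrow> 'w" where
  "act x \<alpha> = (\<Sum>n\<in>Poly_Mapping.keys (fst x). prd (gen (Poly_Mapping.lookup (fst x) n)) \<alpha> (- n - 1)) + scaleF (lev * snd x) \<alpha>"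

lemma act_superset:
  "\<alpha> \<in> local_fields \<Longrightarrow> finite S \<Longrightarrow> Poly_Mapping.keys (fst x) \<subseteq> S \<Longrightarrow>
    act x \<alpha> = (\<Sum>n\<in>S. prd (gen (Poly_Mapping.lookup (fst x) n)) \<alpha> (- n - 1)) + scaleF (lev * snd x) \<alpha>"
  unfolding act_def by (intro arg_cong2[where f = "(+)"] sum.mono_neutral_left) (auto simp: in_keys_iff prd_0_left)

lemma vector_space_fields: "vector_space scaleF"
  by standard (simp_all add: scaleF_def fun_eq_iff scale_right_distrib scale_left_distrib)

sublocale VF: complex_space scaleF
  unfolding complex_space_def by (rule vector_space_fields)

lemma act_mode: "\<alpha> \<in> local_fields \<Longrightarrow> act (mode F n) \<alpha> = prd (gen F) \<alpha> (- n - 1)"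
  by (cases "F = 0") (simp_all add: act_def mode_def prd_0_left)

text \<open>
  The bracket relations are \<open>prd_commutator\<close>.  The identity field is annihilated by the nonnegative
  modes, because products with the identity field have no singular part.
\<close>

sublocale IM: induced_map "loop_scale (fin_scale sh)" "affine_bracket (\<lambda>_ _. 0) (hZ_form B)" nonneg_part
  "level_functional lev" scaleF local_fields act id_field
proof
  fix x y :: "(int \<Rightarrow>\<^sub>0 'h) loop_ext" and \<alpha> \<beta> :: "int \<Rightarrow> 'w \<Rightarrow> 'w" and c :: complex
  show "0 \<in> local_fields" "id_field \<in> local_fields" by (rule local_fields_0 local_fields_id)+
  show "\<alpha> + \<beta> \<in> local_fields" if "\<alpha> \<in> local_fields" "\<beta> \<in> local_fields" using that by (rule local_fields_add)
  show "scaleF c \<alpha> \<in> local_fields" if "\<alpha> \<in> local_fields" using that by (rule local_fields_scale)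
  show act_G: "act x \<alpha> \<in> local_fields" if "\<alpha> \<in> local_fields" for x \<alpha>
    unfolding act_def using that by (intro local_fields_add local_fields_sum local_fields_prd local_fields_scale)
  show "act x (\<alpha> + \<beta>) = act x \<alpha> + act x \<beta>" if "\<alpha> \<in> local_fields" "\<beta> \<in> local_fields"
    unfolding act_def using that
    by (simp add: prd_add_right sum.distrib VF.scale_right_distrib del: plus_fun_apply) (simp add: algebra_simps sum.distrib)
  show "act x (scaleF c \<alpha>) = scaleF c (act x \<alpha>)" if "\<alpha> \<in> local_fields"
    unfolding act_def using that by (simp add: prd_scale_right VF.scale_right_distrib VF.scale_sum_right mult.commute)
  show "act (x + y) \<alpha> = act x \<alpha> + act y \<alpha>" if a: "\<alpha> \<in> local_fields"
  proof -
    have S: "finite (Poly_Mapping.keys (fst x) \<union> Poly_Mapping.keys (fst y))" by simp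
    show ?thesis using Poly_Mapping.keys_add[of "fst x" "fst y"]
      by (simp add: act_superset[OF a S] lookup_add prd_add_left[OF a] sum.distrib VF.scale_left_distrib distrib_left algebra_simps)
  qed
  show "act (loop_scale (fin_scale sh) c x) \<alpha> = scaleF c (act x \<alpha>)" if a: "\<alpha> \<in> local_fields"
  proof -
    have "Poly_Mapping.keys (fin_scale (fin_scale sh) c (fst x)) \<subseteq> Poly_Mapping.keys (fst x)"
      by (auto simp: in_keys_iff lookup_scale2 fin_scale_0)
    then have "Poly_Mapping.keys (fst (loop_scale (fin_scale sh) c x)) \<subseteq> Poly_Mapping.keys (fst x)" by (simp add: loop_scale_def)
    from act_superset[OF a finite_keys this] show ?thesis
      by (simp add: loop_scale_def lookup_scale2 prd_scale_left[OF a] act_def VF.scale_right_distrib VF.scale_sum_right mult.left_commute)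
  qed
  show "act (affine_bracket (\<lambda>_ _. 0) (hZ_form B) x y) \<alpha> = act x (act y \<alpha>) - act y (act x \<alpha>)" if a: "\<alpha> \<in> local_fields"
  proof -
    define p where "p x n = prd (gen (Poly_Mapping.lookup (fst x) n))" for x :: "(int \<Rightarrow>\<^sub>0 'h) loop_ext" and n
    have pg: "p x n \<alpha> i \<in> local_fields" for x n i using a by (simp add: p_def local_fields_prd)
    have ex: "act x (act y \<alpha>) = (\<Sum>m\<in>Poly_Mapping.keys (fst x). \<Sum>n\<in>Poly_Mapping.keys (fst y). p x m (p y n \<alpha> (- n - 1)) (- m - 1))
       + (\<Sum>m\<in>Poly_Mapping.keys (fst x). scaleF (lev * snd y) (p x m \<alpha> (- m - 1)))
       + (\<Sum>n\<in>Poly_Mapping.keys (fst y). scaleF (lev * snd x) (p y n \<alpha> (- n - 1)))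
       + scaleF (lev * snd x) (scaleF (lev * snd y) \<alpha>)" for x y
    proof -
      have y: "act y \<alpha> = (\<Sum>n\<in>Poly_Mapping.keys (fst y). p y n \<alpha> (- n - 1)) + scaleF (lev * snd y) \<alpha>"
        by (simp add: act_def p_def)
      have "p x m (act y \<alpha>) i = (\<Sum>n\<in>Poly_Mapping.keys (fst y). p x m (p y n \<alpha> (- n - 1)) i) + scaleF (lev * snd y) (p x m \<alpha> i)" for m i
        unfolding y p_def[of x]
        by (simp only: prd_add_right[OF local_fields_sum[OF pg] local_fields_scale[OF a]] plus_fun_apply prd_sum_right[OF pg] prd_scale_right[OF a])
      moreover have "act x (act y \<alpha>) = (\<Sum>m\<in>Poly_Mapping.keys (fst x). p x m (act y \<alpha>) (- m - 1)) + scaleF (lev * snd x) (act y \<alpha>)"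
        by (simp only: act_def[of x] p_def)
      ultimately have "act x (act y \<alpha>) = (\<Sum>m\<in>Poly_Mapping.keys (fst x).
          (\<Sum>n\<in>Poly_Mapping.keys (fst y). p x m (p y n \<alpha> (- n - 1)) (- m - 1)) + scaleF (lev * snd y) (p x m \<alpha> (- m - 1)))
          + scaleF (lev * snd x) (act y \<alpha>)" by (simp only:)
      then show ?thesis unfolding y sum.distrib VF.scale_right_distrib VF.scale_sum_right by (simp only: add.assoc)
    qed
    have "act x (act y \<alpha>) - act y (act x \<alpha>)
      = (\<Sum>m\<in>Poly_Mapping.keys (fst x). \<Sum>n\<in>Poly_Mapping.keys (fst y).
          p x m (p y n \<alpha> (- n - 1)) (- m - 1) - p y n (p x m \<alpha> (- m - 1)) (- n - 1))"
      unfolding ex sum_subtractf sum.swap[of "\<lambda>n m. p y n (p x m \<alpha> (- m - 1)) (- n - 1)"]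
      by (simp add: VF.scale_left_commute algebra_simps)
    also have "\<dots> = (\<Sum>m\<in>Poly_Mapping.keys (fst x). \<Sum>n\<in>Poly_Mapping.keys (fst y).
          scaleF (lev * (if m + n = 0 then of_int m * hZ_form B (Poly_Mapping.lookup (fst x) m) (Poly_Mapping.lookup (fst y) n) else 0)) \<alpha>)"
      unfolding p_def prd_commutator[OF a] by (intro sum.cong refl arg_cong2[where f = scaleF]) auto
    also have "\<dots> = act (affine_bracket (\<lambda>_ _. 0) (hZ_form B) x y) \<alpha>"
      by (simp add: act_def affine_bracket_def VF.scale_sum_left sum_distrib_left)
    finally show ?thesis ..
  qed
  show "act x id_field = scaleF (level_functional lev x) id_field" if x: "x \<in> nonneg_part"
  proof -
    have "prd (gen (Poly_Mapping.lookup (fst x) n)) id_field (- n - 1) = 0" for n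
    proof (cases "n < 0")
      case True
      then show ?thesis using x by (simp add: nonneg_part_def prd_0_left local_fields_id)
    next
      case False
      have "prd (gen F) id_field = (\<lambda>i p w. bin (p + i) i *s gen F (p + i) w)" for F
        by (rule prd_eq[OF gen_field is_field_id is_prod_id_right[OF gen_field]])
      then show ?thesis using False by (simp add: fun_eq_iff)
    qed
    then show ?thesis by (simp add: act_def level_functional_def mult.commute)
  qed
qed

end

section \<open>Existence and uniqueness\<close>

locale heisenberg_vacuum_algebra = quasi_heisenberg_module sW sh B q lev \<rho>
  for sW :: "complex \<Rightarrow> 'w::ab_group_add \<Rightarrow> 'w" (infixr "*s" 75) and sh :: "complex \<Rightarrow> 'h::ab_group_add \<Rightarrow> 'h"
    and B q lev \<rho> +
  fixes Y :: "(int \<Rightarrow>\<^sub>0 'h) loop_ext tensors set \<Rightarrow> int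
     \<Rightarrow> (int \<Rightarrow>\<^sub>0 'h) loop_ext tensors set \<Rightarrow> (int \<Rightarrow>\<^sub>0 'h) loop_ext tensors set"
  assumes vertex_structure: "hZ_vertex_structure sh B lev Y"
begin

abbreviation VV where "VV \<equiv> hZ_module sh B lev"
abbreviation vacuum where "vacuum \<equiv> hZ_vacuum sh B lev"
abbreviation emb where "emb \<equiv> hZ_embed sh B lev"

lemma VV_eq: "VV = IM.V" by (simp only: affine_module_def)
lemma vacuum_eq: "vacuum = IM.vac" by (simp only: affine_vacuum_def IM.vac_def)

lemma va: "vertex_algebra VV Y vacuum"
  and Y_emb: "v \<in> carrier VV \<Longrightarrow> Y (emb F) k v = IM.ia (mode F (- k - 1)) v"
  using vertex_structure by (auto simp: affine_vertex_structure_def affine_action_def)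

lemma emb_eq: "emb F = IM.ia (mode F (- 1)) vacuum"
  by (simp only: affine_embed_def affine_action_def)

lemma vacuum_carrier: "vacuum \<in> carrier VV" using va by (simp add: vertex_algebra_def)

lemma emb_carrier: "emb F \<in> carrier VV"
  unfolding emb_eq VV_eq vacuum_eq by (intro IM.ia_carrier IM.vac_carrier)

lemma Y_carrier: "u \<in> carrier VV \<Longrightarrow> v \<in> carrier VV \<Longrightarrow> Y u k v \<in> carrier VV"
  and Y_add: "u \<in> carrier VV \<Longrightarrow> u' \<in> carrier VV \<Longrightarrow> v \<in> carrier VV \<Longrightarrow> Y (u \<oplus>\<^bsub>VV\<^esub> u') k v = Y u k v \<oplus>\<^bsub>VV\<^esub> Y u' k v"
  and Y_smult: "u \<in> carrier VV \<Longrightarrow> v \<in> carrier VV \<Longrightarrow> Y (c \<odot>\<^bsub>VV\<^esub> u) k v = c \<odot>\<^bsub>VV\<^esub> Y u k v"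
  and Y_low: "u \<in> carrier VV \<Longrightarrow> v \<in> carrier VV \<Longrightarrow> \<exists>N. \<forall>k<N. Y u k v = \<zero>\<^bsub>VV\<^esub>"
  and Y_vacuum: "v \<in> carrier VV \<Longrightarrow> Y vacuum k v = (if k = 0 then v else \<zero>\<^bsub>VV\<^esub>)"
proof -
  have vm: "vertex_map VV VV Y" using va by (simp only: vertex_algebra_def)
  show "u \<in> carrier VV \<Longrightarrow> v \<in> carrier VV \<Longrightarrow> Y u k v \<in> carrier VV"
    using vm[unfolded vertex_map_def, THEN conjunct1] by blast
  show "u \<in> carrier VV \<Longrightarrow> u' \<in> carrier VV \<Longrightarrow> v \<in> carrier VV \<Longrightarrow> Y (u \<oplus>\<^bsub>VV\<^esub> u') k v = Y u k v \<oplus>\<^bsub>VV\<^esub> Y u' k v"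
    using vm[unfolded vertex_map_def, THEN conjunct2, THEN conjunct1] by blast
  show "u \<in> carrier VV \<Longrightarrow> v \<in> carrier VV \<Longrightarrow> Y (c \<odot>\<^bsub>VV\<^esub> u) k v = c \<odot>\<^bsub>VV\<^esub> Y u k v"
    using vm[unfolded vertex_map_def, THEN conjunct2, THEN conjunct2, THEN conjunct1] by blast
  show "u \<in> carrier VV \<Longrightarrow> v \<in> carrier VV \<Longrightarrow> \<exists>N. \<forall>k<N. Y u k v = \<zero>\<^bsub>VV\<^esub>"
    using vm[unfolded vertex_map_def, THEN conjunct2, THEN conjunct2, THEN conjunct2, THEN conjunct2, THEN conjunct2] by blast
  show "v \<in> carrier VV \<Longrightarrow> Y vacuum k v = (if k = 0 then v else \<zero>\<^bsub>VV\<^esub>)"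
    using va[unfolded vertex_algebra_def, THEN conjunct2, THEN conjunct2, THEN conjunct2, THEN conjunct1] by blast
qed

lemma zero_carrier: "\<zero>\<^bsub>VV\<^esub> \<in> carrier VV" and zero_add: "\<zero>\<^bsub>VV\<^esub> \<oplus>\<^bsub>VV\<^esub> \<zero>\<^bsub>VV\<^esub> = \<zero>\<^bsub>VV\<^esub>"
  unfolding VV_eq IM.V_zero IM.V_add IM.V_carrier by (auto simp: IM.supported_def intro!: exI[of _ 0])

text \<open>
  The central element acts on the vacuum as the level, and commutes with everything.
\<close>

lemma central_action: assumes "v \<in> carrier VV" shows "IM.ia central v = lev \<odot>\<^bsub>VV\<^esub> v"
  unfolding VV_eq
proof (induction v rule: IM.wd_class_induct)
  case 1
  have "central \<in> (nonneg_part :: (int \<Rightarrow>\<^sub>0 'h) loop_ext set)" by (simp add: nonneg_part_def central_def)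
  moreover have "level_functional lev (central :: (int \<Rightarrow>\<^sub>0 'h) loop_ext) = lev" by (simp add: level_functional_def central_def)
  ultimately show ?case using IM.ia_vac by metis
next
  case (2 v w)
  obtain t where t: "v = IM.wd_class t" using IM.V_wd_class[OF 2(1)] by blast
  obtain t' where t': "w = IM.wd_class t'" using IM.V_wd_class[OF 2(2)] by blast
  have "lev \<odot>\<^bsub>IM.V\<^esub> (v \<oplus>\<^bsub>IM.V\<^esub> w) = (lev \<odot>\<^bsub>IM.V\<^esub> v) \<oplus>\<^bsub>IM.V\<^esub> (lev \<odot>\<^bsub>IM.V\<^esub> w)"
    by (simp only: t t' IM.wd_class_add[symmetric] IM.wd_class_scalar[symmetric] distrib_left)
  then show ?case using 2 by (simp add: IM.ia_add_right)
next
  case (3 c v)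
  obtain t where t: "v = IM.wd_class t" using IM.V_wd_class[OF 3(1)] by blast
  have "scalar lev * (scalar c * t) = scalar c * (scalar lev * t)"
    unfolding mult.assoc[symmetric] IM.scalar_commute[of lev "scalar c"] ..
  then have "lev \<odot>\<^bsub>IM.V\<^esub> (c \<odot>\<^bsub>IM.V\<^esub> v) = c \<odot>\<^bsub>IM.V\<^esub> (lev \<odot>\<^bsub>IM.V\<^esub> v)"
    by (simp only: t IM.wd_class_scalar[symmetric])
  then show ?case using 3 by (simp add: IM.ia_scale_right)
next
  case (4 x v)
  have "affine_bracket (\<lambda>_ _. 0) (hZ_form B) central x = 0"
    by (simp add: affine_bracket_def central_def zero_prod_def)
  from IM.ia_commute[OF 4(1) this] show ?case using 4 by (simp add: IM.ia_scale_right)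
qed (use assms in \<open>simp only: VV_eq\<close>)

text \<open>
  The vacuum algebra is spanned by iterated products of the elements \<open>a \<otimes> e\<^sup>m\<close> with the vacuum.
\<close>

lemma generation_induct [consumes 1, case_names vacuum add smult Y]:
  assumes v: "v \<in> carrier VV"
    and vacuum: "Q vacuum"
    and add: "\<And>v w. v \<in> carrier VV \<Longrightarrow> w \<in> carrier VV \<Longrightarrow> Q v \<Longrightarrow> Q w \<Longrightarrow> Q (v \<oplus>\<^bsub>VV\<^esub> w)"
    and smult: "\<And>c v. v \<in> carrier VV \<Longrightarrow> Q v \<Longrightarrow> Q (c \<odot>\<^bsub>VV\<^esub> v)"
    and Y: "\<And>m a k v. v \<in> carrier VV \<Longrightarrow> Q v \<Longrightarrow> Q (Y (emb (Poly_Mapping.single m a)) k v)"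
  shows "Q v"
proof -
  have carr: "IM.ia x v \<in> carrier VV" if "v \<in> carrier VV" for x v
    using that unfolding VV_eq by (rule IM.ia_carrier)
  have ia_add: "Q (IM.ia (x + y) v)" if "v \<in> carrier VV" "Q (IM.ia x v)" "Q (IM.ia y v)" for x y v
    using add[OF carr[OF that(1)] carr[OF that(1)] that(2,3)] IM.ia_add_left[OF that(1)[unfolded VV_eq]] by (simp only: VV_eq)
  have step: "Q (IM.ia x v)" if v: "v \<in> carrier VV" "Q v" for x v
  proof -
    have mode: "Q (IM.ia (mode F n) v)" for F n
    proof (induction F rule: poly_mapping_add_induct)
      case 1
      have "Q (Y (emb (Poly_Mapping.single 0 0)) (- n - 1) v)" by (rule Y[OF v])
      then show ?case unfolding Y_emb[OF v(1)] by simp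
    next
      case (2 f g)
      then show ?case unfolding mode_add by (intro ia_add v(1))
    next
      case (3 m a)
      have "Q (Y (emb (Poly_Mapping.single m a)) (- n - 1) v)" by (rule Y[OF v])
      then show ?case unfolding Y_emb[OF v(1)] by simp
    qed
    have loop: "Q (IM.ia (f, 0) v)" for f
    proof (induction f rule: poly_mapping_add_induct)
      case 1
      then show ?case using mode[of 0 0] by (simp add: mode_def)
    next
      case (2 f g)
      have "(f + g, 0 :: complex) = (f, 0) + (g, 0)" by simp
      then show ?case using 2 by (simp only: ia_add[OF v(1)])
    next
      case (3 n F)
      then show ?case using mode[of F n] by (simp add: mode_def)
    qed
    have x: "x = (fst x, 0) + loop_scale (fin_scale sh) (snd x) central"
      by (simp add: loop_scale_def central_def prod_eq_iff)
        (rule poly_mapping_eqI, simp add: lookup_scale2 fin_scale_0)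
    have "Q (IM.ia (loop_scale (fin_scale sh) (snd x) central) v)"
      using smult[OF _ smult[OF v, of lev], of "snd x"] carr[OF v(1), of central]
      by (simp only: IM.ia_scale_left[OF v(1)[unfolded VV_eq]] central_action[OF v(1)] VV_eq)
    then show ?thesis by (subst x) (rule ia_add[OF v(1) loop])
  qed
  show ?thesis
    by (rule IM.wd_class_induct[of Q])
      (use vacuum add smult step v in \<open>simp_all only: VV_eq vacuum_eq\<close>)
qed

definition \<Phi> where "\<Phi> = IM.ind_map"

lemma \<Phi>_local_fields: "v \<in> carrier VV \<Longrightarrow> \<Phi> v \<in> local_fields"
  and \<Phi>_add: "v \<in> carrier VV \<Longrightarrow> v' \<in> carrier VV \<Longrightarrow> \<Phi> (v \<oplus>\<^bsub>VV\<^esub> v') = \<Phi> v + \<Phi> v'"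
  and \<Phi>_smult: "v \<in> carrier VV \<Longrightarrow> \<Phi> (c \<odot>\<^bsub>VV\<^esub> v) = scaleF c (\<Phi> v)"
  and \<Phi>_vacuum: "\<Phi> vacuum = id_field"
  unfolding VV_eq vacuum_eq \<Phi>_def by (rule IM.ind_map_properties; assumption)+

lemma \<Phi>_field: "v \<in> carrier VV \<Longrightarrow> is_field (\<Phi> v)" by (rule local_fields_field[OF \<Phi>_local_fields])

lemma \<Phi>_Y_emb: "v \<in> carrier VV \<Longrightarrow> \<Phi> (Y (emb F) k v) = prd (gen F) (\<Phi> v) k"
  unfolding Y_emb using IM.ind_map_properties(4)[of v "mode F (- k - 1)"] act_mode[OF \<Phi>_local_fields, of v F "- k - 1"]
  by (simp add: \<Phi>_def VV_eq)

lemma \<Phi>_emb: "\<Phi> (emb F) = gen F"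
proof -
  have "prd (gen F) id_field = (\<lambda>i p w. bin (p + i) i *s gen F (p + i) w)"
    by (rule prd_eq[OF gen_field is_field_id is_prod_id_right[OF gen_field]])
  moreover have "\<Phi> (emb F) = act (mode F (- 1)) (\<Phi> vacuum)"
    unfolding emb_eq \<Phi>_def by (rule IM.ind_map_properties(4)) (use vacuum_carrier in \<open>simp only: VV_eq\<close>)
  ultimately show ?thesis by (simp add: \<Phi>_vacuum act_mode local_fields_id fun_eq_iff)
qed

lemma \<Phi>_zero: "\<Phi> \<zero>\<^bsub>VV\<^esub> = 0"
proof -
  have "\<Phi> \<zero>\<^bsub>VV\<^esub> = \<Phi> \<zero>\<^bsub>VV\<^esub> + \<Phi> \<zero>\<^bsub>VV\<^esub>" using \<Phi>_add[OF zero_carrier zero_carrier] by (simp only: zero_add)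
  then show ?thesis by simp
qed

text \<open>
  Mutual locality of all fields in the image follows from locality to the generators by induction.
\<close>

lemma \<Phi>_quasi_local:
  assumes "u \<in> carrier VV" "v \<in> carrier VV"
  shows "\<exists>fs. quasi_local fs (\<Phi> u) (\<Phi> v)"
  using assms(1)
proof (induction u rule: generation_induct)
  case vacuum
  have "quasi_local [] id_field (\<Phi> v)"
    by (simp add: quasi_local_def nonzero_forms_def fun_eq_iff id_field_def field_zero[OF \<Phi>_field[OF assms(2)]])
  then show ?case unfolding \<Phi>_vacuum ..
next
  case (add u u')
  then obtain fs gs where "quasi_local fs (\<Phi> u) (\<Phi> v)" "quasi_local gs (\<Phi> u') (\<Phi> v)" by blast
  from quasi_local_plus_left[OF \<Phi>_field[OF assms(2)] quasi_local_common[OF this]] show ?case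
    unfolding \<Phi>_add[OF add(1,2)] ..
next
  case (smult c u)
  then show ?case unfolding \<Phi>_smult[OF smult(1)] scaleF_def
    using quasi_local_scale_left[OF \<Phi>_field[OF assms(2)]] by blast
next
  case (Y m a k u)
  let ?g = "gen (Poly_Mapping.single m a)"
  obtain h12 h13 h23 where "quasi_local h12 ?g (\<Phi> u)" "quasi_local h13 ?g (\<Phi> v)" "quasi_local h23 (\<Phi> u) (\<Phi> v)"
    using \<Phi>_local_fields[OF Y(1)] \<Phi>_local_fields[OF assms(2)] Y(2) unfolding local_fields_def by blast
  from prod_quasi_local[OF gen_field \<Phi>_field[OF Y(1)] \<Phi>_field[OF assms(2)] this local_fields_prod[OF \<Phi>_local_fields[OF Y(1)]]]
  show ?case unfolding \<Phi>_Y_emb[OF Y(1)] .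
qed

text \<open>
  The map \<open>\<Phi>\<close> is multiplicative.  In the induction step for \<open>Y(e, x\<^sub>0) u\<close> with a generator \<open>e\<close>, the
  Jacobi identities for \<open>e, u, v\<close> in the vertex algebra and for the three fields have the same first
  two terms, so the third terms agree; their coefficients are the two sides of the claim.
\<close>

theorem \<Phi>_prod:
  assumes "u \<in> carrier VV" "v \<in> carrier VV"
  shows "is_prod (\<Phi> u) (\<Phi> v) (\<lambda>i. \<Phi> (Y u i v))"
  using assms
proof (induction u arbitrary: v rule: generation_induct)
  case vacuum
  have "(\<lambda>i. \<Phi> (Y vacuum i v)) = (\<lambda>i p w. if i = 0 then \<Phi> v p w else 0)"
    using vacuum by (auto simp: fun_eq_iff Y_vacuum \<Phi>_zero)
  then show ?case unfolding \<Phi>_vacuum using is_prod_id_left[OF \<Phi>_field[OF vacuum]] by simp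
next
  case (add u u')
  have "(\<lambda>i. \<Phi> (Y (u \<oplus>\<^bsub>VV\<^esub> u') i v)) = (\<lambda>i. \<Phi> (Y u i v)) + (\<lambda>i. \<Phi> (Y u' i v))"
    using add by (simp add: fun_eq_iff Y_add Y_carrier \<Phi>_add)
  then show ?case unfolding \<Phi>_add[OF add(1,2)]
    using is_prod_plus_left[OF \<Phi>_field[OF add(1)] \<Phi>_field[OF add(2)] \<Phi>_field[OF add(5)] add(3)[OF add(5)] add(4)[OF add(5)]]
    by (simp only:)
next
  case (smult c u)
  have "(\<lambda>i. \<Phi> (Y (c \<odot>\<^bsub>VV\<^esub> u) i v)) = (\<lambda>i p w. c *s \<Phi> (Y u i v) p w)"
    using smult by (simp add: fun_eq_iff Y_smult Y_carrier \<Phi>_smult scaleF_def)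
  then show ?case unfolding \<Phi>_smult[OF smult(1)] scaleF_def
    using is_prod_scale_left[OF \<Phi>_field[OF smult(3)] smult(2)[OF smult(3)], of c] by (simp only:)
next
  case (Y m a k u)
  define e where "e = emb (Poly_Mapping.single m a)"
  have e: "e \<in> carrier VV" unfolding e_def by (rule emb_carrier)
  let ?g = "gen (Poly_Mapping.single m a)"
  have eY: "is_prod ?g (\<Phi> v) (\<lambda>i. \<Phi> (Y e i v))" if "v \<in> carrier VV" for v
    using local_fields_prod[OF \<Phi>_local_fields[OF that]] unfolding e_def \<Phi>_Y_emb[OF that] .
  define Z where "Z i = prd (\<Phi> (Y e i u)) (\<Phi> v)" for i
  have Z: "is_prod (\<Phi> (Y e i u)) (\<Phi> v) (Z i)" for i
    unfolding Z_def using is_prod_prd[OF \<Phi>_field \<Phi>_field] \<Phi>_quasi_local Y_carrier[OF e Y(1)] Y(3) by blast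
  have Z_eq: "Z i j p w = \<Phi> (Y (Y e i u) j v) p w" for i j p w
  proof -
    let ?A = "\<lambda>i j. \<Phi> (Y e i (Y u j v)) p w" and ?B = "\<lambda>i j. \<Phi> (Y u j (Y e i v)) p w"
    let ?C = "\<lambda>i j. \<Phi> (Y (Y e i u) j v) p w"
    have "defect ?A ?B (\<lambda>i j. Z i j p w) = 0"
      by (rule field_jacobi[OF gen_field \<Phi>_field[OF Y(1)] \<Phi>_field[OF Y(3)] eY[OF Y(1)] Y(2)[OF Y(3)] eY[OF Y(3)]
            eY[OF Y_carrier[OF Y(1,3)]] Y(2)[OF Y_carrier[OF e Y(3)]] Z])
    moreover have "defect ?A ?B ?C = 0"
      by (rule vertex_algebra_jacobi[OF va, where L = "\<lambda>x. \<Phi> x p w"])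
        (simp_all add: \<Phi>_add \<Phi>_smult scaleF_def e Y(1) Y(3))
    ultimately have "d10 (\<lambda>i j. Z i j p w) = d10 ?C" unfolding defect_def fun_eq_iff by simp
    then have "d10 (\<lambda>i j. Z i j p w) i (- 1) j = d10 ?C i (- 1) j" by (simp only:)
    then show ?thesis unfolding d10_residue .
  qed
  have Zk: "Z k = (\<lambda>j. \<Phi> (Y (Y e k u) j v))" by (intro ext) (rule Z_eq)
  show ?case using Z[of k] unfolding Zk e_def .
qed

definition YW where "YW = restrict \<Phi> (carrier VV)"

lemma YW_quasi_module: "quasi_module VV Y vacuum (module_of_type sW) YW"
  unfolding quasi_module_def
proof (intro conjI ballI allI)
  show "Module.module complex_ring (module_of_type sW)" by (rule module_of_type_module)
  have r: "YW v = \<Phi> v" if "v \<in> carrier VV" for v using that by (simp add: YW_def)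
  have closed: "u \<oplus>\<^bsub>VV\<^esub> v \<in> carrier VV" "c \<odot>\<^bsub>VV\<^esub> u \<in> carrier VV" if u: "u \<in> carrier VV" and v: "v \<in> carrier VV" for c u v
  proof -
    obtain t where t: "u = IM.wd_class t" using IM.V_wd_class[OF u[unfolded VV_eq]] by blast
    obtain t' where t': "v = IM.wd_class t'" using IM.V_wd_class[OF v[unfolded VV_eq]] by blast
    show "u \<oplus>\<^bsub>VV\<^esub> v \<in> carrier VV" "c \<odot>\<^bsub>VV\<^esub> u \<in> carrier VV"
      unfolding VV_eq t t' by (simp_all only: IM.wd_class_add[symmetric] IM.wd_class_scalar[symmetric] IM.wd_class_carrier)
  qed
  have low: "\<exists>N. \<forall>k<N. \<Phi> v k w = 0" if "v \<in> carrier VV" for v w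
    using \<Phi>_field[OF that] unfolding is_field_def by blast
  show "vertex_map VV (module_of_type sW) YW"
    unfolding vertex_map_def
    by (auto simp: r closed \<Phi>_add \<Phi>_smult scaleF_def field_add[OF \<Phi>_field] field_scale[OF \<Phi>_field] low)
  show "YW vacuum k w = (if k = 0 then w else \<zero>\<^bsub>module_of_type sW\<^esub>)" for k w
    by (simp add: r vacuum_carrier \<Phi>_vacuum id_field_def)
  fix u v assume uv: "u \<in> carrier VV" "v \<in> carrier VV"
  have "is_prod (YW u) (YW v) (\<lambda>i. YW (Y u i v))" using \<Phi>_prod[OF uv] uv by (simp add: r Y_carrier)
  from quasi_jacobi_prod[where YW = YW and u = u and v = v and Y = Y, OF _ _ this] uv show "\<exists>f. f \<noteq> 0 \<and> (\<forall>w\<in>carrier (module_of_type sW). quasi_jacobi Y (module_of_type sW) YW f u v w)"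
    by (simp add: r \<Phi>_field)
qed

lemma YW_emb: "YW (emb (Poly_Mapping.single m a)) k w = twisted_field q sW \<rho> a m k w"
  by (simp add: YW_def emb_carrier \<Phi>_emb gen_single)

text \<open>
  By induction along the generation of the vertex algebra by \<open>\<hh>[\<int>]\<close>: the fields of \<open>e\<close> and \<open>v\<close>
  determine those of the coefficients of \<open>Y(e, x\<^sub>0) v\<close>, by \<open>third_term_unique\<close>.
\<close>

theorem quasi_module_unique:
  assumes Q: "quasi_module VV Y vacuum (module_of_type sW) YW'"
    and gen': "\<And>a m k w. YW' (emb (Poly_Mapping.single m a)) k w = twisted_field q sW \<rho> a m k w"
    and v: "v \<in> carrier VV"
  shows "YW' v = \<Phi> v"
  using v
proof (induction v rule: generation_induct)
  case vacuum
  have "YW' vacuum k w = (if k = 0 then w else 0)" for k w using Q by (simp add: quasi_module_def)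
  then show ?case by (auto simp: fun_eq_iff \<Phi>_vacuum id_field_def)
next
  case (add u v)
  have "YW' (u \<oplus>\<^bsub>VV\<^esub> v) = YW' u + YW' v"
    using Q add(1,2) unfolding quasi_module_def vertex_map_def by (auto simp: fun_eq_iff)
  then show ?case using add by (simp add: \<Phi>_add)
next
  case (smult c v)
  have "YW' (c \<odot>\<^bsub>VV\<^esub> v) = scaleF c (YW' v)"
    using Q smult(1) unfolding quasi_module_def vertex_map_def by (auto simp: fun_eq_iff scaleF_def)
  then show ?case using smult by (simp add: \<Phi>_smult)
next
  case (Y m a k v)
  define e where "e = emb (Poly_Mapping.single m a)"
  let ?g = "gen (Poly_Mapping.single m a)"
  have e: "e \<in> carrier VV" unfolding e_def by (rule emb_carrier)
  have Ye: "YW' e = ?g" by (simp add: fun_eq_iff e_def gen' gen_single)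
  have "\<forall>u\<in>carrier VV. \<forall>v\<in>carrier VV. \<exists>f. f \<noteq> 0 \<and> (\<forall>w. quasi_jacobi Y (module_of_type sW) YW' f u v w)"
    using Q by (simp add: quasi_module_def)
  then obtain f where f: "f \<noteq> 0" "\<And>w. quasi_jacobi Y (module_of_type sW) YW' f e v w"
    using e Y(1) by blast
  have P: "is_prod ?g (\<Phi> v) (\<lambda>i. \<Phi> (Y e i v))"
    using \<Phi>_prod[OF e Y(1)] unfolding e_def \<Phi>_emb .
  have low': "\<exists>M. low M (\<lambda>p. YW' (Y e i v) p w)" for i w
  proof -
    obtain M where "\<And>p. p < M \<Longrightarrow> YW' (Y e i v) p w = 0"
      using Q Y_carrier[OF e Y(1), of i] unfolding quasi_module_def vertex_map_def by fastforce
    then show ?thesis unfolding low_def by blast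
  qed
  obtain N where N: "\<And>i. i < N \<Longrightarrow> Y e i v = \<zero>\<^bsub>VV\<^esub>" using Y_low[OF e Y(1)] by blast
  have z: "YW' \<zero>\<^bsub>VV\<^esub> = 0"
  proof -
    note zero_add
    moreover have "YW' (\<zero>\<^bsub>VV\<^esub> \<oplus>\<^bsub>VV\<^esub> \<zero>\<^bsub>VV\<^esub>) = YW' \<zero>\<^bsub>VV\<^esub> + YW' \<zero>\<^bsub>VV\<^esub>"
      using Q zero_carrier unfolding quasi_module_def vertex_map_def by (auto simp: fun_eq_iff)
    ultimately show ?thesis by simp
  qed
  have "(\<lambda>i p. YW' (Y e i v) p w) = (\<lambda>i p. \<Phi> (Y e i v) p w)" for w
  proof (rule third_term_unique[OF gen_field \<Phi>_field[OF Y(1)] P _ low' f(1)])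
    show "low N (\<lambda>i p. YW' (Y e i v) p w)" by (simp add: low_def N z fun_eq_iff)
    have bA: "bounded2 (comp2 ?g (\<Phi> v) w)" and bB: "bounded1 (comp2' ?g (\<Phi> v) w)"
      by (rule bounded2_comp2[OF gen_field \<Phi>_field[OF Y(1)]] bounded1_comp2'[OF gen_field \<Phi>_field[OF Y(1)]])+
    then obtain N1 N2 where N12: "\<And>k l. l < N1 \<Longrightarrow> comp2 ?g (\<Phi> v) w k l = 0" "\<And>k l. k < N2 \<Longrightarrow> comp2' ?g (\<Phi> v) w k l = 0"
      unfolding bounded1_def bounded2_def by metis
    have "\<forall>k. dmul (poly_dist f) (dist3 (defect (\<lambda>k l. YW' e k (YW' v l w)) (\<lambda>k l. YW' v l (YW' e k w)) (\<lambda>k l. YW' (Y e k v) l w))) k = 0"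
      by (rule quasi_jacobi_iff[of N1 YW' e v w N2 N Y f, THEN iffD1, OF _ _ _ f(2)])
        (use N12 N z in \<open>simp_all add: Ye Y(2)\<close>)
    then show "dmul (poly_dist f) (dist3 (defect (comp2 ?g (\<Phi> v) w) (comp2' ?g (\<Phi> v) w) (\<lambda>i p. YW' (Y e i v) p w))) k = 0" for k
      unfolding Ye Y(2) by blast
  qed
  note eq = this
  show ?case unfolding e_def[symmetric]
  proof (intro ext)
    fix p w
    from fun_cong[OF fun_cong[OF eq[of w], of k], of p] show "YW' (Y e k v) p w = \<Phi> (Y e k v) p w" by simp
  qed
qed

end

theorem proposition7p9:
  fixes sh :: "complex \<Rightarrow> 'h::ab_group_add \<Rightarrow> 'h"
    and B :: "'h \<Rightarrow> 'h \<Rightarrow> complex"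
    and q l :: complex
    and Y :: "(int \<Rightarrow>\<^sub>0 'h) loop_ext tensors set \<Rightarrow> int
               \<Rightarrow> (int \<Rightarrow>\<^sub>0 'h) loop_ext tensors set \<Rightarrow> (int \<Rightarrow>\<^sub>0 'h) loop_ext tensors set"
    and sW :: "complex \<Rightarrow> 'w::ab_group_add \<Rightarrow> 'w"
    and \<rho> :: "'h loop_ext \<Rightarrow> 'w \<Rightarrow> 'w"
  assumes "vector_space sh"
    and "symmetric_bilinear sh B"
    and "q \<noteq> 0" and "\<And>n::nat. n > 0 \<Longrightarrow> q ^ n \<noteq> 1"
    and "hZ_vertex_structure sh B l Y"
    and "vector_space sW"
    and "lie_module (loop_scale sh) (hq_bracket B q) sW \<rho>"
    and "restricted \<rho>"
    and "has_level sW \<rho> l"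
  shows "\<exists>!YW. YW \<in> extensional (carrier (hZ_module sh B l)) \<and>
           quasi_module (hZ_module sh B l) Y (hZ_vacuum sh B l) (module_of_type sW) YW \<and>
           (\<forall>a m k w. YW (hZ_embed sh B l (Poly_Mapping.single m a)) k w
                        = twisted_field q sW \<rho> a m k w)"
proof -
  interpret W: vector_space sW by (rule assms(6))
  interpret hb: vector_space sh by (rule assms(1))
  interpret heisenberg_vacuum_algebra sW sh B q l \<rho> Y
    by unfold_locales (rule assms(2-5,7-9); assumption?)+
  show ?thesis
  proof (intro ex1I[of _ YW] conjI allI)
    show "YW \<in> extensional (carrier VV)" by (simp add: YW_def)
    show "quasi_module VV Y vacuum (module_of_type sW) YW" by (rule YW_quasi_module)
    show "YW (emb (Poly_Mapping.single m a)) k w = twisted_field q sW \<rho> a m k w" for a m k w by (rule YW_emb)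
    fix YW' assume YW': "YW' \<in> extensional (carrier VV) \<and> quasi_module VV Y vacuum (module_of_type sW) YW' \<and>
      (\<forall>a m k w. YW' (emb (Poly_Mapping.single m a)) k w = twisted_field q sW \<rho> a m k w)"
    show "YW' = YW"
    proof (rule extensionalityI)
      show "YW' \<in> extensional (carrier VV)" "YW \<in> extensional (carrier VV)" using YW' by (simp_all add: YW_def)
      show "YW' v = YW v" if "v \<in> carrier VV" for v
        using quasi_module_unique[OF _ _ that, of YW'] YW' that by (simp add: YW_def)
    qed
  qed
qed

end
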